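(* Let $N\simeq\mathbb{Z}^d$ be a lattice, let $\mathbf{\Sigma}=(\Sigma,\{v_i\}_{1\le i\le k})$ be a simplicial stacky fan in $N$, and let $\beta\in N\otimes\mathbb{C}$. There exists a $\mathbb{C}$-vector space isomorphism $$\phi:K\mathbb{C}(\mathbf{\Sigma};\beta)\simeq H\mathbb{C}(\mathbf{\Sigma};\beta).$$ It is induced by $\mathbb{C}$-algebra isomorphisms $$\phi_\alpha:(K\mathbb{C}(\mathbf{\Sigma};\beta))_\alpha\simeq(S_{\mathbf{\Sigma}}\otimes_{\mathbb{Z}}\mathbb{C})/(Z+S_{\mathbf{\Sigma}}(\alpha)),$$ for each element $\alpha=(\alpha_i)\in\mathrm{Bx}(\mathbf{\Sigma};\beta)$, induced by the identifications $R_i=e^{2\pi\sqrt{-1}\,\alpha_i+[v_i]}$ for all $i$, $1\le i\le k$.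
   Context: Stacky fan: $\Sigma$ is a rational simplicial fan in $N\otimes\mathbb{R}$, and $v_1,\dots,v_k\in N$ are chosen nonzero lattice vectors, one on each ray of $\Sigma$, so that $v_i$ generates the $i$-th ray. The union of the supports of all cones is also denoted $\Sigma$. For a cone $\sigma$ of $\Sigma$, $I(\sigma)\subset\{1,\dots,k\}$ is the set of $i$ such that $v_i$ generates a ray of $\sigma$. The ring $R=\mathbb{Z}[\mathbf{\Sigma}]$ is the free abelian group on the symbols $[n]$, $n\in N\cap\Sigma$, with product $[m]\cdot[n]=[m+n]$ if $m,n$ lie in a common cone of $\Sigma$, and $0$ otherwise. $S_{\mathbf{\Sigma}}\subset R$ is the subring generated by $[v_1],\dots,[v_k]$. Fix a basis $g_1,\dots,g_d$ of $M=\mathrm{Hom}(N,\mathbb{Z})$, put $Z_j=\sum_{i=1}^kg_j(v_i)[v_i]$, and let $Z=(Z_1,\dots,Z_d)\subset S_{\mathbf{\Sigma}}$ be the ideal they generate. For a maximal cone $\sigma$, $\mathrm{Bx}(\sigma;\beta)\subset\mathbb{C}^k$ is the finite set of $\alpha=(\alpha_i)_{1\le i\le k}$ such that $\sum_{i=1}^k\alpha_iv_i=n+\beta$ for some $n\in N$, $0\le\Re\alpha_i<1$ for all $i$, and $\alpha_i=0$ if $i\notin I(\sigma)$. $\mathrm{Bx}(\mathbf{\Sigma};\beta)$ is the union of the sets $\mathrm{Bx}(\sigma;\beta)$ over all maximal cones $\sigma$. The $R$-module $\mathbb{Z}[\mathbf{\Sigma};\beta]$ is the free abelian group with basis the symbols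 $[n+\beta,\alpha]$ for all $n\in N$ and all $\alpha$ such that, for some maximal cone $\sigma$, $\alpha\in\mathrm{Bx}(\sigma;\beta)$ and $n+\beta\in\sum_{i=1}^k\alpha_iv_i+\sum_{i\in I(\sigma)}\mathbb{Z}_{\ge0}v_i$. The module structure is $[n']\cdot[n+\beta,\alpha]:=[n'+n+\beta,\alpha']$ if there is a maximal cone $\sigma$ with $n'\in\sigma\cap N$, $\alpha\in\mathrm{Bx}(\sigma;\beta)$, $n+\beta\in\sum_i\alpha_iv_i+\sum_{i\in I(\sigma)}\mathbb{Z}_{\ge0}v_i$, where $\alpha'\in\mathrm{Bx}(\sigma;\beta)$ is determined by $n'+n+\beta\in\sum_i\alpha'_iv_i+\sum_{i\in I(\sigma)}\mathbb{Z}_{\ge0}v_i$; if no such $\sigma$ exists the product is $0$ (the product is independent of the choice of $\sigma$). The deformed SR-cohomology is $H\mathbb{Z}(\mathbf{\Sigma};\beta)=\mathbb{Z}[\mathbf{\Sigma};\beta]/Z\cdot\mathbb{Z}[\mathbf{\Sigma};\beta]$, and $H\mathbb{C}(\mathbf{\Sigma};\beta)$ is the same with $\mathbb{Z}$-coefficients replaced by $\mathbb{C}$. For $\alpha\in\mathrm{Bx}(\mathbf{\Sigma};\beta)$, $S_{\mathbf{\Sigma}}(\alpha)\subset S_{\mathbf{\Sigma}}$ is the kernel of the $S_{\mathbf{\Sigma}}$-module map $S_{\mathbf{\Sigma}}\to\mathbb{Z}[\mathbf{\Sigma};\beta]$, $s\mapsto s\cdot[\sum_{i=1}^k\alpha_iv_i,\alpha]$;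 in the quotient $(S_{\mathbf{\Sigma}}\otimes\mathbb{C})/(Z+S_{\mathbf{\Sigma}}(\alpha))$ the ideals are extended to $S_{\mathbf{\Sigma}}\otimes\mathbb{C}$. There is a direct sum decomposition into $S_{\mathbf{\Sigma}}$-submodules $H\mathbb{Z}(\mathbf{\Sigma};\beta)\simeq\bigoplus_{\alpha\in\mathrm{Bx}(\mathbf{\Sigma};\beta)}S_{\mathbf{\Sigma}}/(Z+S_{\mathbf{\Sigma}}(\alpha))$ (the summand of $\alpha$ being generated by $[\sum_i\alpha_iv_i,\alpha]$), and likewise over $\mathbb{C}$. The elements $[v_i]$ are nilpotent in $(S_{\mathbf{\Sigma}}\otimes\mathbb{C})/Z$, so the exponentials make sense. The deformed Grothendieck ring $K\mathbb{C}(\mathbf{\Sigma};\beta)$ is the quotient of $\mathbb{C}[R_1^{\pm1},\dots,R_k^{\pm1}]$ by the ideal $U+V$, where $U$ is generated by the elements $\prod_{i\in I}(1-R_i)$ for all $I\subset\{1,\dots,k\}$ such that $v_i$, $i\in I$, do not generate a cone of $\Sigma$, and $V$ is generated by the elements $\prod_{i=1}^kR_i^{f(v_i)}-e^{2\pi\sqrt{-1}f(\beta)}$ for all linear $f:N\to\mathbb{Z}$. This ring is Artinian, and its maximal ideals correspond bijectively to $\alpha\in\mathrm{Bx}(\mathbf{\Sigma};\beta)$, with $\alpha$ corresponding to the point $R_i=e^{2\pi\sqrt{-1}\,\alpha_i}$. $(K\mathbb{C}(\mathbf{\Sigma};\beta))_\alpha$ denotes the localization at the maximal ideal corresponding to $\alpha$;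 $K\mathbb{C}(\mathbf{\Sigma};\beta)$ is the direct sum of these local rings. "Induced" means that $\phi$ is the direct sum of the $\phi_\alpha$ under these two decompositions. *)

theory Defs
  imports
    "HOL-Analysis.Polytope"
    "HOL-Library.Poly_Mapping"
    "HOL-Algebra.QuotRing"
    "HOL-Algebra.Generated_Rings"
    "HOL-Algebra.Module"
begin

text \<open>
  The real vector space \<open>'v\<close> plays the role of \<open>N \<otimes> \<real>\<close>, with \<open>N\<close> a full lattice in it.  No
  \<open>euclidean_space\<close> structure is assumed, so that \<open>d = 0\<close> is allowed.
\<close>

definition is_lattice :: "nat \<Rightarrow> 'v::real_vector set \<Rightarrow> bool" where
  "is_lattice d N \<longleftrightarrow>
     (\<exists>B. finite B \<and> card B = d \<and> independent B \<and> span B = UNIV \<and>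
          N = {\<Sum>b\<in>B. of_int (c b) *\<^sub>R b | c :: 'v \<Rightarrow> int. True})"

text \<open>
  An element of \<open>M = Hom(N, \<int>)\<close> is represented by its unique real-linear extension to
  \<open>N \<otimes> \<real>\<close>; on lattice points \<open>\<lfloor>f n\<rfloor>\<close> is just the integer \<open>f n\<close>.
\<close>

definition dual_lattice :: "'v::real_vector set \<Rightarrow> ('v \<Rightarrow> real) set" where
  "dual_lattice N = {f. linear f \<and> f ` N \<subseteq> \<int>}"

definition is_dual_basis :: "nat \<Rightarrow> 'v::real_vector set \<Rightarrow> (nat \<Rightarrow> 'v \<Rightarrow> real) \<Rightarrow> bool" where
  "is_dual_basis d N g \<longleftrightarrow>
     (\<forall>j\<in>{1..d}. g j \<in> dual_lattice N) \<and>
     (\<forall>f\<in>dual_lattice N.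
        \<exists>!c. c \<in> {1..d} \<rightarrow>\<^sub>E (UNIV :: int set) \<and> f = (\<lambda>x. \<Sum>j\<in>{1..d}. of_int (c j) * g j x))"

definition rational_simplicial_cone :: "'v::real_vector set \<Rightarrow> 'v set \<Rightarrow> bool" where
  "rational_simplicial_cone N \<sigma> \<longleftrightarrow>
     (\<exists>B. finite B \<and> B \<subseteq> N \<and> independent B \<and> \<sigma> = convex_cone hull B)"

text \<open>The library counts the empty set as a face of every set, hence the condition \<open>\<tau> \<noteq> {}\<close>.\<close>

definition rational_simplicial_fan :: "'v::real_vector set \<Rightarrow> 'v set set \<Rightarrow> bool" where
  "rational_simplicial_fan N \<Sigma> \<longleftrightarrow>
     finite \<Sigma> \<and> \<Sigma> \<noteq> {} \<and>
     (\<forall>\<sigma>\<in>\<Sigma>. rational_simplicial_cone N \<sigma>) \<and>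
     (\<forall>\<sigma>\<in>\<Sigma>. \<forall>\<tau>. \<tau> face_of \<sigma> \<and> \<tau> \<noteq> {} \<longrightarrow> \<tau> \<in> \<Sigma>) \<and>
     (\<forall>\<sigma>\<in>\<Sigma>. \<forall>\<tau>\<in>\<Sigma>. (\<sigma> \<inter> \<tau>) face_of \<sigma> \<and> (\<sigma> \<inter> \<tau>) face_of \<tau>)"

record 'v stacky_fan =
  lat :: "'v set"
  cones :: "'v set set"
  nrays :: nat
  gen :: "nat \<Rightarrow> 'v"

definition simplicial_stacky_fan :: "nat \<Rightarrow> 'v::real_vector stacky_fan \<Rightarrow> bool" where
  "simplicial_stacky_fan d X \<longleftrightarrow>
     is_lattice d (lat X) \<and> rational_simplicial_fan (lat X) (cones X) \<and>
     (\<forall>i\<in>{1..nrays X}. gen X i \<in> lat X \<and> gen X i \<noteq> 0) \<and>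
     bij_betw (\<lambda>i. convex_cone hull {gen X i}) {1..nrays X} {\<rho> \<in> cones X. dim \<rho> = 1}"

definition ray_indices :: "'v::real_vector stacky_fan \<Rightarrow> 'v set \<Rightarrow> nat set" where
  "ray_indices X \<sigma> = {i \<in> {1..nrays X}. (convex_cone hull {gen X i}) face_of \<sigma>}"

definition maximal_cones :: "'v::real_vector stacky_fan \<Rightarrow> 'v set set" where
  "maximal_cones X = {\<sigma> \<in> cones X. \<forall>\<tau>\<in>cones X. \<sigma> \<subseteq> \<tau> \<longrightarrow> \<tau> = \<sigma>}"

text \<open>
  \<open>N \<otimes> \<complex> = (N \<otimes> \<real>) \<oplus> i (N \<otimes> \<real>)\<close> is represented by pairs (real part, imaginary part) in
  \<open>'v \<times> 'v\<close>.
\<close>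

definition of_lat :: "'v::real_vector \<Rightarrow> 'v \<times> 'v" where
  "of_lat n = (n, 0)"

definition dual_ext :: "('v \<Rightarrow> real) \<Rightarrow> 'v \<times> 'v \<Rightarrow> complex" where
  "dual_ext f \<beta> = Complex (f (fst \<beta>)) (f (snd \<beta>))"

definition lin_comb :: "'v::real_vector stacky_fan \<Rightarrow> (nat \<Rightarrow> complex) \<Rightarrow> 'v \<times> 'v" where
  "lin_comb X \<alpha> =
     (\<Sum>i\<in>{1..nrays X}. Re (\<alpha> i) *\<^sub>R gen X i, \<Sum>i\<in>{1..nrays X}. Im (\<alpha> i) *\<^sub>R gen X i)"

text \<open>
  Vectors in \<open>\<complex>\<^sup>k\<close> are functions on \<open>nat\<close> that vanish outside \<open>{1..k}\<close>; in \<open>Bx\<close> this is part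
  of the last condition, since \<open>ray_indices X \<sigma> \<subseteq> {1..nrays X}\<close>.
\<close>

definition Bx :: "'v::real_vector stacky_fan \<Rightarrow> 'v \<times> 'v \<Rightarrow> 'v set \<Rightarrow> (nat \<Rightarrow> complex) set" where
  "Bx X \<beta> \<sigma> =
     {\<alpha>. (\<exists>n\<in>lat X. lin_comb X \<alpha> = of_lat n + \<beta>) \<and>
         (\<forall>i. 0 \<le> Re (\<alpha> i) \<and> Re (\<alpha> i) < 1) \<and>
         (\<forall>i. i \<notin> ray_indices X \<sigma> \<longrightarrow> \<alpha> i = 0)}"

definition Box :: "'v::real_vector stacky_fan \<Rightarrow> 'v \<times> 'v \<Rightarrow> (nat \<Rightarrow> complex) set" where
  "Box X \<beta> = (\<Union>\<sigma>\<in>maximal_cones X. Bx X \<beta> \<sigma>)"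

text \<open>
  \<open>'b \<Rightarrow>\<^sub>0 'a\<close> is the free \<open>'a\<close>-module on the symbols \<open>'b\<close>; the coefficients \<open>'a\<close> are \<open>int\<close> or
  \<open>complex\<close>.  The multiplication of \<open>\<int>[\<Sigma>]\<close> below is not the monoid-ring multiplication provided
  by the type class.
\<close>

definition sr_mult ::
  "'v::real_vector stacky_fan \<Rightarrow> ('v \<Rightarrow>\<^sub>0 'a) \<Rightarrow> ('v \<Rightarrow>\<^sub>0 'a) \<Rightarrow> ('v \<Rightarrow>\<^sub>0 'a::comm_ring_1)" where
  "sr_mult X p q =
     (\<Sum>m\<in>Poly_Mapping.keys p. \<Sum>n\<in>Poly_Mapping.keys q.
        if \<exists>\<sigma>\<in>cones X. m \<in> \<sigma> \<and> n \<in> \<sigma>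
        then Poly_Mapping.single (m + n) (Poly_Mapping.lookup p m * Poly_Mapping.lookup q n)
        else 0)"

definition SR :: "'v::real_vector stacky_fan \<Rightarrow> ('v \<Rightarrow>\<^sub>0 'a::comm_ring_1) ring" where
  "SR X =
     \<lparr>carrier = {p. Poly_Mapping.keys p \<subseteq> lat X \<inter> \<Union>(cones X)},
      mult = sr_mult X,
      one = Poly_Mapping.single 0 1,
      zero = 0,
      add = (+)\<rparr>"

text \<open>\<open>x\<close> stands for \<open>n + \<beta>\<close>: the symbol \<open>[n + \<beta>, \<alpha>]\<close> is admitted because of the cone \<open>\<sigma>\<close>.\<close>

definition symbol_at ::
  "'v::real_vector stacky_fan \<Rightarrow> 'v \<times> 'v \<Rightarrow> 'v set \<Rightarrow> 'v \<times> 'v \<Rightarrow> (nat \<Rightarrow> complex) \<Rightarrow> bool" where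
  "symbol_at X \<beta> \<sigma> x \<alpha> \<longleftrightarrow>
     \<alpha> \<in> Bx X \<beta> \<sigma> \<and>
     (\<exists>m :: nat \<Rightarrow> nat. x = lin_comb X \<alpha> + of_lat (\<Sum>i\<in>ray_indices X \<sigma>. of_nat (m i) *\<^sub>R gen X i))"

definition symbols ::
  "'v::real_vector stacky_fan \<Rightarrow> 'v \<times> 'v \<Rightarrow> (('v \<times> 'v) \<times> (nat \<Rightarrow> complex)) set" where
  "symbols X \<beta> =
     {(x, \<alpha>). (\<exists>n\<in>lat X. x = of_lat n + \<beta>) \<and> (\<exists>\<sigma>\<in>maximal_cones X. symbol_at X \<beta> \<sigma> x \<alpha>)}"

definition sr_act ::
  "'v::real_vector stacky_fan \<Rightarrow> 'v \<times> 'v \<Rightarrow> ('v \<Rightarrow>\<^sub>0 'a) \<Rightarrow>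
     (('v \<times> 'v) \<times> (nat \<Rightarrow> complex) \<Rightarrow>\<^sub>0 'a) \<Rightarrow> (('v \<times> 'v) \<times> (nat \<Rightarrow> complex) \<Rightarrow>\<^sub>0 'a::comm_ring_1)"
where
  "sr_act X \<beta> p q =
     (\<Sum>n'\<in>Poly_Mapping.keys p. \<Sum>(x, \<alpha>)\<in>Poly_Mapping.keys q.
        if \<exists>\<sigma>\<in>maximal_cones X. n' \<in> \<sigma> \<and> symbol_at X \<beta> \<sigma> x \<alpha>
        then Poly_Mapping.single
               (of_lat n' + x,
                THE \<alpha>'. \<exists>\<sigma>\<in>maximal_cones X.
                  n' \<in> \<sigma> \<and> symbol_at X \<beta> \<sigma> x \<alpha> \<and> symbol_at X \<beta> \<sigma> (of_lat n' + x) \<alpha>')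
               (Poly_Mapping.lookup p n' * Poly_Mapping.lookup q (x, \<alpha>))
        else 0)"

definition SR_module ::
  "'v::real_vector stacky_fan \<Rightarrow> 'v \<times> 'v \<Rightarrow>
     ('v \<Rightarrow>\<^sub>0 'a::comm_ring_1, ('v \<times> 'v) \<times> (nat \<Rightarrow> complex) \<Rightarrow>\<^sub>0 'a) module" where
  "SR_module X \<beta> =
     \<lparr>carrier = {q. Poly_Mapping.keys q \<subseteq> symbols X \<beta>},
      mult = undefined,
      one = undefined,
      zero = 0,
      add = (+),
      smult = sr_act X \<beta>\<rparr>"

definition box_symbol ::
  "'v::real_vector stacky_fan \<Rightarrow> (nat \<Rightarrow> complex) \<Rightarrow>
     (('v \<times> 'v) \<times> (nat \<Rightarrow> complex) \<Rightarrow>\<^sub>0 'a::comm_ring_1)" where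
  "box_symbol X \<alpha> = Poly_Mapping.single (lin_comb X \<alpha>, \<alpha>) 1"

definition ray_elt :: "'v::real_vector stacky_fan \<Rightarrow> nat \<Rightarrow> ('v \<Rightarrow>\<^sub>0 'a::comm_ring_1)" where
  "ray_elt X i = Poly_Mapping.single (gen X i) 1"

definition S_ring :: "'v::real_vector stacky_fan \<Rightarrow> ('v \<Rightarrow>\<^sub>0 int) ring" where
  "S_ring X = (SR X)\<lparr>carrier := generate_ring (SR X) (ray_elt X ` {1..nrays X})\<rparr>"

definition Z_elt :: "'v::real_vector stacky_fan \<Rightarrow> (nat \<Rightarrow> 'v \<Rightarrow> real) \<Rightarrow> nat \<Rightarrow> ('v \<Rightarrow>\<^sub>0 int)" where
  "Z_elt X g j = (\<Sum>i\<in>{1..nrays X}. Poly_Mapping.single (gen X i) \<lfloor>g j (gen X i)\<rfloor>)"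

definition Z_ideal ::
  "nat \<Rightarrow> 'v::real_vector stacky_fan \<Rightarrow> (nat \<Rightarrow> 'v \<Rightarrow> real) \<Rightarrow> ('v \<Rightarrow>\<^sub>0 int) set" where
  "Z_ideal d X g = genideal (S_ring X) (Z_elt X g ` {1..d})"

definition S_ann ::
  "'v::real_vector stacky_fan \<Rightarrow> 'v \<times> 'v \<Rightarrow> (nat \<Rightarrow> complex) \<Rightarrow> ('v \<Rightarrow>\<^sub>0 int) set" where
  "S_ann X \<beta> \<alpha> =
     a_kernel (S_ring X) (SR_module X \<beta>) (\<lambda>s. s \<odot>\<^bsub>SR_module X \<beta>\<^esub> box_symbol X \<alpha>)"

definition coeff_ext :: "('b \<Rightarrow>\<^sub>0 int) \<Rightarrow> ('b \<Rightarrow>\<^sub>0 'a::comm_ring_1)" where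
  "coeff_ext = Poly_Mapping.map of_int"

definition scalar :: "complex \<Rightarrow> ('b::zero \<Rightarrow>\<^sub>0 complex)" where
  "scalar c = Poly_Mapping.single 0 c"

text \<open>
  \<open>S\<close> is a subgroup of the free abelian group \<open>\<int>[\<Sigma>]\<close> and \<open>\<complex>\<close> is flat over \<open>\<int>\<close>, so \<open>S \<otimes> \<complex>\<close> embeds
  into \<open>\<int>[\<Sigma>] \<otimes> \<complex> = \<complex>[\<Sigma>]\<close>.  It is represented by its image there, the additive group generated
  by the products \<open>c s\<close>, which stand for the pure tensors \<open>s \<otimes> c\<close>.
\<close>

definition SC_ring :: "'v::real_vector stacky_fan \<Rightarrow> ('v \<Rightarrow>\<^sub>0 complex) ring" where
  "SC_ring X = (SR X)\<lparr>carrier :=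
     generate (add_monoid (SR X))
       {scalar c \<otimes>\<^bsub>SR X\<^esub> coeff_ext s | c s. s \<in> carrier (S_ring X)}\<rparr>"

definition ideal_ext :: "'v::real_vector stacky_fan \<Rightarrow> ('v \<Rightarrow>\<^sub>0 int) set \<Rightarrow> ('v \<Rightarrow>\<^sub>0 complex) set" where
  "ideal_ext X I = genideal (SC_ring X) (coeff_ext ` I)"

definition Q_ideal ::
  "nat \<Rightarrow> 'v::real_vector stacky_fan \<Rightarrow> (nat \<Rightarrow> 'v \<Rightarrow> real) \<Rightarrow> 'v \<times> 'v \<Rightarrow> (nat \<Rightarrow> complex) \<Rightarrow>
     ('v \<Rightarrow>\<^sub>0 complex) set" where
  "Q_ideal d X g \<beta> \<alpha> = ideal_ext X (Z_ideal d X g) <+>\<^bsub>SC_ring X\<^esub> ideal_ext X (S_ann X \<beta> \<alpha>)"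

definition Q_ring ::
  "nat \<Rightarrow> 'v::real_vector stacky_fan \<Rightarrow> (nat \<Rightarrow> 'v \<Rightarrow> real) \<Rightarrow> 'v \<times> 'v \<Rightarrow> (nat \<Rightarrow> complex) \<Rightarrow>
     ('v \<Rightarrow>\<^sub>0 complex) set ring" where
  "Q_ring d X g \<beta> \<alpha> = SC_ring X Quot Q_ideal d X g \<beta> \<alpha>"

definition Q_class ::
  "nat \<Rightarrow> 'v::real_vector stacky_fan \<Rightarrow> (nat \<Rightarrow> 'v \<Rightarrow> real) \<Rightarrow> 'v \<times> 'v \<Rightarrow> (nat \<Rightarrow> complex) \<Rightarrow>
     ('v \<Rightarrow>\<^sub>0 complex) \<Rightarrow> ('v \<Rightarrow>\<^sub>0 complex) set" where
  "Q_class d X g \<beta> \<alpha> s = Q_ideal d X g \<beta> \<alpha> +>\<^bsub>SC_ring X\<^esub> s"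

definition module_quot :: "('r, 'm) module \<Rightarrow> 'm set \<Rightarrow> ('r, 'm set) module" where
  "module_quot M H =
     \<lparr>carrier = a_rcosets\<^bsub>M\<^esub> H,
      mult = undefined,
      one = undefined,
      zero = H,
      add = set_add M,
      smult = (\<lambda>r A. \<Union>m\<in>A. H +>\<^bsub>M\<^esub> (r \<odot>\<^bsub>M\<^esub> m))\<rparr>"

definition Z_submodule ::
  "nat \<Rightarrow> 'v::real_vector stacky_fan \<Rightarrow> (nat \<Rightarrow> 'v \<Rightarrow> real) \<Rightarrow> 'v \<times> 'v \<Rightarrow>
     (('v \<times> 'v) \<times> (nat \<Rightarrow> complex) \<Rightarrow>\<^sub>0 'a::comm_ring_1) set" where
  "Z_submodule d X g \<beta> =
     generate (add_monoid (SR_module X \<beta>))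
       {coeff_ext z \<odot>\<^bsub>SR_module X \<beta>\<^esub> m | z m. z \<in> Z_ideal d X g \<and> m \<in> carrier (SR_module X \<beta>)}"

definition HC ::
  "nat \<Rightarrow> 'v::real_vector stacky_fan \<Rightarrow> (nat \<Rightarrow> 'v \<Rightarrow> real) \<Rightarrow> 'v \<times> 'v \<Rightarrow>
     ('v \<Rightarrow>\<^sub>0 complex, (('v \<times> 'v) \<times> (nat \<Rightarrow> complex) \<Rightarrow>\<^sub>0 complex) set) module" where
  "HC d X g \<beta> = module_quot (SR_module X \<beta>) (Z_submodule d X g \<beta>)"

text \<open>
  The embedding of the summand of \<open>\<alpha>\<close> in the decomposition of \<open>H\<complex>\<close>: the class of \<open>s\<close> goes to
  \<open>s\<close> times the class of the generator.  All members of the union are the same coset.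
\<close>

definition H_summand ::
  "nat \<Rightarrow> 'v::real_vector stacky_fan \<Rightarrow> (nat \<Rightarrow> 'v \<Rightarrow> real) \<Rightarrow> 'v \<times> 'v \<Rightarrow> (nat \<Rightarrow> complex) \<Rightarrow>
     ('v \<Rightarrow>\<^sub>0 complex) set \<Rightarrow> (('v \<times> 'v) \<times> (nat \<Rightarrow> complex) \<Rightarrow>\<^sub>0 complex) set" where
  "H_summand d X g \<beta> \<alpha> A =
     (\<Union>s\<in>A. s \<odot>\<^bsub>HC d X g \<beta>\<^esub> (Z_submodule d X g \<beta> +>\<^bsub>SR_module X \<beta>\<^esub> box_symbol X \<alpha>))"

text \<open>
  A Laurent monomial is its exponent vector \<open>nat \<Rightarrow>\<^sub>0 int\<close>; here the multiplication is the one of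
  the type class.
\<close>

definition laurent_ring :: "nat \<Rightarrow> ((nat \<Rightarrow>\<^sub>0 int) \<Rightarrow>\<^sub>0 complex) ring" where
  "laurent_ring k =
     \<lparr>carrier = {p. \<forall>m\<in>Poly_Mapping.keys p. Poly_Mapping.keys m \<subseteq> {1..k}},
      mult = (*),
      one = 1,
      zero = 0,
      add = (+)\<rparr>"

definition laurent_power :: "nat \<Rightarrow> int \<Rightarrow> ((nat \<Rightarrow>\<^sub>0 int) \<Rightarrow>\<^sub>0 complex)" where
  "laurent_power i a = Poly_Mapping.single (Poly_Mapping.single i a) 1"

abbreviation laurent_var :: "nat \<Rightarrow> ((nat \<Rightarrow>\<^sub>0 int) \<Rightarrow>\<^sub>0 complex)" where
  "laurent_var i \<equiv> laurent_power i 1"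

definition laurent_eval :: "nat \<Rightarrow> (nat \<Rightarrow> complex) \<Rightarrow> ((nat \<Rightarrow>\<^sub>0 int) \<Rightarrow>\<^sub>0 complex) \<Rightarrow> complex" where
  "laurent_eval k r p =
     (\<Sum>m\<in>Poly_Mapping.keys p.
        Poly_Mapping.lookup p m * (\<Prod>i\<in>{1..k}. r i powi Poly_Mapping.lookup m i))"

definition U_ideal :: "'v::real_vector stacky_fan \<Rightarrow> ((nat \<Rightarrow>\<^sub>0 int) \<Rightarrow>\<^sub>0 complex) set" where
  "U_ideal X = genideal (laurent_ring (nrays X))
     {\<Prod>i\<in>I. (1 - laurent_var i) | I.
        I \<subseteq> {1..nrays X} \<and> convex_cone hull (gen X ` I) \<notin> cones X}"

definition V_ideal :: "'v::real_vector stacky_fan \<Rightarrow> 'v \<times> 'v \<Rightarrow> ((nat \<Rightarrow>\<^sub>0 int) \<Rightarrow>\<^sub>0 complex) set" where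
  "V_ideal X \<beta> = genideal (laurent_ring (nrays X))
     {(\<Prod>i\<in>{1..nrays X}. laurent_power i \<lfloor>f (gen X i)\<rfloor>)
        - scalar (exp (2 * of_real pi * \<i> * dual_ext f \<beta>)) | f. f \<in> dual_lattice (lat X)}"

definition UV_ideal :: "'v::real_vector stacky_fan \<Rightarrow> 'v \<times> 'v \<Rightarrow> ((nat \<Rightarrow>\<^sub>0 int) \<Rightarrow>\<^sub>0 complex) set" where
  "UV_ideal X \<beta> = U_ideal X <+>\<^bsub>laurent_ring (nrays X)\<^esub> V_ideal X \<beta>"

definition KC :: "'v::real_vector stacky_fan \<Rightarrow> 'v \<times> 'v \<Rightarrow> ((nat \<Rightarrow>\<^sub>0 int) \<Rightarrow>\<^sub>0 complex) set ring" where
  "KC X \<beta> = laurent_ring (nrays X) Quot UV_ideal X \<beta>"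

definition K_class ::
  "'v::real_vector stacky_fan \<Rightarrow> 'v \<times> 'v \<Rightarrow> ((nat \<Rightarrow>\<^sub>0 int) \<Rightarrow>\<^sub>0 complex) \<Rightarrow>
     ((nat \<Rightarrow>\<^sub>0 int) \<Rightarrow>\<^sub>0 complex) set" where
  "K_class X \<beta> p = UV_ideal X \<beta> +>\<^bsub>laurent_ring (nrays X)\<^esub> p"

definition K_point :: "(nat \<Rightarrow> complex) \<Rightarrow> nat \<Rightarrow> complex" where
  "K_point \<alpha> i = exp (2 * of_real pi * \<i> * \<alpha> i)"

definition K_max_ideal ::
  "'v::real_vector stacky_fan \<Rightarrow> 'v \<times> 'v \<Rightarrow> (nat \<Rightarrow> complex) \<Rightarrow>
     ((nat \<Rightarrow>\<^sub>0 int) \<Rightarrow>\<^sub>0 complex) set set" where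
  "K_max_ideal X \<beta> \<alpha> =
     K_class X \<beta> ` {p \<in> carrier (laurent_ring (nrays X)). laurent_eval (nrays X) (K_point \<alpha>) p = 0}"

text \<open>
  Fractions with denominators outside the prime ideal \<open>P\<close>, as classes of pairs (numerator,
  denominator).  In the operations all members of the unions are the same class.
\<close>

definition fraction :: "('a, 'b) ring_scheme \<Rightarrow> 'a set \<Rightarrow> 'a \<Rightarrow> 'a \<Rightarrow> ('a \<times> 'a) set" where
  "fraction A P a s =
     {(b, t). b \<in> carrier A \<and> t \<in> carrier A - P \<and>
        (\<exists>u\<in>carrier A - P. u \<otimes>\<^bsub>A\<^esub> (t \<otimes>\<^bsub>A\<^esub> a \<ominus>\<^bsub>A\<^esub> s \<otimes>\<^bsub>A\<^esub> b) = \<zero>\<^bsub>A\<^esub>)}"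

definition localization :: "('a, 'b) ring_scheme \<Rightarrow> 'a set \<Rightarrow> ('a \<times> 'a) set ring" where
  "localization A P =
     \<lparr>carrier = {fraction A P a s | a s. a \<in> carrier A \<and> s \<in> carrier A - P},
      mult = (\<lambda>F G. \<Union>(a, s)\<in>F. \<Union>(b, t)\<in>G. fraction A P (a \<otimes>\<^bsub>A\<^esub> b) (s \<otimes>\<^bsub>A\<^esub> t)),
      one = fraction A P \<one>\<^bsub>A\<^esub> \<one>\<^bsub>A\<^esub>,
      zero = fraction A P \<zero>\<^bsub>A\<^esub> \<one>\<^bsub>A\<^esub>,
      add = (\<lambda>F G. \<Union>(a, s)\<in>F. \<Union>(b, t)\<in>G.
               fraction A P (t \<otimes>\<^bsub>A\<^esub> a \<oplus>\<^bsub>A\<^esub> s \<otimes>\<^bsub>A\<^esub> b) (s \<otimes>\<^bsub>A\<^esub> t))\<rparr>"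

definition KC_local ::
  "'v::real_vector stacky_fan \<Rightarrow> 'v \<times> 'v \<Rightarrow> (nat \<Rightarrow> complex) \<Rightarrow>
     (((nat \<Rightarrow>\<^sub>0 int) \<Rightarrow>\<^sub>0 complex) set \<times> ((nat \<Rightarrow>\<^sub>0 int) \<Rightarrow>\<^sub>0 complex) set) set ring" where
  "KC_local X \<beta> \<alpha> = localization (KC X \<beta>) (K_max_ideal X \<beta> \<alpha>)"

definition K_localize ::
  "'v::real_vector stacky_fan \<Rightarrow> 'v \<times> 'v \<Rightarrow> (nat \<Rightarrow> complex) \<Rightarrow> ((nat \<Rightarrow>\<^sub>0 int) \<Rightarrow>\<^sub>0 complex) set \<Rightarrow>
     (((nat \<Rightarrow>\<^sub>0 int) \<Rightarrow>\<^sub>0 complex) set \<times> ((nat \<Rightarrow>\<^sub>0 int) \<Rightarrow>\<^sub>0 complex) set) set" where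
  "K_localize X \<beta> \<alpha> x = fraction (KC X \<beta>) (K_max_ideal X \<beta> \<alpha>) x \<one>\<^bsub>KC X \<beta>\<^esub>"

text \<open>
  A \<open>\<complex>\<close>-algebra is a ring \<open>A\<close> with its structure homomorphism \<open>\<iota> :: complex \<Rightarrow> _\<close>; a complex
  vector space is an additive group with a scalar multiplication.
\<close>

definition complex_algebra_iso ::
  "('a, 'm) ring_scheme \<Rightarrow> (complex \<Rightarrow> 'a) \<Rightarrow> ('b, 'n) ring_scheme \<Rightarrow> (complex \<Rightarrow> 'b) \<Rightarrow> ('a \<Rightarrow> 'b) set"
where
  "complex_algebra_iso A \<iota> B \<kappa> = {h \<in> ring_iso A B. \<forall>c. h (\<iota> c) = \<kappa> c}"

definition complex_linear_iso ::
  "('a, 'm) ring_scheme \<Rightarrow> (complex \<Rightarrow> 'a \<Rightarrow> 'a) \<Rightarrow>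
     ('b, 'n) ring_scheme \<Rightarrow> (complex \<Rightarrow> 'b \<Rightarrow> 'b) \<Rightarrow> ('a \<Rightarrow> 'b) set"
where
  "complex_linear_iso A s B t =
     {h. bij_betw h (carrier A) (carrier B) \<and>
         (\<forall>x\<in>carrier A. \<forall>y\<in>carrier A. h (x \<oplus>\<^bsub>A\<^esub> y) = h x \<oplus>\<^bsub>B\<^esub> h y) \<and>
         (\<forall>c. \<forall>x\<in>carrier A. h (s c x) = t c (h x))}"

text \<open>
  The value of \<open>e\<^bsup>c + x\<^esup>\<close> for a scalar \<open>c\<close> and nilpotent \<open>x\<close>:
  \<open>e\<^bsup>c + x\<^esup> = e\<^bsup>c\<^esup> (\<Sum>m. x\<^sup>m / m!)\<close>, summing over the finitely
  many \<open>m\<close> with \<open>x\<^sup>m \<noteq> 0\<close>.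
\<close>

definition exp_nilpotent ::
  "('a, 'm) ring_scheme \<Rightarrow> (complex \<Rightarrow> 'a) \<Rightarrow> complex \<Rightarrow> 'a \<Rightarrow> 'a" where
  "exp_nilpotent A \<iota> c x =
     \<iota> (exp c) \<otimes>\<^bsub>A\<^esub>
       finsum A (\<lambda>m. \<iota> (1 / fact m) \<otimes>\<^bsub>A\<^esub> (x [^]\<^bsub>A\<^esub> m)) {m :: nat. x [^]\<^bsub>A\<^esub> m \<noteq> \<zero>\<^bsub>A\<^esub>}"

end

theory Submission
  imports
    Defs
    "HOL-Computational_Algebra.Fundamental_Theorem_Algebra"
    "HOL-Analysis.Complex_Transcendental"
begin

text \<open>
  The \<open>R\<^sub>i\<close> take values \<open>e\<^bsup>2\<pi>i\<alpha>\<^sub>i\<^esup>\<close> at the point of \<open>\<alpha>\<close>, so near that point one may write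
  \<open>R\<^sub>i = e\<^bsup>2\<pi>i\<alpha>\<^sub>i + x\<^sub>i\<^esup>\<close> with nilpotent \<open>x\<^sub>i\<close>.  In these coordinates the relations of the Grothendieck ring
  become those of the cohomology.  The relation of \<open>V\<close> for \<open>f\<close> is a unit times \<open>e\<^bsup>\<Sum> f(v\<^sub>i) x\<^sub>i\<^esup> - 1\<close>, because
  \<open>\<Sum> \<alpha>\<^sub>i v\<^sub>i - \<beta>\<close> is a lattice point, hence a unit times the linear form \<open>\<Sum> f(v\<^sub>i) x\<^sub>i\<close>, and these forms generate
  \<open>Z\<close>.  In a generator of \<open>U\<close> the factor \<open>1 - R\<^sub>i\<close> is a unit if \<open>\<alpha>\<^sub>i \<noteq> 0\<close> and a unit times \<open>x\<^sub>i\<close> if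
  \<open>\<alpha>\<^sub>i = 0\<close>; so \<open>U\<close> becomes the ideal of the monomials \<open>x\<^sup>m\<close> for which the supports of \<open>m\<close> and \<open>\<alpha>\<close>
  together are not a face, and these are the Stanley-Reisner relations together with \<open>S(\<alpha>)\<close>.

  Both sides are compared with the polynomial ring in the \<open>x\<^sub>i\<close>.  It maps onto \<open>S \<otimes> \<complex>\<close> (\<open>sr_hom\<close>), and
  the preimage of \<open>Z + S(\<alpha>)\<close> is \<open>box_ideal \<alpha>\<close> (\<open>Q_ideal_sr_hom\<close>, \<open>sr_hom_in_box_ideal_iff\<close>).  The map \<open>Phi \<alpha>\<close>
  from Laurent polynomials to polynomials is the substitution above; it is multiplicative modulo \<open>box_ideal \<alpha>\<close>
  and kills \<open>U + V\<close> (\<open>Phi_UV\<close>).  It is onto because a subalgebra that contains the exponential of a nilpotent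
  contains the nilpotent (\<open>Phi_surj\<close>).  Taking logarithms of the \<open>e\<^bsup>-2\<pi>i\<alpha>\<^sub>i\<^esup> R\<^sub>i\<close> gives a map \<open>Psi \<alpha>\<close> back,
  and it follows that an element killed by \<open>Phi \<alpha>\<close> vanishes after multiplication by some \<open>u\<close> with
  \<open>u(\<alpha>) \<noteq> 0\<close> (\<open>local_injectivity\<close>).  That is exactly what makes \<open>Phi \<alpha>\<close> induce an isomorphism on the localization.

  Finiteness comes from one argument, \<open>transversal_prod\<close>.  On a single maximal cone \<open>\<sigma>\<close>, that is, when \<open>R\<^sub>i = 1\<close>
  for all \<open>v\<^sub>i\<close> outside \<open>\<sigma>\<close>, the relations \<open>V\<close> make each \<open>R\<^sub>j\<close> a root of an explicit one-variable polynomial;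
  the product of these polynomials over all maximal cones vanishes because non-faces vanish in \<open>U\<close>.
  The same argument makes the \<open>x\<^sub>i\<close> nilpotent.  It also yields the finiteness of the box and a
  Nullstellensatz (\<open>nullstellensatz\<close>), which turns local into global injectivity (\<open>global_injectivity\<close>); a Chinese
  remainder argument gives surjectivity onto the sum over the box.  Finally the deformed module is visibly the
  direct sum over \<open>\<alpha>\<close> of the polynomial ring modulo the non-face monomials for \<open>\<alpha>\<close> (\<open>module_map\<close>), so its
  quotient by \<open>Z\<close> is the sum of the \<open>box_ideal\<close> quotients (\<open>Zsub_eq\<close>).
\<close>

abbreviation "keys \<equiv> Poly_Mapping.keys"
abbreviation "lookup \<equiv> Poly_Mapping.lookup"
abbreviation "single \<equiv> Poly_Mapping.single"
type_synonym 'a mpoly = "(nat \<Rightarrow>\<^sub>0 nat) \<Rightarrow>\<^sub>0 'a"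
type_synonym laurent = "(nat \<Rightarrow>\<^sub>0 int) \<Rightarrow>\<^sub>0 complex"

section \<open>Ideals and exponentials in complex algebras\<close>

text \<open>
  Ideals are taken relative to a subring \<open>C\<close>, because the Laurent polynomials in
  \<open>R\<^sub>1, \<dots>, R\<^sub>k\<close> are a subring of a ring with infinitely many variables.  A congruence modulo \<open>J\<close> is
  written \<open>a - b \<in> J\<close>.
\<close>

definition rel_ideal :: "'a::comm_ring_1 set \<Rightarrow> 'a set \<Rightarrow> bool" where
  "rel_ideal C J \<longleftrightarrow> J \<subseteq> C \<and> 0 \<in> J \<and> (\<forall>a\<in>J. \<forall>b\<in>J. a + b \<in> J) \<and> (\<forall>r\<in>C. \<forall>a\<in>J. r * a \<in> J)"

locale complex_subalgebra =
  fixes C :: "'a::comm_ring_1 set" and \<iota> :: "complex \<Rightarrow> 'a"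
  assumes iota_zero [simp]: "\<iota> 0 = 0" and iota_one [simp]: "\<iota> 1 = 1"
    and iota_add: "\<iota> (a + b) = \<iota> a + \<iota> b" and iota_mult: "\<iota> (a * b) = \<iota> a * \<iota> b"
    and iota_in [simp, intro]: "\<iota> a \<in> C"
    and add_in [intro]: "x \<in> C \<Longrightarrow> y \<in> C \<Longrightarrow> x + y \<in> C"
    and mult_in [intro]: "x \<in> C \<Longrightarrow> y \<in> C \<Longrightarrow> x * y \<in> C"
begin

lemma one_in [simp, intro]: "1 \<in> C" and zero_in [simp, intro]: "0 \<in> C"
  using iota_in[of 1] iota_in[of 0] by simp_all

lemma iota_uminus: "\<iota> (- a) = - \<iota> a"
  using iota_add[of a "- a"] by (simp add: add_eq_0_iff2)

lemma uminus_in [intro]: "x \<in> C \<Longrightarrow> - x \<in> C"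
  using mult_in[OF iota_in[of "- 1"], of x] by (simp add: iota_uminus)

lemma diff_in [intro]: "x \<in> C \<Longrightarrow> y \<in> C \<Longrightarrow> x - y \<in> C"
  using add_in[of x "- y"] by auto

lemma sum_in [intro]: "(\<And>i. i \<in> A \<Longrightarrow> f i \<in> C) \<Longrightarrow> sum f A \<in> C"
  by (induction A rule: infinite_finite_induct) auto

lemma prod_in [intro]: "(\<And>i. i \<in> A \<Longrightarrow> f i \<in> C) \<Longrightarrow> prod f A \<in> C"
  by (induction A rule: infinite_finite_induct) auto

lemma power_in [intro]: "x \<in> C \<Longrightarrow> x ^ n \<in> C"
  by (induction n) auto

lemma iota_prod: "\<iota> (prod f A) = (\<Prod>i\<in>A. \<iota> (f i))"
  by (induction A rule: infinite_finite_induct) (auto simp: iota_mult)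

lemma iota_power: "\<iota> (a ^ n) = \<iota> a ^ n"
  by (induction n) (auto simp: iota_mult)

definition ev :: "complex poly \<Rightarrow> 'a \<Rightarrow> 'a" where
  "ev p x = poly (map_poly \<iota> p) x"

lemma ev_0 [simp]: "ev 0 x = 0" by (simp add: ev_def)

lemma ev_pCons [simp]: "ev (pCons a p) x = \<iota> a + x * ev p x"
  by (simp add: ev_def map_poly_pCons)

lemma ev_add [simp]: "ev (p + q) x = ev p x + ev q x"
proof (induction p arbitrary: q)
  case 0 then show ?case by simp
next
  case (pCons a p)
  obtain b r where q: "q = pCons b r" by (cases q) auto
  show ?case by (simp only: q add_pCons ev_pCons iota_add pCons.IH distrib_left ac_simps)
qed

lemma ev_smult [simp]: "ev (smult c p) x = \<iota> c * ev p x"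
  by (induction p) (auto simp: iota_mult algebra_simps)

lemma ev_mult [simp]: "ev (p * q) x = ev p x * ev q x"
  by (induction p) (auto simp: algebra_simps)

lemma ev_one [simp]: "ev 1 x = 1" by (simp add: one_pCons)

lemma ev_power [simp]: "ev (p ^ n) x = ev p x ^ n"
  by (induction n) auto

lemma ev_monom: "ev (monom c n) x = \<iota> c * x ^ n"
  by (induction n) (auto simp: monom_0 monom_Suc algebra_simps)

lemma ev_uminus [simp]: "ev (- p) x = - ev p x"
  using ev_add[of p "-p" x] by (simp add: add_eq_0_iff2)

lemma ev_diff [simp]: "ev (p - q) x = ev p x - ev q x"
  using ev_add[of p "-q" x] by simp

lemma ev_sum: "ev (sum f A) x = (\<Sum>i\<in>A. ev (f i) x)"
  by (induction A rule: infinite_finite_induct) auto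

lemma ev_prod: "ev (prod f A) x = (\<Prod>i\<in>A. ev (f i) x)"
  by (induction A rule: infinite_finite_induct) auto

lemma ev_in [intro]: "x \<in> C \<Longrightarrow> ev p x \<in> C"
  by (induction p) auto

text \<open>The polynomial \<open>X\<^sup>q - c\<close> splits over \<open>\<complex>\<close>; evaluate the factorization at \<open>x\<close>.\<close>

lemma power_minus_const_splits:
  assumes "q > 0"
  shows "\<exists>\<rho>. x ^ q - \<iota> c = (\<Prod>i<q. x - \<iota> (\<rho> i))"
proof -
  let ?p = "monom 1 q - [:c:] :: complex poly"
  have deg: "degree ?p = q" and lc: "lead_coeff ?p = 1"
  proof -
    have "degree [:c:] < degree (monom 1 q :: complex poly)" using assms by (simp add: degree_monom_eq)
    then show "degree ?p = q" using degree_add_eq_left[of "- [:c:]" "monom 1 q"]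
      unfolding diff_conv_add_uminus by (simp add: degree_monom_eq)
    then show "lead_coeff ?p = 1" using assms by (simp add: coeff_pCons split: nat.splits)
  qed
  obtain \<rho> where "smult (lead_coeff ?p) (\<Prod>k<degree ?p. [:- \<rho> k, 1:]) = ?p"
    by (rule complex_poly_decompose')
  then have "?p = (\<Prod>k<q. [:- \<rho> k, 1:])" using deg lc by simp
  then have "ev ?p x = ev (\<Prod>k<q. [:- \<rho> k, 1:]) x" by simp
  then have "x ^ q - \<iota> c = (\<Prod>i<q. x - \<iota> (\<rho> i))"
    by (simp add: ev_prod ev_monom iota_uminus)
  then show ?thesis by blast
qed

end

locale subalgebra_ideal = complex_subalgebra +
  fixes J
  assumes rel_ideal: "rel_ideal C J"
begin

lemma ideal_sub: "a \<in> J \<Longrightarrow> a \<in> C"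
  and ideal_zero [simp, intro]: "0 \<in> J"
  and ideal_add [intro]: "a \<in> J \<Longrightarrow> b \<in> J \<Longrightarrow> a + b \<in> J"
  and ideal_mult [intro]: "r \<in> C \<Longrightarrow> a \<in> J \<Longrightarrow> r * a \<in> J"
  using rel_ideal by (auto simp: rel_ideal_def)

lemma ideal_mult' [intro]: "a \<in> J \<Longrightarrow> r \<in> C \<Longrightarrow> a * r \<in> J"
  using ideal_mult[of r a] by (simp add: mult.commute)

lemma ideal_uminus [intro]: "a \<in> J \<Longrightarrow> - a \<in> J"
  using ideal_mult[of "-1" a] by auto

lemma ideal_diff [intro]: "a \<in> J \<Longrightarrow> b \<in> J \<Longrightarrow> a - b \<in> J"
  using ideal_add[of a "- b"] by auto

lemma ideal_sum [intro]: "(\<And>i. i \<in> A \<Longrightarrow> f i \<in> J) \<Longrightarrow> sum f A \<in> J"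
  by (induction A rule: infinite_finite_induct) auto

lemma ideal_prod: "finite A \<Longrightarrow> i \<in> A \<Longrightarrow> f i \<in> J \<Longrightarrow> (\<And>j. j \<in> A \<Longrightarrow> f j \<in> C) \<Longrightarrow> prod f A \<in> J"
  by (subst prod.remove[of A i]) (auto intro!: ideal_mult' prod_in)

lemma ideal_power: "x \<in> C \<Longrightarrow> x ^ n \<in> J \<Longrightarrow> n \<le> m \<Longrightarrow> x ^ m \<in> J"
  using ideal_mult[of "x ^ (m - n)" "x ^ n"] by (auto simp flip: power_add)

lemma cong_trans: "a - b \<in> J \<Longrightarrow> b - c \<in> J \<Longrightarrow> a - c \<in> J"
  using ideal_add[of "a - b" "b - c"] by simp

lemma cong_sym: "a - b \<in> J \<Longrightarrow> b - a \<in> J"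
  using ideal_uminus[of "a - b"] by simp

lemma cong_mult:
  assumes "a - b \<in> J" "c - d \<in> J" "b \<in> C" "c \<in> C"
  shows "a * c - b * d \<in> J"
proof -
  have "a * c - b * d = (a - b) * c + b * (c - d)" by (simp add: algebra_simps)
  then show ?thesis using assms by auto
qed

lemma cong_in_iff: "a - b \<in> J \<Longrightarrow> a \<in> J \<longleftrightarrow> b \<in> J"
  using ideal_diff[of a "a - b"] ideal_add[of "a - b" b] by auto

lemma cong_prod:
  assumes "\<And>i. i \<in> A \<Longrightarrow> f i - g i \<in> J" "\<And>i. i \<in> A \<Longrightarrow> f i \<in> C" "\<And>i. i \<in> A \<Longrightarrow> g i \<in> C"
  shows "prod f A - prod g A \<in> J"
  using assms by (induction A rule: infinite_finite_induct) (auto intro!: cong_mult)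

lemma cong_power: "a - b \<in> J \<Longrightarrow> a \<in> C \<Longrightarrow> b \<in> C \<Longrightarrow> a ^ n - b ^ n \<in> J"
  by (induction n) (auto intro!: cong_mult)

definition adjoin :: "'a \<Rightarrow> 'a set" where
  "adjoin a = {j + r * a | j r. j \<in> J \<and> r \<in> C}"

lemma adjoin_ideal: "a \<in> C \<Longrightarrow> rel_ideal C (adjoin a)"
  unfolding rel_ideal_def
proof (intro conjI ballI)
  assume a: "a \<in> C"
  show "adjoin a \<subseteq> C" using a ideal_sub by (auto simp: adjoin_def)
  show "0 \<in> adjoin a" unfolding adjoin_def
    by (rule CollectI, rule exI[of _ 0], rule exI[of _ 0]) auto
  show "x + y \<in> adjoin a" if "x \<in> adjoin a" "y \<in> adjoin a" for x y
  proof -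
    from that obtain j r j' r' where *: "x = j + r * a" "y = j' + r' * a" "j \<in> J" "j' \<in> J" "r \<in> C" "r' \<in> C"
      by (auto simp: adjoin_def)
    then have "x + y = (j + j') + (r + r') * a" by (simp add: algebra_simps)
    then show ?thesis using * unfolding adjoin_def by blast
  qed
  show "s * x \<in> adjoin a" if "s \<in> C" "x \<in> adjoin a" for s x
  proof -
    from that obtain j r where *: "x = j + r * a" "j \<in> J" "r \<in> C"
      by (auto simp: adjoin_def)
    then have "s * x = s * j + (s * r) * a" by (simp add: algebra_simps)
    then show ?thesis using * that unfolding adjoin_def by blast
  qed
qed

lemma adjoin_sup: "J \<subseteq> adjoin a" and adjoin_mem: "a \<in> adjoin a"
proof -
  show "J \<subseteq> adjoin a"
  proof
    fix x assume "x \<in> J"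
    moreover have "x = x + 0 * a" by simp
    ultimately show "x \<in> adjoin a" unfolding adjoin_def by blast
  qed
  show "a \<in> adjoin a" unfolding adjoin_def
    by (rule CollectI, rule exI[of _ 0], rule exI[of _ 1]) auto
qed

lemma colon_ideal: "a \<in> C \<Longrightarrow> rel_ideal C {x \<in> C. x * a \<in> J}"
  unfolding rel_ideal_def
  by (auto simp: distrib_right mult.assoc)

text \<open>
  If every \<open>J + (a\<^sub>s)\<close> contained \<open>1\<close>, the factors could be cancelled from the product modulo \<open>J\<close> one after
  the other, until \<open>1 \<in> J\<close>.
\<close>

lemma prod_in_imp_adjoin_proper:
  assumes "finite S" "\<And>s. s \<in> S \<Longrightarrow> a s \<in> C" "(\<Prod>s\<in>S. a s) \<in> J" "1 \<notin> J"
  shows "\<exists>s\<in>S. 1 \<notin> adjoin (a s)"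
proof (rule ccontr)
  assume *: "\<not> ?thesis"
  have "prod a T \<in> J \<longrightarrow> 1 \<in> J" if "T \<subseteq> S" for T
    using finite_subset[OF that \<open>finite S\<close>] that
  proof (induction T rule: finite_induct)
    case (insert s T)
    show ?case
    proof
      assume in_J: "prod a (insert s T) \<in> J"
      from * insert obtain j r where jr: "1 = j + r * a s" "j \<in> J" "r \<in> C"
        by (auto simp: adjoin_def)
      have "prod a T = j * prod a T + r * (a s * prod a T)"
        using jr(1) by (metis distrib_right mult.assoc mult_1)
      moreover have "prod a T \<in> C" using insert.prems assms(2) by (intro prod_in) auto
      ultimately have "prod a T \<in> J" using jr in_J insert.hyps
        by (metis ideal_add ideal_mult ideal_mult' prod.insert)
      then show "1 \<in> J" using insert by auto
    qed
  qed auto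
  then show False using assms by blast
qed

end

context complex_subalgebra begin

lemma ideal_locale: "rel_ideal C J \<Longrightarrow> subalgebra_ideal C \<iota> J"
  by unfold_locales

text \<open>
  The substitute for the Nullstellensatz: modulo \<open>J\<close> every \<open>R\<^sub>j\<close> is killed by a product of linear
  factors, and one of the factors can be adjoined without making the ideal improper.
\<close>

lemma exists_point:
  assumes "finite F" "rel_ideal C J" "1 \<notin> J"
    and "\<And>j. j \<in> F \<Longrightarrow> R j \<in> C"
    and "\<And>j. j \<in> F \<Longrightarrow> finite (S j)"
    and "\<And>j. j \<in> F \<Longrightarrow> (\<Prod>s\<in>S j. R j - \<iota> (rt j s)) \<in> J"
  shows "\<exists>J' p. rel_ideal C J' \<and> J \<subseteq> J' \<and> 1 \<notin> J' \<and> (\<forall>j\<in>F. R j - \<iota> (p j) \<in> J')"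
  using assms
proof (induction F arbitrary: J rule: finite_induct)
  case empty
  then show ?case by auto
next
  case (insert j F)
  interpret subalgebra_ideal C \<iota> J by (rule ideal_locale[OF insert.prems(1)])
  obtain s where s: "s \<in> S j" "1 \<notin> adjoin (R j - \<iota> (rt j s))"
    using prod_in_imp_adjoin_proper[of "S j" "\<lambda>s. R j - \<iota> (rt j s)"] insert.prems by blast
  let ?J = "adjoin (R j - \<iota> (rt j s))"
  have "rel_ideal C ?J" using insert.prems by (intro adjoin_ideal) auto
  moreover have "J \<subseteq> ?J" by (rule adjoin_sup)
  moreover have "\<exists>J' p. rel_ideal C J' \<and> ?J \<subseteq> J' \<and> 1 \<notin> J' \<and> (\<forall>j\<in>F. R j - \<iota> (p j) \<in> J')"
    by (rule insert.IH) (use insert.prems s calculation in auto)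
  ultimately obtain J' p where J': "rel_ideal C J'" "?J \<subseteq> J'" "1 \<notin> J'" "\<forall>i\<in>F. R i - \<iota> (p i) \<in> J'"
    by blast
  then have "\<forall>i\<in>insert j F. R i - \<iota> ((p(j := rt j s)) i) \<in> J'"
    using adjoin_mem insert.hyps by auto
  then show ?case using J' \<open>J \<subseteq> ?J\<close> by blast
qed

text \<open>
  Choosing one \<open>y\<^sub>i\<close> with \<open>i \<notin> I s\<close> for every \<open>s\<close> gives a product of \<open>y\<close> over a set that is contained in
  no \<open>I s\<close>; expanding \<open>\<Prod> e\<^sub>s\<close> modulo \<open>J\<close> yields only such products.  The expansion is replaced by
  an induction that passes from \<open>K\<close> to the colon ideal of \<open>e\<^sub>s\<close>.  In the applications \<open>s\<close> runs through the maximal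
  cones, and the sets contained in no \<open>I s\<close> are the non-faces.
\<close>

lemma transversal_prod:
  assumes "finite F"
    and "rel_ideal C K" "J \<subseteq> K" "\<And>i. i \<in> V \<Longrightarrow> y i \<in> C" "finite V"
    and "\<And>s. s \<in> F \<Longrightarrow> e s \<in> C"
    and "\<And>s K. s \<in> F \<Longrightarrow> rel_ideal C K \<Longrightarrow> J \<subseteq> K \<Longrightarrow> (\<forall>i\<in>V - I s. y i \<in> K) \<Longrightarrow> e s \<in> K"
    and "\<And>D. D \<subseteq> V \<Longrightarrow> (\<And>s. s \<in> F \<Longrightarrow> \<not> D \<subseteq> I s) \<Longrightarrow> (\<Prod>i\<in>D. y i) \<in> K"
  shows "(\<Prod>s\<in>F. e s) \<in> K"
  using assms
proof (induction F arbitrary: K rule: finite_induct)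
  case empty
  then show ?case using empty(7)[of "{}"] by simp
next
  case (insert s F)
  interpret subalgebra_ideal C \<iota> K by (rule ideal_locale[OF insert.prems(1)])
  have es: "e s \<in> C" using insert.prems(5) by auto
  let ?K = "{x \<in> C. x * e s \<in> K}"
  have "prod e F \<in> ?K"
  proof (rule insert.IH)
    show "rel_ideal C ?K" using es by (rule colon_ideal)
    show "J \<subseteq> ?K" using insert.prems(2) es ideal_sub by auto
    fix D assume D: "D \<subseteq> V" "\<And>s. s \<in> F \<Longrightarrow> \<not> D \<subseteq> I s"
    have fD: "finite D" using D(1) insert.prems(4) finite_subset by blast
    have yD: "prod y D \<in> C" using D(1) insert.prems(3) by (intro prod_in) auto
    have "e s \<in> {x \<in> C. x * prod y D \<in> K}"
    proof (rule insert.prems(6))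
      show "rel_ideal C {x \<in> C. x * prod y D \<in> K}" using yD by (rule colon_ideal)
      show "J \<subseteq> {x \<in> C. x * prod y D \<in> K}" using insert.prems(2) yD ideal_sub by auto
      show "\<forall>i\<in>V - I s. y i \<in> {x \<in> C. x * prod y D \<in> K}"
      proof
        fix i assume i: "i \<in> V - I s"
        have *: "prod y (insert i D) \<in> K"
          by (rule insert.prems(7)) (use i D in auto)
        have "y i * prod y D \<in> K"
        proof (cases "i \<in> D")
          case True
          then have "insert i D = D" by auto
          then show ?thesis using * i insert.prems(3) by (metis DiffD1 ideal_mult)
        next
          case False
          then show ?thesis using * fD by simp
        qed
        then show "y i \<in> {x \<in> C. x * prod y D \<in> K}" using i insert.prems(3) by auto
      qed
    qed simp
    then show "prod y D \<in> ?K" using yD by (auto simp: mult.commute)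
  next
    show "e t \<in> K'" if "t \<in> F" "rel_ideal C K'" "J \<subseteq> K'" "\<forall>i\<in>V - I t. y i \<in> K'" for t K'
      using insert.prems(6)[of t K'] that by simp
  qed (use insert.prems(3,4,5) in simp_all)
  then show ?case using insert.hyps by (simp add: mult.commute)
qed

end

context subalgebra_ideal begin

definition nilp :: "'a \<Rightarrow> bool" where "nilp x \<longleftrightarrow> x \<in> C \<and> (\<exists>n. x ^ n \<in> J)"

lemma nilp_in: "nilp x \<Longrightarrow> x \<in> C" by (simp add: nilp_def)

lemma ideal_nilp: "x \<in> J \<Longrightarrow> nilp x"
  unfolding nilp_def using ideal_sub by (auto intro!: exI[of _ 1])

lemma nilp_mult: "nilp x \<Longrightarrow> y \<in> C \<Longrightarrow> nilp (y * x)"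
  unfolding nilp_def by (auto simp: power_mult_distrib)

lemma nilp_add:
  assumes "nilp x" "nilp y"
  shows "nilp (x + y)"
proof -
  obtain n m where nm: "x ^ n \<in> J" "y ^ m \<in> J" and xy: "x \<in> C" "y \<in> C"
    using assms by (auto simp: nilp_def)
  have "of_nat a \<in> C" for a by (induction a) auto
  moreover have "x ^ k * y ^ (n + m - k) \<in> J" for k
    using ideal_power[of x n k] ideal_power[of y m "n + m - k"] nm xy by (cases "n \<le> k") auto
  ultimately have "(x + y) ^ (n + m) \<in> J"
    unfolding binomial_ring by (intro ideal_sum) (simp add: ideal_mult mult.assoc)
  then show ?thesis using xy by (auto simp: nilp_def)
qed

lemma nilp_zero [simp]: "nilp 0" by (simp add: ideal_nilp)

lemma nilp_uminus: "nilp x \<Longrightarrow> nilp (- x)"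
  using nilp_mult[of x "-1"] by auto

lemma nilp_sum: "(\<And>i. i \<in> A \<Longrightarrow> nilp (f i)) \<Longrightarrow> nilp (sum f A)"
  by (induction A rule: infinite_finite_induct) (auto intro: nilp_add)

lemma nilp_cong: "nilp x \<Longrightarrow> y - x \<in> J \<Longrightarrow> nilp y"
  using nilp_add[of x "y - x"] ideal_nilp by auto

text \<open>Geometric series.\<close>

lemma unit_nilp_inverse:
  assumes "nilp x" "c \<noteq> 0"
  shows "\<exists>y\<in>C. (\<iota> c + x) * y - 1 \<in> J"
proof -
  define z where "z = - (\<iota> (1/c) * x)"
  have z: "nilp z" unfolding z_def using assms by (intro nilp_uminus nilp_mult) auto
  then obtain n where n: "z ^ n \<in> J" and "z \<in> C" by (auto simp: nilp_def)
  have geo: "(1 - z) * (\<Sum>i<n. z ^ i) = 1 - z ^ n" by (simp add: one_diff_power_eq)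
  have u: "\<iota> c * \<iota> (1 / c) = 1" using assms by (simp flip: iota_mult)
  have "\<iota> c * (1 - z) = \<iota> c + (\<iota> c * \<iota> (1/c)) * x" by (simp add: z_def algebra_simps)
  then have "\<iota> c + x = \<iota> c * (1 - z)" using u by simp
  then have "(\<iota> c + x) * (\<iota> (1/c) * (\<Sum>i<n. z ^ i)) = (\<iota> c * \<iota> (1/c)) * ((1 - z) * (\<Sum>i<n. z ^ i))"
    by (simp only: ac_simps)
  then have "(\<iota> c + x) * (\<iota> (1/c) * (\<Sum>i<n. z ^ i)) - 1 = - (z ^ n)" using geo u by simp
  moreover have "\<iota> (1/c) * (\<Sum>i<n. z ^ i) \<in> C" using \<open>z \<in> C\<close> by auto
  ultimately show ?thesis using n by (metis ideal_uminus)
qed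

definition texp :: "nat \<Rightarrow> 'a \<Rightarrow> 'a" where
  "texp n x = (\<Sum>m<n. \<iota> (1 / fact m) * x ^ m)"

text \<open>
  An exponential modulo \<open>J\<close> is determined only up to \<open>J\<close>, hence a relation.  Asking for agreement with
  all sufficiently long truncations spares a common truncation order for all nilpotent elements.
\<close>

definition is_exp :: "'a \<Rightarrow> 'a \<Rightarrow> bool" where
  "is_exp x a \<longleftrightarrow> nilp x \<and> a \<in> C \<and> (\<exists>n0. \<forall>n\<ge>n0. a - texp n x \<in> J)"

lemma texp_in [intro]: "x \<in> C \<Longrightarrow> texp n x \<in> C"
  unfolding texp_def by auto

lemma texp_stable:
  assumes "x \<in> C" "x ^ N \<in> J" "N \<le> n"
  shows "texp n x - texp N x \<in> J"
proof -
  have "texp n x - texp N x = (\<Sum>m\<in>{N..<n}. \<iota> (1 / fact m) * x ^ m)"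
    unfolding texp_def using assms(3) sum_diff_nat_ivl[of 0 N n "\<lambda>m. \<iota> (1 / fact m) * x ^ m"]
    by (simp add: atLeast0LessThan)
  also have "\<dots> \<in> J" using assms by (intro ideal_sum ideal_mult) (auto intro: ideal_power)
  finally show ?thesis .
qed

lemma is_expI:
  assumes "x \<in> C" "x ^ N \<in> J" "a \<in> C" "a - texp N x \<in> J"
  shows "is_exp x a"
  unfolding is_exp_def nilp_def
proof (intro conjI)
  show "\<exists>n0. \<forall>n\<ge>n0. a - texp n x \<in> J"
    using assms texp_stable by (meson cong_sym cong_trans)
qed (use assms in auto)

lemma is_exp_exists: "nilp x \<Longrightarrow> \<exists>a. is_exp x a"
  by (metis diff_self ideal_zero is_expI nilp_def texp_in)

lemma is_exp_unique: "is_exp x a \<Longrightarrow> is_exp x b \<Longrightarrow> a - b \<in> J"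
  unfolding is_exp_def by (metis cong_sym cong_trans nle_le)

lemma is_exp_in: "is_exp x a \<Longrightarrow> a \<in> C" and is_exp_nilp: "is_exp x a \<Longrightarrow> nilp x"
  by (simp_all add: is_exp_def)

lemma is_exp_cong:
  assumes "is_exp x a" "b - a \<in> J" "b \<in> C" shows "is_exp x b"
proof -
  obtain n0 where "\<forall>n\<ge>n0. a - texp n x \<in> J" using assms by (auto simp: is_exp_def)
  then have "\<forall>n\<ge>n0. b - texp n x \<in> J" using assms cong_trans by blast
  then show ?thesis using assms by (auto simp: is_exp_def)
qed

text \<open>
  The two sides differ by terms \<open>x\<^sup>i y\<^sup>j\<close> with \<open>i, j < n \<le> i + j\<close>, and \<open>n \<ge> 2 N\<close> forces one of the
  exponents to be at least \<open>N\<close>.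
\<close>

lemma texp_add:
  assumes "x \<in> C" "y \<in> C" "x ^ N \<in> J" "y ^ N \<in> J" "2 * N \<le> n"
  shows "texp n x * texp n y - texp n (x + y) \<in> J"
proof -
  define f where "f i j = (\<iota> (1 / fact i) * x ^ i) * (\<iota> (1 / fact j) * y ^ j)" for i j :: nat
  have *: "\<iota> (1 / fact m) * (x + y) ^ m = (\<Sum>i\<le>m. f i (m - i))" for m
    unfolding binomial_ring sum_distrib_left
  proof (rule sum.cong[OF refl])
    fix i assume i: "i \<in> {..m}"
    have "\<iota> (of_nat r) = of_nat r" for r by (induction r) (auto simp: iota_add)
    moreover have "1 / fact m * of_nat (m choose i) = (1 / fact i) * (1 / fact (m - i) :: complex)"
      using i by (simp add: binomial_fact)
    ultimately have "\<iota> (1 / fact m) * of_nat (m choose i) = \<iota> (1 / fact i) * \<iota> (1 / fact (m - i))"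
      by (metis iota_mult)
    have "\<iota> (1 / fact m) * (of_nat (m choose i) * x ^ i * y ^ (m - i))
        = (\<iota> (1 / fact m) * of_nat (m choose i)) * (x ^ i * y ^ (m - i))" by (simp only: mult.assoc)
    also have "\<dots> = f i (m - i)" unfolding \<open>_ = \<iota> (1 / fact i) * \<iota> (1 / fact (m - i))\<close> f_def
      by (simp only: ac_simps)
    finally show "\<iota> (1 / fact m) * (of_nat (m choose i) * x ^ i * y ^ (m - i)) = f i (m - i)" .
  qed
  have 1: "texp n (x + y) = (\<Sum>(i,j)\<in>{(i,j). i + j < n}. f i j)"
    unfolding texp_def * by (rule sum.triangle_reindex[symmetric])
  have 2: "texp n x * texp n y = (\<Sum>(i,j)\<in>{..<n}\<times>{..<n}. f i j)"
    unfolding texp_def sum_product f_def by (simp add: sum.cartesian_product)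
  have sub: "{(i,j). i + j < n} \<subseteq> {..<n}\<times>{..<n}" by auto
  have "texp n x * texp n y - texp n (x + y) = (\<Sum>(i,j)\<in>{..<n}\<times>{..<n} - {(i,j). i + j < n}. f i j)"
    unfolding 1 2 by (subst sum_diff[OF _ sub]) auto
  also have "\<dots> \<in> J"
  proof (rule ideal_sum, clarsimp)
    fix i j assume "\<not> i + j < n"
    then have "N \<le> i \<or> N \<le> j" using assms by linarith
    then have "x ^ i \<in> J \<or> y ^ j \<in> J" using assms ideal_power by blast
    then show "f i j \<in> J" unfolding f_def using assms by auto
  qed
  finally show ?thesis .
qed

lemma is_exp_add:
  assumes "is_exp x a" "is_exp y b" shows "is_exp (x + y) (a * b)"
proof -
  have xy: "x \<in> C" "y \<in> C" using assms by (auto simp: is_exp_def nilp_def)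
  have ab: "a \<in> C" "b \<in> C" using assms by (auto simp: is_exp_def)
  obtain n1 n2 where n: "\<forall>n\<ge>n1. a - texp n x \<in> J" "\<forall>n\<ge>n2. b - texp n y \<in> J"
    using assms by (auto simp: is_exp_def)
  obtain k l where "x ^ k \<in> J" "y ^ l \<in> J" using assms by (auto simp: is_exp_def nilp_def)
  then have N: "x ^ (k + l) \<in> J" "y ^ (k + l) \<in> J" using xy ideal_power by auto
  have "a * b - texp n (x + y) \<in> J" if "n \<ge> n1 + n2 + 2 * (k + l)" for n
  proof -
    have "a * b - texp n x * texp n y \<in> J" using n ab xy that by (intro cong_mult) auto
    moreover have "texp n x * texp n y - texp n (x + y) \<in> J"
      by (rule texp_add[OF xy N]) (use that in auto)
    ultimately show ?thesis by (rule cong_trans)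
  qed
  then show ?thesis unfolding is_exp_def
    using assms ab by (auto intro: nilp_add is_exp_nilp)
qed

lemma is_exp_ideal: "x \<in> J \<Longrightarrow> is_exp x 1"
  by (rule is_expI[of x 1]) (auto simp: ideal_sub texp_def)

lemma is_exp_zero: "is_exp 0 1" by (rule is_exp_ideal) simp

lemma is_exp_uminus:
  assumes "is_exp x a" "b \<in> C" "a * b - 1 \<in> J"
  shows "is_exp (- x) b"
proof -
  obtain c where c: "is_exp (- x) c" using assms is_exp_exists nilp_uminus is_exp_nilp by blast
  then have "is_exp 0 (a * c)" using is_exp_add[OF assms(1) c] by simp
  then have ac: "a * c - 1 \<in> J" using is_exp_unique is_exp_zero by blast
  have "b - c = c * (a * b - 1) - b * (a * c - 1)" by (simp add: algebra_simps)
  then have "b - c \<in> J" using ac assms c is_exp_in by (metis ideal_diff ideal_mult)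
  then show ?thesis using c assms is_exp_cong by blast
qed

lemma is_exp_of_nat: "is_exp x a \<Longrightarrow> is_exp (of_nat n * x) (a ^ n)"
  by (induction n) (auto simp: is_exp_zero distrib_right intro!: is_exp_add)

lemma is_exp_sum:
  "(\<And>i. i \<in> A \<Longrightarrow> is_exp (f i) (g i)) \<Longrightarrow> is_exp (sum f A) (prod g A)"
  by (induction A rule: infinite_finite_induct) (auto simp: is_exp_zero intro!: is_exp_add)

lemma texp_Suc: "\<exists>s\<in>C. texp (Suc n) x = 1 + x * s" if "x \<in> C"
proof (rule bexI)
  show "texp (Suc n) x = 1 + x * (\<Sum>m<n. \<iota> (1 / fact (Suc m)) * x ^ m)"
    unfolding texp_def by (subst sum.lessThan_Suc_shift) (simp add: sum_distrib_left ac_simps)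
qed (use that in auto)

lemma is_exp_minus_one: 
  assumes "is_exp x a" shows "\<exists>s\<in>C. a - (1 + x * s) \<in> J"
proof -
  obtain n0 where "\<forall>n\<ge>n0. a - texp n x \<in> J" using assms by (auto simp: is_exp_def)
  moreover have "x \<in> C" using assms by (simp add: is_exp_def nilp_def)
  moreover from this obtain s where "s \<in> C" "texp (Suc n0) x = 1 + x * s" using texp_Suc by blast
  ultimately show ?thesis by (metis le_SucI order_refl)
qed

lemma is_exp_minus_one_nilp: "is_exp x a \<Longrightarrow> nilp (a - 1)"
proof -
  assume a: "is_exp x a"
  then obtain s where s: "s \<in> C" "a - (1 + x * s) \<in> J" using is_exp_minus_one by blast
  have "nilp (s * x)" using a s is_exp_nilp nilp_mult by blast
  then show ?thesis by (rule nilp_cong) (use s in \<open>simp add: algebra_simps\<close>)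
qed

lemma texp_Suc_Suc: "\<exists>s\<in>C. texp (Suc (Suc n)) x = 1 + x * (1 + x * s)" if "x \<in> C"
proof (rule bexI)
  show "texp (Suc (Suc n)) x = 1 + x * (1 + x * (\<Sum>m<n. \<iota> (1 / fact (Suc (Suc m))) * x ^ m))"
    unfolding texp_def by (subst sum.lessThan_Suc_shift, subst sum.lessThan_Suc_shift)
      (simp add: sum_distrib_left ac_simps distrib_left)
qed (use that in auto)

text \<open>Here \<open>e\<^sup>x - 1 = x (1 + x s)\<close>, and the second factor is invertible modulo \<open>J\<close>.\<close>

lemma is_exp_one_imp_ideal:
  assumes "is_exp x 1" shows "x \<in> J"
proof -
  obtain n0 where n0: "\<forall>n\<ge>n0. 1 - texp n x \<in> J" using assms by (auto simp: is_exp_def)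
  have x: "x \<in> C" using assms by (simp add: is_exp_def nilp_def)
  obtain s where s: "s \<in> C" "texp (Suc (Suc n0)) x = 1 + x * (1 + x * s)"
    using texp_Suc_Suc[OF x] by blast
  have "1 - texp (Suc (Suc n0)) x \<in> J" using n0 by simp
  then have *: "x * (1 + x * s) \<in> J" unfolding s(2) using ideal_uminus by force
  have "nilp (s * x)" using assms s is_exp_nilp nilp_mult by blast
  then obtain y where y: "y \<in> C" "(\<iota> 1 + s * x) * y - 1 \<in> J" using unit_nilp_inverse[of "s * x" 1] by auto
  have "x = (x * (1 + x * s)) * y - x * ((\<iota> 1 + s * x) * y - 1)" by (simp add: algebra_simps)
  then show ?thesis using * y x by (metis ideal_diff ideal_mult ideal_mult')
qed

text \<open>
  With \<open>y = a - 1\<close> the power \<open>y\<^sup>m\<close> is \<open>x\<^sup>m\<close> plus higher powers of \<open>x\<close> modulo \<open>J\<close>.  Going down from a power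
  of \<open>x\<close> that lies in \<open>J\<close>, one finds all multiples of \<open>x\<^sup>m\<close> with \<open>m \<ge> 1\<close> by polynomials in \<open>x\<close> in \<open>D\<close>.
\<close>

lemma exponential_in_subalgebra:
  assumes "is_exp x a" "a \<in> D" "J \<subseteq> D" "\<And>c. \<iota> c \<in> D"
    and addD: "\<And>u v. u \<in> D \<Longrightarrow> v \<in> D \<Longrightarrow> u + v \<in> D" and multD: "\<And>u v. u \<in> D \<Longrightarrow> v \<in> D \<Longrightarrow> u * v \<in> D"
  shows "x \<in> D"
proof -
  have x: "x \<in> C" using assms by (simp add: is_exp_def nilp_def)
  have diffD: "u - v \<in> D" if "u \<in> D" "v \<in> D" for u v
    using addD[OF that(1) multD[OF assms(4)[of "-1"] that(2)]] by (simp add: iota_uminus)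
  have powD: "u ^ n \<in> D" if "u \<in> D" for u n
    by (induction n) (use assms(4)[of 1] multD that in auto)
  obtain n0 where n0: "\<forall>n\<ge>n0. a - texp n x \<in> J" using assms by (auto simp: is_exp_def)
  define q where "q = (\<Sum>m<n0. monom (1 / fact (Suc (Suc m))) m :: complex poly)"
  have "texp (Suc (Suc n0)) x = 1 + x * (1 + x * ev q x)"
    unfolding texp_def q_def by (subst sum.lessThan_Suc_shift, subst sum.lessThan_Suc_shift)
      (simp add: sum_distrib_left ac_simps distrib_left ev_sum ev_monom)
  then have y: "(a - 1) - x * ev (1 + pCons 0 q) x \<in> J" using n0[rule_format, of "Suc (Suc n0)"]
    by (simp add: diff_diff_eq)
  obtain N where N: "x ^ N \<in> J" using assms by (auto simp: is_exp_def nilp_def)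
  have main: "\<forall>p. x ^ Suc m * ev p x \<in> D" if "m \<le> N" for m
    using that
  proof (induction m rule: inc_induct)
    case base
    have "x ^ Suc N * ev p x \<in> J" for p :: "complex poly"
      by (rule ideal_mult'[OF ideal_power[OF x N] ev_in[OF x]]) simp
    then show ?case using \<open>J \<subseteq> D\<close> by blast
  next
    case (step m)
    obtain r where r: "(1 + pCons 0 q) ^ Suc m = 1 + pCons 0 r"
    proof -
      obtain b r where br: "(1 + pCons 0 q) ^ Suc m = pCons b r" using pCons_cases by blast
      have "poly (pCons b r) 0 = 1" unfolding br[symmetric] poly_power by simp
      then have "b = 1" by simp
      then show ?thesis using that[of r] br by (simp add: one_pCons)
    qed
    have "(a - 1) ^ Suc m - (x * ev (1 + pCons 0 q) x) ^ Suc m \<in> J"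
      using y x is_exp_in[OF assms(1)] by (intro cong_power) auto
    moreover have "(x * ev (1 + pCons 0 q) x) ^ Suc m = x ^ Suc m * ev ((1 + pCons 0 q) ^ Suc m) x"
      by (simp only: power_mult_distrib ev_power)
    moreover have "\<dots> = x ^ Suc m + x ^ Suc (Suc m) * ev r x"
      unfolding r by (simp add: algebra_simps)
    ultimately have "(a - 1) ^ Suc m - (x ^ Suc m + x ^ Suc (Suc m) * ev r x) \<in> D"
      using \<open>J \<subseteq> D\<close> by auto
    moreover have "(a - 1) ^ Suc m \<in> D" by (intro powD diffD assms(2)) (use assms(4)[of 1] in simp)
    moreover have "x ^ Suc (Suc m) * ev r x \<in> D" using step.IH by blast
    moreover have "x ^ Suc m = (a - 1) ^ Suc m - ((a - 1) ^ Suc m - (x ^ Suc m + x ^ Suc (Suc m) * ev r x))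
        - x ^ Suc (Suc m) * ev r x" by simp
    ultimately have xm: "x ^ Suc m \<in> D" using diffD by metis
    show ?case
    proof
      fix p :: "complex poly"
      obtain b s where p: "p = pCons b s" using pCons_cases by blast
      have "x ^ Suc m * ev p x = \<iota> b * x ^ Suc m + x ^ Suc (Suc m) * ev s x"
        unfolding p by (simp add: algebra_simps)
      then show "x ^ Suc m * ev p x \<in> D" using addD multD[OF assms(4)[of b] xm] step.IH by metis
    qed
  qed
  from main[of 0, rule_format, of 1] show ?thesis by simp
qed

text \<open>
  Successive approximation: if \<open>e\<^bsup>y z\<^esup> = 1 + y + y\<^bsup>m+1\<^esup> r\<close>, then lowering the exponent by
  \<open>y\<^bsup>m+1\<^esup> r\<close> leaves an error divisible by \<open>y\<^bsup>m+2\<^esup>\<close>.  That the logarithm is a multiple of \<open>y\<close> is what later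
  gives the monomial relations.
\<close>

lemma logarithm_exists:
  assumes y: "nilp y"
  shows "\<exists>z\<in>C. is_exp (y * z) (1 + y)"
proof -
  have yC: "y \<in> C" using y by (rule nilp_in)
  have approx: "\<exists>z\<in>C. \<exists>r\<in>C. is_exp (y * z) (1 + y + y ^ Suc m * r)" for m
  proof (induction m)
    case 0
    have "is_exp (y * 0) (1 + y + y ^ Suc 0 * (-1))" using is_exp_zero by simp
    then show ?case by blast
  next
    case (Suc m)
    then obtain z r where z: "z \<in> C" "r \<in> C" "is_exp (y * z) (1 + y + y ^ Suc m * r)" by blast
    \<comment> \<open>The correction to the exponent.\<close>
    define w where "w = - (y ^ Suc m * r)"
    have "nilp ((- (y ^ m * r)) * y)" using y z yC by (intro nilp_mult) auto
    then have "nilp w" by (simp add: w_def ac_simps)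
    then obtain b where b: "is_exp w b" using is_exp_exists by blast
    have wC: "w \<in> C" using z yC by (auto simp: w_def)
    obtain n0 where n0: "\<forall>n\<ge>n0. b - texp n w \<in> J" using b by (auto simp: is_exp_def)
    obtain s where s: "s \<in> C" "texp (Suc (Suc n0)) w = 1 + w * (1 + w * s)"
      using texp_Suc_Suc[OF wC] by blast
    have b2: "b - (1 + w * (1 + w * s)) \<in> J" using n0 s by (metis le_SucI order_refl)
    have "is_exp (y * z + w) ((1 + y + y ^ Suc m * r) * b)" using z b is_exp_add by blast
    then have "is_exp (y * z + w) ((1 + y + y ^ Suc m * r) * (1 + w * (1 + w * s)))"
    proof (rule is_exp_cong)
      have "(1 + y + y ^ Suc m * r) * (1 + w * (1 + w * s)) - (1 + y + y ^ Suc m * r) * b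
        = (1 + y + y ^ Suc m * r) * (- (b - (1 + w * (1 + w * s))))" by (simp add: algebra_simps)
      then show "(1 + y + y ^ Suc m * r) * (1 + w * (1 + w * s)) - (1 + y + y ^ Suc m * r) * b \<in> J"
        using b2 yC z by (metis add_in ideal_mult ideal_uminus mult_in one_in power_in)
    next
      show "(1 + y + y ^ Suc m * r) * (1 + w * (1 + w * s)) \<in> C"
        using yC z(1,2) wC s(1) by (intro mult_in add_in power_in one_in)
    qed
    moreover have "\<exists>r'\<in>C. (1 + y + y ^ Suc m * r) * (1 + w * (1 + w * s)) = 1 + y + y ^ Suc (Suc m) * r'"
    proof -
      define v where "v = y ^ m * r"
      have v: "v \<in> C" using yC z by (auto simp: v_def)
      have w: "w = - (y * v)" by (simp add: w_def v_def)
      have e: "(1 + y + y ^ Suc m * r) * (1 + w * (1 + w * s))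
          = (1 + y - w) * (1 + w * (1 + w * s))" by (simp add: w_def)
      have "\<dots> = 1 + y + y * w + w * w * (s - 1 + y * s - w * s)" by (simp add: algebra_simps)
      also have "\<dots> = 1 + y + y * w * (1 - v * (s - 1 + y * s - w * s))"
        by (simp add: w algebra_simps)
      also have "y * w = y ^ Suc (Suc m) * (- r)" by (simp add: w_def ac_simps)
      also have "\<dots> * (1 - v * (s - 1 + y * s - w * s)) = y ^ Suc (Suc m) * (- r * (1 - v * (s - 1 + y * s - w * s)))"
        by (simp add: mult.assoc)
      finally have "(1 + y + y ^ Suc m * r) * (1 + w * (1 + w * s))
        = 1 + y + y ^ Suc (Suc m) * (- r * (1 - v * (s - 1 + y * s - w * s)))" using e by simp
      moreover have "- r * (1 - v * (s - 1 + y * s - w * s)) \<in> C"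
        using z(1,2) v s(1) yC wC by (intro mult_in diff_in uminus_in add_in one_in)
      ultimately show ?thesis by blast
    qed
    moreover have "y * z + w = y * (z - y ^ m * r)" by (simp add: w_def algebra_simps)
    moreover have "z - y ^ m * r \<in> C" using z yC by auto
    ultimately show ?case by (metis (no_types, lifting))
  qed
  obtain N where N: "y ^ N \<in> J" using y by (auto simp: nilp_def)
  obtain z r where z: "z \<in> C" "r \<in> C" "is_exp (y * z) (1 + y + y ^ Suc N * r)" using approx by blast
  have "is_exp (y * z) (1 + y)"
  proof (rule is_exp_cong[OF z(3)])
    have "1 + y - (1 + y + y ^ Suc N * r) = - (y ^ N * (y * r))" by (simp add: ac_simps)
    then show "1 + y - (1 + y + y ^ Suc N * r) \<in> J" using N yC z by (metis ideal_mult' ideal_uminus mult_in)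
  qed (use yC in auto)
  then show ?thesis using z by blast
qed

end

section \<open>Linear extension from monomials\<close>

definition lin_ext :: "('a::comm_ring_1 \<Rightarrow> 'm \<Rightarrow> 'b::ab_group_add) \<Rightarrow> ('m \<Rightarrow>\<^sub>0 'a) \<Rightarrow> 'b" where
  "lin_ext f p = (\<Sum>m\<in>keys p. f (lookup p m) m)"

lemma lin_ext_superset:
  assumes "finite A" "keys p \<subseteq> A" "\<And>m. f 0 m = 0"
  shows "lin_ext f p = (\<Sum>m\<in>A. f (lookup p m) m)"
  unfolding lin_ext_def by (rule sum.mono_neutral_left) (use assms in \<open>auto simp: in_keys_iff\<close>)

locale additive_coeff =
  fixes f :: "'a::comm_ring_1 \<Rightarrow> 'm \<Rightarrow> 'b::ab_group_add"
  assumes f_add: "f (a + b) m = f a m + f b m"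
begin

lemma f_0 [simp]: "f 0 m = 0"
  using f_add[of 0 0 m] by simp

lemma lin_ext_0 [simp]: "lin_ext f 0 = 0"
  by (simp add: lin_ext_def)

lemma lin_ext_single [simp]: "lin_ext f (single m a) = f a m"
  using f_0 by (simp add: lin_ext_def)

lemma lin_ext_add [simp]: "lin_ext f (p + q) = lin_ext f p + lin_ext f q"
proof -
  let ?A = "keys p \<union> keys q"
  show ?thesis
    using lin_ext_superset[of ?A "p + q" f] lin_ext_superset[of ?A p f] lin_ext_superset[of ?A q f]
      keys_add[of p q] by (simp add: lookup_add f_add sum.distrib)
qed

lemma lin_ext_uminus [simp]: "lin_ext f (- p) = - lin_ext f p"
  using lin_ext_add[of p "- p"] by (simp add: add_eq_0_iff2)

lemma lin_ext_diff [simp]: "lin_ext f (p - q) = lin_ext f p - lin_ext f q"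
  using lin_ext_add[of p "- q"] by simp

lemma lin_ext_sum: "lin_ext f (sum g A) = (\<Sum>i\<in>A. lin_ext f (g i))"
  by (induction A rule: infinite_finite_induct) auto

end

lemma poly_mapping_sum_singles: "p = (\<Sum>m\<in>keys p. single m (lookup p m))"
  by (rule poly_mapping_eqI) (auto simp: lookup_sum lookup_single when_def in_keys_iff)

lemma poly_mapping_induct_keys [case_names zero single add]:
  fixes p :: "'m \<Rightarrow>\<^sub>0 'a::comm_monoid_add"
  assumes "P 0"
    and "\<And>m a. m \<in> keys p \<Longrightarrow> P (single m a)"
    and "\<And>p q. P p \<Longrightarrow> P q \<Longrightarrow> P (p + q)"
  shows "P p"
proof -
  have "P (\<Sum>m\<in>A. single m (lookup p m))" if "A \<subseteq> keys p" for A
    using finite_subset[OF that finite_keys] that by (induction A rule: finite_induct) (auto intro: assms)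
  from this[of "keys p"] show ?thesis using poly_mapping_sum_singles[of p] by simp
qed

lemma poly_mapping_induct [case_names zero single add]:
  fixes p :: "'m \<Rightarrow>\<^sub>0 'a::comm_monoid_add"
  assumes "P 0"
    and "\<And>m a. P (single m a)"
    and "\<And>p q. P p \<Longrightarrow> P q \<Longrightarrow> P (p + q)"
  shows "P p"
  by (rule poly_mapping_induct_keys) (use assms in auto)

text \<open>
  Multiplicativity is checked on monomials.  It is stated modulo an ideal because the exponential substitution
  is multiplicative only modulo the relations.
\<close>

lemma (in subalgebra_ideal) lin_ext_mult:
  fixes h :: "'m::comm_monoid_add \<Rightarrow> 'a" and \<kappa> :: "'c::comm_ring_1 \<Rightarrow> 'a"
  assumes \<kappa>: "\<And>a b. \<kappa> (a + b) = \<kappa> a + \<kappa> b" "\<And>a b. \<kappa> (a * b) = \<kappa> a * \<kappa> b" "\<And>a. \<kappa> a \<in> C"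
    and M: "\<And>m n. m \<in> M \<Longrightarrow> n \<in> M \<Longrightarrow> h (m + n) - h m * h n \<in> J"
    and p: "keys p \<subseteq> M" and q: "keys q \<subseteq> M"
  shows "lin_ext (\<lambda>c m. \<kappa> c * h m) (p * q)
      - lin_ext (\<lambda>c m. \<kappa> c * h m) p * lin_ext (\<lambda>c m. \<kappa> c * h m) q \<in> J"
proof -
  interpret additive_coeff "\<lambda>c m. \<kappa> c * h m"
    by unfold_locales (simp add: \<kappa> distrib_right)
  let ?F = "lin_ext (\<lambda>c m. \<kappa> c * h m)"
  have "keys q \<subseteq> M \<Longrightarrow> ?F (p * q) - ?F p * ?F q \<in> J" for q
  proof (induction p rule: poly_mapping_induct_keys)
    case zero then show ?case by simp
  next
    case (add p1 p2)
    have "?F ((p1 + p2) * q) - ?F (p1 + p2) * ?F q = (?F (p1 * q) - ?F p1 * ?F q) + (?F (p2 * q) - ?F p2 * ?F q)"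
      by (simp add: distrib_right)
    then show ?case using add by auto
  next
    case (single m a)
    show ?case
    proof (rule poly_mapping_induct_keys[of _ q])
      show "?F (single m a * 0) - ?F (single m a) * ?F 0 \<in> J" by simp
      show "?F (single m a * (p1 + p2)) - ?F (single m a) * ?F (p1 + p2) \<in> J"
        if "?F (single m a * p1) - ?F (single m a) * ?F p1 \<in> J"
           "?F (single m a * p2) - ?F (single m a) * ?F p2 \<in> J" for p1 p2
        using ideal_add[OF that] by (simp add: distrib_left algebra_simps)
      show "?F (single m a * single n b)
          - ?F (single m a) * ?F (single n b) \<in> J" if "n \<in> keys q" for n b
      proof -
        have "?F (single m a * single n b)
          - ?F (single m a) * ?F (single n b) = (\<kappa> a * \<kappa> b) * (h (m + n) - h m * h n)"
          by (simp add: mult_single \<kappa> algebra_simps)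
        moreover have "m \<in> M" "n \<in> M" using single p that by auto
        ultimately show ?thesis using M[of m n] mult_in[OF \<kappa>(3) \<kappa>(3), of a b] by (simp add: ideal_mult)
      qed
    qed
  qed
  then show ?thesis using q by blast
qed

section \<open>Cones and lattice points of a simplicial fan\<close>

lemma convex_cone_hull_finite:
  fixes v :: "'i \<Rightarrow> 'v::real_vector"
  assumes "finite A"
  shows "convex_cone hull (v ` A) = {\<Sum>i\<in>A. c i *\<^sub>R v i | c. \<forall>i. c i \<ge> (0::real)}" (is "_ = ?R")
proof
  show "convex_cone hull (v ` A) \<subseteq> ?R"
  proof (rule hull_minimal)
    show "v ` A \<subseteq> ?R"
    proof
      fix x assume "x \<in> v ` A"
      then obtain i where i: "i \<in> A" "x = v i" by auto
      have "x = (\<Sum>j\<in>A. (if j = i then 1 else 0) *\<^sub>R v j)" using i assms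
        by (simp add: if_distrib[of "\<lambda>r. r *\<^sub>R _"] cong: if_cong)
      then show "x \<in> ?R" by (intro CollectI exI[of _ "\<lambda>j. if j = i then 1 else 0"]) auto
    qed
    show "convex_cone ?R"
      unfolding convex_cone_iff
    proof (intro conjI ballI allI impI)
      show "0 \<in> ?R" by (intro CollectI exI[of _ "\<lambda>_. 0"]) auto
      show "x + y \<in> ?R" if xy: "x \<in> ?R" "y \<in> ?R" for x y
      proof -
        obtain c where "x = (\<Sum>i\<in>A. c i *\<^sub>R v i)" "\<forall>i. c i \<ge> 0" using xy(1) by blast
        moreover obtain d where "y = (\<Sum>i\<in>A. d i *\<^sub>R v i)" "\<forall>i. d i \<ge> 0" using xy(2) by blast
        ultimately show ?thesis
          by (intro CollectI exI[of _ "\<lambda>i. c i + d i"]) (auto simp: scaleR_add_left sum.distrib)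
      qed
      show "a *\<^sub>R x \<in> ?R" if xa: "x \<in> ?R" "0 \<le> a" for x a
      proof -
        obtain c where "x = (\<Sum>i\<in>A. c i *\<^sub>R v i)" "\<forall>i. c i \<ge> 0" using xa(1) by blast
        then show ?thesis using xa(2)
          by (intro CollectI exI[of _ "\<lambda>i. a * c i"]) (auto simp: scaleR_sum_right)
      qed
    qed
  qed
  show "?R \<subseteq> convex_cone hull (v ` A)"
  proof
    fix x assume "x \<in> ?R"
    then obtain c where c: "x = (\<Sum>i\<in>A. c i *\<^sub>R v i)" "\<forall>i. c i \<ge> 0" by blast
    have "(\<Sum>i\<in>B. c i *\<^sub>R v i) \<in> convex_cone hull (v ` A)" if "B \<subseteq> A" for B
      using finite_subset[OF that assms] that
    proof (induction B rule: finite_induct)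
      case empty then show ?case by (simp add: convex_cone_hull_contains_0)
    next
      case (insert i B)
      then show ?case using c(2) by (simp add: convex_cone_hull_add convex_cone_hull_mul hull_inc)
    qed
    then show "x \<in> convex_cone hull (v ` A)" using c by blast
  qed
qed

text \<open>
  A point of the smaller cone has coordinates \<open>0\<close> outside \<open>B\<close>, and a combination of two nonnegative numbers
  with positive weights is \<open>0\<close> only if both numbers are.
\<close>

lemma convex_cone_hull_face:
  fixes v :: "'i \<Rightarrow> 'v::real_vector"
  assumes "finite A" "B \<subseteq> A"
    and indep: "\<And>c. (\<Sum>i\<in>A. c i *\<^sub>R v i) = 0 \<Longrightarrow> \<forall>i\<in>A. c i = 0"
  shows "(convex_cone hull (v ` B)) face_of (convex_cone hull (v ` A))"
proof -
  have fB: "finite B" using assms finite_subset by blast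
  have eqB: "(\<Sum>i\<in>B. c i *\<^sub>R v i) = (\<Sum>i\<in>A. (if i \<in> B then c i else 0) *\<^sub>R v i)" for c
    by (rule sum.mono_neutral_cong_left) (use assms in auto)
  have mem: "(\<Sum>i\<in>A. c i *\<^sub>R v i) \<in> convex_cone hull (v ` B)" if "\<forall>i. c i \<ge> 0" "\<forall>i\<in>A - B. c i = 0" for c
  proof -
    have "(\<Sum>i\<in>A. c i *\<^sub>R v i) = (\<Sum>i\<in>B. c i *\<^sub>R v i)"
      by (rule sum.mono_neutral_right) (use assms that in auto)
    then show ?thesis unfolding convex_cone_hull_finite[OF fB] using that by blast
  qed
  show ?thesis unfolding face_of_def
  proof (intro conjI ballI impI)
    show "convex_cone hull (v ` B) \<subseteq> convex_cone hull (v ` A)" using assms by (intro hull_mono) auto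
    show "convex (convex_cone hull (v ` B))" by (rule convex_convex_cone_hull)
    fix a b x assume a: "a \<in> convex_cone hull (v ` A)" and b: "b \<in> convex_cone hull (v ` A)"
      and x: "x \<in> convex_cone hull (v ` B)" and seg: "x \<in> open_segment a b"
    obtain \<alpha> where \<alpha>: "a = (\<Sum>i\<in>A. \<alpha> i *\<^sub>R v i)" "\<forall>i. \<alpha> i \<ge> 0"
      using a unfolding convex_cone_hull_finite[OF assms(1)] by blast
    obtain \<gamma> where \<gamma>: "b = (\<Sum>i\<in>A. \<gamma> i *\<^sub>R v i)" "\<forall>i. \<gamma> i \<ge> 0"
      using b unfolding convex_cone_hull_finite[OF assms(1)] by blast
    obtain \<xi> where \<xi>: "x = (\<Sum>i\<in>B. \<xi> i *\<^sub>R v i)"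
      using x unfolding convex_cone_hull_finite[OF fB] by blast
    obtain u where u: "u > 0" "u < 1" "x = (1 - u) *\<^sub>R a + u *\<^sub>R b" using seg by (auto simp: in_segment)
    have "(\<Sum>i\<in>A. ((1 - u) * \<alpha> i + u * \<gamma> i - (if i \<in> B then \<xi> i else 0)) *\<^sub>R v i) = (1 - u) *\<^sub>R a + u *\<^sub>R b - x"
      unfolding \<alpha>(1) \<gamma>(1) \<xi> eqB
      by (simp add: scaleR_sum_right sum.distrib sum_subtractf scaleR_add_left scaleR_diff_left)
    then have "\<forall>i\<in>A. (1 - u) * \<alpha> i + u * \<gamma> i - (if i \<in> B then \<xi> i else 0) = 0"
      by (intro indep) (use u in simp)
    then have *: "(1 - u) * \<alpha> i + u * \<gamma> i = 0" if "i \<in> A - B" for i using that by auto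
    have "(1 - u) * \<alpha> i = 0 \<and> u * \<gamma> i = 0" if "i \<in> A - B" for i
      using *[OF that] u \<alpha>(2)[rule_format, of i] \<gamma>(2)[rule_format, of i]
        mult_nonneg_nonneg[of "1 - u" "\<alpha> i"] mult_nonneg_nonneg[of u "\<gamma> i"]
      by linarith
    then have "\<forall>i\<in>A - B. \<alpha> i = 0" "\<forall>i\<in>A - B. \<gamma> i = 0" using u by auto
    then show "a \<in> convex_cone hull (v ` B)" "b \<in> convex_cone hull (v ` B)"
      using mem \<alpha> \<gamma> by auto
  qed
qed

locale simplicial_fan =
  fixes d :: nat and X :: "'v::real_vector stacky_fan"
  assumes fan: "simplicial_stacky_fan d X"
begin

abbreviation N where "N \<equiv> lat X"
abbreviation V where "V \<equiv> {1..nrays X}"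
abbreviation v where "v \<equiv> gen X"
abbreviation rays where "rays \<equiv> ray_indices X"

lemma rays_sub: "rays \<sigma> \<subseteq> V" by (auto simp: ray_indices_def)

lemma finite_rays [simp]: "finite (rays \<sigma>)" using rays_sub finite_subset by blast

lemma lattice: "is_lattice d N" and fan': "rational_simplicial_fan N (cones X)"
  and gen_lat: "i \<in> V \<Longrightarrow> v i \<in> N" and gen_nz: "i \<in> V \<Longrightarrow> v i \<noteq> 0"
  and ray_bij: "bij_betw (\<lambda>i. convex_cone hull {v i}) V {\<rho> \<in> cones X. dim \<rho> = 1}"
  using fan by (auto simp: simplicial_stacky_fan_def)

lemma finite_cones: "finite (cones X)" and cones_nonempty: "cones X \<noteq> {}"
  and cone_face: "\<sigma> \<in> cones X \<Longrightarrow> \<tau> face_of \<sigma> \<Longrightarrow> \<tau> \<noteq> {} \<Longrightarrow> \<tau> \<in> cones X"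
  and cone_inter: "\<sigma> \<in> cones X \<Longrightarrow> \<tau> \<in> cones X \<Longrightarrow> (\<sigma> \<inter> \<tau>) face_of \<sigma>"
  using fan' by (auto simp: rational_simplicial_fan_def)

lemma cone_basis: "\<sigma> \<in> cones X \<Longrightarrow> \<exists>B. finite B \<and> B \<subseteq> N \<and> independent B \<and> \<sigma> = convex_cone hull B"
  using fan' by (auto simp: rational_simplicial_fan_def rational_simplicial_cone_def)

lemma cone_convex_cone: "\<sigma> \<in> cones X \<Longrightarrow> convex_cone \<sigma>"
  using cone_basis convex_cone_convex_cone_hull by blast

lemma ray_cone: "i \<in> V \<Longrightarrow> convex_cone hull {v i} \<in> cones X"
  using bij_betwE[OF ray_bij] by blast

text \<open>The intersection of \<open>\<sigma>\<close> with a ray of the fan is a face of \<open>\<sigma>\<close>.\<close>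

lemma rays_iff: assumes "\<sigma> \<in> cones X" shows "i \<in> rays \<sigma> \<longleftrightarrow> i \<in> V \<and> v i \<in> \<sigma>"
proof (cases "i \<in> V")
  case True
  show ?thesis
  proof
    assume "i \<in> rays \<sigma>"
    then show "i \<in> V \<and> v i \<in> \<sigma>" using hull_inc[of "v i" "{v i}"]
      by (auto simp: ray_indices_def dest: face_of_imp_subset)
  next
    assume "i \<in> V \<and> v i \<in> \<sigma>"
    then have "convex_cone hull {v i} \<subseteq> \<sigma>" using cone_convex_cone[OF assms] by (intro hull_minimal) auto
    then have "\<sigma> \<inter> convex_cone hull {v i} = convex_cone hull {v i}" by auto
    then show "i \<in> rays \<sigma>" using cone_inter[OF assms ray_cone[OF True]] True
      by (simp add: ray_indices_def)
  qed
next
  case False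
  then show ?thesis using rays_sub[of \<sigma>] by blast
qed

lemma dim_ray: fixes b :: 'v assumes "b \<noteq> 0" shows "dim (convex_cone hull {b}) = 1"
proof (rule real_vector.dim_unique)
  show "{b} \<subseteq> convex_cone hull {b}" by (rule hull_subset)
  show "convex_cone hull {b} \<subseteq> span {b}"
    by (rule hull_minimal) (auto simp: convex_cone_span real_vector.span_base)
  show "independent {b}" using assms by simp
  show "card {b} = 1" by simp
qed

lemma hull_single: "convex_cone hull {b::'v} = {t *\<^sub>R b | t. t \<ge> 0}"
  using convex_cone_hull_finite[of "{b}" "\<lambda>x. x"] by (auto intro: exI[of _ "\<lambda>_. _"])

text \<open>
  A cone of the fan is given by some independent set \<open>B\<close> of lattice vectors.  The rays spanned by elements
  of \<open>B\<close> are faces, hence rays of the fan, and by the face property every ray of the fan that is a face of the cone is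
  spanned by an element of \<open>B\<close>.  So the \<open>v\<^sub>i\<close> on the cone are positive multiples of the elements of \<open>B\<close>.
\<close>

lemma cone_generators:
  assumes \<sigma>: "\<sigma> \<in> cones X"
  shows "\<sigma> = convex_cone hull (v ` rays \<sigma>)"
    and "(\<Sum>i\<in>rays \<sigma>. c i *\<^sub>R v i) = 0 \<Longrightarrow> \<forall>i\<in>rays \<sigma>. c i = 0"
proof -
  obtain B where B: "finite B" "independent B" "\<sigma> = convex_cone hull B" using cone_basis[OF \<sigma>] by blast
  have ray: "\<exists>i\<in>rays \<sigma>. convex_cone hull {v i} = convex_cone hull {b}" if "b \<in> B" for b
  proof -
    have "(convex_cone hull ((\<lambda>x. x) ` {b})) face_of (convex_cone hull ((\<lambda>x. x) ` B))"
    proof (rule convex_cone_hull_face)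
      show "\<forall>i\<in>B. c i = 0" if "(\<Sum>i\<in>B. c i *\<^sub>R i) = 0" for c
        using real_vector.independentD[OF B(2,1) subset_refl that] by blast
    qed (use that B in auto)
    then have face: "(convex_cone hull {b}) face_of \<sigma>" using B by simp
    then have "convex_cone hull {b} \<in> cones X" using cone_face[OF \<sigma>] convex_cone_hull_nonempty by blast
    moreover have "b \<noteq> 0" using B(2) that real_vector.dependent_zero[of B] by auto
    ultimately have "convex_cone hull {b} \<in> {\<rho> \<in> cones X. dim \<rho> = 1}" using dim_ray by auto
    then have "convex_cone hull {b} \<in> (\<lambda>i. convex_cone hull {v i}) ` V"
      using ray_bij by (simp add: bij_betw_def)
    then obtain i where i: "i \<in> V" "convex_cone hull {v i} = convex_cone hull {b}" by auto
    then have "i \<in> rays \<sigma>" using face by (simp add: ray_indices_def)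
    then show ?thesis using i by blast
  qed
  have ray': "\<exists>b\<in>B. \<exists>t>0. v i = t *\<^sub>R b \<and> convex_cone hull {b} = convex_cone hull {v i}" if "i \<in> rays \<sigma>" for i
  proof -
    have iV: "i \<in> V" and vi: "v i \<in> \<sigma>" and face: "(convex_cone hull {v i}) face_of \<sigma>"
      using that rays_iff[OF \<sigma>] by (auto simp: ray_indices_def)
    obtain c where c: "v i = (\<Sum>b\<in>B. c b *\<^sub>R b)" "\<forall>b. c b \<ge> 0"
    proof -
      have "v i \<in> {\<Sum>b\<in>B. c b *\<^sub>R b | c. \<forall>b. c b \<ge> 0}"
        using vi convex_cone_hull_finite[OF B(1), of "\<lambda>x. x"] B(3) by simp
      then show ?thesis using that by blast
    qed
    have "\<exists>b\<in>B. c b \<noteq> 0"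
    proof (rule ccontr)
      assume "\<not> ?thesis"
      then have "v i = 0" using c by simp
      then show False using gen_nz[OF iV] by blast
    qed
    then obtain b where b: "b \<in> B" "c b \<noteq> 0" by blast
    define r where "r = (\<Sum>b\<in>B - {b}. c b *\<^sub>R b)"
    have vr: "v i = c b *\<^sub>R b + r" unfolding c(1) r_def using b B by (simp add: sum.remove)
    have cc: "convex_cone \<sigma>" using cone_convex_cone \<sigma> by blast
    have bs: "c b *\<^sub>R b \<in> \<sigma>"
      using b B c(2) cc hull_inc[of b B] by (simp add: convex_cone_scaleR)
    have "r = (\<Sum>x\<in>B. (if x = b then 0 else c x) *\<^sub>R x)"
      unfolding r_def by (rule sum.mono_neutral_cong_left) (use B in auto)
    then have rs: "r \<in> \<sigma>"
      using convex_cone_hull_finite[OF B(1), of "\<lambda>x. x"] c(2) unfolding B(3)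
      by simp (rule exI[of _ "\<lambda>x. if x = b then 0 else c x"], auto)
    \<comment> \<open>The generator is the midpoint of \<open>2 c\<^sub>b b\<close> and \<open>2 r\<close>, so the face property puts \<open>c\<^sub>b b\<close> on its ray.\<close>
    have "c b *\<^sub>R b \<in> convex_cone hull {v i}"
    proof (cases "c b *\<^sub>R b = r")
      case True
      then have "v i = 2 *\<^sub>R (c b *\<^sub>R b)" unfolding vr by (simp only: scaleR_2)
      then have "c b *\<^sub>R b = (1/2) *\<^sub>R v i" by simp
      then show ?thesis unfolding hull_single by (intro CollectI exI[of _ "1/2"]) auto
    next
      case False
      have "v i = (1 - 1/2) *\<^sub>R (2 *\<^sub>R (c b *\<^sub>R b)) + (1/2) *\<^sub>R (2 *\<^sub>R r)" unfolding vr by simp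
      then have "v i \<in> open_segment (2 *\<^sub>R (c b *\<^sub>R b)) (2 *\<^sub>R r)"
        unfolding in_segment using False by (intro conjI exI[of _ "1/2"]) (auto simp: real_vector.scale_left_imp_eq simp del: scaleR_scaleR)
      moreover have "2 *\<^sub>R (c b *\<^sub>R b) \<in> \<sigma>" "2 *\<^sub>R r \<in> \<sigma>"
        using convex_cone_scaleR[OF cc _ bs, of 2] convex_cone_scaleR[OF cc _ rs, of 2] by auto
      moreover have "v i \<in> convex_cone hull {v i}" by (simp add: hull_inc)
      ultimately have "2 *\<^sub>R (c b *\<^sub>R b) \<in> convex_cone hull {v i}" using face unfolding face_of_def by blast
      from convex_cone_scaleR[OF convex_cone_convex_cone_hull _ this, of "1/2"]
      have "(1/2) *\<^sub>R (2 *\<^sub>R (c b *\<^sub>R b)) \<in> convex_cone hull {v i}"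
        by simp
      then show ?thesis by simp
    qed
    then obtain t where t: "t \<ge> 0" "c b *\<^sub>R b = t *\<^sub>R v i" unfolding hull_single by blast
    have "b \<noteq> 0" using b(1) B(2) real_vector.dependent_zero[of B] by auto
    then have "t \<noteq> 0" using t b by auto
    then have tp: "t > 0" and cp: "c b > 0" using t b c(2)[rule_format, of b] by auto
    have "v i = (1 / t) *\<^sub>R (t *\<^sub>R v i)" using tp by simp
    then have 1: "v i = (c b / t) *\<^sub>R b" unfolding t(2)[symmetric] by simp
    have "convex_cone hull {b} = convex_cone hull {v i}"
    proof (rule antisym; rule hull_minimal)
      have "b = (t / c b) *\<^sub>R v i" unfolding 1 using tp cp by simp
      then show "{b} \<subseteq> convex_cone hull {v i}" unfolding hull_single using tp cp
        by (auto intro!: exI[of _ "t / c b"])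
      show "{v i} \<subseteq> convex_cone hull {b}" unfolding hull_single using tp cp 1
        by (auto intro!: exI[of _ "c b / t"])
    qed (rule convex_cone_convex_cone_hull)+
    then show ?thesis using 1 tp cp b by (intro bexI[of _ b] exI[of _ "c b / t"]) auto
  qed
  then obtain b t where bt: "\<And>i. i \<in> rays \<sigma> \<Longrightarrow> b i \<in> B \<and> t i > (0::real) \<and> v i = t i *\<^sub>R b i
      \<and> convex_cone hull {b i} = convex_cone hull {v i}" by metis
  have inj: "inj_on b (rays \<sigma>)"
  proof (rule inj_onI)
    fix i j assume ij: "i \<in> rays \<sigma>" "j \<in> rays \<sigma>" "b i = b j"
    then have "convex_cone hull {v i} = convex_cone hull {v j}" using bt by metis
    moreover have "i \<in> V" "j \<in> V" using ij(1,2) rays_sub[of \<sigma>] by auto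
    ultimately show "i = j" using inj_onD[OF bij_betw_imp_inj_on[OF ray_bij], of i j] by blast
  qed
  show "\<sigma> = convex_cone hull (v ` rays \<sigma>)"
  proof
    show "\<sigma> \<subseteq> convex_cone hull (v ` rays \<sigma>)" unfolding B(3)
    proof (rule hull_minimal)
      show "B \<subseteq> convex_cone hull (v ` rays (convex_cone hull B))"
      proof
        fix b assume "b \<in> B"
        then obtain i where i: "i \<in> rays \<sigma>" "convex_cone hull {v i} = convex_cone hull {b}" using ray by blast
        have "b \<in> convex_cone hull {v i}" using i by (simp add: hull_inc)
        also have "\<dots> \<subseteq> convex_cone hull (v ` rays \<sigma>)" using i by (intro hull_mono) auto
        finally show "b \<in> convex_cone hull (v ` rays (convex_cone hull B))" using B by simp
      qed
    qed (rule convex_cone_convex_cone_hull)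
    show "convex_cone hull (v ` rays \<sigma>) \<subseteq> \<sigma>"
      using cone_convex_cone[OF \<sigma>] rays_iff[OF \<sigma>] by (intro hull_minimal) auto
  qed
  show "\<forall>i\<in>rays \<sigma>. c i = 0" if z: "(\<Sum>i\<in>rays \<sigma>. c i *\<^sub>R v i) = 0"
  proof
    fix i assume i: "i \<in> rays \<sigma>"
    have "(\<Sum>i\<in>rays \<sigma>. c i *\<^sub>R v i) = (\<Sum>i\<in>rays \<sigma>. (c i * t i) *\<^sub>R b i)"
      using bt by (intro sum.cong) auto
    also have "\<dots> = (\<Sum>x\<in>b ` rays \<sigma>. (c (the_inv_into (rays \<sigma>) b x) * t (the_inv_into (rays \<sigma>) b x)) *\<^sub>R x)"
      using inj by (simp add: sum.reindex the_inv_into_f_f)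
    finally have "(\<Sum>x\<in>b ` rays \<sigma>. (c (the_inv_into (rays \<sigma>) b x) * t (the_inv_into (rays \<sigma>) b x)) *\<^sub>R x) = 0"
      using z by simp
    moreover have "b ` rays \<sigma> \<subseteq> B" "b i \<in> b ` rays \<sigma>" using bt i by auto
    ultimately have "c (the_inv_into (rays \<sigma>) b (b i)) * t (the_inv_into (rays \<sigma>) b (b i)) = 0"
      by (intro real_vector.independentD[OF B(2)]) simp_all
    then show "c i = 0" using inj i bt[OF i] by (auto simp: the_inv_into_f_f)
  qed
qed

lemma cone_eq: "\<sigma> \<in> cones X \<Longrightarrow> \<sigma> = {\<Sum>i\<in>rays \<sigma>. c i *\<^sub>R v i | c. \<forall>i. c i \<ge> (0::real)}"
  using cone_generators(1) convex_cone_hull_finite[of "rays \<sigma>" v] by simp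

lemma rays_hull_face:
  assumes "J \<subseteq> rays \<sigma>" "\<sigma> \<in> cones X"
  shows "convex_cone hull (v ` J) \<in> cones X"
proof -
  have "(convex_cone hull (v ` J)) face_of (convex_cone hull (v ` rays \<sigma>))"
    by (rule convex_cone_hull_face) (use assms cone_generators in auto)
  then show ?thesis using cone_generators(1)[OF assms(2)] cone_face[OF assms(2)] convex_cone_hull_nonempty
    by metis
qed

definition faceset :: "nat set \<Rightarrow> bool" where
  "faceset J \<longleftrightarrow> (\<exists>\<sigma>\<in>maximal_cones X. J \<subseteq> rays \<sigma>)"

lemma maximal_cone: "\<sigma> \<in> maximal_cones X \<Longrightarrow> \<sigma> \<in> cones X"
  by (simp add: maximal_cones_def)

lemma exists_maximal: assumes "\<sigma> \<in> cones X" shows "\<exists>\<tau>\<in>maximal_cones X. \<sigma> \<subseteq> \<tau>"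
proof -
  have "finite {\<tau> \<in> cones X. \<sigma> \<subseteq> \<tau>}" "{\<tau> \<in> cones X. \<sigma> \<subseteq> \<tau>} \<noteq> {}" using finite_cones assms by auto
  then obtain \<tau> where "\<tau> \<in> {\<tau> \<in> cones X. \<sigma> \<subseteq> \<tau>}" "\<forall>\<rho>\<in>{\<tau> \<in> cones X. \<sigma> \<subseteq> \<tau>}. \<tau> \<subseteq> \<rho> \<longrightarrow> \<tau> = \<rho>"
    using finite_has_maximal[of "{\<tau> \<in> cones X. \<sigma> \<subseteq> \<tau>}"] by blast
  then show ?thesis unfolding maximal_cones_def by (intro bexI[of _ \<tau>]) auto
qed

lemma rays_mono: "\<sigma> \<in> cones X \<Longrightarrow> \<tau> \<in> cones X \<Longrightarrow> \<sigma> \<subseteq> \<tau> \<Longrightarrow> rays \<sigma> \<subseteq> rays \<tau>"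
  using rays_iff by blast

lemma faceset_iff_cone: "faceset J \<longleftrightarrow> (\<exists>\<sigma>\<in>cones X. J \<subseteq> rays \<sigma>)"
  unfolding faceset_def using exists_maximal rays_mono maximal_cone by (meson subset_trans)

lemma faceset_mono: "faceset J \<Longrightarrow> K \<subseteq> J \<Longrightarrow> faceset K"
  unfolding faceset_def by blast

lemma faceset_sub: "faceset J \<Longrightarrow> J \<subseteq> V"
  unfolding faceset_def using rays_sub by blast

lemma faceset_empty: "faceset {}"
  unfolding faceset_iff_cone using cones_nonempty by blast

text \<open>The condition on the right is the one in the definition of \<open>U\<close>.\<close>

lemma faceset_iff_hull: "J \<subseteq> V \<Longrightarrow> faceset J \<longleftrightarrow> convex_cone hull (v ` J) \<in> cones X"
proof
  assume "faceset J"
  then show "convex_cone hull (v ` J) \<in> cones X" using faceset_iff_cone rays_hull_face by blast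
next
  assume J: "J \<subseteq> V" "convex_cone hull (v ` J) \<in> cones X"
  then have "J \<subseteq> rays (convex_cone hull (v ` J))" using rays_iff[OF J(2)] J(1) by (blast intro: hull_inc)
  then show "faceset J" using J faceset_iff_cone by blast
qed

lemma finite_maximal: "finite (maximal_cones X)"
  using finite_cones by (simp add: maximal_cones_def)

lemma sum_support: "A \<subseteq> V \<Longrightarrow> {i. c i \<noteq> 0} \<subseteq> A \<Longrightarrow> (\<Sum>i\<in>V. c i *\<^sub>R v i) = (\<Sum>i\<in>A. c i *\<^sub>R v i)"
  by (rule sum.mono_neutral_right) auto

lemma coeff_unique:
  assumes "\<sigma> \<in> cones X" "{i. c i \<noteq> 0} \<subseteq> rays \<sigma>" "{i. c' i \<noteq> 0} \<subseteq> rays \<sigma>"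
    and "(\<Sum>i\<in>V. c i *\<^sub>R v i) = (\<Sum>i\<in>V. c' i *\<^sub>R v i)"
  shows "c = (c' :: nat \<Rightarrow> real)"
proof -
  have "(\<Sum>i\<in>rays \<sigma>. (c i - c' i) *\<^sub>R v i) = 0"
    using assms(4) unfolding sum_support[OF rays_sub assms(2)] sum_support[OF rays_sub assms(3)]
    by (simp add: scaleR_diff_left sum_subtractf)
  then have *: "\<forall>i\<in>rays \<sigma>. c i - c' i = 0"
    by (rule cone_generators(2)[OF assms(1)])
  show ?thesis
  proof
    fix i show "c i = c' i"
    proof (cases "i \<in> rays \<sigma>")
      case False
      then have "c i = 0" "c' i = 0" using assms(2,3) by blast+
      then show ?thesis by simp
    qed (use * in simp)
  qed
qed

lemma in_cone_coeffs:
  assumes "\<sigma> \<in> cones X" "x \<in> \<sigma>"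
  obtains c where "x = (\<Sum>i\<in>V. c i *\<^sub>R v i)" "\<And>i. c i \<ge> (0::real)" "{i. c i \<noteq> 0} \<subseteq> rays \<sigma>"
proof -
  have "x \<in> {\<Sum>i\<in>rays \<sigma>. c i *\<^sub>R v i | c. \<forall>i. c i \<ge> (0::real)}"
    using assms(2) cone_eq[OF assms(1)] by (rule subst[rotated])
  then obtain c where c: "x = (\<Sum>i\<in>rays \<sigma>. c i *\<^sub>R v i)" "\<forall>i. c i \<ge> (0::real)" by blast
  let ?c = "\<lambda>i. if i \<in> rays \<sigma> then c i else 0"
  have "x = (\<Sum>i\<in>V. ?c i *\<^sub>R v i)"
    unfolding c(1) by (rule sum.mono_neutral_cong_left) (use rays_sub in auto)
  then show ?thesis using c(2) by (intro that[of ?c]) auto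
qed

lemma coeffs_in_cone:
  assumes "\<sigma> \<in> cones X" "\<And>i. c i \<ge> (0::real)" "{i. c i \<noteq> 0} \<subseteq> rays \<sigma>"
  shows "(\<Sum>i\<in>V. c i *\<^sub>R v i) \<in> \<sigma>"
proof -
  have "(\<Sum>i\<in>rays \<sigma>. c i *\<^sub>R v i) \<in> {\<Sum>i\<in>rays \<sigma>. c i *\<^sub>R v i | c. \<forall>i. c i \<ge> (0::real)}"
    using assms(2) by blast
  then show ?thesis unfolding sum_support[OF rays_sub assms(3)] cone_eq[OF assms(1), symmetric] .
qed

text \<open>
  The point lies in the common face \<open>\<sigma> \<inter> \<tau>\<close>, so it is also a combination of the generators of that
  face, which are generators of both cones.
\<close>

lemma rep_unique:
  assumes "\<sigma> \<in> cones X" "\<tau> \<in> cones X"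
    and c: "\<And>i. c i \<ge> (0::real)" "{i. c i \<noteq> 0} \<subseteq> rays \<sigma>"
    and c': "\<And>i. c' i \<ge> 0" "{i. c' i \<noteq> 0} \<subseteq> rays \<tau>"
    and eq: "(\<Sum>i\<in>V. c i *\<^sub>R v i) = (\<Sum>i\<in>V. c' i *\<^sub>R v i)"
  shows "c = c'"
proof -
  let ?x = "\<Sum>i\<in>V. c i *\<^sub>R v i"
  have "?x \<in> \<sigma> \<inter> \<tau>" using coeffs_in_cone[OF assms(1) c] coeffs_in_cone[OF assms(2) c'] eq by simp
  have st: "\<sigma> \<inter> \<tau> \<in> cones X"
    using cone_face[OF assms(1) cone_inter[OF assms(1,2)]] \<open>?x \<in> \<sigma> \<inter> \<tau>\<close> by blast
  obtain e where e: "?x = (\<Sum>i\<in>V. e i *\<^sub>R v i)" "\<And>i. e i \<ge> (0::real)" "{i. e i \<noteq> 0} \<subseteq> rays (\<sigma> \<inter> \<tau>)"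
    using in_cone_coeffs[OF st \<open>?x \<in> \<sigma> \<inter> \<tau>\<close>] by blast
  have "rays (\<sigma> \<inter> \<tau>) \<subseteq> rays \<sigma>" "rays (\<sigma> \<inter> \<tau>) \<subseteq> rays \<tau>" using rays_mono st assms by auto
  then have "{i. e i \<noteq> 0} \<subseteq> rays \<sigma>" "{i. e i \<noteq> 0} \<subseteq> rays \<tau>" using e(3) by blast+
  then have "c = e" "c' = e"
    using coeff_unique[OF assms(1) c(2) _ e(1)] coeff_unique[OF assms(2) c'(2) _ trans[OF eq[symmetric] e(1)]] by blast+
  then show ?thesis by simp
qed

lemma support_in_cone:
  assumes "faceset {i. c i \<noteq> 0}" "\<And>i. c i \<ge> (0::real)" "\<tau> \<in> cones X" "(\<Sum>i\<in>V. c i *\<^sub>R v i) \<in> \<tau>"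
  shows "{i. c i \<noteq> 0} \<subseteq> rays \<tau>"
proof -
  obtain \<sigma> where \<sigma>: "\<sigma> \<in> cones X" "{i. c i \<noteq> 0} \<subseteq> rays \<sigma>" using assms(1) faceset_iff_cone by blast
  obtain c' where c': "(\<Sum>i\<in>V. c i *\<^sub>R v i) = (\<Sum>i\<in>V. c' i *\<^sub>R v i)" "\<And>i. c' i \<ge> (0::real)" "{i. c' i \<noteq> 0} \<subseteq> rays \<tau>"
    using in_cone_coeffs[OF assms(3,4)] by blast
  have "c = c'" by (rule rep_unique[OF \<sigma>(1) assms(3) assms(2) \<sigma>(2) c'(2,3,1)])
  then show ?thesis using c' by simp
qed

lemma lattice_basis:
  obtains B where "finite B" "independent B" "span B = UNIV" "N = {\<Sum>b\<in>B. of_int (c b) *\<^sub>R b | c :: 'v \<Rightarrow> int. True}"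
  using lattice by (auto simp: is_lattice_def)

lemma lat_add: "x \<in> N \<Longrightarrow> y \<in> N \<Longrightarrow> x + y \<in> N"
  and lat_zero: "0 \<in> N" and lat_scale: "x \<in> N \<Longrightarrow> of_int a *\<^sub>R x \<in> N"
proof -
  obtain B where "finite B" "independent B" "span B = UNIV"
    and B: "N = {\<Sum>b\<in>B. of_int (c b) *\<^sub>R b | c :: 'v \<Rightarrow> int. True}" by (rule lattice_basis)
  show "0 \<in> N" unfolding B by (intro CollectI exI[of _ "\<lambda>_. 0"]) simp
  show "x + y \<in> N" if xy: "x \<in> N" "y \<in> N"
  proof -
    obtain c c' :: "'v \<Rightarrow> int" where "x = (\<Sum>b\<in>B. of_int (c b) *\<^sub>R b)" "y = (\<Sum>b\<in>B. of_int (c' b) *\<^sub>R b)"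
      using xy unfolding B by blast
    then have "x + y = (\<Sum>b\<in>B. of_int (c b + c' b) *\<^sub>R b)"
      by (simp add: scaleR_add_left sum.distrib)
    then show ?thesis unfolding B by (intro CollectI exI[of _ "\<lambda>b. c b + c' b"]) simp
  qed
  show "of_int a *\<^sub>R x \<in> N" if x: "x \<in> N"
  proof -
    obtain c :: "'v \<Rightarrow> int" where "x = (\<Sum>b\<in>B. of_int (c b) *\<^sub>R b)" using x unfolding B by blast
    then have "of_int a *\<^sub>R x = (\<Sum>b\<in>B. of_int (a * c b) *\<^sub>R b)" by (simp add: scaleR_sum_right)
    then show ?thesis unfolding B by (intro CollectI exI[of _ "\<lambda>b. a * c b"]) simp
  qed
qed

lemma lat_sum: "(\<And>i. i \<in> A \<Longrightarrow> f i \<in> N) \<Longrightarrow> sum f A \<in> N"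
  by (induction A rule: infinite_finite_induct) (auto intro: lat_add lat_zero)

lemma lat_nat_comb: "A \<subseteq> V \<Longrightarrow> (\<Sum>i\<in>A. of_nat (m i) *\<^sub>R v i) \<in> N"
proof (rule lat_sum)
  fix i assume "A \<subseteq> V" "i \<in> A"
  then show "of_nat (m i) *\<^sub>R v i \<in> N" using lat_scale[OF gen_lat, of i "int (m i)"] by auto
qed

lemma dual_linear: "f \<in> dual_lattice N \<Longrightarrow> linear f" and dual_int: "f \<in> dual_lattice N \<Longrightarrow> n \<in> N \<Longrightarrow> f n \<in> \<int>"
  by (auto simp: dual_lattice_def)

lemma dual_floor: "f \<in> dual_lattice N \<Longrightarrow> n \<in> N \<Longrightarrow> of_int \<lfloor>f n\<rfloor> = f n"
  using dual_int Ints_cases by fastforce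

lemma dualI:
  assumes B: "finite B" "N = {\<Sum>b\<in>B. of_int (c b) *\<^sub>R b | c :: 'v \<Rightarrow> int. True}"
    and f: "linear f" "\<And>b. b \<in> B \<Longrightarrow> f b \<in> \<int>"
  shows "f \<in> dual_lattice N"
proof -
  have "f x \<in> \<int>" if x: "x \<in> N" for x
  proof -
    obtain c :: "'v \<Rightarrow> int" where "x = (\<Sum>b\<in>B. of_int (c b) *\<^sub>R b)" using x unfolding B by blast
    then have "f x = (\<Sum>b\<in>B. of_int (c b) * f b)"
      using f(1) by (simp add: linear_sum linear_cmul)
    then show ?thesis using f(2) by (auto intro!: Ints_mult)
  qed
  then show ?thesis using f by (auto simp: dual_lattice_def)
qed

text \<open>The coordinate functions of a lattice basis are integral.\<close>

lemma dual_separates: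
  "(\<And>f. f \<in> dual_lattice N \<Longrightarrow> f w \<in> \<int>) \<Longrightarrow> w \<in> N"
  "(\<And>f. f \<in> dual_lattice N \<Longrightarrow> f w = 0) \<Longrightarrow> w = 0"
proof -
  obtain B where B: "finite B" "independent B" "span B = UNIV" "N = {\<Sum>b\<in>B. of_int (c b) *\<^sub>R b | c :: 'v \<Rightarrow> int. True}"
    by (rule lattice_basis)
  have "w \<in> range (\<lambda>u. \<Sum>b\<in>B. u b *\<^sub>R b)"
    using B real_vector.span_finite[OF B(1)] by auto
  then obtain u where u: "w = (\<Sum>b\<in>B. u b *\<^sub>R b)" by blast
  have ex: "\<exists>f\<in>dual_lattice N. f w = u b" if b: "b \<in> B" for b
  proof -
    obtain f :: "'v \<Rightarrow> real" where f: "linear f" "\<forall>x\<in>B. f x = (if x = b then 1 else 0)"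
      using linear_independent_extend[OF B(2), of "\<lambda>x. if x = b then 1 else 0 :: real"] by blast
    have "f w = u b" unfolding u using f b B(1)
      by (simp add: linear_sum linear_cmul if_distrib[of "\<lambda>r. _ * r"] cong: if_cong)
    moreover have "f \<in> dual_lattice N" by (rule dualI[OF B(1,4)]) (use f in auto)
    ultimately show ?thesis by blast
  qed
  show "w \<in> N" if "\<And>f. f \<in> dual_lattice N \<Longrightarrow> f w \<in> \<int>"
  proof -
    have "u b \<in> \<int>" if "b \<in> B" for b using ex[OF that] \<open>\<And>f. f \<in> dual_lattice N \<Longrightarrow> f w \<in> \<int>\<close> by metis
    then have "\<forall>b\<in>B. u b = of_int \<lfloor>u b\<rfloor>" using Ints_cases by fastforce
    then have "w = (\<Sum>b\<in>B. of_int \<lfloor>u b\<rfloor> *\<^sub>R b)" unfolding u by (intro sum.cong) auto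
    then show ?thesis unfolding B(4) by (auto intro!: exI[of _ "\<lambda>b. \<lfloor>u b\<rfloor>"])
  qed
  show "w = 0" if "\<And>f. f \<in> dual_lattice N \<Longrightarrow> f w = 0"
  proof -
    have "u b = 0" if "b \<in> B" for b using ex[OF that] \<open>\<And>f. f \<in> dual_lattice N \<Longrightarrow> f w = 0\<close> by metis
    then show ?thesis unfolding u by simp
  qed
qed

text \<open>
  The generators of a cone are independent over the reals, hence over the rationals, so a rational-linear
  functional \<open>F\<close> is \<open>1\<close> at \<open>v\<^sub>j\<close> and \<open>0\<close> at the others.  Clearing the denominators of \<open>F\<close> on a lattice basis gives an
  integral functional.
\<close>

lemma dual_functional:
  assumes \<sigma>: "\<sigma> \<in> cones X" and j: "j \<in> rays \<sigma>"
  shows "\<exists>f\<in>dual_lattice N. \<exists>q::nat. q > 0 \<and> f (v j) = of_nat q \<and> (\<forall>i\<in>rays \<sigma> - {j}. f (v i) = 0)"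
proof -
  let ?s = "\<lambda>q::rat. \<lambda>x::'v. of_rat q *\<^sub>R x"
  interpret Q: vector_space ?s
    by unfold_locales (auto simp: scaleR_add_right of_rat_add scaleR_add_left of_rat_mult)
  interpret QQ: vector_space_pair ?s "(*) :: rat \<Rightarrow> rat \<Rightarrow> rat"
    by unfold_locales (auto simp: algebra_simps)
  have inj: "inj_on v (rays \<sigma>)"
  proof (rule inj_onI)
    fix a b assume ab: "a \<in> rays \<sigma>" "b \<in> rays \<sigma>" "v a = v b"
    then have "convex_cone hull {v a} = convex_cone hull {v b}" by simp
    moreover have "a \<in> V" "b \<in> V" using ab(1,2) rays_sub[of \<sigma>] by auto
    ultimately show "a = b" using inj_onD[OF bij_betw_imp_inj_on[OF ray_bij], of a b] by blast
  qed
  have ind: "\<not> Q.dependent (v ` rays \<sigma>)"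
  proof
    assume "Q.dependent (v ` rays \<sigma>)"
    then obtain u where u: "(\<Sum>x\<in>v ` rays \<sigma>. ?s (u x) x) = 0" "\<exists>x\<in>v ` rays \<sigma>. u x \<noteq> 0"
      using Q.dependent_finite[of "v ` rays \<sigma>"] by auto
    have "(\<Sum>i\<in>rays \<sigma>. of_rat (u (v i)) *\<^sub>R v i) = 0" using u(1) inj by (simp add: sum.reindex)
    from cone_generators(2)[OF \<sigma> this] show False using u(2) by auto
  qed
  obtain F where F: "Vector_Spaces.linear ?s (*) F" "\<forall>x\<in>v ` rays \<sigma>. F x = (if x = v j then 1 else 0::rat)"
    using QQ.linear_independent_extend[OF ind, of "\<lambda>x. if x = v j then 1 else 0"] by blast
  interpret F: Vector_Spaces.linear ?s "(*)" F by (rule F(1))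
  obtain B where B: "finite B" "independent B" "span B = UNIV" "N = {\<Sum>b\<in>B. of_int (c b) *\<^sub>R b | c :: 'v \<Rightarrow> int. True}"
    by (rule lattice_basis)
  \<comment> \<open>A common denominator of the values of \<open>F\<close> on the lattice basis.\<close>
  define D where "D = (\<Prod>b\<in>B. snd (quotient_of (F b)))"
  have D: "D > 0" unfolding D_def by (intro prod_pos) (simp add: quotient_of_denom_pos')
  have DF: "of_int D * F b \<in> \<int>" if "b \<in> B" for b
  proof -
    obtain n e where ne: "quotient_of (F b) = (n, e)" by (cases "quotient_of (F b)")
    then have Fb: "F b = of_int n / of_int e" "e > 0" using quotient_of_div quotient_of_denom_pos by auto
    have "D = e * (\<Prod>b\<in>B - {b}. snd (quotient_of (F b)))" unfolding D_def using B that ne by (simp add: prod.remove)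
    then have "of_int D * F b = of_int ((\<Prod>b\<in>B - {b}. snd (quotient_of (F b))) * n)" using Fb by simp
    then show ?thesis by (metis Ints_of_int)
  qed
  obtain f :: "'v \<Rightarrow> real" where f: "linear f" "\<forall>x\<in>B. f x = of_rat (of_int D * F x)"
    using linear_independent_extend[OF B(2), of "\<lambda>x. of_rat (of_int D * F x)"] by blast
  have fF: "f x = of_rat (of_int D * F x)" if "x \<in> N" for x
  proof -
    obtain c :: "'v \<Rightarrow> int" where c: "x = (\<Sum>b\<in>B. of_int (c b) *\<^sub>R b)" using \<open>x \<in> N\<close> unfolding B(4) by blast
    have "x = (\<Sum>b\<in>B. ?s (of_int (c b)) b)" using c by simp
    then have "F x = (\<Sum>b\<in>B. of_int (c b) * F b)" using F.sum[of "\<lambda>b. ?s (of_int (c b)) b" B] F.scale[of "of_int (c _)"] by simp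
    moreover have "f x = (\<Sum>b\<in>B. of_int (c b) * f b)" unfolding c using f(1) by (simp add: linear_sum linear_cmul)
    ultimately show ?thesis using f(2)
      by (simp add: sum_distrib_left of_rat_sum of_rat_mult mult.left_commute)
  qed
  have dual: "f \<in> dual_lattice N"
  proof (rule dualI[OF B(1,4) f(1)])
    fix b assume "b \<in> B"
    then obtain z where "of_int D * F b = of_int z" using DF Ints_cases by blast
    then show "f b \<in> \<int>" using f(2) \<open>b \<in> B\<close> by simp
  qed
  have "f (v i) = (if i = j then of_int D else 0)" if "i \<in> rays \<sigma>" for i
  proof -
    have "i \<in> V" using that rays_sub[of \<sigma>] by blast
    then have "f (v i) = of_rat (of_int D * F (v i))" using fF gen_lat by blast
    moreover have "F (v i) = (if i = j then 1 else 0)" using F(2) that j inj_onD[OF inj, of i j] by auto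
    ultimately show ?thesis by simp
  qed
  then have "f (v j) = of_nat (nat D)" "\<forall>i\<in>rays \<sigma> - {j}. f (v i) = 0" using D j by auto
  then show ?thesis using dual D by (intro bexI[of _ f] exI[of _ "nat D"]) auto
qed

end

section \<open>The Stanley-Reisner ring as a quotient of a polynomial ring\<close>

locale biadditive_coeff =
  fixes f :: "'a::comm_ring_1 \<Rightarrow> 'm \<Rightarrow> 'a \<Rightarrow> 'n \<Rightarrow> 'b::ab_group_add"
  assumes f_add1: "f (a + a') m b n = f a m b n + f a' m b n"
    and f_add2: "f a m (b + b') n = f a m b n + f a m b' n"
begin

definition bilin_ext :: "('m \<Rightarrow>\<^sub>0 'a) \<Rightarrow> ('n \<Rightarrow>\<^sub>0 'a) \<Rightarrow> 'b" where
  "bilin_ext p q = lin_ext (\<lambda>a m. lin_ext (\<lambda>b n. f a m b n) q) p"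

lemma inner: "additive_coeff (\<lambda>b n. f a m b n)"
  by unfold_locales (rule f_add2)

lemma outer: "additive_coeff (\<lambda>a m. lin_ext (\<lambda>b n. f a m b n) q)"
  by unfold_locales (simp add: lin_ext_def f_add1 sum.distrib)

lemma bilin_add1: "bilin_ext (p + p') q = bilin_ext p q + bilin_ext p' q"
  and bilin_01: "bilin_ext 0 q = 0"
  using additive_coeff.lin_ext_add[OF outer] additive_coeff.lin_ext_0[OF outer] by (simp_all add: bilin_ext_def)

lemma bilin_add2: "bilin_ext p (q + q') = bilin_ext p q + bilin_ext p q'"
  and bilin_02: "bilin_ext p 0 = 0"
  using additive_coeff.lin_ext_add[OF inner] additive_coeff.lin_ext_0[OF inner]
  by (simp_all add: bilin_ext_def) (simp_all add: lin_ext_def sum.distrib)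

lemma bilin_single: "bilin_ext (single m a) (single n b) = f a m b n"
  unfolding bilin_ext_def additive_coeff.lin_ext_single[OF outer]
  by (rule additive_coeff.lin_ext_single[OF inner])

lemma bilin_sum2: "bilin_ext p (sum q A) = (\<Sum>i\<in>A. bilin_ext p (q i))"
  by (induction A rule: infinite_finite_induct) (auto simp: bilin_add2 bilin_02)

end

text \<open>The index set \<open>{1..k}\<close> has to keep its form under simplification.\<close>

declare One_nat_def [simp del]

definition mvar :: "nat \<Rightarrow> ((nat \<Rightarrow>\<^sub>0 nat) \<Rightarrow>\<^sub>0 'a::comm_ring_1)" where
  "mvar i = single (single i 1) 1"

lemma mvar_power: "mvar i ^ n = single (single i n) (1::'a::comm_ring_1)"
  by (induction n) (simp_all add: mvar_def mult_single flip: single_add Suc_eq_plus1_left)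

lemma mpoly_in_subalgebra:
  fixes p :: "(nat \<Rightarrow>\<^sub>0 nat) \<Rightarrow>\<^sub>0 'a::comm_ring_1"
  assumes c: "\<And>c. single 0 c \<in> D" and x: "\<And>i. mvar i \<in> D"
    and a: "\<And>p q. p \<in> D \<Longrightarrow> q \<in> D \<Longrightarrow> p + q \<in> D" and m: "\<And>p q. p \<in> D \<Longrightarrow> q \<in> D \<Longrightarrow> p * q \<in> D"
  shows "p \<in> D"
proof -
  have one: "1 \<in> D" using c[of 1] by simp
  have mon: "single m (1::'a) \<in> D" for m :: "nat \<Rightarrow>\<^sub>0 nat"
  proof (induction m rule: poly_mapping_induct)
    case zero then show ?case using c by blast
  next
    case (single i n)
    have "mvar i ^ n \<in> D" by (induction n) (auto intro: one m x)
    then show ?case by (simp add: mvar_power)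
  next
    case (add p q)
    then show ?case using m[OF add] by (simp add: mult_single)
  qed
  show ?thesis
  proof (induction p rule: poly_mapping_induct)
    case zero then show ?case using c[of 0] by simp
  next
    case (single k b)
    then show ?case using m[OF c[of b] mon[of k]] by (simp add: mult_single)
  qed (rule a)
qed

lemma lookup_coeff_ext: "lookup (coeff_ext p) k = of_int (lookup p k)"
  unfolding coeff_ext_def by transfer (auto simp: when_def)

lemma coeff_ext_add: "coeff_ext (p + q) = coeff_ext p + coeff_ext q"
  by (rule poly_mapping_eqI) (simp add: lookup_coeff_ext lookup_add)

lemma coeff_ext_0 [simp]: "coeff_ext 0 = 0"
  by (rule poly_mapping_eqI) (simp add: lookup_coeff_ext)

lemma coeff_ext_single [simp]: "coeff_ext (single k c) = single k (of_int c)"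
  by (rule poly_mapping_eqI) (simp add: lookup_coeff_ext lookup_single when_def)

lemma coeff_ext_sum: "coeff_ext (sum f A) = (\<Sum>i\<in>A. coeff_ext (f i))"
  by (induction A rule: infinite_finite_induct) (auto simp: coeff_ext_add)

lemma coeff_ext_mult: 
  fixes p q :: "'m::comm_monoid_add \<Rightarrow>\<^sub>0 int"
  shows "(coeff_ext (p * q) :: 'm \<Rightarrow>\<^sub>0 'a::comm_ring_1) = coeff_ext p * coeff_ext q"
proof (induction p rule: poly_mapping_induct)
  case (single m a)
  show ?case
    by (induction q rule: poly_mapping_induct) (auto simp: mult_single distrib_left coeff_ext_add)
qed (auto simp: distrib_right coeff_ext_add)

context simplicial_fan begin

definition lat_vec :: "(nat \<Rightarrow>\<^sub>0 nat) \<Rightarrow> 'v" where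
  "lat_vec m = (\<Sum>i\<in>V. of_nat (lookup m i) *\<^sub>R v i)"

lemma lat_vec_add: "lat_vec (m + n) = lat_vec m + lat_vec n"
  by (simp add: lat_vec_def lookup_add scaleR_add_left sum.distrib)

lemma lat_vec_0 [simp]: "lat_vec 0 = 0" by (simp add: lat_vec_def)

lemma lat_vec_single: "i \<in> V \<Longrightarrow> lat_vec (single i 1) = v i"
proof -
  assume "i \<in> V"
  have "lat_vec (single i 1) = (\<Sum>j\<in>V. if j = i then v i else 0)"
    unfolding lat_vec_def by (rule sum.cong) (auto simp: lookup_single when_def)
  then show ?thesis using \<open>i \<in> V\<close> by simp
qed

lemma keys_add_nat: "keys (m + n) = keys m \<union> keys (n :: nat \<Rightarrow>\<^sub>0 nat)"
  by (auto simp: in_keys_iff lookup_add)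

lemma keys_pos: "{i. 0 < lookup m i} = keys (m :: nat \<Rightarrow>\<^sub>0 nat)"
  by (auto simp: in_keys_iff)

lemma lat_vec_lat: "lat_vec m \<in> N"
  unfolding lat_vec_def by (rule lat_nat_comb) simp

lemma lat_vec_in_cone: "\<sigma> \<in> cones X \<Longrightarrow> keys m \<subseteq> rays \<sigma> \<Longrightarrow> lat_vec m \<in> \<sigma>"
  unfolding lat_vec_def by (rule coeffs_in_cone) (simp_all add: keys_pos)

lemma lat_vec_cone_iff:
  assumes "faceset (keys m)" "\<sigma> \<in> cones X"
  shows "lat_vec m \<in> \<sigma> \<longleftrightarrow> keys m \<subseteq> rays \<sigma>"
proof
  assume "lat_vec m \<in> \<sigma>"
  then show "keys m \<subseteq> rays \<sigma>"
    using support_in_cone[of "\<lambda>i. real (lookup m i)" \<sigma>] assms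
    by (simp add: keys_pos lat_vec_def)
qed (use assms lat_vec_in_cone in blast)

lemma lat_vec_inj:
  assumes "faceset (keys m)" "faceset (keys n)" "lat_vec m = lat_vec n"
  shows "m = n"
proof -
  obtain \<sigma> \<rho> where "\<sigma> \<in> cones X" "\<rho> \<in> cones X" "keys m \<subseteq> rays \<sigma>" "keys n \<subseteq> rays \<rho>"
    using assms faceset_iff_cone by meson
  then have "(\<lambda>i. real (lookup m i)) = (\<lambda>i. real (lookup n i))"
    using assms(3) by (intro rep_unique[of \<sigma> \<rho>]) (simp_all add: keys_pos lat_vec_def)
  then show ?thesis by (intro poly_mapping_eqI) (metis of_nat_eq_iff)
qed

text \<open>
  The ring \<open>S\<close> is the face ring of the fan: \<open>x\<^sup>m\<close> stands for the product of the \<open>[v\<^sub>i]\<close> with exponents \<open>m\<^sub>i\<close>, which is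
  a single symbol or \<open>0\<close>.
\<close>

definition sr_mon :: "'a::comm_ring_1 \<Rightarrow> (nat \<Rightarrow>\<^sub>0 nat) \<Rightarrow> ('v \<Rightarrow>\<^sub>0 'a)" where
  "sr_mon c m = (if faceset (keys m) then single (lat_vec m) c else 0)"

definition sr_hom :: "((nat \<Rightarrow>\<^sub>0 nat) \<Rightarrow>\<^sub>0 'a::comm_ring_1) \<Rightarrow> ('v \<Rightarrow>\<^sub>0 'a)" where
  "sr_hom = lin_ext sr_mon"

sublocale sr_hom_ext: additive_coeff "sr_mon :: 'a::comm_ring_1 \<Rightarrow> _"
  by unfold_locales (simp add: sr_mon_def single_add)

lemma sr_hom_add: "sr_hom (p + q) = sr_hom p + sr_hom q" and sr_hom_diff: "sr_hom (p - q) = sr_hom p - sr_hom q"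
  and sr_hom_uminus: "sr_hom (- p) = - sr_hom p" and sr_hom_0 [simp]: "sr_hom 0 = 0"
  and sr_hom_single: "sr_hom (single m c) = sr_mon c m"
  and sr_hom_sum: "sr_hom (sum f A) = (\<Sum>i\<in>A. sr_hom (f i))"
  by (simp_all add: sr_hom_def sr_hom_ext.lin_ext_sum)

lemma sr_hom_scalar: "sr_hom (single 0 c) = single 0 c"
  by (simp add: sr_hom_single sr_mon_def faceset_empty)

lemma scalar_sr_hom: "scalar c = sr_hom (single 0 c)"
  by (simp add: sr_hom_scalar scalar_def)

lemma sr_hom_1: "sr_hom 1 = 1"
  using sr_hom_scalar[of 1] by simp

lemma faceset_single: "i \<in> V \<Longrightarrow> faceset {i}"
  using faceset_iff_cone ray_cone rays_iff hull_inc by (metis empty_subsetI insert_subset singletonI)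

lemma sr_hom_mvar: "sr_hom (mvar i) = (if i \<in> V then ray_elt X i else 0)"
proof (cases "i \<in> V")
  case True
  then show ?thesis using lat_vec_single[OF True] faceset_single[OF True]
    by (simp add: mvar_def sr_hom_single sr_mon_def ray_elt_def)
next
  case False
  then have "\<not> faceset {i}" using faceset_sub by blast
  then show ?thesis using False unfolding mvar_def by (simp only: sr_hom_single sr_mon_def keys_single) auto
qed

text \<open>Distinct monomials supported on faces go to distinct symbols.\<close>

lemma sr_hom_lookup:
  assumes "faceset (keys m)"
  shows "lookup (sr_hom p) (lat_vec m) = lookup p m"
proof (induction p rule: poly_mapping_induct)
  case (single n c)
  then show ?case using assms lat_vec_inj[of n m]
    by (auto simp: sr_hom_single sr_mon_def lookup_single when_def)
qed (simp_all add: sr_hom_add lookup_add)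

definition sr_coeff :: "'a::comm_ring_1 \<Rightarrow> 'v \<Rightarrow> 'a \<Rightarrow> 'v \<Rightarrow> 'v \<Rightarrow>\<^sub>0 'a" where
  "sr_coeff a m b n = (if \<exists>\<sigma>\<in>cones X. m \<in> \<sigma> \<and> n \<in> \<sigma> then single (m + n) (a * b) else 0)"

sublocale sr: biadditive_coeff "sr_coeff :: 'a::comm_ring_1 \<Rightarrow> _"
  by unfold_locales (auto simp: sr_coeff_def single_add distrib_left distrib_right)

lemma sr_mult_bilin: "sr_mult X = sr.bilin_ext"
  by (intro ext) (simp add: sr_mult_def sr.bilin_ext_def lin_ext_def sr_coeff_def)

lemma faceset_common_cone:
  assumes "faceset (keys m)" "faceset (keys n)"
  shows "(\<exists>\<sigma>\<in>cones X. lat_vec m \<in> \<sigma> \<and> lat_vec n \<in> \<sigma>) \<longleftrightarrow> faceset (keys (m + n))"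
  unfolding keys_add_nat faceset_iff_cone
  by (intro bex_cong refl) (simp add: lat_vec_cone_iff assms)

lemma sr_hom_mult: "sr_mult X (sr_hom p) (sr_hom q) = sr_hom (p * q)"
proof (induction p rule: poly_mapping_induct)
  case (single m a)
  show ?case
  proof (induction q rule: poly_mapping_induct)
    case (single n b)
    show ?case
    proof (cases "faceset (keys m) \<and> faceset (keys n)")
      case True
      then show ?thesis using faceset_common_cone[of m n]
        by (simp add: sr_mult_bilin sr_hom_single sr_mon_def sr.bilin_single mult_single sr_coeff_def lat_vec_add)
    next
      case False
      then have "\<not> faceset (keys (m + n))" using faceset_mono unfolding keys_add_nat by blast
      then show ?thesis using False
        by (auto simp: sr_mult_bilin sr_hom_single sr_mon_def sr.bilin_01 sr.bilin_02 mult_single)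
    qed
  qed (simp_all add: sr_mult_bilin sr.bilin_02 sr.bilin_add2 distrib_left sr_hom_add)
qed (simp_all add: sr_mult_bilin sr.bilin_01 sr.bilin_add1 distrib_right sr_hom_add)

lemma sr_hom_coeff_ext: "coeff_ext (sr_hom p) = sr_hom (coeff_ext p)"
  by (induction p rule: poly_mapping_induct)
    (auto simp: sr_hom_add coeff_ext_add sr_hom_single sr_mon_def)

definition sr_ring :: "('v \<Rightarrow>\<^sub>0 'a::comm_ring_1) ring" where
  "sr_ring = (SR X)\<lparr>carrier := range sr_hom\<rparr>"

lemma sr_ring_sel [simp]:
  "carrier sr_ring = range sr_hom" "mult sr_ring = sr_mult X" "one sr_ring = single 0 1"
  "zero sr_ring = 0" "add sr_ring = (+)"
  by (simp_all add: sr_ring_def SR_def)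

lemma sr_ring_cring: "cring (sr_ring :: ('v \<Rightarrow>\<^sub>0 'a::comm_ring_1) ring)"
proof (rule cringI)
  show "abelian_group (sr_ring :: ('v \<Rightarrow>\<^sub>0 'a) ring)"
  proof (rule abelian_groupI)
    fix x :: "'v \<Rightarrow>\<^sub>0 'a" assume "x \<in> carrier sr_ring"
    then obtain p where "x = sr_hom p" by auto
    then show "\<exists>y\<in>carrier sr_ring. y \<oplus>\<^bsub>sr_ring\<^esub> x = \<zero>\<^bsub>sr_ring\<^esub>"
      by (intro bexI[of _ "sr_hom (- p)"]) (simp_all add: sr_hom_uminus[symmetric] sr_hom_add[symmetric])
  qed (auto simp: sr_hom_add[symmetric] ac_simps intro: image_eqI[of 0 _ 0])
  show "comm_monoid (sr_ring :: ('v \<Rightarrow>\<^sub>0 'a) ring)"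
  proof -
    have one: "sr_mult X 1 (sr_hom p) = sr_hom p" for p :: "_ \<Rightarrow>\<^sub>0 'a" using sr_hom_mult[of 1 p] by (simp add: sr_hom_1)
    show ?thesis by (rule comm_monoidI) (auto simp: sr_hom_mult one ac_simps sr_hom_1 intro: image_eqI[of 1 _ 1])
  qed
  show "(x \<oplus>\<^bsub>sr_ring\<^esub> y) \<otimes>\<^bsub>sr_ring\<^esub> z = x \<otimes>\<^bsub>sr_ring\<^esub> z \<oplus>\<^bsub>sr_ring\<^esub> y \<otimes>\<^bsub>sr_ring\<^esub> z"
    if "x \<in> carrier sr_ring" "y \<in> carrier sr_ring" "z \<in> carrier sr_ring" for x y z :: "'v \<Rightarrow>\<^sub>0 'a"
    using that by (auto simp: sr_hom_mult sr_hom_add[symmetric] distrib_right)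
qed

lemma sr_hom_ideal:
  fixes I :: "((nat \<Rightarrow>\<^sub>0 nat) \<Rightarrow>\<^sub>0 'a::comm_ring_1) set"
  assumes "rel_ideal UNIV I"
  shows "ideal (sr_hom ` I) sr_ring"
proof (rule idealI)
  show "ring (sr_ring :: ('v \<Rightarrow>\<^sub>0 'a) ring)" using sr_ring_cring by (rule cring.axioms)
  have um: "- a \<in> I" if "a \<in> I" for a
  proof -
    have "(-1) * a \<in> I" using assms that unfolding rel_ideal_def by blast
    then show ?thesis by simp
  qed
  show "subgroup (sr_hom ` I) (add_monoid sr_ring)"
  proof
    show "inv\<^bsub>add_monoid sr_ring\<^esub> x \<in> sr_hom ` I" if x: "x \<in> sr_hom ` I" for x
    proof -
      obtain p where p: "x = sr_hom p" "p \<in> I" using x by blast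
      have "\<ominus>\<^bsub>sr_ring\<^esub> x = sr_hom (- p)"
        by (rule abelian_group.minus_equality[OF ring.is_abelian_group[OF cring.axioms(1)[OF sr_ring_cring]]])
          (use p in \<open>simp_all add: sr_hom_uminus[symmetric] sr_hom_add[symmetric]\<close>)
      then show ?thesis using um[OF p(2)] by (simp add: a_inv_def)
    qed
  qed (use assms in \<open>auto simp: rel_ideal_def sr_hom_add[symmetric] intro: image_eqI[of 0 _ 0]\<close>)
  show "x \<otimes>\<^bsub>sr_ring\<^esub> a \<in> sr_hom ` I" "a \<otimes>\<^bsub>sr_ring\<^esub> x \<in> sr_hom ` I" if ax: "a \<in> sr_hom ` I" "x \<in> carrier sr_ring" for a x
  proof -
    obtain p where "a = sr_hom p" "p \<in> I" using ax(1) by blast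
    moreover obtain q where "x = sr_hom q" using ax(2) by auto
    ultimately have p: "a = sr_hom p" "p \<in> I" "x = sr_hom q" by auto
    then have "q * p \<in> I" using assms unfolding rel_ideal_def by blast
    then show "x \<otimes>\<^bsub>sr_ring\<^esub> a \<in> sr_hom ` I" "a \<otimes>\<^bsub>sr_ring\<^esub> x \<in> sr_hom ` I"
      using p by (auto simp: sr_hom_mult mult.commute)
  qed
qed

lemma SR_sel [simp]: "mult (SR X) = sr_mult X" "one (SR X) = single 0 1"
  "zero (SR X) = 0" "add (SR X) = (+)"
  by (simp_all add: SR_def)

lemma range_sr_hom_SR: "range sr_hom \<subseteq> carrier (SR X)"
proof
  fix x assume "x \<in> range sr_hom"
  then obtain p where "x = sr_hom p" by blast
  moreover have "sr_hom p \<in> carrier (SR X)"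
  proof (induction p rule: poly_mapping_induct)
    case (single m a)
    have "lat_vec m \<in> \<Union> (cones X)" if "faceset (keys m)"
      using that lat_vec_in_cone unfolding faceset_iff_cone by blast
    then show ?case by (auto simp: SR_def sr_hom_single sr_mon_def lat_vec_lat)
  next
    case (add p q)
    then show ?case using keys_add[of "sr_hom p" "sr_hom q"] by (auto simp: SR_def sr_hom_add)
  qed (simp add: SR_def)
  ultimately show "x \<in> carrier (SR X)" by simp
qed

lemma SR_a_inv: "x \<in> carrier (SR X) \<Longrightarrow> \<ominus>\<^bsub>SR X\<^esub> x = - x"
proof -
  have keys_um: "keys (- y) = keys y" for y :: "'v \<Rightarrow>\<^sub>0 'a"
    by (auto simp: in_keys_iff)
  have "abelian_group (SR X :: ('v \<Rightarrow>\<^sub>0 'a) ring)"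
  proof (rule abelian_groupI)
    fix x y :: "'v \<Rightarrow>\<^sub>0 'a" assume "x \<in> carrier (SR X)" "y \<in> carrier (SR X)"
    then show "x \<oplus>\<^bsub>SR X\<^esub> y \<in> carrier (SR X)" using keys_add[of x y] by (auto simp: SR_def)
  next
    fix x :: "'v \<Rightarrow>\<^sub>0 'a" assume "x \<in> carrier (SR X)"
    then show "\<exists>y\<in>carrier (SR X). y \<oplus>\<^bsub>SR X\<^esub> x = \<zero>\<^bsub>SR X\<^esub>"
      by (intro bexI[of _ "- x"]) (auto simp: SR_def keys_um)
  qed (auto simp: SR_def ac_simps)
  moreover assume "x \<in> carrier (SR X)"
  moreover from this have "- x \<in> carrier (SR X)" by (auto simp: SR_def keys_um)
  ultimately show ?thesis by (intro abelian_group.minus_equality) auto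
qed

lemma S_carrier: "generate_ring (SR X) (ray_elt X ` V) = range (sr_hom :: _ \<Rightarrow> 'v \<Rightarrow>\<^sub>0 int)"
proof
  show "generate_ring (SR X) (ray_elt X ` V) \<subseteq> range (sr_hom :: _ \<Rightarrow> 'v \<Rightarrow>\<^sub>0 int)"
  proof
    fix x :: "'v \<Rightarrow>\<^sub>0 int" assume "x \<in> generate_ring (SR X) (ray_elt X ` V)"
    then show "x \<in> range sr_hom"
    proof induction
      case one then show ?case by (auto simp: sr_hom_1 intro: image_eqI[of 1 _ 1])
    next
      case (incl h)
      then obtain i where "i \<in> V" "h = ray_elt X i" by blast
      then have "h = sr_hom (mvar i)" by (simp only: sr_hom_mvar if_True)
      then show ?case by blast
    next
      case (a_inv h)
      then have "\<ominus>\<^bsub>SR X\<^esub> h = - h" using SR_a_inv range_sr_hom_SR by blast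
      then show ?case using a_inv by (auto simp: sr_hom_uminus[symmetric])
    next
      case (eng_add h1 h2)
      then show ?case by (auto simp: sr_hom_add[symmetric])
    next
      case (eng_mult h1 h2)
      then show ?case by (auto simp: sr_hom_mult)
    qed
  qed
  show "range (sr_hom :: _ \<Rightarrow> 'v \<Rightarrow>\<^sub>0 int) \<subseteq> generate_ring (SR X) (ray_elt X ` V)"
  proof
    let ?G = "generate_ring (SR X :: ('v \<Rightarrow>\<^sub>0 int) ring) (ray_elt X ` V)"
    fix x :: "'v \<Rightarrow>\<^sub>0 int" assume "x \<in> range sr_hom"
    then obtain p where p: "x = sr_hom p" by blast
    have one: "sr_hom 1 \<in> ?G" using generate_ring.one[of "SR X"] by (simp add: sr_hom_1)
    have um: "sr_hom (- q) \<in> ?G" if "sr_hom q \<in> ?G" for q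
    proof -
      have "sr_hom q \<in> carrier (SR X)" using range_sr_hom_SR by blast
      then show ?thesis using generate_ring.a_inv[OF that] SR_a_inv[of "sr_hom q"] by (simp add: sr_hom_uminus)
    qed
    have add: "sr_hom (q + r) \<in> ?G" if "sr_hom q \<in> ?G" "sr_hom r \<in> ?G" for q r
      using generate_ring.eng_add[OF that] by (simp add: sr_hom_add)
    have mult: "sr_hom (q * r) \<in> ?G" if "sr_hom q \<in> ?G" "sr_hom r \<in> ?G" for q r
      using generate_ring.eng_mult[OF that] by (simp add: sr_hom_mult)
    have zero: "sr_hom 0 \<in> ?G" using add[OF one um[OF one]] by simp
    have "p \<in> {p. sr_hom p \<in> ?G}"
    proof (rule mpoly_in_subalgebra)
      show "single 0 c \<in> {p. sr_hom p \<in> ?G}" for c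
      proof -
        have nat: "sr_hom (of_nat n) \<in> ?G" for n by (induction n) (use zero one add in \<open>auto simp: add.commute\<close>)
        have "sr_hom (of_int c) \<in> ?G" using nat um[OF nat] by (cases c rule: int_cases2) auto
        then show ?thesis by (simp flip: single_of_int)
      qed
      show "mvar i \<in> {p. sr_hom p \<in> ?G}" for i
      proof (cases "i \<in> V")
        case True
        then have "ray_elt X i \<in> ?G" by (intro generate_ring.incl) blast
        then show ?thesis using True by (simp only: sr_hom_mvar if_True mem_Collect_eq)
      next
        case False
        then show ?thesis using zero by (simp only: sr_hom_mvar if_False mem_Collect_eq sr_hom_0)
      qed
    qed (use add mult in auto)
    then show "x \<in> ?G" using p by simp
  qed
qed

lemma S_ring_eq: "S_ring X = sr_ring"
  unfolding S_ring_def sr_ring_def S_carrier ..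

lemma SC_ring_eq: "SC_ring X = sr_ring"
proof -
  let ?H = "{scalar c \<otimes>\<^bsub>SR X\<^esub> coeff_ext s | c s. s \<in> carrier (S_ring X)}"
  have H: "?H \<subseteq> range sr_hom"
  proof
    fix x :: "'v \<Rightarrow>\<^sub>0 complex" assume "x \<in> ?H"
    then obtain c s where "x = sr_mult X (scalar c) (coeff_ext s)" "s \<in> range sr_hom"
      unfolding S_ring_eq sr_ring_sel SR_sel by blast
    then obtain p where "x = sr_mult X (scalar c) (coeff_ext (sr_hom p))" by blast
    then have "x = sr_hom (single 0 c * coeff_ext p)"
      by (simp only: scalar_sr_hom sr_hom_coeff_ext sr_hom_mult)
    then show "x \<in> range sr_hom" by blast
  qed
  have "generate (add_monoid (SR X)) ?H = range sr_hom"
  proof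
    show "generate (add_monoid (SR X)) ?H \<subseteq> range sr_hom"
    proof
      fix x :: "'v \<Rightarrow>\<^sub>0 complex" assume "x \<in> generate (add_monoid (SR X)) ?H"
      then show "x \<in> range sr_hom"
      proof induction
        case one show ?case using rangeI[of sr_hom 0] by simp
      next
        case (incl h)
        then show ?case by (rule subsetD[OF H])
      next
        case (inv h)
        then have h: "h \<in> range sr_hom" by (rule subsetD[OF H])
        then have "\<ominus>\<^bsub>SR X\<^esub> h = - h" using SR_a_inv range_sr_hom_SR by blast
        then show ?case using h unfolding a_inv_def by (auto simp: sr_hom_uminus[symmetric])
      next
        case (eng h1 h2)
        then show ?case by (auto simp: sr_hom_add[symmetric])
      qed
    qed
    show "range sr_hom \<subseteq> generate (add_monoid (SR X)) ?H"
    proof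
      fix x :: "'v \<Rightarrow>\<^sub>0 complex" assume "x \<in> range sr_hom"
      then obtain p :: "_ \<Rightarrow>\<^sub>0 complex" where p: "x = sr_hom p" by blast
      have "sr_hom p \<in> generate (add_monoid (SR X)) ?H"
      proof (induction p rule: poly_mapping_induct)
        case zero
        then show ?case using generate.one[of "add_monoid (SR X)" ?H] by simp
      next
        case (single m c)
        have "sr_hom (single m c) = sr_hom (single 0 c * coeff_ext (single m 1))"
          by (simp add: mult_single)
        also have "\<dots> = scalar c \<otimes>\<^bsub>SR X\<^esub> coeff_ext (sr_hom (single m 1))"
          by (simp only: sr_hom_mult scalar_sr_hom sr_hom_coeff_ext SR_sel)
        finally show ?case by (intro generate.incl) (auto simp: S_ring_eq)
      next
        case (add p q)
        then show ?case using generate.eng[OF add] by (simp add: sr_hom_add)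
      qed
      then show "x \<in> generate (add_monoid (SR X)) ?H" using p by simp
    qed
  qed
  then show ?thesis unfolding SC_ring_def sr_ring_def by simp
qed

end

lemma complex_poly_subalgebra:
  "complex_subalgebra (UNIV :: ('m::comm_monoid_add \<Rightarrow>\<^sub>0 complex) set) scalar"
  by unfold_locales (auto simp: scalar_def single_add mult_single)

section \<open>The relation ideals of the box and the deformed module\<close>

locale fan_basis = simplicial_fan d X for d and X :: "'v::real_vector stacky_fan" +
  fixes g :: "nat \<Rightarrow> 'v \<Rightarrow> real" and \<beta> :: "'v \<times> 'v"
  assumes dual_basis: "is_dual_basis d (lat X) g"
begin

abbreviation Qring where "Qring \<equiv> Q_ring d X g \<beta>"
abbreviation Qclass where "Qclass \<equiv> Q_class d X g \<beta>"
abbreviation Hmod where "Hmod \<equiv> HC d X g \<beta>"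
abbreviation Kring where "Kring \<equiv> KC X \<beta>"
abbreviation Kclass where "Kclass \<equiv> K_class X \<beta>"
abbreviation Klocalize where "Klocalize \<equiv> K_localize X \<beta>"
abbreviation Kmax where "Kmax \<equiv> K_max_ideal X \<beta>"
abbreviation BoxX where "BoxX \<equiv> Box X \<beta>"
abbreviation Mmod :: "('v \<Rightarrow>\<^sub>0 'a::comm_ring_1, ('v \<times> 'v) \<times> (nat \<Rightarrow> complex) \<Rightarrow>\<^sub>0 'a) module" where
  "Mmod \<equiv> SR_module X \<beta>"
abbreviation two_pi_i :: complex where "two_pi_i \<equiv> 2 * of_real pi * \<i>"

lemma g_dual: "j \<in> {1..d} \<Longrightarrow> g j \<in> dual_lattice N"
  using dual_basis by (auto simp: is_dual_basis_def)

lemma dual_expand: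
  assumes "f \<in> dual_lattice N"
  obtains c :: "nat \<Rightarrow> int" where "f = (\<lambda>x. \<Sum>j\<in>{1..d}. of_int (c j) * g j x)"
  using dual_basis assms unfolding is_dual_basis_def by blast

text \<open>
  For \<open>f\<close> in the dual lattice the \<open>f(v\<^sub>i)\<close> are integers, and this is the linear form in the \<open>x\<^sub>i\<close> with these
  coefficients.
\<close>

definition lin_form :: "('v \<Rightarrow> real) \<Rightarrow> ((nat \<Rightarrow>\<^sub>0 nat) \<Rightarrow>\<^sub>0 'a::comm_ring_1)" where
  "lin_form f = (\<Sum>i\<in>V. single (single i 1) (of_int \<lfloor>f (v i)\<rfloor>))"

definition linear_ideal :: "((nat \<Rightarrow>\<^sub>0 nat) \<Rightarrow>\<^sub>0 'a::comm_ring_1) set" where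
  "linear_ideal = {\<Sum>j\<in>{1..d}. r j * lin_form (g j) | r. True}"

definition supp :: "(nat \<Rightarrow> complex) \<Rightarrow> nat set" where "supp \<alpha> = {i. \<alpha> i \<noteq> 0}"

definition nonface_ideal :: "(nat \<Rightarrow> complex) \<Rightarrow> ((nat \<Rightarrow>\<^sub>0 nat) \<Rightarrow>\<^sub>0 'a::comm_ring_1) set" where
  "nonface_ideal \<alpha> = {w. \<forall>m\<in>keys w. \<not> faceset (keys m \<union> supp \<alpha>)}"

text \<open>
  The preimage of \<open>Z + S(\<alpha>)\<close> under \<open>sr_hom\<close>.  The Stanley-Reisner relations are contained in
  \<open>nonface_ideal \<alpha>\<close>, because supersets of non-faces are non-faces.
\<close>

definition box_ideal :: "(nat \<Rightarrow> complex) \<Rightarrow> ((nat \<Rightarrow>\<^sub>0 nat) \<Rightarrow>\<^sub>0 'a::comm_ring_1) set" where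
  "box_ideal \<alpha> = {z + w | z w. z \<in> linear_ideal \<and> w \<in> nonface_ideal \<alpha>}"

lemma linear_ideal_rel: "rel_ideal UNIV (linear_ideal :: (_ \<Rightarrow>\<^sub>0 'a::comm_ring_1) set)"
  unfolding rel_ideal_def
proof (intro conjI ballI)
  show "0 \<in> (linear_ideal :: (_ \<Rightarrow>\<^sub>0 'a) set)" unfolding linear_ideal_def by (intro CollectI exI[of _ "\<lambda>_. 0"]) simp
  fix a b :: "_ \<Rightarrow>\<^sub>0 'a" assume "a \<in> linear_ideal" "b \<in> linear_ideal"
  then obtain r s where "a = (\<Sum>j\<in>{1..d}. r j * lin_form (g j))" "b = (\<Sum>j\<in>{1..d}. s j * lin_form (g j))"
    unfolding linear_ideal_def by blast
  then show "a + b \<in> linear_ideal" unfolding linear_ideal_def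
    by (intro CollectI exI[of _ "\<lambda>j. r j + s j"]) (simp add: distrib_right sum.distrib)
next
  fix p a :: "_ \<Rightarrow>\<^sub>0 'a" assume "a \<in> linear_ideal"
  then obtain r where "a = (\<Sum>j\<in>{1..d}. r j * lin_form (g j))" unfolding linear_ideal_def by blast
  then show "p * a \<in> linear_ideal" unfolding linear_ideal_def
    by (intro CollectI exI[of _ "\<lambda>j. p * r j"]) (simp add: sum_distrib_left mult.assoc)
qed simp

lemma nonface_ideal_rel: "rel_ideal UNIV (nonface_ideal \<alpha> :: (_ \<Rightarrow>\<^sub>0 'a::comm_ring_1) set)"
  unfolding rel_ideal_def
proof (intro conjI ballI)
  fix a b :: "_ \<Rightarrow>\<^sub>0 'a" assume "a \<in> nonface_ideal \<alpha>" "b \<in> nonface_ideal \<alpha>"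
  then show "a + b \<in> nonface_ideal \<alpha>" unfolding nonface_ideal_def using keys_add[of a b] by blast
next
  fix p a :: "_ \<Rightarrow>\<^sub>0 'a" assume a: "a \<in> nonface_ideal \<alpha>"
  show "p * a \<in> nonface_ideal \<alpha>" unfolding nonface_ideal_def
  proof (intro CollectI ballI notI)
    fix m assume "m \<in> keys (p * a)" and f: "faceset (keys m \<union> supp \<alpha>)"
    then obtain k l where "m = k + l" "l \<in> keys a" using keys_mult[of p a] by blast
    moreover from this have "faceset (keys l \<union> supp \<alpha>)"
      using f faceset_mono[OF f, of "keys l \<union> supp \<alpha>"] by (auto simp: keys_add_nat)
    ultimately show False using a unfolding nonface_ideal_def by blast
  qed
qed (auto simp: nonface_ideal_def)

lemma sum_ideals: 
  assumes "rel_ideal UNIV I" "rel_ideal UNIV J"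
  shows "rel_ideal UNIV {z + w | z w. z \<in> I \<and> w \<in> J}"
  unfolding rel_ideal_def
proof (intro conjI ballI)
  show "0 \<in> {z + w | z w. z \<in> I \<and> w \<in> J}" 
    using assms unfolding rel_ideal_def by (intro CollectI exI[of _ 0]) auto
  fix a b assume "a \<in> {z + w | z w. z \<in> I \<and> w \<in> J}" "b \<in> {z + w | z w. z \<in> I \<and> w \<in> J}"
  then obtain z w z' w' where *: "a = z + w" "b = z' + w'" "z \<in> I" "z' \<in> I" "w \<in> J" "w' \<in> J" by blast
  then show "a + b \<in> {z + w | z w. z \<in> I \<and> w \<in> J}"
    using assms unfolding rel_ideal_def
    by (intro CollectI exI[of _ "z + z'"] exI[of _ "w + w'"]) (auto simp: ac_simps)
next
  fix p a assume "a \<in> {z + w | z w. z \<in> I \<and> w \<in> J}"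
  then obtain z w where *: "a = z + w" "z \<in> I" "w \<in> J" by blast
  then show "p * a \<in> {z + w | z w. z \<in> I \<and> w \<in> J}"
    using assms unfolding rel_ideal_def
    by (intro CollectI exI[of _ "p * z"] exI[of _ "p * w"]) (auto simp: distrib_left)
qed simp

lemma box_ideal_rel: "rel_ideal UNIV (box_ideal \<alpha> :: (_ \<Rightarrow>\<^sub>0 'a::comm_ring_1) set)"
  unfolding box_ideal_def by (rule sum_ideals[OF linear_ideal_rel nonface_ideal_rel])

lemma ideal_parts:
  "(linear_ideal :: (_ \<Rightarrow>\<^sub>0 'a::comm_ring_1) set) \<subseteq> box_ideal \<alpha>" "(nonface_ideal \<alpha> :: (_ \<Rightarrow>\<^sub>0 'a::comm_ring_1) set) \<subseteq> box_ideal \<alpha>"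
proof -
  have 0: "(0 :: _ \<Rightarrow>\<^sub>0 'a) \<in> linear_ideal" "(0 :: _ \<Rightarrow>\<^sub>0 'a) \<in> nonface_ideal \<alpha>"
    using linear_ideal_rel nonface_ideal_rel unfolding rel_ideal_def by blast+
  show "linear_ideal \<subseteq> (box_ideal \<alpha> :: (_ \<Rightarrow>\<^sub>0 'a) set)"
  proof
    fix z :: "_ \<Rightarrow>\<^sub>0 'a" assume "z \<in> linear_ideal"
    then show "z \<in> box_ideal \<alpha>" unfolding box_ideal_def using 0 by (intro CollectI exI[of _ z] exI[of _ 0]) simp
  qed
  show "nonface_ideal \<alpha> \<subseteq> (box_ideal \<alpha> :: (_ \<Rightarrow>\<^sub>0 'a) set)"
  proof
    fix z :: "_ \<Rightarrow>\<^sub>0 'a" assume "z \<in> nonface_ideal \<alpha>"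
    then show "z \<in> box_ideal \<alpha>" unfolding box_ideal_def using 0 by (intro CollectI exI[of _ 0] exI[of _ z]) simp
  qed
qed

lemma lin_form_g_linear_ideal: "j \<in> {1..d} \<Longrightarrow> lin_form (g j) \<in> linear_ideal"
  unfolding linear_ideal_def
  by (intro CollectI exI[of _ "\<lambda>i. if i = j then 1 else 0"])
    (simp add: if_distrib[of "\<lambda>r. r * _"] cong: if_cong)

lemma lin_form_linear_ideal:
  assumes "f \<in> dual_lattice N"
  shows "(lin_form f :: _ \<Rightarrow>\<^sub>0 'a::comm_ring_1) \<in> linear_ideal"
proof -
  obtain c :: "nat \<Rightarrow> int" where "f = (\<lambda>x. \<Sum>j\<in>{1..d}. of_int (c j) * g j x)" by (rule dual_expand[OF assms])
  then have c: "f x = (\<Sum>j\<in>{1..d}. of_int (c j) * g j x)" for x by simp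
  have fl: "\<lfloor>f (v i)\<rfloor> = (\<Sum>j\<in>{1..d}. c j * \<lfloor>g j (v i)\<rfloor>)" if "i \<in> V" for i
  proof -
    have "(of_int \<lfloor>f (v i)\<rfloor> :: real) = of_int (\<Sum>j\<in>{1..d}. c j * \<lfloor>g j (v i)\<rfloor>)"
      unfolding dual_floor[OF assms gen_lat[OF that]] unfolding c of_int_sum of_int_mult
      by (rule sum.cong) (auto simp: dual_floor[OF g_dual gen_lat[OF that]])
    then show ?thesis by (simp only: of_int_eq_iff)
  qed
  have "(lin_form f :: _ \<Rightarrow>\<^sub>0 'a) = (\<Sum>i\<in>V. \<Sum>j\<in>{1..d}. single (single i 1) (of_int (c j) * of_int \<lfloor>g j (v i)\<rfloor>))"
    unfolding lin_form_def
  proof (rule sum.cong[OF refl])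
    fix i assume "i \<in> V"
    have "single m (sum h A) = (\<Sum>j\<in>A. single m (h j))" for m h and A :: "nat set"
      by (induction A rule: infinite_finite_induct) (auto simp: single_add)
    then show "single (single i 1) (of_int \<lfloor>f (v i)\<rfloor> :: 'a) =
      (\<Sum>j\<in>{1..d}. single (single i 1) (of_int (c j) * of_int \<lfloor>g j (v i)\<rfloor>))"
      using fl[OF \<open>i \<in> V\<close>] by simp
  qed
  also have "\<dots> = (\<Sum>j\<in>{1..d}. single 0 (of_int (c j)) * lin_form (g j))"
    unfolding lin_form_def sum_distrib_left by (subst sum.swap) (simp only: mult_single add_0)
  finally show ?thesis unfolding linear_ideal_def
    by (intro CollectI exI[of _ "\<lambda>j. single 0 (of_int (c j))"]) simp
qed

lemma coeff_ext_lin_form: "coeff_ext (lin_form f) = lin_form f"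
  by (simp add: lin_form_def coeff_ext_sum)

lemma sr_hom_lin_form: "sr_hom (lin_form f) = (\<Sum>i\<in>V. single (v i) (of_int \<lfloor>f (v i)\<rfloor>))"
  unfolding lin_form_def sr_hom_sum
proof (rule sum.cong[OF refl])
  fix i assume i: "i \<in> V"
  show "sr_hom (single (single i 1) (of_int \<lfloor>f (v i)\<rfloor>)) = single (v i) (of_int \<lfloor>f (v i)\<rfloor>)"
    using faceset_single[OF i] lat_vec_single[OF i] by (simp add: sr_hom_single sr_mon_def)
qed

lemma Z_elt_sr_hom: "Z_elt X g j = sr_hom (lin_form (g j))"
  by (simp add: sr_hom_lin_form Z_elt_def)

lemma genideal_contains_linear_ideal:
  fixes I :: "((nat \<Rightarrow>\<^sub>0 nat) \<Rightarrow>\<^sub>0 'a::comm_ring_1) set"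
  assumes "ideal I' sr_ring" "\<And>j. j \<in> {1..d} \<Longrightarrow> sr_hom (lin_form (g j) :: _ \<Rightarrow>\<^sub>0 'a) \<in> I'"
  shows "sr_hom ` (linear_ideal :: (_ \<Rightarrow>\<^sub>0 'a) set) \<subseteq> I'"
proof
  interpret I': ideal I' "sr_ring :: ('v \<Rightarrow>\<^sub>0 'a) ring" by (rule assms(1))
  fix x assume "x \<in> sr_hom ` (linear_ideal :: (_ \<Rightarrow>\<^sub>0 'a) set)"
  then obtain r where x: "x = sr_hom (\<Sum>j\<in>{1..d}. r j * lin_form (g j))" unfolding linear_ideal_def by blast
  have "(\<Sum>j\<in>A. sr_mult X (sr_hom (r j)) (sr_hom (lin_form (g j)))) \<in> I'" if "A \<subseteq> {1..d}" for A
    using finite_subset[OF that] that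
  proof (induction A rule: infinite_finite_induct)
    case empty
    show ?case using additive_subgroup.zero_closed[OF I'.additive_subgroup_axioms] by simp
  next
    case (insert j A)
    then have "sr_mult X (sr_hom (r j)) (sr_hom (lin_form (g j))) \<in> I'"
      using I'.I_l_closed[OF assms(2)[of j], of "sr_hom (r j)"] by simp
    then show ?case using insert additive_subgroup.a_closed[OF I'.additive_subgroup_axioms] by simp
  qed simp
  then show "x \<in> I'" unfolding x by (simp add: sr_hom_sum sr_hom_mult)
qed

lemma Z_ideal_sr_hom: "Z_ideal d X g = sr_hom ` linear_ideal"
proof -
  interpret R: cring "sr_ring :: ('v \<Rightarrow>\<^sub>0 int) ring" by (rule sr_ring_cring)
  show ?thesis unfolding Z_ideal_def S_ring_eq
  proof
    have sub: "Z_elt X g ` {1..d} \<subseteq> carrier sr_ring" by (auto simp: Z_elt_sr_hom)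
    show "genideal sr_ring (Z_elt X g ` {1..d}) \<subseteq> sr_hom ` linear_ideal"
      by (rule R.genideal_minimal[OF sr_hom_ideal[OF linear_ideal_rel]]) (auto simp: Z_elt_sr_hom intro!: imageI lin_form_g_linear_ideal)
    show "sr_hom ` linear_ideal \<subseteq> genideal sr_ring (Z_elt X g ` {1..d})"
      by (rule genideal_contains_linear_ideal[OF R.genideal_ideal[OF sub]])
        (use R.genideal_self[OF sub] in \<open>auto simp: Z_elt_sr_hom\<close>)
  qed
qed

lemma coeff_ext_linear_ideal: "p \<in> linear_ideal \<Longrightarrow> coeff_ext p \<in> linear_ideal"
proof -
  assume "p \<in> linear_ideal"
  then obtain r where "p = (\<Sum>j\<in>{1..d}. r j * lin_form (g j))" unfolding linear_ideal_def by blast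
  then show ?thesis unfolding linear_ideal_def
    by (intro CollectI exI[of _ "\<lambda>j. coeff_ext (r j)"])
      (simp add: coeff_ext_sum coeff_ext_mult coeff_ext_lin_form)
qed

lemma ideal_ext_Z: "ideal_ext X (Z_ideal d X g) = sr_hom ` linear_ideal"
proof -
  interpret R: cring "sr_ring :: ('v \<Rightarrow>\<^sub>0 complex) ring" by (rule sr_ring_cring)
  show ?thesis unfolding ideal_ext_def SC_ring_eq Z_ideal_sr_hom
  proof
    have sub: "coeff_ext ` sr_hom ` linear_ideal \<subseteq> carrier (sr_ring :: ('v \<Rightarrow>\<^sub>0 complex) ring)" by (auto simp: sr_hom_coeff_ext)
    show "genideal sr_ring (coeff_ext ` sr_hom ` linear_ideal) \<subseteq> (sr_hom ` linear_ideal :: ('v \<Rightarrow>\<^sub>0 complex) set)"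
      by (rule R.genideal_minimal[OF sr_hom_ideal[OF linear_ideal_rel]]) (auto simp: sr_hom_coeff_ext intro!: imageI coeff_ext_linear_ideal)
    show "(sr_hom ` linear_ideal :: ('v \<Rightarrow>\<^sub>0 complex) set) \<subseteq> genideal sr_ring (coeff_ext ` sr_hom ` linear_ideal)"
    proof (rule genideal_contains_linear_ideal[OF R.genideal_ideal[OF sub]])
      fix j assume "j \<in> {1..d}"
      then have "(coeff_ext (sr_hom (lin_form (g j))) :: 'v \<Rightarrow>\<^sub>0 complex) \<in> coeff_ext ` sr_hom ` linear_ideal" using lin_form_g_linear_ideal by blast
      then show "(sr_hom (lin_form (g j)) :: 'v \<Rightarrow>\<^sub>0 complex) \<in> genideal sr_ring (coeff_ext ` sr_hom ` linear_ideal)"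
        using R.genideal_self[OF sub] by (auto simp: sr_hom_coeff_ext coeff_ext_lin_form)
    qed
  qed
qed

text \<open>The map \<open>p \<mapsto> p \<cdot> [\<Sum> \<alpha>\<^sub>i v\<^sub>i, \<alpha>]\<close>.\<close>

definition module_mon :: "(nat \<Rightarrow> complex) \<Rightarrow> 'a::comm_ring_1 \<Rightarrow> (nat \<Rightarrow>\<^sub>0 nat) \<Rightarrow>
    (('v \<times> 'v) \<times> (nat \<Rightarrow> complex) \<Rightarrow>\<^sub>0 'a)" where
  "module_mon \<alpha> c m = (if faceset (keys m \<union> supp \<alpha>)
     then single (lin_comb X \<alpha> + of_lat (lat_vec m), \<alpha>) c else 0)"

definition module_map :: "(nat \<Rightarrow> complex) \<Rightarrow> ((nat \<Rightarrow>\<^sub>0 nat) \<Rightarrow>\<^sub>0 'a::comm_ring_1) \<Rightarrow>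
    (('v \<times> 'v) \<times> (nat \<Rightarrow> complex) \<Rightarrow>\<^sub>0 'a)" where
  "module_map \<alpha> = lin_ext (module_mon \<alpha>)"

sublocale module_ext: additive_coeff "module_mon \<alpha> :: 'a::comm_ring_1 \<Rightarrow> _"
  by unfold_locales (simp add: module_mon_def single_add)

lemma module_map_add: "module_map \<alpha> (p + q) = module_map \<alpha> p + module_map \<alpha> q"
  and module_map_uminus: "module_map \<alpha> (- p) = - module_map \<alpha> p" and module_map_0 [simp]: "module_map \<alpha> 0 = 0"
  and module_map_single: "module_map \<alpha> (single m c) = module_mon \<alpha> c m"
  and module_map_sum: "module_map \<alpha> (sum f A) = (\<Sum>i\<in>A. module_map \<alpha> (f i))"
  by (simp_all add: module_map_def module_ext.lin_ext_sum)

lemma of_lat_inj: "of_lat x = of_lat y \<longleftrightarrow> x = y"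
  by (simp add: of_lat_def)

lemma of_lat_add: "of_lat (x + y) = of_lat x + of_lat y"
  by (simp add: of_lat_def)

lemma module_map_lookup:
  assumes "faceset (keys m \<union> supp \<alpha>)"
  shows "lookup (module_map \<alpha>' p) (lin_comb X \<alpha> + of_lat (lat_vec m), \<alpha>)
    = (if \<alpha>' = \<alpha> then lookup p m else 0)"
proof (induction p rule: poly_mapping_induct)
  case (single n c)
  have "n = m" if "lat_vec n = lat_vec m" "faceset (keys n \<union> supp \<alpha>)"
    by (rule lat_vec_inj[OF _ _ that(1)]) (use faceset_mono assms that in blast)+
  then show ?case using assms
    by (auto simp: module_map_single module_mon_def lookup_single when_def of_lat_inj)
qed (simp_all add: module_map_add lookup_add)

lemma module_map_eq_0_iff: "module_map \<alpha> p = 0 \<longleftrightarrow> p \<in> nonface_ideal \<alpha>"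
proof
  assume "module_map \<alpha> p = 0"
  then show "p \<in> nonface_ideal \<alpha>" unfolding nonface_ideal_def using module_map_lookup[of _ \<alpha> \<alpha> p] by (auto simp: in_keys_iff)
next
  assume "p \<in> nonface_ideal \<alpha>"
  then show "module_map \<alpha> p = 0" unfolding module_map_def lin_ext_def module_mon_def nonface_ideal_def by (intro sum.neutral) auto
qed

lemma Bx_supp: "\<alpha> \<in> Bx X \<beta> \<sigma> \<longleftrightarrow> (\<exists>n\<in>N. lin_comb X \<alpha> = of_lat n + \<beta>) \<and> (\<forall>i. 0 \<le> Re (\<alpha> i) \<and> Re (\<alpha> i) < 1) \<and> supp \<alpha> \<subseteq> rays \<sigma>"
  unfolding Bx_def supp_def by auto

lemma Box_iff: "\<alpha> \<in> BoxX \<longleftrightarrow> (\<exists>n\<in>N. lin_comb X \<alpha> = of_lat n + \<beta>) \<and> (\<forall>i. 0 \<le> Re (\<alpha> i) \<and> Re (\<alpha> i) < 1) \<and> faceset (supp \<alpha>)"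
  unfolding Box_def faceset_def by (auto simp: Bx_supp)

lemma nat_sum_rays:
  "\<exists>k. keys k \<subseteq> rays \<sigma> \<and> (\<Sum>i\<in>rays \<sigma>. of_nat (m i) *\<^sub>R v i) = lat_vec k"
proof -
  let ?f = "\<lambda>i. if i \<in> rays \<sigma> then m i else 0"
  have fin: "finite {i. ?f i \<noteq> 0}" by (rule finite_subset[of _ "rays \<sigma>"]) auto
  let ?k = "Abs_poly_mapping ?f"
  have l: "lookup ?k = ?f" using fin by simp
  have "(\<Sum>i\<in>rays \<sigma>. of_nat (m i) *\<^sub>R v i) = lat_vec ?k"
    unfolding lat_vec_def l by (rule sum.mono_neutral_cong_left) (use rays_sub in auto)
  moreover have "keys ?k \<subseteq> rays \<sigma>" by (auto simp: in_keys_iff l split: if_splits)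
  ultimately show ?thesis by blast
qed

lemma symbol_at_iff:
  "symbol_at X \<beta> \<sigma> x \<alpha> \<longleftrightarrow> \<alpha> \<in> Bx X \<beta> \<sigma> \<and>
    (\<exists>k. keys k \<subseteq> rays \<sigma> \<and> x = lin_comb X \<alpha> + of_lat (lat_vec k))"
proof -
  have "\<exists>m. lat_vec k = (\<Sum>i\<in>rays \<sigma>. of_nat (m i) *\<^sub>R v i)" if "keys k \<subseteq> rays \<sigma>" for k
    using sum_support[OF rays_sub, of "\<lambda>i. real (lookup k i)" \<sigma>] that
    by (intro exI[of _ "lookup k"]) (simp add: lat_vec_def keys_pos)
  then show ?thesis unfolding symbol_at_def using nat_sum_rays by metis
qed

lemma symbol_at_mon:
  assumes "\<alpha> \<in> BoxX" "faceset (keys m)" "\<sigma> \<in> cones X"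
  shows "symbol_at X \<beta> \<sigma> (lin_comb X \<alpha> + of_lat (lat_vec m)) \<alpha> \<longleftrightarrow> keys m \<union> supp \<alpha> \<subseteq> rays \<sigma>"
proof
  assume "symbol_at X \<beta> \<sigma> (lin_comb X \<alpha> + of_lat (lat_vec m)) \<alpha>"
  then obtain k where k: "\<alpha> \<in> Bx X \<beta> \<sigma>" "keys k \<subseteq> rays \<sigma>" "lat_vec m = lat_vec k"
    unfolding symbol_at_iff by (auto simp: of_lat_inj)
  then have "m = k" using assms by (intro lat_vec_inj) (auto simp: faceset_iff_cone)
  then show "keys m \<union> supp \<alpha> \<subseteq> rays \<sigma>" using k by (simp add: Bx_supp)
next
  assume "keys m \<union> supp \<alpha> \<subseteq> rays \<sigma>"
  then show "symbol_at X \<beta> \<sigma> (lin_comb X \<alpha> + of_lat (lat_vec m)) \<alpha>"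
    using assms(1) unfolding symbol_at_iff Bx_supp Box_iff by auto
qed

lemma lin_comb_lat: "lin_comb X \<alpha> + of_lat (lat_vec k) =
    (\<Sum>i\<in>V. (Re (\<alpha> i) + real (lookup k i)) *\<^sub>R v i, \<Sum>i\<in>V. Im (\<alpha> i) *\<^sub>R v i)"
  by (simp add: lin_comb_def of_lat_def lat_vec_def scaleR_add_left sum.distrib)

text \<open>
  The coordinates of \<open>x\<close> with respect to the generators of \<open>\<sigma>\<close> are unique, and \<open>0 \<le> Re \<alpha>\<^sub>i < 1\<close> recovers
  \<open>\<alpha>\<^sub>i\<close> from \<open>\<alpha>\<^sub>i\<close> plus a natural number.
\<close>

lemma symbol_unique:
  assumes \<sigma>: "\<sigma> \<in> cones X" and "symbol_at X \<beta> \<sigma> x \<alpha>" "symbol_at X \<beta> \<sigma> x \<alpha>'"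
  shows "\<alpha> = \<alpha>'"
proof -
  obtain k k' where k: "\<alpha> \<in> Bx X \<beta> \<sigma>" "keys k \<subseteq> rays \<sigma>" "x = lin_comb X \<alpha> + of_lat (lat_vec k)"
    and k': "\<alpha>' \<in> Bx X \<beta> \<sigma>" "keys k' \<subseteq> rays \<sigma>" "x = lin_comb X \<alpha>' + of_lat (lat_vec k')"
    using assms(2,3) unfolding symbol_at_iff by auto
  have z: "\<alpha> i = 0" "\<alpha>' i = 0" "lookup k i = 0" "lookup k' i = 0" if "i \<notin> rays \<sigma>" for i
    using that k k' by (auto simp: Bx_supp supp_def in_keys_iff)
  have eq: "(\<Sum>i\<in>V. (Re (\<alpha> i) + real (lookup k i)) *\<^sub>R v i) = (\<Sum>i\<in>V. (Re (\<alpha>' i) + real (lookup k' i)) *\<^sub>R v i)"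
      "(\<Sum>i\<in>V. Im (\<alpha> i) *\<^sub>R v i) = (\<Sum>i\<in>V. Im (\<alpha>' i) *\<^sub>R v i)"
    using k(3) k'(3) unfolding lin_comb_lat by simp_all
  have re: "(\<lambda>i. Re (\<alpha> i) + real (lookup k i)) = (\<lambda>i. Re (\<alpha>' i) + real (lookup k' i))"
    by (rule coeff_unique[OF \<sigma> _ _ eq(1)]) (use z in fastforce)+
  have im: "(\<lambda>i. Im (\<alpha> i)) = (\<lambda>i. Im (\<alpha>' i))"
    by (rule coeff_unique[OF \<sigma> _ _ eq(2)]) (use z in fastforce)+
  show ?thesis
  proof
    fix i
    have "Re (\<alpha> i) + real (lookup k i) = Re (\<alpha>' i) + real (lookup k' i)" using fun_cong[OF re] .
    moreover have "0 \<le> Re (\<alpha> i)" "Re (\<alpha> i) < 1" "0 \<le> Re (\<alpha>' i)" "Re (\<alpha>' i) < 1" using k k' by (auto simp: Bx_supp)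
    moreover from calculation have "real (lookup k i) < real (lookup k' i + 1)"
        "real (lookup k' i) < real (lookup k i + 1)" by simp_all
    then have "lookup k i = lookup k' i" unfolding of_nat_less_iff by simp
    ultimately have "Re (\<alpha> i) = Re (\<alpha>' i)" by simp
    then show "\<alpha> i = \<alpha>' i" using fun_cong[OF im, of i] by (simp add: complex_eq_iff)
  qed
qed

definition act_coeff :: "'a::comm_ring_1 \<Rightarrow> 'v \<Rightarrow> 'a \<Rightarrow> ('v \<times> 'v) \<times> (nat \<Rightarrow> complex) \<Rightarrow>
    (('v \<times> 'v) \<times> (nat \<Rightarrow> complex) \<Rightarrow>\<^sub>0 'a)" where
  "act_coeff a n' b y = (case y of (x, \<alpha>) \<Rightarrow> if \<exists>\<sigma>\<in>maximal_cones X. n' \<in> \<sigma> \<and> symbol_at X \<beta> \<sigma> x \<alpha>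
        then single
               (of_lat n' + x,
                THE \<alpha>'. \<exists>\<sigma>\<in>maximal_cones X.
                  n' \<in> \<sigma> \<and> symbol_at X \<beta> \<sigma> x \<alpha> \<and> symbol_at X \<beta> \<sigma> (of_lat n' + x) \<alpha>')
               (a * b)
        else 0)"

sublocale act: biadditive_coeff "act_coeff :: 'a::comm_ring_1 \<Rightarrow> _"
  by unfold_locales (auto simp: act_coeff_def single_add distrib_left distrib_right split: prod.splits)

lemma sr_act_bilin: "sr_act X \<beta> = act.bilin_ext"
proof (intro ext)
  fix p and q :: "('v \<times> 'v) \<times> (nat \<Rightarrow> complex) \<Rightarrow>\<^sub>0 'a"
  show "sr_act X \<beta> p q = act.bilin_ext p q"
    unfolding sr_act_def act.bilin_ext_def lin_ext_def act_coeff_def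
    by (intro sum.cong refl) (auto simp: case_prod_beta)
qed

text \<open>
  Adding generators of a common cone changes only the integral coordinates, so the description operator in the action
  returns \<open>\<alpha>\<close>.
\<close>

lemma act_mon:
  assumes \<alpha>: "\<alpha> \<in> BoxX" and m: "faceset (keys m)" and n: "faceset (keys n \<union> supp \<alpha>)"
  shows "act_coeff a (lat_vec m) b (lin_comb X \<alpha> + of_lat (lat_vec n), \<alpha>) = module_mon \<alpha> (a * b) (m + n)"
proof -
  have n': "faceset (keys n)" using n faceset_mono by blast
  have cond: "lat_vec m \<in> \<sigma> \<and> symbol_at X \<beta> \<sigma> (lin_comb X \<alpha> + of_lat (lat_vec n)) \<alpha> \<longleftrightarrow>
    keys (m + n) \<union> supp \<alpha> \<subseteq> rays \<sigma>" if "\<sigma> \<in> maximal_cones X" for \<sigma>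
    using maximal_cone[OF that] by (auto simp: lat_vec_cone_iff[OF m] symbol_at_mon[OF \<alpha> n'] keys_add_nat)
  have sum: "of_lat (lat_vec m) + (lin_comb X \<alpha> + of_lat (lat_vec n)) = lin_comb X \<alpha> + of_lat (lat_vec (m + n))"
    by (simp add: lat_vec_add of_lat_add ac_simps)
  show ?thesis
  proof (cases "faceset (keys (m + n) \<union> supp \<alpha>)")
    case False
    then show ?thesis using cond by (auto simp: act_coeff_def module_mon_def faceset_def)
  next
    case True
    then obtain \<sigma> where \<sigma>: "\<sigma> \<in> maximal_cones X" "keys (m + n) \<union> supp \<alpha> \<subseteq> rays \<sigma>"
      unfolding faceset_def by blast
    have mn: "faceset (keys (m + n))" using True faceset_mono by blast
    have at: "symbol_at X \<beta> \<sigma> (lin_comb X \<alpha> + of_lat (lat_vec (m + n))) \<alpha>"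
      if "\<sigma> \<in> maximal_cones X" "keys (m + n) \<union> supp \<alpha> \<subseteq> rays \<sigma>" for \<sigma>
      using symbol_at_mon[OF \<alpha> mn maximal_cone[OF that(1)]] that(2) by blast
    have "(THE \<alpha>'. \<exists>\<sigma>\<in>maximal_cones X. lat_vec m \<in> \<sigma> \<and> symbol_at X \<beta> \<sigma> (lin_comb X \<alpha> + of_lat (lat_vec n)) \<alpha>
       \<and> symbol_at X \<beta> \<sigma> (of_lat (lat_vec m) + (lin_comb X \<alpha> + of_lat (lat_vec n))) \<alpha>') = \<alpha>"
      unfolding sum
    proof (rule the_equality)
      show "\<exists>\<sigma>\<in>maximal_cones X. lat_vec m \<in> \<sigma> \<and> symbol_at X \<beta> \<sigma> (lin_comb X \<alpha> + of_lat (lat_vec n)) \<alpha>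
       \<and> symbol_at X \<beta> \<sigma> (lin_comb X \<alpha> + of_lat (lat_vec (m + n))) \<alpha>"
        using \<sigma> cond at by blast
      fix \<alpha>' assume "\<exists>\<sigma>\<in>maximal_cones X. lat_vec m \<in> \<sigma> \<and> symbol_at X \<beta> \<sigma> (lin_comb X \<alpha> + of_lat (lat_vec n)) \<alpha>
       \<and> symbol_at X \<beta> \<sigma> (lin_comb X \<alpha> + of_lat (lat_vec (m + n))) \<alpha>'"
      then show "\<alpha>' = \<alpha>" using cond at symbol_unique maximal_cone by blast
    qed
    then show ?thesis using True \<sigma> cond by (auto simp: act_coeff_def module_mon_def sum)
  qed
qed

lemma act_module_map:
  assumes \<alpha>: "\<alpha> \<in> BoxX"
  shows "sr_act X \<beta> (sr_hom p) (module_map \<alpha> q) = module_map \<alpha> (p * q)"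
proof (induction p rule: poly_mapping_induct)
  case (single m a)
  show ?case
  proof (induction q rule: poly_mapping_induct)
    case (single n b)
    show ?case
    proof (cases "faceset (keys m) \<and> faceset (keys n \<union> supp \<alpha>)")
      case True
      then show ?thesis using act_mon[OF \<alpha>, of m n a b]
        by (simp add: sr_act_bilin sr_hom_single sr_mon_def module_map_single module_mon_def[of \<alpha> b n] act.bilin_single mult_single)
    next
      case False
      then have "\<not> faceset (keys (m + n) \<union> supp \<alpha>)"
        using faceset_mono unfolding keys_add_nat by blast
      then show ?thesis using False
        by (auto simp: sr_act_bilin sr_hom_single sr_mon_def module_map_single module_mon_def act.bilin_01 act.bilin_02 mult_single)
    qed
  qed (simp_all add: sr_act_bilin act.bilin_02 act.bilin_add2 distrib_left module_map_add)
qed (simp_all add: sr_act_bilin act.bilin_01 act.bilin_add1 distrib_right module_map_add sr_hom_add)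

lemma box_symbol_module_map: "\<alpha> \<in> BoxX \<Longrightarrow> (box_symbol X \<alpha> :: _ \<Rightarrow>\<^sub>0 'a::comm_ring_1) = module_map \<alpha> 1"
proof -
  assume "\<alpha> \<in> BoxX"
  then have "module_map \<alpha> (single 0 (1::'a)) = single (lin_comb X \<alpha>, \<alpha>) 1"
    unfolding module_map_single module_mon_def Box_iff by (simp add: of_lat_def flip: zero_prod_def)
  then show ?thesis by (simp add: box_symbol_def)
qed

lemma SR_module_sel [simp]: "module.smult (Mmod) = sr_act X \<beta>" "zero (Mmod) = 0" "add (Mmod) = (+)"
  by (simp_all add: SR_module_def)

lemma S_ann_sr_hom: "\<alpha> \<in> BoxX \<Longrightarrow> S_ann X \<beta> \<alpha> = sr_hom ` nonface_ideal \<alpha>"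
  unfolding S_ann_def a_kernel_def kernel_def S_ring_eq
  by (auto simp: box_symbol_module_map act_module_map module_map_eq_0_iff)

lemma ideal_ext_S_ann:
  assumes "\<alpha> \<in> BoxX"
  shows "ideal_ext X (S_ann X \<beta> \<alpha>) = sr_hom ` nonface_ideal \<alpha>"
proof -
  interpret R: cring "sr_ring :: ('v \<Rightarrow>\<^sub>0 complex) ring" by (rule sr_ring_cring)
  show ?thesis unfolding ideal_ext_def SC_ring_eq S_ann_sr_hom[OF assms]
  proof
    have sub: "coeff_ext ` sr_hom ` nonface_ideal \<alpha> \<subseteq> carrier (sr_ring :: ('v \<Rightarrow>\<^sub>0 complex) ring)" by (auto simp: sr_hom_coeff_ext)
    have "(coeff_ext p :: _ \<Rightarrow>\<^sub>0 complex) \<in> nonface_ideal \<alpha>" if "p \<in> nonface_ideal \<alpha>" for p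
      using that unfolding nonface_ideal_def by (auto simp: in_keys_iff lookup_coeff_ext)
    then show "genideal sr_ring (coeff_ext ` sr_hom ` nonface_ideal \<alpha>) \<subseteq> (sr_hom ` nonface_ideal \<alpha> :: ('v \<Rightarrow>\<^sub>0 complex) set)"
      by (intro R.genideal_minimal[OF sr_hom_ideal[OF nonface_ideal_rel]]) (auto simp: sr_hom_coeff_ext)
    interpret I: ideal "genideal sr_ring (coeff_ext ` sr_hom ` nonface_ideal \<alpha>)" "sr_ring :: ('v \<Rightarrow>\<^sub>0 complex) ring"
      by (rule R.genideal_ideal[OF sub])
    show "(sr_hom ` nonface_ideal \<alpha> :: ('v \<Rightarrow>\<^sub>0 complex) set) \<subseteq> genideal sr_ring (coeff_ext ` sr_hom ` nonface_ideal \<alpha>)"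
    proof
      fix x :: "'v \<Rightarrow>\<^sub>0 complex" assume "x \<in> sr_hom ` nonface_ideal \<alpha>"
      then obtain p where p: "x = sr_hom p" "p \<in> nonface_ideal \<alpha>" by blast
      have "sr_hom p \<in> genideal sr_ring (coeff_ext ` sr_hom ` nonface_ideal \<alpha>)"
      proof (induction p rule: poly_mapping_induct_keys)
        case zero
        then show ?case using I.zero_closed by simp
      next
        case (single m c)
        then have "single m (1::int) \<in> nonface_ideal \<alpha>" using p(2) by (auto simp: nonface_ideal_def)
        then have "(coeff_ext (sr_hom (single m (1::int))) :: 'v \<Rightarrow>\<^sub>0 complex) \<in> genideal sr_ring (coeff_ext ` sr_hom ` nonface_ideal \<alpha>)"
          using R.genideal_self[OF sub] by blast
        then have "(sr_hom (single m 1) :: 'v \<Rightarrow>\<^sub>0 complex) \<in> genideal sr_ring (coeff_ext ` sr_hom ` nonface_ideal \<alpha>)"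
          by (simp add: sr_hom_coeff_ext)
        from I.I_l_closed[OF this, of "sr_hom (single 0 c)"]
        show ?case by (simp add: sr_hom_mult mult_single)
      next
        case (add p q)
        then show ?case using I.a_closed by (simp add: sr_hom_add)
      qed
      then show "x \<in> genideal sr_ring (coeff_ext ` sr_hom ` nonface_ideal \<alpha>)" using p by simp
    qed
  qed
qed

lemma Q_ideal_sr_hom: "\<alpha> \<in> BoxX \<Longrightarrow> Q_ideal d X g \<beta> \<alpha> = sr_hom ` box_ideal \<alpha>"
  unfolding Q_ideal_def ideal_ext_Z ideal_ext_S_ann box_ideal_def SC_ring_eq set_add_def set_mult_def
  by (auto simp: sr_hom_add[symmetric])

text \<open>The kernel of \<open>sr_hom\<close> is spanned by the monomials on non-faces, which lie in \<open>nonface_ideal \<alpha>\<close>.\<close>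

lemma sr_hom_in_box_ideal_iff: "sr_hom p \<in> sr_hom ` box_ideal \<alpha> \<longleftrightarrow> p \<in> box_ideal \<alpha>"
proof
  assume "sr_hom p \<in> sr_hom ` box_ideal \<alpha>"
  then obtain q where q: "sr_hom p = sr_hom q" "q \<in> box_ideal \<alpha>" by blast
  have "p - q \<in> nonface_ideal \<alpha>" unfolding nonface_ideal_def
  proof (intro CollectI ballI notI)
    fix m assume m: "m \<in> keys (p - q)" "faceset (keys m \<union> supp \<alpha>)"
    then have "faceset (keys m)" using faceset_mono by blast
    then have "lookup (p - q) m = lookup (sr_hom (p - q)) (lat_vec m)" by (simp add: sr_hom_lookup)
    then show False using m q by (simp add: sr_hom_diff in_keys_iff)
  qed
  then have "p - q \<in> box_ideal \<alpha>" using ideal_parts by blast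
  then have "(p - q) + q \<in> box_ideal \<alpha>" using q box_ideal_rel unfolding rel_ideal_def by blast
  then show "p \<in> box_ideal \<alpha>" by simp
qed auto

end

section \<open>The quotient rings and the quotient module\<close>

lemma coset_translate: "add G = (+) \<Longrightarrow> H +>\<^bsub>G\<^esub> a = (\<lambda>h. h + a) ` H"
  by (auto simp: a_r_coset_def r_coset_def)

locale additive_subset =
  fixes H :: "'a::ab_group_add set"
  assumes zero_in: "0 \<in> H" and plus_in: "a \<in> H \<Longrightarrow> b \<in> H \<Longrightarrow> a + b \<in> H" and minus_in: "a \<in> H \<Longrightarrow> - a \<in> H"
begin

lemma diff_in: "a \<in> H \<Longrightarrow> b \<in> H \<Longrightarrow> a - b \<in> H"
  using plus_in[of a "- b"] minus_in[of b] by simp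

lemma translate_mem: "x \<in> (\<lambda>h. h + a) ` H \<longleftrightarrow> x - a \<in> H"
  by (auto intro: image_eqI[of _ _ "x - a"])

lemma translate_eq_iff: "(\<lambda>h. h + a) ` H = (\<lambda>h. h + b) ` H \<longleftrightarrow> a - b \<in> H"
proof
  assume "(\<lambda>h. h + a) ` H = (\<lambda>h. h + b) ` H"
  then show "a - b \<in> H" using translate_mem[of a a] translate_mem[of a b] zero_in by simp
next
  assume ab: "a - b \<in> H"
  show "(\<lambda>h. h + a) ` H = (\<lambda>h. h + b) ` H"
  proof (rule Set.set_eqI)
    fix x
    have "x - b = (x - a) + (a - b)" "x - a = (x - b) - (a - b)" by simp_all
    then show "x \<in> (\<lambda>h. h + a) ` H \<longleftrightarrow> x \<in> (\<lambda>h. h + b) ` H"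
      unfolding translate_mem using ab plus_in diff_in by metis
  qed
qed

end

lemma ideal_additive_subset:
  assumes "rel_ideal UNIV I" shows "additive_subset (I :: 'a::comm_ring_1 set)"
proof
  show "- a \<in> I" if "a \<in> I" for a
  proof -
    have "(-1) * a \<in> I" using assms that unfolding rel_ideal_def by blast
    then show ?thesis by simp
  qed
qed (use assms in \<open>auto simp: rel_ideal_def\<close>)

context fan_basis begin

definition box_class :: "(nat \<Rightarrow> complex) \<Rightarrow> complex mpoly \<Rightarrow> ('v \<Rightarrow>\<^sub>0 complex) set" where
  "box_class \<alpha> p = Qclass \<alpha> (sr_hom p)"

lemma box_ideal_sub: "additive_subset (box_ideal \<alpha>)"
  by (rule ideal_additive_subset[OF box_ideal_rel])

lemma sr_hom_box_ideal_sub: "additive_subset (sr_hom ` (box_ideal \<alpha> :: (_ \<Rightarrow>\<^sub>0 'a::comm_ring_1) set))"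
proof -
  interpret additive_subset "box_ideal \<alpha> :: (_ \<Rightarrow>\<^sub>0 'a) set" by (rule box_ideal_sub)
  show ?thesis
    by unfold_locales
      (use zero_in plus_in minus_in in \<open>auto simp: sr_hom_add[symmetric] sr_hom_uminus[symmetric] intro: image_eqI[of 0 _ 0]\<close>)
qed

lemma box_class_translate: "\<alpha> \<in> BoxX \<Longrightarrow> box_class \<alpha> p = (\<lambda>h. h + sr_hom p) ` sr_hom ` box_ideal \<alpha>"
  unfolding box_class_def Q_class_def SC_ring_eq Q_ideal_sr_hom by (rule coset_translate) simp

lemma box_class_eq_iff: "\<alpha> \<in> BoxX \<Longrightarrow> box_class \<alpha> p = box_class \<alpha> q \<longleftrightarrow> p - q \<in> box_ideal \<alpha>"
  unfolding box_class_translate additive_subset.translate_eq_iff[OF sr_hom_box_ideal_sub] sr_hom_diff[symmetric]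
  by (rule sr_hom_in_box_ideal_iff)

lemma Q_ring_eq: "\<alpha> \<in> BoxX \<Longrightarrow> Qring \<alpha> = sr_ring Quot sr_hom ` box_ideal \<alpha>"
  by (simp add: Q_ring_def SC_ring_eq Q_ideal_sr_hom)

lemma Q_cring: "\<alpha> \<in> BoxX \<Longrightarrow> cring (Qring \<alpha>)"
  unfolding Q_ring_eq by (rule ideal.quotient_is_cring[OF sr_hom_ideal[OF box_ideal_rel] sr_ring_cring])

lemma box_class_hom:
  assumes "\<alpha> \<in> BoxX"
  shows "box_class \<alpha> (p + q) = box_class \<alpha> p \<oplus>\<^bsub>Qring \<alpha>\<^esub> box_class \<alpha> q"
    and "box_class \<alpha> (p * q) = box_class \<alpha> p \<otimes>\<^bsub>Qring \<alpha>\<^esub> box_class \<alpha> q"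
    and "\<one>\<^bsub>Qring \<alpha>\<^esub> = box_class \<alpha> 1"
    and "\<zero>\<^bsub>Qring \<alpha>\<^esub> = box_class \<alpha> 0"
    and "carrier (Qring \<alpha>) = range (box_class \<alpha>)"
proof -
  have h: "(+>\<^bsub>sr_ring\<^esub>) (sr_hom ` box_ideal \<alpha>) \<in> ring_hom sr_ring (sr_ring Quot sr_hom ` (box_ideal \<alpha> :: (_ \<Rightarrow>\<^sub>0 complex) set))"
    by (rule ideal.rcos_ring_hom[OF sr_hom_ideal[OF box_ideal_rel]])
  have box_class: "box_class \<alpha> p = sr_hom ` box_ideal \<alpha> +>\<^bsub>sr_ring\<^esub> sr_hom p" for p
    by (simp add: box_class_def Q_class_def SC_ring_eq Q_ideal_sr_hom[OF assms])
  show "box_class \<alpha> (p + q) = box_class \<alpha> p \<oplus>\<^bsub>Qring \<alpha>\<^esub> box_class \<alpha> q"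
    using ring_hom_add[OF h, of "sr_hom p" "sr_hom q"] by (simp add: box_class Q_ring_eq[OF assms] sr_hom_add)
  show "box_class \<alpha> (p * q) = box_class \<alpha> p \<otimes>\<^bsub>Qring \<alpha>\<^esub> box_class \<alpha> q"
    using ring_hom_mult[OF h, of "sr_hom p" "sr_hom q"] by (simp add: box_class Q_ring_eq[OF assms] sr_hom_mult)
  show "\<one>\<^bsub>Qring \<alpha>\<^esub> = box_class \<alpha> 1"
    using ring_hom_one[OF h] by (simp add: box_class Q_ring_eq[OF assms] sr_hom_1)
  show "\<zero>\<^bsub>Qring \<alpha>\<^esub> = box_class \<alpha> 0"
    by (simp add: Q_ring_eq[OF assms] box_class coset_translate FactRing_def)
  show "carrier (Qring \<alpha>) = range (box_class \<alpha>)"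
    unfolding Q_ring_eq[OF assms] FactRing_def box_class A_RCOSETS_def RCOSETS_def a_r_coset_def by auto
qed

lemma box_class_pow: "\<alpha> \<in> BoxX \<Longrightarrow> box_class \<alpha> p [^]\<^bsub>Qring \<alpha>\<^esub> n = box_class \<alpha> (p ^ n)"
proof -
  assume \<alpha>: "\<alpha> \<in> BoxX"
  interpret Q: cring "Qring \<alpha>" by (rule Q_cring[OF \<alpha>])
  show ?thesis
  proof (induction n)
    case 0 then show ?case using box_class_hom(3)[OF \<alpha>] by simp
  next
    case (Suc n)
    then show ?case using box_class_hom(2)[OF \<alpha>, of "p ^ n" p] by (simp add: mult.commute)
  qed
qed

lemma box_class_finsum: "\<alpha> \<in> BoxX \<Longrightarrow> finite A \<Longrightarrow> finsum (Qring \<alpha>) (\<lambda>i. box_class \<alpha> (f i)) A = box_class \<alpha> (sum f A)"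
proof -
  assume \<alpha>: "\<alpha> \<in> BoxX" and "finite A"
  interpret Q: cring "Qring \<alpha>" by (rule Q_cring[OF \<alpha>])
  show ?thesis using \<open>finite A\<close>
  proof (induction A rule: finite_induct)
    case empty then show ?case using box_class_hom(4)[OF \<alpha>] by simp
  next
    case (insert i A)
    then show ?case using box_class_hom(1,5)[OF \<alpha>] by (subst Q.finsum_insert) auto
  qed
qed

text \<open>The prefix \<open>T\<close> marks calculations modulo \<open>box_ideal \<alpha>\<close> in the polynomial ring.\<close>

sublocale T: subalgebra_ideal "UNIV :: complex mpoly set" scalar "box_ideal \<alpha>" for \<alpha>
  by (intro complex_subalgebra.ideal_locale complex_poly_subalgebra box_ideal_rel)

text \<open>The sum in \<open>exp_nilpotent\<close> stops at the nilpotency order, and modulo \<open>box_ideal \<alpha>\<close> longer truncations agree with it.\<close>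

lemma exp_nilpotent_box_class:
  assumes \<alpha>: "\<alpha> \<in> BoxX" and e: "T.is_exp \<alpha> x a"
  shows "exp_nilpotent (Qring \<alpha>) (\<lambda>c. Qclass \<alpha> (scalar c)) c (box_class \<alpha> x) = box_class \<alpha> (scalar (exp c) * a)"
proof -
  have sc: "Qclass \<alpha> (scalar c) = box_class \<alpha> (scalar c)" for c
    by (simp add: box_class_def scalar_sr_hom) (simp add: scalar_def)
  obtain n0 where n0: "x ^ n0 \<in> box_ideal \<alpha>" using e by (auto simp: T.is_exp_def T.nilp_def)
  define n where "n = (LEAST n. x ^ n \<in> box_ideal \<alpha>)"
  have n: "x ^ n \<in> box_ideal \<alpha>" unfolding n_def using n0 by (rule LeastI)
  have set: "{m. box_class \<alpha> x [^]\<^bsub>Qring \<alpha>\<^esub> m \<noteq> \<zero>\<^bsub>Qring \<alpha>\<^esub>} = {..<n}"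
  proof (rule Set.set_eqI)
    fix m
    have "x ^ m \<in> box_ideal \<alpha> \<longleftrightarrow> n \<le> m"
      using T.ideal_power[OF _ n, of m] Least_le[of "\<lambda>n. x ^ n \<in> box_ideal \<alpha>" m] unfolding n_def by auto
    then show "m \<in> {m. box_class \<alpha> x [^]\<^bsub>Qring \<alpha>\<^esub> m \<noteq> \<zero>\<^bsub>Qring \<alpha>\<^esub>} \<longleftrightarrow> m \<in> {..<n}"
      by (auto simp: box_class_pow[OF \<alpha>] box_class_hom(4)[OF \<alpha>] box_class_eq_iff[OF \<alpha>])
  qed
  have "exp_nilpotent (Qring \<alpha>) (\<lambda>c. Qclass \<alpha> (scalar c)) c (box_class \<alpha> x)
      = box_class \<alpha> (scalar (exp c) * T.texp n x)"
    unfolding exp_nilpotent_def set unfolding sc box_class_pow[OF \<alpha>] box_class_hom(2)[OF \<alpha>, symmetric]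
    by (simp add: box_class_finsum[OF \<alpha>] T.texp_def box_class_hom(2)[OF \<alpha>, symmetric])
  also have "\<dots> = box_class \<alpha> (scalar (exp c) * a)"
  proof -
    obtain k where k: "\<forall>n\<ge>k. a - T.texp n x \<in> box_ideal \<alpha>" using e by (auto simp: T.is_exp_def)
    have "a - T.texp (n + k) x \<in> box_ideal \<alpha>" using k by simp
    moreover have "T.texp (n + k) x - T.texp n x \<in> box_ideal \<alpha>" by (rule T.texp_stable) (use n in auto)
    ultimately have "T.texp n x - a \<in> box_ideal \<alpha>" using T.cong_trans T.cong_sym by blast
    then have "scalar (exp c) * (T.texp n x - a) \<in> box_ideal \<alpha>" by (intro T.ideal_mult) auto
    then show ?thesis unfolding box_class_eq_iff[OF \<alpha>] by (simp add: right_diff_distrib)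
  qed
  finally show ?thesis .
qed

lemma symbols_eq: "symbols X \<beta> = {(lin_comb X \<alpha> + of_lat (lat_vec k), \<alpha>) | \<alpha> k. \<alpha> \<in> BoxX \<and> faceset (keys k \<union> supp \<alpha>)}"
proof (intro Set.set_eqI iffI)
  fix y assume "y \<in> symbols X \<beta>"
  then obtain x \<alpha> \<sigma> where y: "y = (x, \<alpha>)" "\<sigma> \<in> maximal_cones X" "symbol_at X \<beta> \<sigma> x \<alpha>" by (auto simp: symbols_def)
  then obtain k where "\<alpha> \<in> Bx X \<beta> \<sigma>" "keys k \<subseteq> rays \<sigma>" "x = lin_comb X \<alpha> + of_lat (lat_vec k)"
    by (auto simp: symbol_at_iff)
  moreover from this have "faceset (keys k \<union> supp \<alpha>)" "\<alpha> \<in> BoxX"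
    using y(2) by (auto simp: Bx_supp faceset_def Box_def)
  ultimately show "y \<in> {(lin_comb X \<alpha> + of_lat (lat_vec k), \<alpha>) | \<alpha> k. \<alpha> \<in> BoxX \<and> faceset (keys k \<union> supp \<alpha>)}"
    using y by blast
next
  fix y assume "y \<in> {(lin_comb X \<alpha> + of_lat (lat_vec k), \<alpha>) | \<alpha> k. \<alpha> \<in> BoxX \<and> faceset (keys k \<union> supp \<alpha>)}"
  then obtain \<alpha> k where y: "y = (lin_comb X \<alpha> + of_lat (lat_vec k), \<alpha>)" "\<alpha> \<in> BoxX" "faceset (keys k \<union> supp \<alpha>)"
    by blast
  obtain \<sigma> where \<sigma>: "\<sigma> \<in> maximal_cones X" "keys k \<union> supp \<alpha> \<subseteq> rays \<sigma>" using y(3) unfolding faceset_def by blast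
  have "faceset (keys k)" using y(3) faceset_mono by blast
  then have at: "symbol_at X \<beta> \<sigma> (lin_comb X \<alpha> + of_lat (lat_vec k)) \<alpha>"
    using symbol_at_mon[OF y(2) _ maximal_cone[OF \<sigma>(1)]] \<sigma>(2) by blast
  obtain n where "n \<in> N" "lin_comb X \<alpha> = of_lat n + \<beta>" using y(2) unfolding Box_iff by blast
  then have "lin_comb X \<alpha> + of_lat (lat_vec k) = of_lat (n + lat_vec k) + \<beta>" "n + lat_vec k \<in> N"
    using lat_add[OF _ lat_vec_lat] by (auto simp: of_lat_add ac_simps)
  then show "y \<in> symbols X \<beta>" unfolding symbols_def y(1) using at \<sigma>(1) by blast
qed

definition module_sum :: "((nat \<Rightarrow> complex) \<Rightarrow> complex mpoly) \<Rightarrow>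
    (('v \<times> 'v) \<times> (nat \<Rightarrow> complex) \<Rightarrow>\<^sub>0 complex)" where
  "module_sum t = (\<Sum>\<alpha>\<in>BoxX. module_map \<alpha> (t \<alpha>))"

lemma module_sum_add: "module_sum (\<lambda>\<alpha>. s \<alpha> + t \<alpha>) = module_sum s + module_sum t" and module_sum_uminus: "module_sum (\<lambda>\<alpha>. - s \<alpha>) = - module_sum s"
  and module_sum_0: "module_sum (\<lambda>_. 0) = 0"
  by (simp_all add: module_sum_def module_map_add module_map_uminus sum.distrib sum_negf)

lemma module_sum_act: "sr_act X \<beta> (sr_hom p) (module_sum t) = module_sum (\<lambda>\<alpha>. p * t \<alpha>)"
  unfolding module_sum_def sr_act_bilin act.bilin_sum2 by (intro sum.cong refl act_module_map[unfolded sr_act_bilin])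

abbreviation Zsub :: "(('v \<times> 'v) \<times> (nat \<Rightarrow> complex) \<Rightarrow>\<^sub>0 complex) set" where
  "Zsub \<equiv> Z_submodule d X g \<beta>"

definition HC_class :: "(('v \<times> 'v) \<times> (nat \<Rightarrow> complex) \<Rightarrow>\<^sub>0 complex) \<Rightarrow> (('v \<times> 'v) \<times> (nat \<Rightarrow> complex) \<Rightarrow>\<^sub>0 complex) set" where
  "HC_class q = Zsub +>\<^bsub>Mmod\<^esub> q"

lemma HC_class_translate: "HC_class q = (\<lambda>h. h + q) ` Zsub"
  unfolding HC_class_def by (rule coset_translate) simp

context
  assumes fin: "finite (BoxX)"
begin

lemma module_sum_single: "\<alpha> \<in> BoxX \<Longrightarrow> module_sum (\<lambda>\<alpha>'. if \<alpha>' = \<alpha> then t else 0) = module_map \<alpha> t"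
  using fin by (simp add: module_sum_def if_distrib[of "module_map _"] cong: if_cong)

lemma module_sum_lookup:
  "\<alpha> \<in> BoxX \<Longrightarrow> faceset (keys m \<union> supp \<alpha>) \<Longrightarrow>
   lookup (module_sum t) (lin_comb X \<alpha> + of_lat (lat_vec m), \<alpha>) = lookup (t \<alpha>) m"
  using fin by (simp add: module_sum_def lookup_sum module_map_lookup)

lemma module_sum_eq_0: "module_sum t = 0 \<Longrightarrow> \<alpha> \<in> BoxX \<Longrightarrow> t \<alpha> \<in> box_ideal \<alpha>"
proof -
  assume "module_sum t = 0" "\<alpha> \<in> BoxX"
  then have "t \<alpha> \<in> nonface_ideal \<alpha>" unfolding nonface_ideal_def using module_sum_lookup[of \<alpha> _ t] by (auto simp: in_keys_iff)
  then show ?thesis using ideal_parts by blast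
qed

lemma module_map_carrier: "\<alpha> \<in> BoxX \<Longrightarrow> module_map \<alpha> (p :: _ \<Rightarrow>\<^sub>0 complex) \<in> carrier (Mmod)"
proof (induction p rule: poly_mapping_induct)
  case (single m c)
  then show ?case by (auto simp: SR_module_def module_map_single module_mon_def symbols_eq)
next
  case (add p q)
  then show ?case using keys_add[of "module_map \<alpha> p" "module_map \<alpha> q"] by (auto simp: SR_module_def module_map_add)
qed (simp add: SR_module_def)

lemma module_carrier: "carrier (Mmod) = range module_sum"
proof
  show "carrier (Mmod) \<subseteq> range module_sum"
  proof
    fix q :: "('v \<times> 'v) \<times> (nat \<Rightarrow> complex) \<Rightarrow>\<^sub>0 complex" assume "q \<in> carrier (Mmod)"
    then have keys: "keys q \<subseteq> symbols X \<beta>" by (simp add: SR_module_def)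
    show "q \<in> range module_sum"
    proof (induction q rule: poly_mapping_induct_keys)
      case zero
      then show ?case using module_sum_0 by (metis rangeI)
    next
      case (single y c)
      then obtain \<alpha> k where y: "y = (lin_comb X \<alpha> + of_lat (lat_vec k), \<alpha>)" "\<alpha> \<in> BoxX" "faceset (keys k \<union> supp \<alpha>)"
        using subsetD[OF keys single] unfolding symbols_eq by blast
      then have "single y c = module_map \<alpha> (single k c)" by (simp add: module_map_single module_mon_def)
      then show ?case using module_sum_single[OF y(2)] by (metis rangeI)
    next
      case (add p q)
      then obtain s t where "p = module_sum s" "q = module_sum t" by blast
      then have "p + q = module_sum (\<lambda>\<alpha>. s \<alpha> + t \<alpha>)" by (simp only: module_sum_add)
      then show ?case by blast
    qed
  qed
  show "range module_sum \<subseteq> carrier (Mmod)"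
  proof
    fix q assume "q \<in> range module_sum"
    then obtain t where q: "q = module_sum t" by blast
    have "(\<Sum>\<alpha>\<in>A. module_map \<alpha> (t \<alpha>)) \<in> carrier (Mmod)" if "A \<subseteq> BoxX" for A
      using finite_subset[OF that fin] that
    proof (induction A rule: finite_induct)
      case (insert \<alpha> A)
      then show ?case using module_map_carrier[of \<alpha> "t \<alpha>"] keys_add[of "module_map \<alpha> (t \<alpha>)" "\<Sum>\<alpha>\<in>A. module_map \<alpha> (t \<alpha>)"]
        by (auto simp: SR_module_def)
    qed (simp add: SR_module_def)
    then show "q \<in> carrier (Mmod)" unfolding q module_sum_def by blast
  qed
qed

lemma module_a_inv: "x \<in> carrier (Mmod) \<Longrightarrow> \<ominus>\<^bsub>Mmod\<^esub> x = - (x :: _ \<Rightarrow>\<^sub>0 complex)"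
proof -
  have "abelian_group (Mmod :: (_, _ \<Rightarrow>\<^sub>0 complex) module)"
  proof (rule abelian_groupI)
    fix x :: "_ \<Rightarrow>\<^sub>0 complex" assume "x \<in> carrier (Mmod)"
    then obtain t where "x = module_sum t" unfolding module_carrier by blast
    then show "\<exists>y\<in>carrier (Mmod). y \<oplus>\<^bsub>Mmod\<^esub> x = \<zero>\<^bsub>Mmod\<^esub>"
      unfolding module_carrier by (intro bexI[of _ "module_sum (\<lambda>\<alpha>. - t \<alpha>)"]) (simp_all, simp add: module_sum_uminus)
  next
    show "\<zero>\<^bsub>Mmod\<^esub> \<in> carrier (Mmod :: (_, _ \<Rightarrow>\<^sub>0 complex) module)"
      using rangeI[of module_sum "\<lambda>_. 0"] by (simp add: module_carrier module_sum_0)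
  qed (auto simp: ac_simps module_carrier module_sum_add[symmetric])
  moreover assume x: "x \<in> carrier (Mmod)"
  moreover have "- x \<in> carrier (Mmod)" using x unfolding module_carrier by (auto simp: module_sum_uminus[symmetric])
  ultimately show ?thesis by (intro abelian_group.minus_equality) auto
qed

text \<open>
  The submodule generated by \<open>Z\<close> is the sum of its parts in the summands of the \<open>\<alpha>\<close>.  The monomial part of
  \<open>box_ideal \<alpha>\<close> maps to \<open>0\<close> in the module, so only linear forms contribute.
\<close>

lemma Zsub_eq: "Zsub = {module_sum t | t. \<forall>\<alpha>\<in>BoxX. t \<alpha> \<in> box_ideal \<alpha>}" (is "_ = ?R")
proof
  let ?H = "{coeff_ext z \<odot>\<^bsub>Mmod\<^esub> m | z m. z \<in> Z_ideal d X g \<and> m \<in> carrier (Mmod)}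
    :: (('v \<times> 'v) \<times> (nat \<Rightarrow> complex) \<Rightarrow>\<^sub>0 complex) set"
  have H: "?H \<subseteq> ?R"
  proof
    fix x assume "x \<in> ?H"
    then obtain z t where "x = sr_act X \<beta> (coeff_ext z) (module_sum t)" "z \<in> Z_ideal d X g"
      unfolding module_carrier SR_module_sel by blast
    then obtain p where p: "x = sr_act X \<beta> (coeff_ext (sr_hom p)) (module_sum t)" "p \<in> linear_ideal" unfolding Z_ideal_sr_hom by blast
    then have "x = module_sum (\<lambda>\<alpha>. coeff_ext p * t \<alpha>)" by (simp add: sr_hom_coeff_ext module_sum_act)
    moreover have "coeff_ext p * t \<alpha> \<in> box_ideal \<alpha>" for \<alpha>
      using coeff_ext_linear_ideal[OF p(2)] ideal_parts(1) by (intro T.ideal_mult') auto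
    ultimately show "x \<in> ?R" by (intro CollectI exI[of _ "\<lambda>\<alpha>. coeff_ext p * t \<alpha>"]) auto
  qed
  show "Zsub \<subseteq> ?R"
  proof
    fix x assume "x \<in> Zsub"
    then show "x \<in> ?R" unfolding Z_submodule_def
    proof induction
      case one
      then show ?case using module_sum_0 by (intro CollectI exI[of _ "\<lambda>_. 0"]) auto
    next
      case (incl h)
      then show ?case by (rule subsetD[OF H])
    next
      case (inv h)
      then obtain t where t: "h = module_sum t" "\<forall>\<alpha>\<in>BoxX. t \<alpha> \<in> box_ideal \<alpha>" using H by blast
      have "\<ominus>\<^bsub>Mmod\<^esub> h = - h" by (rule module_a_inv) (simp add: t module_carrier)
      then have "inv\<^bsub>add_monoid (Mmod)\<^esub> h = module_sum (\<lambda>\<alpha>. - t \<alpha>)" by (simp add: a_inv_def t module_sum_uminus)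
      then show ?case using t T.ideal_uminus by (intro CollectI exI[of _ "\<lambda>\<alpha>. - t \<alpha>"]) auto
    next
      case (eng h1 h2)
      then obtain s t where "h1 = module_sum s" "\<forall>\<alpha>\<in>BoxX. s \<alpha> \<in> box_ideal \<alpha>" "h2 = module_sum t" "\<forall>\<alpha>\<in>BoxX. t \<alpha> \<in> box_ideal \<alpha>" by blast
      then show ?case using T.ideal_add by (intro CollectI exI[of _ "\<lambda>\<alpha>. s \<alpha> + t \<alpha>"]) (auto simp: module_sum_add)
    qed
  qed
  show "?R \<subseteq> Zsub"
  proof
    fix x assume "x \<in> ?R"
    then obtain t where t: "x = module_sum t" "\<forall>\<alpha>\<in>BoxX. t \<alpha> \<in> box_ideal \<alpha>" by blast
    have add: "a + b \<in> Zsub" if "a \<in> Zsub" "b \<in> Zsub" for a b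
      using that generate.eng[of a "add_monoid (Mmod)" _ b] by (simp add: Z_submodule_def)
    have zero: "0 \<in> Zsub" using generate.one[of "add_monoid (Mmod)"] by (simp add: Z_submodule_def)
    have sum1: "sum f A \<in> Zsub" if "\<And>i. i \<in> A \<Longrightarrow> f i \<in> Zsub" for f and A :: "nat set"
      using that by (induction A rule: infinite_finite_induct) (auto simp: zero add)
    have sum2: "sum f A \<in> Zsub" if "\<And>i. i \<in> A \<Longrightarrow> f i \<in> Zsub" for f and A :: "(nat \<Rightarrow> complex) set"
      using that by (induction A rule: infinite_finite_induct) (auto simp: zero add)
    have "module_map \<alpha> (t \<alpha>) \<in> Zsub" if \<alpha>: "\<alpha> \<in> BoxX" for \<alpha>
    proof -
      obtain z w where "t \<alpha> = z + w" and z: "z \<in> linear_ideal" and "w \<in> nonface_ideal \<alpha>" using t \<alpha> unfolding box_ideal_def by blast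
      then have "module_map \<alpha> (t \<alpha>) = module_map \<alpha> z" by (simp add: module_map_add module_map_eq_0_iff)
      moreover obtain r where "z = (\<Sum>j\<in>{1..d}. r j * lin_form (g j))" using z unfolding linear_ideal_def by blast
      moreover have "module_map \<alpha> (r j * lin_form (g j)) \<in> Zsub" if j: "j \<in> {1..d}" for j
      proof -
        have "module_map \<alpha> (r j * lin_form (g j)) = sr_act X \<beta> (coeff_ext (sr_hom (lin_form (g j)))) (module_map \<alpha> (r j))"
          by (simp add: sr_hom_coeff_ext coeff_ext_lin_form act_module_map[OF \<alpha>] mult.commute)
        moreover have "sr_hom (lin_form (g j)) \<in> Z_ideal d X g" using lin_form_g_linear_ideal[OF j] by (auto simp: Z_ideal_sr_hom)
        ultimately have "module_map \<alpha> (r j * lin_form (g j)) \<in> ?H" using module_map_carrier[OF \<alpha>] by auto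
        then show ?thesis unfolding Z_submodule_def by (rule generate.incl)
      qed
      ultimately show ?thesis by (simp only: module_map_sum) (rule sum1)
    qed
    then show "x \<in> Zsub" unfolding t module_sum_def by (rule sum2)
  qed
qed

lemma module_sum_in_Zsub_iff: "module_sum t \<in> Zsub \<longleftrightarrow> (\<forall>\<alpha>\<in>BoxX. t \<alpha> \<in> box_ideal \<alpha>)"
proof
  assume "module_sum t \<in> Zsub"
  then have "module_sum t \<in> {module_sum t | t. \<forall>\<alpha>\<in>BoxX. t \<alpha> \<in> box_ideal \<alpha>}" using Zsub_eq by simp
  then obtain s where s: "module_sum t = module_sum s" "\<forall>\<alpha>\<in>BoxX. s \<alpha> \<in> box_ideal \<alpha>" by (elim CollectE exE conjE)
  have "module_sum (\<lambda>\<alpha>. t \<alpha> + (- s \<alpha>)) = 0" by (simp only: module_sum_add module_sum_uminus s(1) add.right_inverse)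
  then have "\<forall>\<alpha>\<in>BoxX. t \<alpha> + (- s \<alpha>) \<in> box_ideal \<alpha>" using module_sum_eq_0[of "\<lambda>\<alpha>. t \<alpha> + (- s \<alpha>)"] by blast
  then show "\<forall>\<alpha>\<in>BoxX. t \<alpha> \<in> box_ideal \<alpha>" using s(2) T.cong_in_iff by auto
qed (auto simp: Zsub_eq)

lemma Zsub_sub: "additive_subset Zsub"
proof
  show "0 \<in> Zsub" using module_sum_in_Zsub_iff[of "\<lambda>_. 0"] by (simp add: module_sum_0)
  fix a assume a: "a \<in> Zsub"
  then obtain s where s: "a = module_sum s" "\<forall>\<alpha>\<in>BoxX. s \<alpha> \<in> box_ideal \<alpha>" unfolding Zsub_eq by blast
  then show "- a \<in> Zsub" using module_sum_in_Zsub_iff[of "\<lambda>\<alpha>. - s \<alpha>"] T.ideal_uminus by (simp add: module_sum_uminus)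
  fix b assume "b \<in> Zsub"
  then obtain t where t: "b = module_sum t" "\<forall>\<alpha>\<in>BoxX. t \<alpha> \<in> box_ideal \<alpha>" unfolding Zsub_eq by blast
  then show "a + b \<in> Zsub" using s module_sum_in_Zsub_iff[of "\<lambda>\<alpha>. s \<alpha> + t \<alpha>"] T.ideal_add by (simp add: module_sum_add)
qed

lemma HC_class_module_sum_eq_iff: "HC_class (module_sum s) = HC_class (module_sum t) \<longleftrightarrow> (\<forall>\<alpha>\<in>BoxX. s \<alpha> - t \<alpha> \<in> box_ideal \<alpha>)"
proof -
  have "module_sum s - module_sum t = module_sum (\<lambda>\<alpha>. s \<alpha> - t \<alpha>)" using module_sum_add[of s "\<lambda>\<alpha>. - t \<alpha>"] by (simp add: module_sum_uminus)
  then show ?thesis unfolding HC_class_translate additive_subset.translate_eq_iff[OF Zsub_sub] by (simp add: module_sum_in_Zsub_iff)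
qed

lemma HC_sel: "carrier (Hmod) = range (\<lambda>t. HC_class (module_sum t))" "zero (Hmod) = HC_class 0"
  "HC_class p \<oplus>\<^bsub>Hmod\<^esub> HC_class q = HC_class (p + q)"
proof -
  have "carrier (Hmod) = HC_class ` carrier (Mmod)"
    unfolding HC_def module_quot_def A_RCOSETS_def RCOSETS_def HC_class_def a_r_coset_def by auto
  then show "carrier (Hmod) = range (\<lambda>t. HC_class (module_sum t))" unfolding module_carrier by auto
  show "zero (Hmod) = HC_class 0" by (simp add: HC_def module_quot_def HC_class_translate)
  interpret additive_subset Zsub by (rule Zsub_sub)
  have "HC_class p \<oplus>\<^bsub>Hmod\<^esub> HC_class q = {x + y | x y. x \<in> HC_class p \<and> y \<in> HC_class q}"
    by (auto simp: HC_def module_quot_def set_add_def set_mult_def)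
  also have "\<dots> = HC_class (p + q)"
  proof (intro Set.set_eqI iffI)
    fix z assume "z \<in> {x + y | x y. x \<in> HC_class p \<and> y \<in> HC_class q}"
    then obtain x y where z: "z = x + y" "x - p \<in> Zsub" "y - q \<in> Zsub" unfolding HC_class_translate translate_mem by blast
    have "z - (p + q) = (x - p) + (y - q)" using z by simp
    then show "z \<in> HC_class (p + q)" unfolding HC_class_translate translate_mem using plus_in[OF z(2,3)] by metis
  next
    fix z assume "z \<in> HC_class (p + q)"
    then have "(z - q) - p \<in> Zsub" "q - q \<in> Zsub" unfolding HC_class_translate translate_mem using zero_in by (auto simp: algebra_simps)
    then show "z \<in> {x + y | x y. x \<in> HC_class p \<and> y \<in> HC_class q}" unfolding HC_class_translate translate_mem
      by (intro CollectI exI[of _ "z - q"] exI[of _ q]) simp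
  qed
  finally show "HC_class p \<oplus>\<^bsub>Hmod\<^esub> HC_class q = HC_class (p + q)" .
qed

lemma HC_monoid: "abelian_monoid (Hmod)"
proof (rule abelian_monoidI)
  have "HC_class (module_sum (\<lambda>_. 0)) \<in> carrier (Hmod)" unfolding HC_sel by blast
  then show "\<zero>\<^bsub>Hmod\<^esub> \<in> carrier (Hmod)" by (simp add: HC_sel(2) module_sum_0)
qed (auto simp: HC_sel module_sum_add[symmetric] ac_simps)

lemma HC_finsum:
  assumes "A \<subseteq> BoxX"
  shows "finsum (Hmod) (\<lambda>\<alpha>. HC_class (module_map \<alpha> (t \<alpha>))) A = HC_class (\<Sum>\<alpha>\<in>A. module_map \<alpha> (t \<alpha>))"
  using finite_subset[OF assms fin] assms
proof (induction A rule: finite_induct)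
  case empty
  interpret abelian_monoid "Hmod" by (rule HC_monoid)
  show ?case by (simp add: HC_sel(2))
next
  case (insert \<alpha> A)
  interpret abelian_monoid "Hmod" by (rule HC_monoid)
  have c: "HC_class (module_map \<alpha> (t \<alpha>)) \<in> carrier (Hmod)" if "\<alpha> \<in> BoxX" for \<alpha>
    unfolding HC_sel module_sum_single[OF that, symmetric] by blast
  have "finsum (Hmod) (\<lambda>\<alpha>. HC_class (module_map \<alpha> (t \<alpha>))) (insert \<alpha> A)
      = HC_class (module_map \<alpha> (t \<alpha>)) \<oplus>\<^bsub>Hmod\<^esub> finsum (Hmod) (\<lambda>\<alpha>. HC_class (module_map \<alpha> (t \<alpha>))) A"
    by (rule finsum_insert) (use insert c in auto)
  then show ?case using insert by (simp add: HC_sel(3))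
qed

lemma HC_smult: "sr_hom p \<odot>\<^bsub>Hmod\<^esub> HC_class (module_sum t) = HC_class (module_sum (\<lambda>\<alpha>. p * t \<alpha>))"
proof -
  interpret additive_subset Zsub by (rule Zsub_sub)
  have "HC_class (sr_act X \<beta> (sr_hom p) m) = HC_class (module_sum (\<lambda>\<alpha>. p * t \<alpha>))" if "m \<in> HC_class (module_sum t)" for m
  proof -
    obtain z where "m = z + module_sum t" "z \<in> Zsub" using \<open>m \<in> HC_class (module_sum t)\<close> unfolding HC_class_translate by blast
    then obtain s where s: "m = module_sum s + module_sum t" "\<forall>\<alpha>\<in>BoxX. s \<alpha> \<in> box_ideal \<alpha>" unfolding Zsub_eq by blast
    then have "sr_act X \<beta> (sr_hom p) m = module_sum (\<lambda>\<alpha>. p * (s \<alpha> + t \<alpha>))" by (simp add: module_sum_add[symmetric] module_sum_act)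
    then show ?thesis using s(2) by (simp add: HC_class_module_sum_eq_iff distrib_left T.ideal_mult)
  qed
  moreover have "module_sum t \<in> HC_class (module_sum t)" unfolding HC_class_translate translate_mem using zero_in by simp
  ultimately have "(\<Union>m\<in>HC_class (module_sum t). HC_class (sr_act X \<beta> (sr_hom p) m)) = HC_class (module_sum (\<lambda>\<alpha>. p * t \<alpha>))" by blast
  then show ?thesis by (simp add: HC_def module_quot_def HC_class_def)
qed

lemma H_summand_box_class:
  assumes \<alpha>: "\<alpha> \<in> BoxX"
  shows "H_summand d X g \<beta> \<alpha> (box_class \<alpha> t) = HC_class (module_map \<alpha> t)"
proof -
  interpret Q: additive_subset "box_ideal \<alpha> :: (_ \<Rightarrow>\<^sub>0 complex) set" by (rule box_ideal_sub)
  have cm: "HC_class (module_map \<alpha> p) = HC_class (module_map \<alpha> q)" if "p - q \<in> box_ideal \<alpha>" for p q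
    unfolding module_sum_single[OF \<alpha>, symmetric] HC_class_module_sum_eq_iff using that by auto
  have "s \<odot>\<^bsub>Hmod\<^esub> HC_class (box_symbol X \<alpha>) = HC_class (module_map \<alpha> t)" if "s \<in> box_class \<alpha> t" for s
  proof -
    obtain w where w: "s = sr_hom w + sr_hom t" "w \<in> box_ideal \<alpha>" using \<open>s \<in> box_class \<alpha> t\<close> unfolding box_class_translate[OF \<alpha>] by blast
    have "sr_hom (w + t) \<odot>\<^bsub>Hmod\<^esub> HC_class (module_sum (\<lambda>\<alpha>'. if \<alpha>' = \<alpha> then 1 else 0)) = HC_class (module_sum (\<lambda>\<alpha>'. (w + t) * (if \<alpha>' = \<alpha> then 1 else 0)))"
      by (rule HC_smult)
    also have "(\<lambda>\<alpha>'. (w + t) * (if \<alpha>' = \<alpha> then 1 else 0)) = (\<lambda>\<alpha>'. if \<alpha>' = \<alpha> then w + t else 0)" by auto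
    finally have "s \<odot>\<^bsub>Hmod\<^esub> HC_class (box_symbol X \<alpha>) = HC_class (module_map \<alpha> (w + t))"
      unfolding module_sum_single[OF \<alpha>] box_symbol_module_map[OF \<alpha>] w(1) sr_hom_add .
    also have "\<dots> = HC_class (module_map \<alpha> t)" by (rule cm) (use w in simp)
    finally show ?thesis .
  qed
  moreover have "sr_hom t \<in> box_class \<alpha> t"
    unfolding box_class_translate[OF \<alpha>] additive_subset.translate_mem[OF sr_hom_box_ideal_sub]
    using additive_subset.zero_in[OF sr_hom_box_ideal_sub] by simp
  ultimately show ?thesis unfolding H_summand_def HC_class_def[symmetric] by blast
qed

end

end

section \<open>Laurent polynomials and the points of the Grothendieck ring\<close>

lemma laurent_eval_mult:
  assumes "\<And>i. i \<in> {1..k} \<Longrightarrow> r i \<noteq> 0"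
  shows "laurent_eval k r (p * q) = laurent_eval k r p * laurent_eval k r q"
proof -
  have C: "complex_subalgebra (UNIV :: complex set) (\<lambda>x. x)" by unfold_locales simp_all
  have "rel_ideal (UNIV :: complex set) {0}" by (simp add: rel_ideal_def)
  then have C': "subalgebra_ideal (UNIV :: complex set) (\<lambda>x. x) {0}"
    by (rule complex_subalgebra.ideal_locale[OF C])
  have "lin_ext (\<lambda>c m. c * (\<Prod>i\<in>{1..k}. r i powi lookup m i)) (p * q)
    - lin_ext (\<lambda>c m. c * (\<Prod>i\<in>{1..k}. r i powi lookup m i)) p
    * lin_ext (\<lambda>c m. c * (\<Prod>i\<in>{1..k}. r i powi lookup m i)) q \<in> {0}"
  proof (rule subalgebra_ideal.lin_ext_mult[OF C', where M = UNIV and \<kappa> = "\<lambda>x. x"])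
    fix m n :: "nat \<Rightarrow>\<^sub>0 int"
    have "(\<Prod>i\<in>{1..k}. r i powi lookup (m + n) i)
       = (\<Prod>i\<in>{1..k}. r i powi lookup m i) * (\<Prod>i\<in>{1..k}. r i powi lookup n i)"
      unfolding lookup_add prod.distrib[symmetric] by (intro prod.cong refl power_int_add disjI1 assms)
    then show "(\<Prod>i\<in>{1..k}. r i powi lookup (m + n) i)
       - (\<Prod>i\<in>{1..k}. r i powi lookup m i) * (\<Prod>i\<in>{1..k}. r i powi lookup n i) \<in> {0}" by simp
  qed simp_all
  then show ?thesis by (simp add: laurent_eval_def lin_ext_def)
qed

context simplicial_fan begin

definition L :: "laurent set" where
  "L = {p. \<forall>m\<in>keys p. keys m \<subseteq> V}"

abbreviation Lring where "Lring \<equiv> laurent_ring (nrays X)"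

lemma Lring_sel [simp]: "carrier Lring = L" "mult Lring = (*)" "one Lring = 1" "zero Lring = 0" "add Lring = (+)"
  by (simp_all add: laurent_ring_def L_def)

lemma L_scalar: "scalar c \<in> L" by (auto simp: L_def scalar_def)

lemma L_add: "p \<in> L \<Longrightarrow> q \<in> L \<Longrightarrow> p + q \<in> L"
  unfolding L_def using keys_add[of p q] by blast

lemma L_mult: "p \<in> L \<Longrightarrow> q \<in> L \<Longrightarrow> p * q \<in> L"
  unfolding L_def
proof (intro CollectI ballI)
  fix m assume pq: "p \<in> {p. \<forall>m\<in>keys p. keys m \<subseteq> V}"
    "q \<in> {p. \<forall>m\<in>keys p. keys m \<subseteq> V}" and "m \<in> keys (p * q)"
  then obtain a b where "m = a + b" "a \<in> keys p" "b \<in> keys q" using keys_mult[of p q] by blast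
  then show "keys m \<subseteq> V" using pq keys_add[of a b] by blast
qed

sublocale L: complex_subalgebra L scalar
  by unfold_locales (auto simp: scalar_def single_add mult_single L_scalar[unfolded scalar_def] L_add L_mult)

lemma laurent_power_in: "i \<in> V \<Longrightarrow> laurent_power i a \<in> L"
  by (auto simp: L_def laurent_power_def split: if_splits)

lemma laurent_power_add: "laurent_power i (a + b) = laurent_power i a * laurent_power i b"
  by (simp add: laurent_power_def mult_single single_add)

lemma laurent_power_0 [simp]: "laurent_power i 0 = 1"
  by (simp add: laurent_power_def)

lemma laurent_power_nat: "laurent_power i (int n) = laurent_var i ^ n"
proof (induction n)
  case (Suc n)
  have "laurent_power i (int (Suc n)) = laurent_power i (1 + int n)" by simp
  then show ?case using Suc by (simp only: laurent_power_add power_Suc)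
qed simp

lemma monomial_prod:
  assumes "keys m \<subseteq> V"
  shows "single m (1::complex) = (\<Prod>i\<in>V. laurent_power i (lookup m i))"
proof -
  have *: "(\<Prod>i\<in>A. laurent_power i (f i)) = single (\<Sum>i\<in>A. single i (f i)) 1" for A f
    by (induction A rule: infinite_finite_induct) (auto simp: laurent_power_def mult_single)
  have "m = (\<Sum>i\<in>V. single i (lookup m i))"
  proof (rule poly_mapping_eqI)
    fix j
    show "lookup m j = lookup (\<Sum>i\<in>V. single i (lookup m i)) j"
      using assms by (cases "j \<in> V") (auto simp: lookup_sum lookup_single when_def in_keys_iff)
  qed
  then show ?thesis unfolding * by simp
qed

lemma L_induct [consumes 1, case_names zero mono add]:
  assumes "p \<in> L" "P 0"
    and "\<And>m c. keys m \<subseteq> V \<Longrightarrow> P (scalar c * single m 1)"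
    and "\<And>p q. P p \<Longrightarrow> P q \<Longrightarrow> P (p + q)"
  shows "P p"
proof (rule poly_mapping_induct_keys[of P p])
  fix m and a :: complex assume "m \<in> keys p"
  then have "P (scalar a * single m 1)" using assms(1) by (intro assms(3)) (auto simp: L_def)
  then show "P (single m a)" by (simp add: scalar_def mult_single)
qed (use assms in auto)

lemma Lring_cring: "cring Lring"
proof (rule cringI)
  show "abelian_group Lring"
  proof (rule abelian_groupI)
    show "\<exists>y\<in>carrier Lring. y \<oplus>\<^bsub>Lring\<^esub> x = \<zero>\<^bsub>Lring\<^esub>" if "x \<in> carrier Lring" for x
      using that L.uminus_in by (intro bexI[of _ "- x"]) auto
  qed (auto simp: ac_simps)
  show "comm_monoid Lring" by (rule comm_monoidI) (auto simp: ac_simps)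
qed (simp add: distrib_right)

lemma Lring_a_inv: "x \<in> L \<Longrightarrow> \<ominus>\<^bsub>Lring\<^esub> x = - x"
  by (rule abelian_group.minus_equality[OF ring.is_abelian_group[OF cring.axioms(1)[OF Lring_cring]]])
    (simp_all add: L.uminus_in)

lemma ideal_rel_ideal: "ideal I Lring \<longleftrightarrow> rel_ideal L I"
proof
  assume I: "ideal I Lring"
  then have sub: "additive_subgroup I Lring" by (rule ideal.axioms(1))
  have "I \<subseteq> L" using additive_subgroup.a_subset[OF sub] by simp
  moreover have "0 \<in> I" using additive_subgroup.zero_closed[OF sub] by simp
  moreover have "\<And>a b. a \<in> I \<Longrightarrow> b \<in> I \<Longrightarrow> a + b \<in> I" using additive_subgroup.a_closed[OF sub] by simp
  moreover have "\<And>r a. r \<in> L \<Longrightarrow> a \<in> I \<Longrightarrow> r * a \<in> I" using ideal.I_l_closed[OF I] by simp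
  ultimately show "rel_ideal L I" by (simp add: rel_ideal_def)
next
  assume I: "rel_ideal L I"
  then interpret I: subalgebra_ideal L scalar I by (rule L.ideal_locale)
  show "ideal I Lring"
  proof (rule idealI)
    show "ring Lring" using Lring_cring by (rule cring.axioms)
    show "subgroup I (add_monoid Lring)"
    proof
      show "inv\<^bsub>add_monoid Lring\<^esub> x \<in> I" if "x \<in> I" for x
        using Lring_a_inv[OF I.ideal_sub[OF that]] I.ideal_uminus[OF that] by (simp add: a_inv_def)
    qed (use I.ideal_sub I.ideal_add I.ideal_zero in auto)
  qed (simp_all add: I.ideal_mult I.ideal_mult')
qed

end

context fan_basis begin

definition U_gens where
  "U_gens = {\<Prod>i\<in>I. (1 - laurent_var i) | I. I \<subseteq> V \<and> convex_cone hull (gen X ` I) \<notin> cones X}"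

definition V_gens where
  "V_gens = {(\<Prod>i\<in>V. laurent_power i \<lfloor>f (v i)\<rfloor>) - scalar (exp (two_pi_i * dual_ext f \<beta>)) | f. f \<in> dual_lattice N}"

abbreviation UV where "UV \<equiv> UV_ideal X \<beta>"

lemma gens_sub: "U_gens \<subseteq> L" "V_gens \<subseteq> L"
proof -
  show "U_gens \<subseteq> L" unfolding U_gens_def
  proof clarify
    fix I assume "I \<subseteq> V"
    then show "(\<Prod>i\<in>I. 1 - laurent_var i) \<in> L" using laurent_power_in by (intro L.prod_in L.diff_in) auto
  qed
  show "V_gens \<subseteq> L" unfolding V_gens_def
    by (auto intro!: L.diff_in L.prod_in laurent_power_in)
qed

lemma UV_props: "rel_ideal L UV" "U_gens \<subseteq> UV" "V_gens \<subseteq> UV"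
  and UV_minimal: "rel_ideal L K \<Longrightarrow> U_gens \<subseteq> K \<Longrightarrow> V_gens \<subseteq> K \<Longrightarrow> UV \<subseteq> K"
proof -
  interpret R: cring Lring by (rule Lring_cring)
  have U: "U_ideal X = genideal Lring U_gens" and V: "V_ideal X \<beta> = genideal Lring V_gens"
    by (simp_all add: U_ideal_def V_ideal_def U_gens_def V_gens_def)
  have iU: "ideal (U_ideal X) Lring" and iV: "ideal (V_ideal X \<beta>) Lring"
    unfolding U V by (rule R.genideal_ideal, use gens_sub in simp)+
  have sU: "U_gens \<subseteq> U_ideal X" and sV: "V_gens \<subseteq> V_ideal X \<beta>"
    unfolding U V by (rule R.genideal_self, use gens_sub in simp)+
  have UVs: "UV = {a + b | a b. a \<in> U_ideal X \<and> b \<in> V_ideal X \<beta>}"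
    by (auto simp: UV_ideal_def set_add_def set_mult_def)
  show "rel_ideal L UV" using R.add_ideals[OF iU iV] unfolding UV_ideal_def ideal_rel_ideal .
  have z: "0 \<in> U_ideal X" "0 \<in> V_ideal X \<beta>" using iU iV unfolding ideal_rel_ideal rel_ideal_def by auto
  show "U_gens \<subseteq> UV"
  proof
    fix x assume "x \<in> U_gens"
    then show "x \<in> UV" unfolding UVs using sU z by (intro CollectI exI[of _ x] exI[of _ 0]) auto
  qed
  show "V_gens \<subseteq> UV"
  proof
    fix x assume "x \<in> V_gens"
    then show "x \<in> UV" unfolding UVs using sV z by (intro CollectI exI[of _ 0] exI[of _ x]) auto
  qed
  assume K: "rel_ideal L K" "U_gens \<subseteq> K" "V_gens \<subseteq> K"
  then have "U_ideal X \<subseteq> K" "V_ideal X \<beta> \<subseteq> K"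
    unfolding U V ideal_rel_ideal[symmetric] using R.genideal_minimal by blast+
  then show "UV \<subseteq> K" unfolding UVs using K(1) unfolding rel_ideal_def by blast
qed

sublocale UV: subalgebra_ideal L scalar UV
  by (rule L.ideal_locale[OF UV_props(1)])

lemma nonface_in_UV: "D \<subseteq> V \<Longrightarrow> \<not> faceset D \<Longrightarrow> (\<Prod>i\<in>D. (1 - laurent_var i)) \<in> UV"
  using UV_props(2) faceset_iff_hull unfolding U_gens_def by blast

lemma dual_in_UV: "f \<in> dual_lattice N \<Longrightarrow>
   (\<Prod>i\<in>V. laurent_power i \<lfloor>f (v i)\<rfloor>) - scalar (exp (two_pi_i * dual_ext f \<beta>)) \<in> UV"
  using UV_props(3) unfolding V_gens_def by blast

lemma laurent_power_cong_one:
  assumes "rel_ideal L K" "i \<in> V" "1 - laurent_var i \<in> K"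
  shows "laurent_power i a - 1 \<in> K"
proof -
  interpret K: subalgebra_ideal L scalar K by (rule L.ideal_locale[OF assms(1)])
  have pow: "laurent_var i ^ n - 1 \<in> K" for n
    using K.cong_power[of "laurent_var i" 1 n] K.cong_sym[OF assms(3)] laurent_power_in[OF assms(2)] by auto
  show ?thesis
  proof (cases "a \<ge> 0")
    case True
    then show ?thesis using pow[of "nat a"] laurent_power_nat[of i "nat a"] by simp
  next
    case False
    have "laurent_power i a * laurent_var i ^ nat (- a) = 1"
      using False laurent_power_add[of i a "- a"] laurent_power_nat[of i "nat (- a)"] by simp
    then have "laurent_power i a - 1 = - (laurent_power i a * (laurent_var i ^ nat (- a) - 1))"
      by (simp add: right_diff_distrib)
    then show ?thesis using pow[of "nat (- a)"] laurent_power_in[OF assms(2)]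
      by (simp only:) (intro K.ideal_uminus K.ideal_mult)
  qed
qed

text \<open>
  If \<open>R\<^sub>i = 1\<close> for all \<open>v\<^sub>i\<close> outside \<open>\<sigma>\<close>, the relation of \<open>V\<close> for a functional that is \<open>q\<close> at \<open>v\<^sub>j\<close> and \<open>0\<close>
  at the other generators of \<open>\<sigma>\<close> reads \<open>R\<^sub>j\<^sup>q = c\<close>.
\<close>

lemma cone_polynomial:
  assumes "\<sigma> \<in> cones X" "j \<in> V"
  shows "\<exists>(q::nat) \<rho>. \<forall>K. rel_ideal L K \<longrightarrow> UV \<subseteq> K \<longrightarrow> (\<forall>i\<in>V - rays \<sigma>. 1 - laurent_var i \<in> K) \<longrightarrow>
     (\<Prod>i<q. laurent_var j - scalar (\<rho> i)) \<in> K"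
proof (cases "j \<in> rays \<sigma>")
  case False
  have "(\<Prod>i<1::nat. laurent_var j - scalar 1) \<in> K"
    if K: "rel_ideal L K" "\<forall>i\<in>V - rays \<sigma>. 1 - laurent_var i \<in> K" for K
  proof -
    interpret K: subalgebra_ideal L scalar K by (rule L.ideal_locale[OF K(1)])
    have "1 - laurent_var j \<in> K" using K(2) assms(2) False by blast
    then show ?thesis using K.cong_sym by (simp add: One_nat_def)
  qed
  then show ?thesis by (intro exI[of _ "1::nat"] exI[of _ "\<lambda>_. 1"]) blast
next
  case True
  obtain f and q :: nat where f: "f \<in> dual_lattice N" and q: "q > 0" "f (v j) = of_nat q" "\<forall>i\<in>rays \<sigma> - {j}. f (v i) = 0"
    using dual_functional[OF assms(1) True] by blast
  define c where "c = exp (two_pi_i * dual_ext f \<beta>)"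
  obtain \<rho> where \<rho>: "laurent_var j ^ q - scalar c = (\<Prod>i<q. laurent_var j - scalar (\<rho> i))"
    using L.power_minus_const_splits[OF q(1)] by blast
  have "laurent_var j ^ q - scalar c \<in> K"
    if K: "rel_ideal L K" "UV \<subseteq> K" "\<forall>i\<in>V - rays \<sigma>. 1 - laurent_var i \<in> K" for K
  proof -
    interpret K: subalgebra_ideal L scalar K by (rule L.ideal_locale[OF K(1)])
    have "(\<Prod>i\<in>V. laurent_power i \<lfloor>f (v i)\<rfloor>) - (\<Prod>i\<in>V. if i = j then laurent_var j ^ q else 1) \<in> K"
    proof (rule K.cong_prod)
      fix i assume i: "i \<in> V"
      show "laurent_power i \<lfloor>f (v i)\<rfloor> - (if i = j then laurent_var j ^ q else 1) \<in> K"
      proof (cases "i = j")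
        case True
        then show ?thesis using q laurent_power_nat[of j q] by simp
      next
        case False
        show ?thesis
        proof (cases "i \<in> rays \<sigma>")
          case True
          then show ?thesis using q(3) False by simp
        next
          case False
          then show ?thesis using laurent_power_cong_one[OF K(1) i] K(3) i \<open>i \<noteq> j\<close> by simp
        qed
      qed
    qed (use laurent_power_in assms(2) in auto)
    also have "(\<Prod>i\<in>V. if i = j then laurent_var j ^ q else 1) = laurent_var j ^ q"
      using assms(2) by simp
    finally have "(\<Prod>i\<in>V. laurent_power i \<lfloor>f (v i)\<rfloor>) - laurent_var j ^ q \<in> K" .
    moreover have "(\<Prod>i\<in>V. laurent_power i \<lfloor>f (v i)\<rfloor>) - scalar c \<in> K" using dual_in_UV[OF f] K(2) unfolding c_def by blast
    ultimately show ?thesis using K.cong_trans K.cong_sym by blast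
  qed
  then show ?thesis unfolding \<rho> by blast
qed

text \<open>The product over all maximal cones of the polynomials for the single cones, by \<open>transversal_prod\<close>.\<close>

lemma finite_spectrum:
  assumes "j \<in> V"
  shows "\<exists>(S :: ('v set \<times> nat) set) \<rho>. finite S \<and> (\<Prod>s\<in>S. laurent_var j - scalar (\<rho> s)) \<in> UV"
proof -
  have "\<forall>\<sigma>\<in>maximal_cones X. \<exists>q \<rho>. \<forall>K. rel_ideal L K \<longrightarrow> UV \<subseteq> K \<longrightarrow> (\<forall>i\<in>V - rays \<sigma>. 1 - laurent_var i \<in> K) \<longrightarrow>
     (\<Prod>i<q::nat. laurent_var j - scalar (\<rho> i)) \<in> K"
    using cone_polynomial[OF maximal_cone assms] by blast
  then obtain q :: "'v set \<Rightarrow> nat" and \<rho> where q: "\<And>\<sigma> K. \<sigma> \<in> maximal_cones X \<Longrightarrow> rel_ideal L K \<Longrightarrow> UV \<subseteq> K \<Longrightarrow>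
      (\<forall>i\<in>V - rays \<sigma>. 1 - laurent_var i \<in> K) \<Longrightarrow> (\<Prod>i<q \<sigma>. laurent_var j - scalar (\<rho> \<sigma> i)) \<in> K"
    by metis
  have "(\<Prod>\<sigma>\<in>maximal_cones X. \<Prod>i<q \<sigma>. laurent_var j - scalar (\<rho> \<sigma> i)) \<in> UV"
  proof (rule L.transversal_prod[where J = UV and V = V and y = "\<lambda>i. 1 - laurent_var i" and I = rays])
    show "(\<Prod>i\<in>D. 1 - laurent_var i) \<in> UV" if "D \<subseteq> V" "\<And>\<sigma>. \<sigma> \<in> maximal_cones X \<Longrightarrow> \<not> D \<subseteq> rays \<sigma>" for D
      by (rule nonface_in_UV[OF that(1)]) (use that(2) in \<open>auto simp: faceset_def\<close>)
    show "(\<Prod>i<q \<sigma>. laurent_var j - scalar (\<rho> \<sigma> i)) \<in> L" for \<sigma>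
      using laurent_power_in[OF assms] by (intro L.prod_in L.diff_in L.iota_in)
  qed (use finite_maximal UV_props q laurent_power_in in auto)
  then have "(\<Prod>s\<in>Sigma (maximal_cones X) (\<lambda>\<sigma>. {..<q \<sigma>}). laurent_var j - scalar (\<rho> (fst s) (snd s))) \<in> UV"
    using finite_maximal by (simp add: prod.Sigma case_prod_beta)
  then show ?thesis using finite_maximal
    by (intro exI[of _ "Sigma (maximal_cones X) (\<lambda>\<sigma>. {..<q \<sigma>})"] exI[of _ "\<lambda>s. \<rho> (fst s) (snd s)"]) auto
qed

abbreviation eval where "eval \<equiv> laurent_eval (nrays X)"

lemma eval_lin_ext: "eval r p = lin_ext (\<lambda>c m. c * (\<Prod>i\<in>V. r i powi lookup m i)) p"
  by (simp add: laurent_eval_def lin_ext_def)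

sublocale ev: additive_coeff "\<lambda>c m. c * (\<Prod>i\<in>V. r i powi lookup m i) :: complex" for r
  by unfold_locales (simp add: distrib_right)

lemma eval_add: "eval r (p + q) = eval r p + eval r q" and eval_diff: "eval r (p - q) = eval r p - eval r q"
  and eval_single: "eval r (single m c) = c * (\<Prod>i\<in>V. r i powi lookup m i)"
  and eval_0 [simp]: "eval r 0 = 0"
  by (simp_all add: eval_lin_ext)

lemma eval_scalar [simp]: "eval r (scalar c) = c"
  by (simp add: scalar_def eval_single)

lemma eval_1 [simp]: "eval r 1 = 1"
  using eval_single[of r 0 1] by simp

lemma eval_mult:
  assumes "\<And>i. i \<in> V \<Longrightarrow> r i \<noteq> 0"
  shows "eval r (p * q) = eval r p * eval r q"
  by (rule laurent_eval_mult) (rule assms)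

lemma eval_laurent_power: "i \<in> V \<Longrightarrow> eval r (laurent_power i a) = r i powi a"
proof -
  assume "i \<in> V"
  have "(\<Prod>j\<in>V. r j powi lookup (single i a) j) = (\<Prod>j\<in>V. if j = i then r i powi a else 1)"
    by (rule prod.cong) (auto simp: lookup_single when_def)
  then show ?thesis using \<open>i \<in> V\<close> by (simp add: laurent_power_def eval_single)
qed

lemma eval_prod:
  assumes "\<And>i. i \<in> V \<Longrightarrow> r i \<noteq> 0"
  shows "eval r (prod f A) = (\<Prod>i\<in>A. eval r (f i))"
proof -
  have "eval r (p * q) = eval r p * eval r q" for p q by (rule eval_mult) (rule assms)
  then show ?thesis by (induction A rule: infinite_finite_induct) auto
qed

lemma cong_eval:
  assumes K: "rel_ideal L K" and r: "\<And>i. i \<in> V \<Longrightarrow> laurent_var i - scalar (r i) \<in> K" and nz: "\<And>i. i \<in> V \<Longrightarrow> r i \<noteq> 0"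
    and "p \<in> L"
  shows "p - scalar (eval r p) \<in> K"
proof -
  interpret K: subalgebra_ideal L scalar K by (rule L.ideal_locale[OF K])
  have pw: "laurent_power i a - scalar (r i powi a) \<in> K" if i: "i \<in> V" for i a
  proof -
    have pow: "laurent_var i ^ n - scalar (r i ^ n) \<in> K" for n
      unfolding L.iota_power using r[OF i] laurent_power_in[OF i] by (intro K.cong_power) auto
    show ?thesis
    proof (cases "a \<ge> 0")
      case True
      then show ?thesis using pow[of "nat a"] laurent_power_nat[of i "nat a"] by (simp add: power_int_def)
    next
      case False
      let ?n = "nat (- a)"
      have 1: "laurent_power i a * laurent_var i ^ ?n = 1"
        using False laurent_power_add[of i a "- a"] laurent_power_nat[of i ?n] by simp
      have 2: "scalar (r i powi a) * scalar (r i ^ ?n) = (1 :: laurent)"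
        using False nz[OF i] unfolding L.iota_mult[symmetric] by (simp add: power_int_def flip: power_mult_distrib)
      have "laurent_power i a - scalar (r i powi a)
          = laurent_power i a * (scalar (r i powi a) * scalar (r i ^ ?n)) - scalar (r i powi a) * (laurent_power i a * laurent_var i ^ ?n)"
        by (simp only: 1 2 mult_1_right)
      also have "\<dots> = - (laurent_power i a * scalar (r i powi a) * (laurent_var i ^ ?n - scalar (r i ^ ?n)))"
        by (simp add: algebra_simps)
      finally show ?thesis using pow[of ?n] laurent_power_in[OF i]
        by (simp only:) (intro K.ideal_uminus K.ideal_mult L.mult_in L.iota_in)
    qed
  qed
  show ?thesis using \<open>p \<in> L\<close>
  proof (induction p rule: L_induct)
    case (mono m c)
    have "single m 1 - scalar (\<Prod>i\<in>V. r i powi lookup m i) \<in> K"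
      unfolding monomial_prod[OF mono] L.iota_prod using pw laurent_power_in by (intro K.cong_prod) auto
    then have "scalar c * (single m 1 - scalar (\<Prod>i\<in>V. r i powi lookup m i)) \<in> K" by auto
    moreover have "eval r (scalar c * single m 1) = c * (\<Prod>i\<in>V. r i powi lookup m i)"
      by (simp add: scalar_def mult_single eval_single)
    ultimately show ?case by (simp add: right_diff_distrib L.iota_mult)
  next
    case (add p q)
    then show ?case using K.ideal_add[OF add] by (simp add: eval_add L.iota_add algebra_simps)
  qed simp
qed

text \<open>
  A proper ideal above \<open>U + V\<close> could be enlarged to a proper ideal that contains \<open>R\<^sub>i - r\<^sub>i\<close> for all \<open>i\<close>,
  hence the value at \<open>r\<close> of each of its elements.  The \<open>r\<^sub>i\<close> are nonzero because the \<open>R\<^sub>i\<close> are invertible.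
\<close>

lemma nullstellensatz:
  assumes J: "rel_ideal L J" "UV \<subseteq> J"
    and pts: "\<And>r. (\<And>i. i \<in> V \<Longrightarrow> r i \<noteq> 0) \<Longrightarrow> \<exists>u\<in>J. eval r u \<noteq> 0"
  shows "1 \<in> J"
proof (rule ccontr)
  assume "1 \<notin> J"
  obtain S :: "nat \<Rightarrow> ('v set \<times> nat) set" and \<rho> where S: "\<And>j. j \<in> V \<Longrightarrow> finite (S j)"
      "\<And>j. j \<in> V \<Longrightarrow> (\<Prod>s\<in>S j. laurent_var j - scalar (\<rho> j s)) \<in> UV"
    using finite_spectrum by metis
  have "\<exists>J' p. rel_ideal L J' \<and> J \<subseteq> J' \<and> 1 \<notin> J' \<and> (\<forall>j\<in>V. laurent_var j - scalar (p j) \<in> J')"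
    by (rule L.exists_point[where S = S and rt = \<rho>]) (use J \<open>1 \<notin> J\<close> S laurent_power_in in auto)
  then obtain K r where K: "rel_ideal L K" "J \<subseteq> K" "1 \<notin> K" "\<And>j. j \<in> V \<Longrightarrow> laurent_var j - scalar (r j) \<in> K"
    by blast
  interpret K: subalgebra_ideal L scalar K by (rule L.ideal_locale[OF K(1)])
  have nz: "r i \<noteq> 0" if i: "i \<in> V" for i
  proof
    assume "r i = 0"
    then have "laurent_var i \<in> K" using K(4)[OF i] by simp
    then have "laurent_power i (-1) * laurent_var i \<in> K" using laurent_power_in[OF i] by (intro K.ideal_mult)
    then show False using K(3) by (simp flip: laurent_power_add)
  qed
  obtain u where u: "u \<in> J" "eval r u \<noteq> 0" using pts nz by blast
  have "u - scalar (eval r u) \<in> K" using u J(1) K(2) K.ideal_sub by (intro cong_eval K(1,4) nz) blast+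
  then have "scalar (eval r u) \<in> K" using u(1) K(2) K.cong_in_iff by blast
  then have "scalar (1 / eval r u) * scalar (eval r u) \<in> K" by auto
  then show False using K(3) u(2) by (simp flip: L.iota_mult)
qed

lemma exp_2pi_eq_1: "exp (two_pi_i * a) = 1 \<longleftrightarrow> a \<in> \<int>"
proof
  assume "exp (two_pi_i * a) = 1"
  then have "Im a = 0" "\<exists>n::int. 2 * pi * Re a = of_int (2 * n) * pi"
    unfolding exp_eq_1 by auto
  then obtain n :: int where "Im a = 0" "Re a = of_int n" by auto
  then have "a = of_int n" by (simp add: complex_eq_iff)
  then show "a \<in> \<int>" by simp
next
  assume "a \<in> \<int>"
  then obtain n where "a = of_int n" using Ints_cases by blast
  then show "exp (two_pi_i * a) = 1" unfolding exp_eq_1 by (auto intro!: exI[of _ n])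
qed

lemma dual_ext_lin_comb:
  assumes "linear f" shows "dual_ext f (lin_comb X \<alpha>) = (\<Sum>i\<in>V. \<alpha> i * of_real (f (v i)))"
  using assms unfolding dual_ext_def lin_comb_def complex_eq_iff
  by (simp add: linear_sum linear_cmul)

lemma dual_ext_shift:
  assumes "linear f" shows "dual_ext f (of_lat n + b) = of_real (f n) + dual_ext f b"
  using assms unfolding dual_ext_def of_lat_def complex_eq_iff
  by (simp add: linear_add linear_0)

text \<open>The integer \<open>f(\<Sum> \<alpha>\<^sub>i v\<^sub>i - \<beta>)\<close> disappears in the exponential.\<close>

lemma exp_2pi_dual:
  assumes \<alpha>: "\<alpha> \<in> BoxX" and f: "f \<in> dual_lattice N"
  shows "exp (two_pi_i * (\<Sum>i\<in>V. \<alpha> i * of_int \<lfloor>f (v i)\<rfloor>)) = exp (two_pi_i * dual_ext f \<beta>)"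
proof -
  obtain n where n: "n \<in> N" "lin_comb X \<alpha> = of_lat n + \<beta>" using \<alpha> unfolding Box_iff by blast
  obtain z where z: "f n = of_int z" using dual_int[OF f n(1)] Ints_cases by blast
  have "(\<Sum>i\<in>V. \<alpha> i * of_int \<lfloor>f (v i)\<rfloor>) = (\<Sum>i\<in>V. \<alpha> i * of_real (f (v i)))"
  proof (rule sum.cong[OF refl])
    fix i assume "i \<in> V"
    then have "(of_real (of_int \<lfloor>f (v i)\<rfloor>) :: complex) = of_real (f (v i))" using dual_floor[OF f gen_lat] by presburger
    then show "\<alpha> i * of_int \<lfloor>f (v i)\<rfloor> = \<alpha> i * of_real (f (v i))" by simp
  qed
  also have "\<dots> = of_int z + dual_ext f \<beta>"
    using dual_ext_lin_comb[OF dual_linear[OF f]] dual_ext_shift[OF dual_linear[OF f]] n(2) z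
    by (metis of_real_of_int_eq)
  finally have "exp (two_pi_i * (\<Sum>i\<in>V. \<alpha> i * of_int \<lfloor>f (v i)\<rfloor>))
     = exp (two_pi_i * of_int z) * exp (two_pi_i * dual_ext f \<beta>)"
    by (simp add: distrib_left exp_add)
  moreover have "exp (two_pi_i * of_int z) = 1"
    by (simp only: exp_2pi_eq_1 Ints_of_int)
  ultimately show ?thesis by simp
qed

lemma K_point_nz: "K_point \<alpha> i \<noteq> 0" by (simp add: K_point_def)

lemma K_point_powi: "K_point \<alpha> i powi a = exp (two_pi_i * (\<alpha> i * of_int a))"
  by (simp add: K_point_def exp_power_int ac_simps)

lemma eval_UV: 
  assumes \<alpha>: "\<alpha> \<in> BoxX" and u: "u \<in> UV"
  shows "eval (K_point \<alpha>) u = 0"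
proof -
  have "UV \<subseteq> {p \<in> L. eval (K_point \<alpha>) p = 0}"
  proof (rule UV_minimal)
    show "rel_ideal L {p \<in> L. eval (K_point \<alpha>) p = 0}"
      by (auto simp: rel_ideal_def eval_add eval_mult K_point_nz)
    show "U_gens \<subseteq> {p \<in> L. eval (K_point \<alpha>) p = 0}"
    proof
      fix p assume p: "p \<in> U_gens"
      then obtain I where I: "p = (\<Prod>i\<in>I. 1 - laurent_var i)" "I \<subseteq> V" "\<not> faceset I"
        unfolding U_gens_def using faceset_iff_hull by blast
      have "\<not> I \<subseteq> supp \<alpha>" using I(3) \<alpha> faceset_mono unfolding Box_iff by blast
      then obtain i where i: "i \<in> I" "\<alpha> i = 0" unfolding supp_def by blast
      have "finite I" using I(2) finite_subset by blast
      have "eval (K_point \<alpha>) (1 - laurent_var i) = 0"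
        using i I(2) by (simp add: eval_diff eval_laurent_power subset_iff K_point_def)
      then have "eval (K_point \<alpha>) p = 0" unfolding I(1) eval_prod[OF K_point_nz] using i \<open>finite I\<close> by auto
      then show "p \<in> {p \<in> L. eval (K_point \<alpha>) p = 0}" using p gens_sub by blast
    qed
    show "V_gens \<subseteq> {p \<in> L. eval (K_point \<alpha>) p = 0}"
    proof
      fix p assume p: "p \<in> V_gens"
      then obtain f where f: "f \<in> dual_lattice N"
        "p = (\<Prod>i\<in>V. laurent_power i \<lfloor>f (v i)\<rfloor>) - scalar (exp (two_pi_i * dual_ext f \<beta>))"
        unfolding V_gens_def by blast
      have "eval (K_point \<alpha>) p = (\<Prod>i\<in>V. K_point \<alpha> i powi \<lfloor>f (v i)\<rfloor>) - exp (two_pi_i * dual_ext f \<beta>)"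
        unfolding f(2) eval_diff eval_prod[OF K_point_nz] by (simp add: eval_laurent_power)
      also have "(\<Prod>i\<in>V. K_point \<alpha> i powi \<lfloor>f (v i)\<rfloor>) = exp (two_pi_i * (\<Sum>i\<in>V. \<alpha> i * of_int \<lfloor>f (v i)\<rfloor>))"
        unfolding K_point_powi by (simp add: sum_distrib_left exp_sum)
      finally have "eval (K_point \<alpha>) p = 0" using exp_2pi_dual[OF \<alpha> f(1)] by simp
      then show "p \<in> {p \<in> L. eval (K_point \<alpha>) p = 0}" using p gens_sub by blast
    qed
  qed
  then show ?thesis using u by blast
qed

lemma exists_log: "z \<noteq> 0 \<Longrightarrow> \<exists>a. exp (two_pi_i * a) = z \<and> 0 \<le> Re a \<and> Re a < 1"
proof -
  assume z: "z \<noteq> 0"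
  define b where "b = Ln z / (two_pi_i)"
  have b: "exp (two_pi_i * b) = z" using z by (simp add: b_def exp_Ln)
  define a where "a = b - of_int \<lfloor>Re b\<rfloor>"
  have "exp (two_pi_i * a) = exp (two_pi_i * b) / exp (two_pi_i * of_int \<lfloor>Re b\<rfloor>)"
    unfolding a_def by (simp add: right_diff_distrib exp_diff)
  moreover have "exp (two_pi_i * of_int \<lfloor>Re b\<rfloor>) = 1"
    by (simp only: exp_2pi_eq_1 Ints_of_int)
  ultimately have "exp (two_pi_i * a) = z" using b by simp
  moreover have "0 \<le> Re a" "Re a < 1" unfolding a_def by (simp_all, linarith)
  ultimately show ?thesis by blast
qed

lemma K_point_eq_1_iff: "\<alpha> \<in> BoxX \<Longrightarrow> K_point \<alpha> i = 1 \<longleftrightarrow> \<alpha> i = 0"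
proof
  assume \<alpha>: "\<alpha> \<in> BoxX" and "K_point \<alpha> i = 1"
  then obtain n where n: "\<alpha> i = of_int n" unfolding K_point_def exp_2pi_eq_1 using Ints_cases by blast
  have "0 \<le> Re (\<alpha> i)" "Re (\<alpha> i) < 1" using \<alpha> unfolding Box_iff by blast+
  then show "\<alpha> i = 0" using n by simp
qed (simp add: K_point_def)

lemma K_point_inj:
  assumes "\<alpha> \<in> BoxX" "\<alpha>' \<in> BoxX" "\<And>i. i \<in> V \<Longrightarrow> K_point \<alpha> i = K_point \<alpha>' i"
  shows "\<alpha> = \<alpha>'"
proof
  fix i
  show "\<alpha> i = \<alpha>' i"
  proof (cases "i \<in> V")
    case True
    have "exp (two_pi_i * (\<alpha> i - \<alpha>' i)) = 1"
      using assms(3)[OF True] by (simp add: K_point_def right_diff_distrib exp_diff)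
    then obtain n where n: "\<alpha> i - \<alpha>' i = of_int n" unfolding exp_2pi_eq_1 using Ints_cases by blast
    have "0 \<le> Re (\<alpha> i)" "Re (\<alpha> i) < 1" "0 \<le> Re (\<alpha>' i)" "Re (\<alpha>' i) < 1" using assms unfolding Box_iff by blast+
    moreover have "Re (\<alpha> i) - Re (\<alpha>' i) = of_int n" using n by (metis Re_complex_of_real minus_complex.sel(1) of_real_of_int_eq)
    ultimately have "of_int n < (1::real)" "of_int n > (-1::real)" by linarith+
    then have "n = 0" by simp
    then show ?thesis using n by simp
  next
    case False
    then have "i \<notin> supp \<alpha>" "i \<notin> supp \<alpha>'" using assms(1,2) faceset_sub unfolding Box_iff by blast+
    then show ?thesis by (simp add: supp_def)
  qed
qed

text \<open>
  By \<open>U\<close> the indices with \<open>r\<^sub>i \<noteq> 1\<close> form a face.  By \<open>V\<close> all integral functionals take integral values at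
  \<open>\<Sum> \<alpha>\<^sub>i v\<^sub>i - \<beta>\<close>, where \<open>\<alpha>\<close> consists of the normalized logarithms of the \<open>r\<^sub>i\<close>; so this vector is a lattice point.
\<close>

lemma points_in_Box:
  assumes nz: "\<And>i. i \<in> V \<Longrightarrow> r i \<noteq> 0" and zero: "\<And>u. u \<in> UV \<Longrightarrow> eval r u = 0"
  shows "\<exists>\<alpha>\<in>BoxX. \<forall>i\<in>V. K_point \<alpha> i = r i"
proof -
  have ep: "eval r (prod h A) = (\<Prod>i\<in>A. eval r (h i))" for h and A :: "nat set" by (rule eval_prod) (rule nz)
  define a where "a i = (if i \<in> V then if r i = 1 then 0 else (SOME a. exp (two_pi_i * a) = r i \<and> 0 \<le> Re a \<and> Re a < 1) else 0)" for i
  have a: "exp (two_pi_i * a i) = r i \<and> 0 \<le> Re (a i) \<and> Re (a i) < 1" if "i \<in> V" for i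
    using someI_ex[OF exists_log[OF nz[OF that]]] that by (simp add: a_def)
  have supp: "supp a \<subseteq> {i \<in> V. r i \<noteq> 1}" by (auto simp: supp_def a_def)
  have face: "faceset {i \<in> V. r i \<noteq> 1}"
  proof (rule ccontr)
    assume "\<not> faceset {i \<in> V. r i \<noteq> 1}"
    then have "eval r (\<Prod>i\<in>{i \<in> V. r i \<noteq> 1}. (1 - laurent_var i)) = 0" by (intro zero nonface_in_UV) auto
    moreover have "eval r (\<Prod>i\<in>{i \<in> V. r i \<noteq> 1}. (1 - laurent_var i)) = (\<Prod>i\<in>{i \<in> V. r i \<noteq> 1}. 1 - r i)"
      unfolding ep by (rule prod.cong) (auto simp: eval_diff eval_laurent_power)
    ultimately show False by (auto simp: prod_zero_iff)
  qed
  define w where "w = lin_comb X a - \<beta>"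
  have int: "dual_ext f w \<in> \<int>" if f: "f \<in> dual_lattice N" for f
  proof -
    have lin: "linear f" using dual_linear[OF f] .
    have "0 = (\<Prod>i\<in>V. r i powi \<lfloor>f (v i)\<rfloor>) - exp (two_pi_i * dual_ext f \<beta>)"
      using zero[OF dual_in_UV[OF f]] unfolding eval_diff ep by (simp add: eval_laurent_power)
    also have "(\<Prod>i\<in>V. r i powi \<lfloor>f (v i)\<rfloor>) = (\<Prod>i\<in>V. exp (two_pi_i * (a i * of_real (f (v i)))))"
    proof (rule prod.cong[OF refl])
      fix i assume i: "i \<in> V"
      have e: "(of_int \<lfloor>f (v i)\<rfloor> :: complex) = of_real (f (v i))" using dual_floor[OF f gen_lat[OF i]] by (metis of_real_of_int_eq)
      have "r i powi \<lfloor>f (v i)\<rfloor> = exp (two_pi_i * a i) powi \<lfloor>f (v i)\<rfloor>" using a[OF i] by simp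
      also have "\<dots> = exp (two_pi_i * (a i * of_real (f (v i))))" by (simp add: exp_power_int e[symmetric] ac_simps)
      finally show "r i powi \<lfloor>f (v i)\<rfloor> = exp (two_pi_i * (a i * of_real (f (v i))))" .
    qed
    also have "\<dots> = exp (two_pi_i * dual_ext f (lin_comb X a))"
      unfolding dual_ext_lin_comb[OF lin] by (simp add: sum_distrib_left exp_sum)
    finally have "exp (two_pi_i * (dual_ext f (lin_comb X a) - dual_ext f \<beta>)) = 1"
      by (simp add: right_diff_distrib exp_diff)
    moreover have "dual_ext f (lin_comb X a) - dual_ext f \<beta> = dual_ext f w"
      unfolding w_def dual_ext_def complex_eq_iff using lin by (simp add: linear_diff)
    ultimately show ?thesis by (simp add: exp_2pi_eq_1)
  qed
  have "fst w \<in> N"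
  proof (rule dual_separates(1))
    fix f assume "f \<in> dual_lattice N"
    then obtain n where "dual_ext f w = of_int n" using int Ints_cases by blast
    then show "f (fst w) \<in> \<int>" by (simp add: dual_ext_def complex_eq_iff)
  qed
  moreover have "snd w = 0"
  proof (rule dual_separates(2))
    fix f assume "f \<in> dual_lattice N"
    then obtain n where "dual_ext f w = of_int n" using int Ints_cases by blast
    then show "f (snd w) = 0" by (simp add: dual_ext_def complex_eq_iff)
  qed
  ultimately have "fst w \<in> N" "lin_comb X a = of_lat (fst w) + \<beta>"
    unfolding of_lat_def w_def by (auto simp: prod_eq_iff)
  moreover have "0 \<le> Re (a i) \<and> Re (a i) < 1" for i
    using a[of i] by (cases "i \<in> V") (auto simp: a_def)
  ultimately have "a \<in> BoxX" unfolding Box_iff using faceset_mono[OF face supp] by blast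
  moreover have "\<forall>i\<in>V. K_point a i = r i" using a by (simp add: K_point_def)
  ultimately show ?thesis by blast
qed

text \<open>
  A box element is determined by its point, and the coordinates of the point are among the finitely many roots
  from \<open>finite_spectrum\<close>.
\<close>

lemma finite_Box: "finite (BoxX)"
proof -
  obtain S :: "nat \<Rightarrow> ('v set \<times> nat) set" and \<rho> where S: "\<And>j. j \<in> V \<Longrightarrow> finite (S j)"
      "\<And>j. j \<in> V \<Longrightarrow> (\<Prod>s\<in>S j. laurent_var j - scalar (\<rho> j s)) \<in> UV"
    using finite_spectrum by metis
  let ?F = "\<lambda>\<alpha>. restrict (K_point \<alpha>) V"
  have "K_point \<alpha> j \<in> \<rho> j ` S j" if "\<alpha> \<in> BoxX" "j \<in> V" for \<alpha> j
  proof -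
    have "eval (K_point \<alpha>) (\<Prod>s\<in>S j. laurent_var j - scalar (\<rho> j s)) = 0" using eval_UV[OF that(1) S(2)[OF that(2)]] .
    then have "(\<Prod>s\<in>S j. K_point \<alpha> j - \<rho> j s) = 0"
      unfolding eval_prod[OF K_point_nz] by (simp add: eval_diff eval_laurent_power[OF that(2)])
    then show ?thesis using S(1)[OF that(2)] by auto
  qed
  then have "?F ` BoxX \<subseteq> PiE V (\<lambda>j. \<rho> j ` S j)" by auto
  moreover have "finite (PiE V (\<lambda>j. \<rho> j ` S j))" using S(1) by (intro finite_PiE) auto
  ultimately have "finite (?F ` BoxX)" by (rule finite_subset)
  moreover have "inj_on ?F (BoxX)"
  proof (rule inj_onI)
    fix \<alpha> \<alpha>' assume *: "\<alpha> \<in> BoxX" "\<alpha>' \<in> BoxX" "?F \<alpha> = ?F \<alpha>'"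
    have "K_point \<alpha> i = K_point \<alpha>' i" if "i \<in> V" for i using fun_cong[OF *(3), of i] that by simp
    then show "\<alpha> = \<alpha>'" using K_point_inj * by blast
  qed
  ultimately show ?thesis by (rule finite_imageD)
qed

end

section \<open>The exponential substitution\<close>

context fan_basis begin

lemma mvar_prod:
  assumes "finite D"
  shows "\<exists>m. (\<Prod>i\<in>D. mvar i) = single m (1::'a::comm_ring_1) \<and> keys m = D"
  using assms
proof (induction D rule: finite_induct)
  case empty
  then show ?case by (intro exI[of _ 0]) simp
next
  case (insert i D)
  then obtain m where m: "(\<Prod>i\<in>D. mvar i) = single m (1::'a)" "keys m = D" by blast
  have "(\<Prod>i\<in>insert i D. mvar i) = single (single i 1 + m) (1::'a)"
    using insert.hyps m by (simp add: mvar_def mult_single)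
  moreover have "keys (single i 1 + m) = insert i D"
    by (simp add: keys_add_nat m)
  ultimately show ?case by blast
qed

lemma mono_nonface_ideal: "\<not> faceset (keys m \<union> supp \<alpha>) \<Longrightarrow> single m c \<in> nonface_ideal \<alpha>"
  by (auto simp: nonface_ideal_def split: if_splits)

definition exponent_form :: "(nat \<Rightarrow>\<^sub>0 int) \<Rightarrow> complex mpoly" where
  "exponent_form m = (\<Sum>i\<in>V. scalar (of_int (lookup m i)) * mvar i)"

lemma lin_form_scalar: "lin_form f = (\<Sum>i\<in>V. scalar (of_int \<lfloor>f (v i)\<rfloor>) * mvar i)"
  by (simp only: lin_form_def mvar_def scalar_def mult_single add_0 mult_1_right)

lemma mvar_nonface_ideal: "i \<notin> V \<Longrightarrow> mvar i \<in> nonface_ideal \<alpha>"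
proof -
  assume i: "i \<notin> V"
  have "\<not> faceset (keys (single i (1::nat)) \<union> supp \<alpha>)"
  proof
    assume "faceset (keys (single i (1::nat)) \<union> supp \<alpha>)"
    then have "keys (single i (1::nat)) \<union> supp \<alpha> \<subseteq> V" by (rule faceset_sub)
    then show False using i by simp
  qed
  then show ?thesis unfolding mvar_def by (rule mono_nonface_ideal)
qed

text \<open>
  For every maximal cone \<open>\<sigma>\<close>, a multiple of \<open>x\<^sub>i\<close> is modulo a linear form a combination of the \<open>x\<^sub>j\<close> with \<open>v\<^sub>j\<close>
  outside \<open>\<sigma>\<close>; again \<open>transversal_prod\<close> applies.
\<close>

lemma mvar_nilp: "T.nilp \<alpha> (mvar i)"
proof (cases "i \<in> V")
  case False
  then have "mvar i \<in> box_ideal \<alpha>" using mvar_nonface_ideal ideal_parts by blast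
  then show ?thesis by (rule T.ideal_nilp)
next
  case True
  have "(\<Prod>\<sigma>\<in>maximal_cones X. mvar i :: _ \<Rightarrow>\<^sub>0 complex) \<in> box_ideal \<alpha>"
  proof (rule T.transversal_prod[where J = "box_ideal \<alpha>" and V = V and y = mvar and I = rays])
    show "finite (maximal_cones X)" by (rule finite_maximal)
    show "rel_ideal UNIV (box_ideal \<alpha>)" by (rule box_ideal_rel)
    fix \<sigma> K assume \<sigma>: "\<sigma> \<in> maximal_cones X" and K: "rel_ideal UNIV K" "box_ideal \<alpha> \<subseteq> K"
      "\<forall>i\<in>V - rays \<sigma>. mvar i \<in> (K :: (_ \<Rightarrow>\<^sub>0 complex) set)"
    interpret K: subalgebra_ideal UNIV scalar K by (rule T.ideal_locale[OF K(1)])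
    show "mvar i \<in> K"
    proof (cases "i \<in> rays \<sigma>")
      case False
      then show ?thesis using K(3) True by blast
    next
      case i: True
      obtain f and q :: nat where f: "f \<in> dual_lattice N" and q: "q > 0" "f (v i) = of_nat q" "\<forall>j\<in>rays \<sigma> - {i}. f (v j) = 0"
        using dual_functional[OF maximal_cone[OF \<sigma>] i] by blast
      have lf: "lin_form f \<in> K" using lin_form_linear_ideal[OF f] ideal_parts K(2) by blast
      have lfe: "lin_form f = scalar (of_nat q) * mvar i + (\<Sum>j\<in>V - {i}. scalar (of_int \<lfloor>f (v j)\<rfloor>) * mvar j)"
        unfolding lin_form_scalar using True q(2) by (simp add: sum.remove)
      have S: "(\<Sum>j\<in>V - {i}. scalar (of_int \<lfloor>f (v j)\<rfloor>) * mvar j) \<in> K"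
      proof (rule K.ideal_sum)
        fix j assume j: "j \<in> V - {i}"
        show "scalar (of_int \<lfloor>f (v j)\<rfloor>) * mvar j \<in> K"
        proof (cases "j \<in> rays \<sigma>")
          case True
          then have "f (v j) = 0" using q(3) j by blast
          then show ?thesis by simp
        next
          case False
          then have "mvar j \<in> K" using K(3) j by blast
          then show ?thesis by (intro K.ideal_mult) simp_all
        qed
      qed
      have "scalar (of_nat q) * mvar i \<in> K"
        using K.ideal_diff[OF lf S] unfolding lfe by simp
      then have "scalar (1 / of_nat q) * (scalar (of_nat q) * mvar i) \<in> K" by (rule K.ideal_mult[rotated]) simp
      moreover have "scalar (1 / of_nat q) * scalar (of_nat q) = (1 :: complex mpoly)"
        unfolding T.iota_mult[symmetric] using q(1) by simp
      ultimately show ?thesis by (simp flip: mult.assoc)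
    qed
  next
    fix D assume D: "D \<subseteq> V" "\<And>\<sigma>. \<sigma> \<in> maximal_cones X \<Longrightarrow> \<not> D \<subseteq> rays \<sigma>"
    then have "\<not> faceset D" by (auto simp: faceset_def)
    moreover obtain m where "(\<Prod>i\<in>D. mvar i) = single m (1::complex)" "keys m = D"
      using mvar_prod[of D] finite_subset[OF D(1)] by blast
    ultimately have "(\<Prod>i\<in>D. mvar i :: _ \<Rightarrow>\<^sub>0 complex) \<in> nonface_ideal \<alpha>"
      using mono_nonface_ideal[of m \<alpha> 1] faceset_mono[of "D \<union> supp \<alpha>" D] by auto
    then show "(\<Prod>i\<in>D. mvar i :: _ \<Rightarrow>\<^sub>0 complex) \<in> box_ideal \<alpha>" using ideal_parts by blast
  qed simp_all
  then have "(mvar i :: _ \<Rightarrow>\<^sub>0 complex) ^ card (maximal_cones X) \<in> box_ideal \<alpha>" by simp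
  then show ?thesis unfolding T.nilp_def by blast
qed

lemma exponent_form_nilp: "T.nilp \<alpha> (exponent_form m)"
  unfolding exponent_form_def by (intro T.nilp_sum T.nilp_mult mvar_nilp) simp

lemma exponent_form_add: "exponent_form (m + n) = exponent_form m + exponent_form n" and exponent_form_0 [simp]: "exponent_form 0 = 0"
  by (simp_all add: exponent_form_def lookup_add T.iota_add distrib_right sum.distrib)

definition EXP :: "(nat \<Rightarrow> complex) \<Rightarrow> complex mpoly \<Rightarrow> complex mpoly" where
  "EXP \<alpha> x = (SOME a. T.is_exp \<alpha> x a)"

lemma EXP_is_exp: "T.is_exp \<alpha> (exponent_form m) (EXP \<alpha> (exponent_form m))"
  unfolding EXP_def using T.is_exp_exists[OF exponent_form_nilp] by (rule someI_ex)

definition box_char :: "(nat \<Rightarrow> complex) \<Rightarrow> (nat \<Rightarrow>\<^sub>0 int) \<Rightarrow> complex" where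
  "box_char \<alpha> m = exp (two_pi_i * (\<Sum>i\<in>V. \<alpha> i * of_int (lookup m i)))"

lemma box_char_prod: "box_char \<alpha> m = (\<Prod>i\<in>V. K_point \<alpha> i powi lookup m i)"
  unfolding K_point_powi box_char_def by (simp add: sum_distrib_left exp_sum)

lemma box_char_add: "box_char \<alpha> (m + n) = box_char \<alpha> m * box_char \<alpha> n" and box_char_0 [simp]: "box_char \<alpha> 0 = 1"
  by (simp_all add: box_char_def lookup_add distrib_left sum.distrib exp_add)

text \<open>
  The image of \<open>R\<^sup>m\<close> under \<open>R\<^sub>i = e\<^bsup>2\<pi>i\<alpha>\<^sub>i + x\<^sub>i\<^esup>\<close>.  The exponential is taken of the whole linear form
  \<open>\<Sum> m\<^sub>i x\<^sub>i\<close>, so that negative exponents need no inverses.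
\<close>

definition Phi_mon :: "(nat \<Rightarrow> complex) \<Rightarrow> (nat \<Rightarrow>\<^sub>0 int) \<Rightarrow> complex mpoly" where
  "Phi_mon \<alpha> m = scalar (box_char \<alpha> m) * EXP \<alpha> (exponent_form m)"

definition Phi :: "(nat \<Rightarrow> complex) \<Rightarrow> laurent \<Rightarrow> complex mpoly" where
  "Phi \<alpha> = lin_ext (\<lambda>c m. scalar c * Phi_mon \<alpha> m)"

sublocale phi: additive_coeff "\<lambda>c m. scalar c * Phi_mon \<alpha> m" for \<alpha>
  by unfold_locales (simp add: T.iota_add distrib_right)

lemma Phi_add: "Phi \<alpha> (p + q) = Phi \<alpha> p + Phi \<alpha> q" and Phi_diff: "Phi \<alpha> (p - q) = Phi \<alpha> p - Phi \<alpha> q"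
  and Phi_0 [simp]: "Phi \<alpha> 0 = 0" and Phi_single: "Phi \<alpha> (single m c) = scalar c * Phi_mon \<alpha> m"
  and Phi_sum: "Phi \<alpha> (sum f A) = (\<Sum>i\<in>A. Phi \<alpha> (f i))"
  by (simp_all add: Phi_def phi.lin_ext_sum)

lemma Phi_mon_add: "Phi_mon \<alpha> (m + n) - Phi_mon \<alpha> m * Phi_mon \<alpha> n \<in> box_ideal \<alpha>"
proof -
  have "EXP \<alpha> (exponent_form (m + n)) - EXP \<alpha> (exponent_form m) * EXP \<alpha> (exponent_form n) \<in> box_ideal \<alpha>"
    using T.is_exp_unique[OF EXP_is_exp[of \<alpha> "m + n"]] T.is_exp_add[OF EXP_is_exp[of \<alpha> m] EXP_is_exp[of \<alpha> n]]
    by (simp add: exponent_form_add)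
  then have "scalar (box_char \<alpha> (m + n)) * (EXP \<alpha> (exponent_form (m + n)) - EXP \<alpha> (exponent_form m) * EXP \<alpha> (exponent_form n)) \<in> box_ideal \<alpha>"
    by (intro T.ideal_mult) simp_all
  moreover have "scalar (box_char \<alpha> (m + n)) * (EXP \<alpha> (exponent_form (m + n)) - EXP \<alpha> (exponent_form m) * EXP \<alpha> (exponent_form n)) = Phi_mon \<alpha> (m + n) - Phi_mon \<alpha> m * Phi_mon \<alpha> n"
    unfolding Phi_mon_def by (simp add: box_char_add T.iota_mult algebra_simps)
  ultimately show ?thesis by simp
qed

lemma Phi_mon_0: "Phi_mon \<alpha> 0 - 1 \<in> box_ideal \<alpha>"
  using T.is_exp_unique[OF EXP_is_exp[of \<alpha> 0]] T.is_exp_zero[of \<alpha>] by (simp add: Phi_mon_def)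

lemma Phi_mult: "Phi \<alpha> (p * q) - Phi \<alpha> p * Phi \<alpha> q \<in> box_ideal \<alpha>"
  unfolding Phi_def
  by (rule T.lin_ext_mult[where M = UNIV]) (simp_all add: Phi_mon_add T.iota_add T.iota_mult)

lemma Phi_scalar: "Phi \<alpha> (scalar c) - scalar c \<in> box_ideal \<alpha>"
proof -
  have "scalar c * (Phi_mon \<alpha> 0 - 1) \<in> box_ideal \<alpha>" using Phi_mon_0 by (intro T.ideal_mult) simp_all
  then show ?thesis by (simp add: scalar_def Phi_single right_diff_distrib)
qed

lemma Phi_1: "Phi \<alpha> 1 - 1 \<in> box_ideal \<alpha>"
  using Phi_scalar[of \<alpha> 1] by simp

lemma Phi_prod: "Phi \<alpha> (prod f A) - (\<Prod>i\<in>A. Phi \<alpha> (f i)) \<in> box_ideal \<alpha>"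
proof (induction A rule: infinite_finite_induct)
  case (insert i A)
  have "Phi \<alpha> (f i * prod f A) - Phi \<alpha> (f i) * Phi \<alpha> (prod f A) \<in> box_ideal \<alpha>" by (rule Phi_mult)
  moreover have "Phi \<alpha> (f i) * Phi \<alpha> (prod f A) - Phi \<alpha> (f i) * (\<Prod>i\<in>A. Phi \<alpha> (f i)) \<in> box_ideal \<alpha>"
    using insert.IH by (intro T.cong_mult) simp_all
  ultimately show ?case using insert.hyps T.cong_trans by simp
qed (simp_all add: Phi_1)

lemma Phi_power: "Phi \<alpha> (p ^ n) - Phi \<alpha> p ^ n \<in> box_ideal \<alpha>"
  using Phi_prod[of \<alpha> "\<lambda>_. p" "{..<n}"] by simp

text \<open>Modulo nilpotents \<open>Phi \<alpha>\<close> is the evaluation at the point of \<open>\<alpha>\<close>, so elements that do not vanish there become units.\<close>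

lemma Phi_nilp: "T.nilp \<alpha> (Phi \<alpha> p - scalar (eval (K_point \<alpha>) p))"
proof (induction p rule: poly_mapping_induct)
  case zero
  then show ?case by simp
next
  case (single m c)
  have "Phi \<alpha> (single m c) - scalar (eval (K_point \<alpha>) (single m c))
      = scalar (c * box_char \<alpha> m) * (EXP \<alpha> (exponent_form m) - 1)"
    by (simp add: Phi_single Phi_mon_def eval_single box_char_prod T.iota_mult algebra_simps)
  moreover have "T.nilp \<alpha> (EXP \<alpha> (exponent_form m) - 1)" using EXP_is_exp by (rule T.is_exp_minus_one_nilp)
  ultimately show ?case using T.nilp_mult by simp
next
  case (add p q)
  then show ?case using T.nilp_add[OF add] by (simp add: Phi_add eval_add T.iota_add algebra_simps)
qed

lemma exponent_form_single: "i \<in> V \<Longrightarrow> exponent_form (single i 1) = mvar i"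
proof -
  assume "i \<in> V"
  have "exponent_form (single i 1) = (\<Sum>j\<in>V. if j = i then mvar i else 0)"
    unfolding exponent_form_def by (rule sum.cong) (auto simp: lookup_single when_def)
  then show ?thesis using \<open>i \<in> V\<close> by simp
qed

lemma box_char_single: "i \<in> V \<Longrightarrow> box_char \<alpha> (single i 1) = exp (two_pi_i * \<alpha> i)"
proof -
  assume "i \<in> V"
  have "(\<Sum>j\<in>V. \<alpha> j * of_int (lookup (single i 1) j)) = (\<Sum>j\<in>V. if j = i then \<alpha> i else 0)"
    by (rule sum.cong) (auto simp: lookup_single when_def)
  then show ?thesis using \<open>i \<in> V\<close> by (simp add: box_char_def)
qed

lemma Phi_var: "i \<in> V \<Longrightarrow> \<exists>a. T.is_exp \<alpha> (mvar i) a \<and> Phi \<alpha> (laurent_var i) = scalar (exp (two_pi_i * \<alpha> i)) * a"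
  using EXP_is_exp[of \<alpha> "single i 1"]
  by (intro exI[of _ "EXP \<alpha> (mvar i)"]) (simp add: laurent_power_def Phi_single Phi_mon_def exponent_form_single box_char_single)

text \<open>
  In a generator of \<open>U\<close> for a non-face \<open>I\<close>, the factors with \<open>\<alpha>\<^sub>i = 0\<close> go to multiples of \<open>x\<^sub>i\<close>, and their
  product lies in \<open>nonface_ideal \<alpha>\<close>.  In a relation of \<open>V\<close> the exponent is a linear form that lies in
  \<open>linear_ideal\<close>, and the scalar factor is \<open>e\<^bsup>2\<pi>i f(\<beta>)\<^esup>\<close> by \<open>exp_2pi_dual\<close>.
\<close>

lemma Phi_UV:
  assumes \<alpha>: "\<alpha> \<in> BoxX" and u: "u \<in> UV"
  shows "Phi \<alpha> u \<in> box_ideal \<alpha>"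
proof -
  have "UV \<subseteq> {p \<in> L. Phi \<alpha> p \<in> box_ideal \<alpha>}"
  proof (rule UV_minimal)
    show "rel_ideal L {p \<in> L. Phi \<alpha> p \<in> box_ideal \<alpha>}"
      unfolding rel_ideal_def
    proof (intro conjI ballI)
      fix r a assume r: "r \<in> L" and a: "a \<in> {p \<in> L. Phi \<alpha> p \<in> box_ideal \<alpha>}"
      then have "Phi \<alpha> r * Phi \<alpha> a \<in> box_ideal \<alpha>" by (intro T.ideal_mult) simp_all
      then have "Phi \<alpha> (r * a) \<in> box_ideal \<alpha>" using T.cong_in_iff[OF Phi_mult] by blast
      then show "r * a \<in> {p \<in> L. Phi \<alpha> p \<in> box_ideal \<alpha>}" using r a by (simp add: L.mult_in)
    qed (auto simp: Phi_add)
    show "U_gens \<subseteq> {p \<in> L. Phi \<alpha> p \<in> box_ideal \<alpha>}"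
    proof
      fix p assume p: "p \<in> U_gens"
      then obtain I where I: "p = (\<Prod>i\<in>I. 1 - laurent_var i)" "I \<subseteq> V" "\<not> faceset I"
        unfolding U_gens_def using faceset_iff_hull by blast
      have "finite I" using I(2) finite_subset by blast
      have var: "\<exists>s. Phi \<alpha> (1 - laurent_var i) - mvar i * s \<in> box_ideal \<alpha>" if i: "i \<in> V" "i \<notin> supp \<alpha>" for i
      proof -
        obtain a where a: "T.is_exp \<alpha> (mvar i) a" "Phi \<alpha> (laurent_var i) = scalar (exp (two_pi_i * \<alpha> i)) * a"
          using Phi_var[OF i(1)] by blast
        obtain s where s: "a - (1 + mvar i * s) \<in> box_ideal \<alpha>" using T.is_exp_minus_one[OF a(1)] by blast
        have "Phi \<alpha> (laurent_var i) = a" using a(2) i(2) by (simp add: supp_def)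
        then have "Phi \<alpha> (1 - laurent_var i) - mvar i * (- s) = (Phi \<alpha> 1 - 1) - (a - (1 + mvar i * s))"
          by (simp add: Phi_diff)
        then show ?thesis using T.ideal_diff[OF Phi_1[of \<alpha>] s] by metis
      qed
      then obtain s where s: "\<And>i. i \<in> V \<Longrightarrow> i \<notin> supp \<alpha> \<Longrightarrow> Phi \<alpha> (1 - laurent_var i) - mvar i * s i \<in> box_ideal \<alpha>" by metis
      \<comment> \<open>Only the factors with \<open>\<alpha>\<^sub>i = 0\<close> are replaced by multiples of \<open>x\<^sub>i\<close>.\<close>
      define h where "h i = (if i \<in> supp \<alpha> then Phi \<alpha> (1 - laurent_var i) else mvar i * s i)" for i
      have "(\<Prod>i\<in>I. Phi \<alpha> (1 - laurent_var i)) - (\<Prod>i\<in>I. h i) \<in> box_ideal \<alpha>"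
        using s I(2) by (intro T.cong_prod) (auto simp: h_def)
      then have c: "Phi \<alpha> p - (\<Prod>i\<in>I. h i) \<in> box_ideal \<alpha>" unfolding I(1) by (rule T.cong_trans[OF Phi_prod])
      have "(\<Prod>i\<in>I. h i) = (\<Prod>i\<in>I \<inter> supp \<alpha>. h i) * (\<Prod>i\<in>I - supp \<alpha>. h i)"
        using \<open>finite I\<close> by (rule prod.Int_Diff)
      also have "(\<Prod>i\<in>I - supp \<alpha>. h i) = (\<Prod>i\<in>I - supp \<alpha>. mvar i) * (\<Prod>i\<in>I - supp \<alpha>. s i)"
        unfolding prod.distrib[symmetric] by (rule prod.cong) (auto simp: h_def)
      finally have h: "(\<Prod>i\<in>I. h i) = ((\<Prod>i\<in>I \<inter> supp \<alpha>. h i) * (\<Prod>i\<in>I - supp \<alpha>. s i)) * (\<Prod>i\<in>I - supp \<alpha>. mvar i)"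
        by (simp only: ac_simps)
      obtain m where m: "(\<Prod>i\<in>I - supp \<alpha>. mvar i) = single m (1::complex)" "keys m = I - supp \<alpha>"
        using mvar_prod[of "I - supp \<alpha>"] \<open>finite I\<close> by blast
      have nf: "\<not> faceset (keys m \<union> supp \<alpha>)" using I(3) faceset_mono m(2) by blast
      have "single m (1::complex) \<in> box_ideal \<alpha>" using mono_nonface_ideal[OF nf] ideal_parts by blast
      then have "(\<Prod>i\<in>I - supp \<alpha>. mvar i :: _ \<Rightarrow>\<^sub>0 complex) \<in> box_ideal \<alpha>" unfolding m .
      then have "(\<Prod>i\<in>I. h i) \<in> box_ideal \<alpha>" unfolding h by (intro T.ideal_mult) simp_all
      then show "p \<in> {p \<in> L. Phi \<alpha> p \<in> box_ideal \<alpha>}" using T.cong_in_iff[OF c] p gens_sub by blast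
    qed
    show "V_gens \<subseteq> {p \<in> L. Phi \<alpha> p \<in> box_ideal \<alpha>}"
    proof
      fix p assume p: "p \<in> V_gens"
      then obtain f where f: "f \<in> dual_lattice N"
        "p = (\<Prod>i\<in>V. laurent_power i \<lfloor>f (v i)\<rfloor>) - scalar (exp (two_pi_i * dual_ext f \<beta>))"
        unfolding V_gens_def by blast
      let ?c = "exp (two_pi_i * dual_ext f \<beta>)"
      let ?m = "\<Sum>i\<in>V. single i \<lfloor>f (v i)\<rfloor>"
      have l: "lookup ?m i = \<lfloor>f (v i)\<rfloor>" if "i \<in> V" for i
        using that by (simp add: lookup_sum lookup_single when_def)
      have "keys ?m \<subseteq> V" using keys_sum[of "\<lambda>i. single i \<lfloor>f (v i)\<rfloor>" V] by (auto split: if_splits)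
      then have mono: "single ?m 1 = (\<Prod>i\<in>V. laurent_power i \<lfloor>f (v i)\<rfloor>)"
        unfolding monomial_prod[OF \<open>keys ?m \<subseteq> V\<close>] by (intro prod.cong) (simp_all only: l)
      have "exponent_form ?m = lin_form f" unfolding exponent_form_def lin_form_scalar by (intro sum.cong) (simp_all only: l)
      then have "exponent_form ?m \<in> box_ideal \<alpha>" using subsetD[OF ideal_parts(1) lin_form_linear_ideal[OF f(1)]] by simp
      then have e: "EXP \<alpha> (exponent_form ?m) - 1 \<in> box_ideal \<alpha>" by (rule T.is_exp_unique[OF EXP_is_exp T.is_exp_ideal])
      have "box_char \<alpha> ?m = exp (two_pi_i * (\<Sum>i\<in>V. \<alpha> i * of_int \<lfloor>f (v i)\<rfloor>))"
        unfolding box_char_def by (intro arg_cong[of _ _ exp] arg_cong[of _ _ "\<lambda>x. _ * x"] sum.cong) (simp_all only: l)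
      then have box_char: "box_char \<alpha> ?m = ?c" using exp_2pi_dual[OF \<alpha> f(1)] by simp
      have "Phi \<alpha> p = scalar ?c * (EXP \<alpha> (exponent_form ?m) - 1) - (Phi \<alpha> (scalar ?c) - scalar ?c)"
        unfolding f(2) mono[symmetric] Phi_diff Phi_single Phi_mon_def box_char by (simp add: right_diff_distrib)
      moreover have "scalar ?c * (EXP \<alpha> (exponent_form ?m) - 1) \<in> box_ideal \<alpha>" using e by (intro T.ideal_mult) simp_all
      ultimately have "Phi \<alpha> p \<in> box_ideal \<alpha>" using T.ideal_diff[OF _ Phi_scalar[of \<alpha> ?c]] by simp
      then show "p \<in> {p \<in> L. Phi \<alpha> p \<in> box_ideal \<alpha>}" using p gens_sub by blast
    qed
  qed
  then show ?thesis using u by blast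
qed

text \<open>The image is a subalgebra modulo \<open>box_ideal \<alpha>\<close> that contains the \<open>e\<^bsup>x\<^sub>i\<^esup>\<close>, hence the \<open>x\<^sub>i\<close>.\<close>

lemma Phi_surj: "\<exists>p\<in>L. Phi \<alpha> p - t \<in> box_ideal \<alpha>"
proof -
  let ?D = "{t. \<exists>p\<in>L. Phi \<alpha> p - t \<in> box_ideal \<alpha>}"
  have c: "scalar c \<in> ?D" for c using Phi_scalar L_scalar by blast
  have Q: "box_ideal \<alpha> \<subseteq> ?D"
  proof
    fix t :: "complex mpoly" assume "t \<in> box_ideal \<alpha>"
    then have "Phi \<alpha> 0 - t \<in> box_ideal \<alpha>" using T.ideal_uminus by simp
    then show "t \<in> ?D" by blast
  qed
  have add: "s + t \<in> ?D" if st: "s \<in> ?D" "t \<in> ?D" for s t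
  proof -
    obtain p where p: "p \<in> L" "Phi \<alpha> p - s \<in> box_ideal \<alpha>" using st(1) by blast
    obtain q where q: "q \<in> L" "Phi \<alpha> q - t \<in> box_ideal \<alpha>" using st(2) by blast
    note pq = p(1) q(1) p(2) q(2)
    have "Phi \<alpha> (p + q) - (s + t) \<in> box_ideal \<alpha>" using T.ideal_add[OF pq(3,4)] by (simp add: Phi_add algebra_simps)
    then show ?thesis using pq L_add by blast
  qed
  have mult: "s * t \<in> ?D" if st: "s \<in> ?D" "t \<in> ?D" for s t
  proof -
    obtain p where p: "p \<in> L" "Phi \<alpha> p - s \<in> box_ideal \<alpha>" using st(1) by blast
    obtain q where q: "q \<in> L" "Phi \<alpha> q - t \<in> box_ideal \<alpha>" using st(2) by blast
    note pq = p(1) q(1) p(2) q(2)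
    have "Phi \<alpha> p * Phi \<alpha> q - s * t \<in> box_ideal \<alpha>" using pq(3,4) by (intro T.cong_mult) simp_all
    then have "Phi \<alpha> (p * q) - s * t \<in> box_ideal \<alpha>" by (rule T.cong_trans[OF Phi_mult])
    then show ?thesis using pq L_mult by blast
  qed
  have var: "mvar i \<in> ?D" for i
  proof (cases "i \<in> V")
    case True
    obtain a where a: "T.is_exp \<alpha> (mvar i) a" "Phi \<alpha> (laurent_var i) = scalar (exp (two_pi_i * \<alpha> i)) * a"
      using Phi_var[OF True] by blast
    have "Phi \<alpha> (laurent_var i) \<in> ?D" using laurent_power_in[OF True] T.ideal_zero by (intro CollectI bexI[of _ "laurent_var i"]) simp_all
    then have "scalar (1 / exp (two_pi_i * \<alpha> i)) * Phi \<alpha> (laurent_var i) \<in> ?D" using c by (intro mult)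
    then have "a \<in> ?D" unfolding a(2) mult.assoc[symmetric] T.iota_mult[symmetric] by simp
    then show ?thesis by (rule T.exponential_in_subalgebra[OF a(1)]) (use Q c add mult in auto)
  next
    case False
    then show ?thesis using mvar_nonface_ideal Q ideal_parts by blast
  qed
  have "t \<in> ?D"
    by (rule mpoly_in_subalgebra) (use c[unfolded scalar_def] var add mult in blast)+
  then show ?thesis by blast
qed

end

section \<open>Logarithms and injectivity\<close>

context fan_basis begin

text \<open>The kernel of the map to the localization of the Grothendieck ring at \<open>\<alpha>\<close>.\<close>

definition local_kernel :: "(nat \<Rightarrow> complex) \<Rightarrow> laurent set" where
  "local_kernel \<alpha> = {p \<in> L. \<exists>u\<in>L. eval (K_point \<alpha>) u \<noteq> 0 \<and> u * p \<in> UV}"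

lemma eval_mult_K: "eval (K_point \<alpha>) (p * q) = eval (K_point \<alpha>) p * eval (K_point \<alpha>) q"
  by (rule eval_mult) (rule K_point_nz)

lemma local_kernel_rel: "rel_ideal L (local_kernel \<alpha>)"
  unfolding rel_ideal_def
proof (intro conjI ballI)
  show "local_kernel \<alpha> \<subseteq> L" by (auto simp: local_kernel_def)
  show "0 \<in> local_kernel \<alpha>" unfolding local_kernel_def by (intro CollectI conjI bexI[of _ 1]) simp_all
  fix a b assume "a \<in> local_kernel \<alpha>" "b \<in> local_kernel \<alpha>"
  then obtain u w where u: "a \<in> L" "u \<in> L" "eval (K_point \<alpha>) u \<noteq> 0" "u * a \<in> UV"
    and w: "b \<in> L" "w \<in> L" "eval (K_point \<alpha>) w \<noteq> 0" "w * b \<in> UV" unfolding local_kernel_def by blast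
  have "(u * w) * (a + b) = w * (u * a) + u * (w * b)" by (simp add: algebra_simps)
  also have "\<dots> \<in> UV" by (rule UV.ideal_add[OF UV.ideal_mult[OF w(2) u(4)] UV.ideal_mult[OF u(2) w(4)]])
  finally show "a + b \<in> local_kernel \<alpha>" using u w unfolding local_kernel_def
    by (intro CollectI conjI bexI[of _ "u * w"] L_add L_mult) (simp_all add: eval_mult_K)
next
  fix r a assume r: "r \<in> L" and "a \<in> local_kernel \<alpha>"
  then obtain u where u: "a \<in> L" "u \<in> L" "eval (K_point \<alpha>) u \<noteq> 0" "u * a \<in> UV" unfolding local_kernel_def by blast
  have "u * (r * a) = r * (u * a)" by (simp add: algebra_simps)
  also have "\<dots> \<in> UV" by (rule UV.ideal_mult[OF r u(4)])
  finally show "r * a \<in> local_kernel \<alpha>" using u r unfolding local_kernel_def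
    by (intro CollectI conjI bexI[of _ u] L_mult) simp_all
qed

sublocale J: subalgebra_ideal L scalar "local_kernel \<alpha>" for \<alpha>
  by (rule L.ideal_locale[OF local_kernel_rel])

lemma UV_local_kernel: "UV \<subseteq> local_kernel \<alpha>"
proof
  fix p assume "p \<in> UV"
  then show "p \<in> local_kernel \<alpha>" unfolding local_kernel_def
    by (intro CollectI conjI bexI[of _ 1]) (simp_all add: UV.ideal_sub)
qed

lemma local_kernel_cancel:
  assumes "u \<in> L" "eval (K_point \<alpha>) u \<noteq> 0" "p \<in> L" "u * p \<in> local_kernel \<alpha>"
  shows "p \<in> local_kernel \<alpha>"
proof -
  obtain w where w: "w \<in> L" "eval (K_point \<alpha>) w \<noteq> 0" "w * (u * p) \<in> UV" using assms(4) unfolding local_kernel_def by blast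
  then have "(w * u) * p \<in> UV" by (simp only: mult.assoc)
  then show ?thesis using assms w unfolding local_kernel_def
    by (intro CollectI conjI bexI[of _ "w * u"] L_mult) (simp_all add: eval_mult_K)
qed

definition unip :: "(nat \<Rightarrow> complex) \<Rightarrow> nat \<Rightarrow> laurent" where
  "unip \<alpha> i = scalar (1 / K_point \<alpha> i) * laurent_var i - 1"

lemma unip_in: "i \<in> V \<Longrightarrow> unip \<alpha> i \<in> L"
  unfolding unip_def using laurent_power_in by (intro L.diff_in L.mult_in L_scalar L.one_in)

text \<open>
  In the product from \<open>finite_spectrum\<close>, the factors for the roots other than \<open>e\<^bsup>2\<pi>i\<alpha>\<^sub>i\<^esup>\<close> do not vanish at \<open>\<alpha>\<close> and
  cancel in \<open>local_kernel \<alpha>\<close>.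
\<close>

lemma unip_nilp: assumes i: "i \<in> V" shows "J.nilp \<alpha> (unip \<alpha> i)"
proof -
  obtain S :: "('v set \<times> nat) set" and \<rho> where S: "finite S" "(\<Prod>s\<in>S. laurent_var i - scalar (\<rho> s)) \<in> UV"
    using finite_spectrum[OF i] by blast
  let ?k = "K_point \<alpha> i" and ?f = "\<lambda>s. laurent_var i - scalar (\<rho> s)"
  define u where "u = prod ?f (S - {s. \<rho> s = ?k})"
  have fL: "?f s \<in> L" for s using laurent_power_in[OF i] by (intro L.diff_in L_scalar)
  have uL: "u \<in> L" unfolding u_def using fL by (intro L.prod_in)
  have "eval (K_point \<alpha>) u = (\<Prod>s\<in>S - {s. \<rho> s = ?k}. ?k - \<rho> s)"
    unfolding u_def eval_prod[OF K_point_nz] by (simp add: eval_diff eval_laurent_power[OF i])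
  then have eu: "eval (K_point \<alpha>) u \<noteq> 0" using S(1) by auto
  have "prod ?f S = prod ?f (S \<inter> {s. \<rho> s = ?k}) * u" unfolding u_def using S(1) by (rule prod.Int_Diff)
  also have "prod ?f (S \<inter> {s. \<rho> s = ?k}) = (laurent_var i - scalar ?k) ^ card (S \<inter> {s. \<rho> s = ?k})" by simp
  finally have "u * (laurent_var i - scalar ?k) ^ card (S \<inter> {s. \<rho> s = ?k}) \<in> UV" using S(2) by (simp add: mult.commute)
  then have "u * (laurent_var i - scalar ?k) ^ card (S \<inter> {s. \<rho> s = ?k}) \<in> local_kernel \<alpha>" by (rule subsetD[OF UV_local_kernel])
  then have "(laurent_var i - scalar ?k) ^ card (S \<inter> {s. \<rho> s = ?k}) \<in> local_kernel \<alpha>"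
    by (rule local_kernel_cancel[OF uL eu, rotated]) (intro L.power_in L.diff_in L_scalar laurent_power_in i)
  moreover have "laurent_var i - scalar ?k \<in> L" using laurent_power_in[OF i] by (intro L.diff_in L_scalar)
  ultimately have "J.nilp \<alpha> (laurent_var i - scalar ?k)" unfolding J.nilp_def by blast
  then have "J.nilp \<alpha> (scalar (1 / ?k) * (laurent_var i - scalar ?k))" by (rule J.nilp_mult) (rule L_scalar)
  moreover have "scalar (1 / ?k) * scalar ?k = (1 :: laurent)"
    unfolding L.iota_mult[symmetric] using K_point_nz by simp
  ultimately show ?thesis by (simp add: unip_def right_diff_distrib)
qed

definition log_quot :: "(nat \<Rightarrow> complex) \<Rightarrow> nat \<Rightarrow> laurent" where
  "log_quot \<alpha> i = (SOME z. z \<in> L \<and> J.is_exp \<alpha> (unip \<alpha> i * z) (1 + unip \<alpha> i))"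

lemma log_quot: "i \<in> V \<Longrightarrow> log_quot \<alpha> i \<in> L \<and> J.is_exp \<alpha> (unip \<alpha> i * log_quot \<alpha> i) (1 + unip \<alpha> i)"
  unfolding log_quot_def by (rule someI_ex) (use J.logarithm_exists[OF unip_nilp] in blast)

text \<open>
  The logarithm of \<open>e\<^bsup>-2\<pi>i\<alpha>\<^sub>i\<^esup> R\<^sub>i\<close>; the value \<open>0\<close> outside \<open>{1..k}\<close> reflects that such \<open>x\<^sub>i\<close> lie in
  \<open>nonface_ideal \<alpha>\<close>.
\<close>

definition log_var :: "(nat \<Rightarrow> complex) \<Rightarrow> nat \<Rightarrow> laurent" where
  "log_var \<alpha> i = (if i \<in> V then unip \<alpha> i * log_quot \<alpha> i else 0)"

lemma log_var_in: "log_var \<alpha> i \<in> L"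
  unfolding log_var_def using log_quot unip_in by (auto intro: L_mult)

text \<open>The power \<open>(e\<^bsup>-2\<pi>i\<alpha>\<^sub>i\<^esup> R\<^sub>i)\<^sup>a\<close>.\<close>

definition norm_power :: "(nat \<Rightarrow> complex) \<Rightarrow> nat \<Rightarrow> int \<Rightarrow> laurent" where
  "norm_power \<alpha> i a = scalar (K_point \<alpha> i powi (- a)) * laurent_power i a"

lemma norm_power_add: "norm_power \<alpha> i (a + b) = norm_power \<alpha> i a * norm_power \<alpha> i b"
proof -
  have "K_point \<alpha> i powi (- (a + b)) = K_point \<alpha> i powi (- a) * K_point \<alpha> i powi (- b)"
    using K_point_nz power_int_add[of "K_point \<alpha> i" "- a" "- b"] by simp
  then show ?thesis by (simp only: norm_power_def L.iota_mult laurent_power_add ac_simps)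
qed

lemma norm_power_0 [simp]: "norm_power \<alpha> i 0 = 1" by (simp add: norm_power_def)

lemma norm_power_in: "i \<in> V \<Longrightarrow> norm_power \<alpha> i a \<in> L"
  unfolding norm_power_def using laurent_power_in by (intro L_mult L_scalar)

lemma norm_power_nat: "norm_power \<alpha> i (int n) = (1 + unip \<alpha> i) ^ n"
proof (induction n)
  case (Suc n)
  have "norm_power \<alpha> i 1 = 1 + unip \<alpha> i" by (simp add: norm_power_def unip_def power_int_minus field_simps)
  moreover have "int (Suc n) = 1 + int n" by simp
  ultimately show ?case by (simp only: Suc norm_power_add power_Suc)
qed simp

lemma log_var_exp: assumes i: "i \<in> V" shows "J.is_exp \<alpha> (scalar (of_int a) * log_var \<alpha> i) (norm_power \<alpha> i a)"
proof -
  have pos: "J.is_exp \<alpha> (scalar (of_nat n) * log_var \<alpha> i) (norm_power \<alpha> i (int n))" for n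
  proof -
    have "J.is_exp \<alpha> (log_var \<alpha> i) (1 + unip \<alpha> i)" using log_quot[OF i] i by (simp add: log_var_def)
    then have "J.is_exp \<alpha> (of_nat n * log_var \<alpha> i) ((1 + unip \<alpha> i) ^ n)" by (rule J.is_exp_of_nat)
    moreover have "(of_nat n :: laurent) = scalar (of_nat n)" by (simp add: scalar_def)
    ultimately show ?thesis unfolding norm_power_nat by simp
  qed
  show ?thesis
  proof (cases "a \<ge> 0")
    case True
    then show ?thesis using pos[of "nat a"] by simp
  next
    case False
    let ?n = "nat (- a)"
    have "J.is_exp \<alpha> (- (scalar (of_nat ?n) * log_var \<alpha> i)) (norm_power \<alpha> i a)"
    proof (rule J.is_exp_uminus[OF pos norm_power_in[OF i]])
      have "norm_power \<alpha> i (int ?n) * norm_power \<alpha> i a = 1" using False norm_power_add[of \<alpha> i "int ?n" a] by simp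
      then show "norm_power \<alpha> i (int ?n) * norm_power \<alpha> i a - 1 \<in> local_kernel \<alpha>" by simp
    qed
    moreover have "- (scalar (of_nat ?n) * log_var \<alpha> i) = scalar (of_int a) * log_var \<alpha> i"
      using False L.iota_uminus[of "of_nat ?n"] by simp
    ultimately show ?thesis by simp
  qed
qed

lemma log_var_sum_exp: "J.is_exp \<alpha> (\<Sum>i\<in>V. scalar (of_int (a i)) * log_var \<alpha> i) (\<Prod>i\<in>V. norm_power \<alpha> i (a i))"
  by (intro J.is_exp_sum log_var_exp)

lemma norm_power_prod: "(\<Prod>i\<in>V. norm_power \<alpha> i (a i)) = scalar (\<Prod>i\<in>V. K_point \<alpha> i powi (- a i)) * (\<Prod>i\<in>V. laurent_power i (a i))"
  by (simp add: norm_power_def prod.distrib L.iota_prod)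

text \<open>The substitution of the logarithms \<open>log_var \<alpha> i\<close> for the \<open>x\<^sub>i\<close>.\<close>

definition Psi_mon :: "(nat \<Rightarrow> complex) \<Rightarrow> (nat \<Rightarrow>\<^sub>0 nat) \<Rightarrow> laurent" where
  "Psi_mon \<alpha> m = (\<Prod>i\<in>keys m. log_var \<alpha> i ^ lookup m i)"

lemma Psi_mon_superset: "finite A \<Longrightarrow> keys m \<subseteq> A \<Longrightarrow> Psi_mon \<alpha> m = (\<Prod>i\<in>A. log_var \<alpha> i ^ lookup m i)"
  unfolding Psi_mon_def by (rule prod.mono_neutral_left) (auto simp: in_keys_iff)

lemma Psi_mon_add: "Psi_mon \<alpha> (m + n) = Psi_mon \<alpha> m * Psi_mon \<alpha> n"
  using Psi_mon_superset[of "keys m \<union> keys n"]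
  by (simp add: keys_add_nat lookup_add power_add prod.distrib)

lemma Psi_mon_in: "Psi_mon \<alpha> m \<in> L"
  unfolding Psi_mon_def by (intro L.prod_in L.power_in log_var_in)

definition Psi :: "(nat \<Rightarrow> complex) \<Rightarrow> complex mpoly \<Rightarrow> laurent" where
  "Psi \<alpha> = lin_ext (\<lambda>c m. scalar c * Psi_mon \<alpha> m)"

sublocale psi: additive_coeff "\<lambda>c m. scalar c * Psi_mon \<alpha> m" for \<alpha>
  by unfold_locales (simp add: L.iota_add distrib_right)

lemma Psi_add: "Psi \<alpha> (p + q) = Psi \<alpha> p + Psi \<alpha> q" and Psi_diff: "Psi \<alpha> (p - q) = Psi \<alpha> p - Psi \<alpha> q"
  and Psi_0 [simp]: "Psi \<alpha> 0 = 0" and Psi_single: "Psi \<alpha> (single m c) = scalar c * Psi_mon \<alpha> m"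
  and Psi_sum: "Psi \<alpha> (sum f A) = (\<Sum>i\<in>A. Psi \<alpha> (f i))"
  by (simp_all add: Psi_def psi.lin_ext_sum)

lemma Psi_in: "Psi \<alpha> p \<in> L"
  unfolding Psi_def lin_ext_def by (intro L.sum_in L_mult L_scalar Psi_mon_in)

lemma Psi_mult: "Psi \<alpha> (p * q) = Psi \<alpha> p * Psi \<alpha> q"
proof -
  have "rel_ideal L {0}" by (simp add: rel_ideal_def)
  then interpret Z: subalgebra_ideal L scalar "{0}" by (rule L.ideal_locale)
  have "Psi \<alpha> (p * q) - Psi \<alpha> p * Psi \<alpha> q \<in> {0}" unfolding Psi_def
    by (rule Z.lin_ext_mult[where M = UNIV]) (simp_all add: L.iota_add L.iota_mult Psi_mon_add L_scalar)
  then show ?thesis by simp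
qed

lemma Psi_scalar: "Psi \<alpha> (scalar c) = scalar c"
  by (simp add: scalar_def Psi_single Psi_mon_def mult_single)

lemma Psi_1 [simp]: "Psi \<alpha> 1 = 1"
  using Psi_scalar[of \<alpha> 1] by simp

lemma Psi_power: "Psi \<alpha> (p ^ n) = Psi \<alpha> p ^ n"
  by (induction n) (simp_all add: Psi_mult)

lemma Psi_mvar: "Psi \<alpha> (mvar i) = log_var \<alpha> i"
  by (simp add: mvar_def Psi_single Psi_mon_def)

lemma Psi_texp: "Psi \<alpha> (T.texp n x) = J.texp n (Psi \<alpha> x)"
  unfolding T.texp_def J.texp_def by (simp add: Psi_sum Psi_mult Psi_power Psi_scalar)

lemma Psi_lin: "Psi \<alpha> (\<Sum>i\<in>V. scalar (of_int (a i)) * mvar i) = (\<Sum>i\<in>V. scalar (of_int (a i)) * log_var \<alpha> i)"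
  by (simp add: Psi_sum Psi_mult Psi_scalar Psi_mvar)

lemma prod_inverse: "(\<Prod>i\<in>A. inverse (h i :: complex)) = inverse (\<Prod>i\<in>A. h i)"
  by (induction A rule: infinite_finite_induct) auto

text \<open>The exponential of the image is \<open>1\<close> by the relation of \<open>V\<close> for \<open>f\<close>, so the image is \<open>0\<close>.\<close>

lemma Psi_lin_form:
  assumes \<alpha>: "\<alpha> \<in> BoxX" and f: "f \<in> dual_lattice N"
  shows "Psi \<alpha> (lin_form f) \<in> local_kernel \<alpha>"
proof -
  let ?c = "exp (two_pi_i * dual_ext f \<beta>)"
  have "(\<Prod>i\<in>V. K_point \<alpha> i powi \<lfloor>f (v i)\<rfloor>) = ?c"
    using exp_2pi_dual[OF \<alpha> f] unfolding K_point_powi by (simp add: sum_distrib_left exp_sum)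
  then have c: "(\<Prod>i\<in>V. K_point \<alpha> i powi (- \<lfloor>f (v i)\<rfloor>)) = 1 / ?c"
    by (simp add: power_int_minus prod_inverse divide_inverse)
  have "scalar (1 / ?c) * ((\<Prod>i\<in>V. laurent_power i \<lfloor>f (v i)\<rfloor>) - scalar ?c) \<in> local_kernel \<alpha>"
    using dual_in_UV[OF f] UV_local_kernel by (intro J.ideal_mult L_scalar) auto
  moreover have "scalar (1 / ?c) * scalar ?c = (1 :: laurent)"
    unfolding L.iota_mult[symmetric] by simp
  ultimately have "1 - (\<Prod>i\<in>V. norm_power \<alpha> i \<lfloor>f (v i)\<rfloor>) \<in> local_kernel \<alpha>"
    unfolding norm_power_prod c using J.cong_sym by (simp add: right_diff_distrib)
  then have "J.is_exp \<alpha> (\<Sum>i\<in>V. scalar (of_int \<lfloor>f (v i)\<rfloor>) * log_var \<alpha> i) 1"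
    by (rule J.is_exp_cong[OF log_var_sum_exp]) simp
  then show ?thesis unfolding lin_form_scalar Psi_lin by (rule J.is_exp_one_imp_ideal)
qed

text \<open>
  If \<open>\<alpha>\<^sub>i = 0\<close>, then \<open>log_var \<alpha> i\<close> is a multiple of \<open>1 - R\<^sub>i\<close>.  So the image of the monomial is a multiple of a
  generator of \<open>U\<close> without those factors \<open>1 - R\<^sub>i\<close> that do not vanish at \<open>\<alpha>\<close>, and these cancel in
  \<open>local_kernel \<alpha>\<close>.
\<close>

lemma Psi_nonface_ideal:
  assumes \<alpha>: "\<alpha> \<in> BoxX" and w: "w \<in> nonface_ideal \<alpha>"
  shows "Psi \<alpha> w \<in> local_kernel \<alpha>"
proof -
  have "Psi_mon \<alpha> m \<in> local_kernel \<alpha>" if m: "\<not> faceset (keys m \<union> supp \<alpha>)" for m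
  proof (cases "keys m \<subseteq> V")
    case False
    then obtain i where i: "i \<in> keys m" "i \<notin> V" by blast
    have "log_var \<alpha> i = 0" unfolding log_var_def by (rule if_not_P[OF i(2)])
    then have "log_var \<alpha> i ^ lookup m i = 0" using i(1) by (simp add: in_keys_iff)
    then have "Psi_mon \<alpha> m = 0" unfolding Psi_mon_def using i(1) by (intro prod_zero) auto
    then show ?thesis by simp
  next
    case True
    have sV: "supp \<alpha> \<subseteq> V" using \<alpha> faceset_sub unfolding Box_iff by blast
    let ?K = "keys m"
    have fin: "finite (?K \<union> supp \<alpha>)" using True sV finite_subset by blast
    have U: "(\<Prod>i\<in>?K \<union> supp \<alpha>. 1 - laurent_var i) \<in> local_kernel \<alpha>"
      using nonface_in_UV[OF _ m] True sV UV_local_kernel by blast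
    \<comment> \<open>The factors of the generator of \<open>U\<close> that do not vanish at \<open>\<alpha>\<close>.\<close>
    define u where "u = (\<Prod>i\<in>supp \<alpha>. 1 - laurent_var i)"
    have lL: "1 - laurent_var i \<in> L" if "i \<in> V" for i
      using laurent_power_in[OF that] by (intro L.diff_in L.one_in)
    have uL: "u \<in> L" unfolding u_def using sV lL by (intro L.prod_in) blast
    have "eval (K_point \<alpha>) u = (\<Prod>i\<in>supp \<alpha>. 1 - K_point \<alpha> i)"
      unfolding u_def eval_prod[OF K_point_nz] 
      by (rule prod.cong[OF refl]) (use sV in \<open>simp add: eval_diff eval_laurent_power subset_iff\<close>)
    then have eu: "eval (K_point \<alpha>) u \<noteq> 0"
      using fin K_point_eq_1_iff[OF \<alpha>] by (auto simp: supp_def)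
    have "(\<Prod>i\<in>?K \<union> supp \<alpha>. 1 - laurent_var i) = u * (\<Prod>i\<in>?K - supp \<alpha>. 1 - laurent_var i)"
    proof -
      have "?K \<union> supp \<alpha> = supp \<alpha> \<union> (?K - supp \<alpha>)" by blast
      then show ?thesis unfolding u_def using fin by (simp only:) (rule prod.union_disjoint, auto)
    qed
    then have uu: "u * (\<Prod>i\<in>?K - supp \<alpha>. 1 - laurent_var i) \<in> local_kernel \<alpha>" using U by (simp only:)
    have "(\<Prod>i\<in>?K - supp \<alpha>. 1 - laurent_var i) \<in> L"
    proof (rule L.prod_in)
      fix i assume "i \<in> ?K - supp \<alpha>"
      then show "1 - laurent_var i \<in> L" using lL True by blast
    qed
    then have "(\<Prod>i\<in>?K - supp \<alpha>. 1 - laurent_var i) \<in> local_kernel \<alpha>" by (rule local_kernel_cancel[OF uL eu _ uu])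
    moreover have "(\<Prod>i\<in>?K. log_var \<alpha> i ^ lookup m i)
      = ((\<Prod>i\<in>?K \<inter> supp \<alpha>. log_var \<alpha> i ^ lookup m i)
        * (\<Prod>i\<in>?K - supp \<alpha>. - log_quot \<alpha> i * log_var \<alpha> i ^ (lookup m i - 1)))
        * (\<Prod>i\<in>?K - supp \<alpha>. 1 - laurent_var i)"
    proof -
      have "(\<Prod>i\<in>?K. log_var \<alpha> i ^ lookup m i) = (\<Prod>i\<in>?K \<inter> supp \<alpha>. log_var \<alpha> i ^ lookup m i)
         * (\<Prod>i\<in>?K - supp \<alpha>. log_var \<alpha> i ^ lookup m i)"
        by (rule prod.Int_Diff) simp
      also have "(\<Prod>i\<in>?K - supp \<alpha>. log_var \<alpha> i ^ lookup m i)
        = (\<Prod>i\<in>?K - supp \<alpha>. (- log_quot \<alpha> i * log_var \<alpha> i ^ (lookup m i - 1)) * (1 - laurent_var i))"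
      proof (rule prod.cong[OF refl])
        fix i assume i: "i \<in> ?K - supp \<alpha>"
        then have "i \<in> V" using True by blast
        moreover have "K_point \<alpha> i = 1" "lookup m i > 0"
          using i K_point_eq_1_iff[OF \<alpha>] by (auto simp: supp_def in_keys_iff)
        ultimately have X: "log_var \<alpha> i = - log_quot \<alpha> i * (1 - laurent_var i)"
          by (simp add: log_var_def unip_def algebra_simps)
        obtain n where n: "lookup m i = Suc n"
          using \<open>lookup m i > 0\<close> gr0_implies_Suc by blast
        have "log_var \<alpha> i ^ Suc n = (- log_quot \<alpha> i * (1 - laurent_var i)) * log_var \<alpha> i ^ n"
          unfolding power_Suc by (rule arg_cong[OF X, of "\<lambda>x. x * log_var \<alpha> i ^ n"])
        then show "log_var \<alpha> i ^ lookup m i = (- log_quot \<alpha> i * log_var \<alpha> i ^ (lookup m i - 1)) * (1 - laurent_var i)"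
          unfolding n diff_Suc_1 by (simp only: ac_simps)
      qed
      finally show ?thesis unfolding prod.distrib by (simp only: mult.assoc)
    qed
    moreover have "(\<Prod>i\<in>?K \<inter> supp \<alpha>. log_var \<alpha> i ^ lookup m i)
        * (\<Prod>i\<in>?K - supp \<alpha>. - log_quot \<alpha> i * log_var \<alpha> i ^ (lookup m i - 1)) \<in> L"
    proof (intro L_mult L.prod_in L.power_in log_var_in L.uminus_in)
      fix i assume "i \<in> ?K - supp \<alpha>"
      then show "log_quot \<alpha> i \<in> L" using True log_quot by blast
    qed
    ultimately show ?thesis unfolding Psi_mon_def by (simp only: J.ideal_mult)
  qed
  then have "scalar (lookup w m) * Psi_mon \<alpha> m \<in> local_kernel \<alpha>" if "m \<in> keys w" for m
    using w that unfolding nonface_ideal_def by (intro J.ideal_mult L_scalar) auto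
  then show ?thesis unfolding Psi_def lin_ext_def by (rule J.ideal_sum)
qed

lemma Psi_box_ideal:
  assumes \<alpha>: "\<alpha> \<in> BoxX" and t: "t \<in> box_ideal \<alpha>"
  shows "Psi \<alpha> t \<in> local_kernel \<alpha>"
proof -
  obtain z w where zw: "t = z + w" "z \<in> linear_ideal" "w \<in> nonface_ideal \<alpha>" using t unfolding box_ideal_def by blast
  then obtain r where "z = (\<Sum>j\<in>{1..d}. r j * lin_form (g j))" unfolding linear_ideal_def by blast
  then have "Psi \<alpha> z = (\<Sum>j\<in>{1..d}. Psi \<alpha> (r j) * Psi \<alpha> (lin_form (g j)))" by (simp only: Psi_sum Psi_mult)
  also have "\<dots> \<in> local_kernel \<alpha>" by (intro J.ideal_sum J.ideal_mult Psi_in Psi_lin_form[OF \<alpha>] g_dual)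
  finally show ?thesis unfolding zw(1) Psi_add using Psi_nonface_ideal[OF \<alpha> zw(3)] by (intro J.ideal_add)
qed

lemma Psi_is_exp:
  assumes \<alpha>: "\<alpha> \<in> BoxX" and e: "T.is_exp \<alpha> x a"
  shows "J.is_exp \<alpha> (Psi \<alpha> x) (Psi \<alpha> a)"
proof -
  obtain n where "x ^ n \<in> box_ideal \<alpha>" using e by (auto simp: T.is_exp_def T.nilp_def)
  then have n: "Psi \<alpha> x ^ n \<in> local_kernel \<alpha>" using Psi_box_ideal[OF \<alpha>] by (simp flip: Psi_power)
  obtain k where k: "\<forall>n\<ge>k. a - T.texp n x \<in> box_ideal \<alpha>" using e by (auto simp: T.is_exp_def)
  have "Psi \<alpha> a - J.texp m (Psi \<alpha> x) \<in> local_kernel \<alpha>" if "m \<ge> k" for m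
    using Psi_box_ideal[OF \<alpha> k[rule_format, OF that]] by (simp add: Psi_diff Psi_texp)
  then show ?thesis unfolding J.is_exp_def J.nilp_def using Psi_in n by blast
qed

text \<open>
  On \<open>R\<^sup>m\<close> this holds because \<open>Psi \<alpha>\<close> carries \<open>e\<^bsup>\<Sum> m\<^sub>i x\<^sub>i\<^esup>\<close> to the exponential of the sum of the
  logarithms, which is \<open>R\<^sup>m\<close> up to the constant \<open>box_char \<alpha> m\<close>.
\<close>

lemma Psi_Phi:
  assumes \<alpha>: "\<alpha> \<in> BoxX" and p: "p \<in> L"
  shows "Psi \<alpha> (Phi \<alpha> p) - p \<in> local_kernel \<alpha>"
  using p
proof (induction p rule: L_induct)
  case zero
  then show ?case by simp
next
  case (add p q)
  then show ?case using J.ideal_add[OF add] by (simp add: Phi_add Psi_add algebra_simps)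
next
  case (mono m c)
  have "J.is_exp \<alpha> (Psi \<alpha> (exponent_form m)) (Psi \<alpha> (EXP \<alpha> (exponent_form m)))" by (rule Psi_is_exp[OF \<alpha> EXP_is_exp])
  moreover have "J.is_exp \<alpha> (Psi \<alpha> (exponent_form m)) (\<Prod>i\<in>V. norm_power \<alpha> i (lookup m i))"
    unfolding exponent_form_def Psi_lin by (rule log_var_sum_exp)
  ultimately have e: "Psi \<alpha> (EXP \<alpha> (exponent_form m)) - (\<Prod>i\<in>V. norm_power \<alpha> i (lookup m i)) \<in> local_kernel \<alpha>"
    by (rule J.is_exp_unique)
  have "(\<Prod>i\<in>V. norm_power \<alpha> i (lookup m i)) = scalar (1 / box_char \<alpha> m) * single m 1"
    unfolding norm_power_prod monomial_prod[OF mono] box_char_prod by (simp add: power_int_minus prod_inverse divide_inverse)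
  moreover have "scalar (c * box_char \<alpha> m) * (Psi \<alpha> (EXP \<alpha> (exponent_form m)) - (\<Prod>i\<in>V. norm_power \<alpha> i (lookup m i))) \<in> local_kernel \<alpha>"
    using e by (intro J.ideal_mult L_scalar)
  moreover have "scalar (c * box_char \<alpha> m) * scalar (1 / box_char \<alpha> m) = (scalar c :: laurent)"
    unfolding L.iota_mult[symmetric] by (simp add: box_char_def)
  ultimately have "scalar (c * box_char \<alpha> m) * Psi \<alpha> (EXP \<alpha> (exponent_form m)) - scalar c * single m 1 \<in> local_kernel \<alpha>"
    by (simp add: right_diff_distrib flip: mult.assoc)
  moreover have "Psi \<alpha> (Phi \<alpha> (scalar c * single m 1)) = scalar (c * box_char \<alpha> m) * Psi \<alpha> (EXP \<alpha> (exponent_form m))"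
  proof -
    have "scalar c * single m 1 = single m c" by (simp add: scalar_def mult_single)
    then show ?thesis by (simp add: Phi_single Phi_mon_def Psi_mult Psi_scalar L.iota_mult mult.assoc)
  qed
  ultimately show ?case by simp
qed

lemma local_injectivity:
  assumes \<alpha>: "\<alpha> \<in> BoxX" and p: "p \<in> L" "Phi \<alpha> p \<in> box_ideal \<alpha>"
  shows "\<exists>u\<in>L. eval (K_point \<alpha>) u \<noteq> 0 \<and> u * p \<in> UV"
proof -
  have "p \<in> local_kernel \<alpha>" using J.cong_in_iff[OF Psi_Phi[OF \<alpha> p(1)]] Psi_box_ideal[OF \<alpha> p(2)] by blast
  then show ?thesis unfolding local_kernel_def by blast
qed

text \<open>
  The \<open>u\<close> with \<open>u p \<in> U + V\<close> form an ideal.  It has an element that does not vanish at a given point: by local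
  injectivity if the point belongs to the box, and otherwise already in \<open>U + V\<close>.  So it contains \<open>1\<close>.
\<close>

lemma global_injectivity:
  assumes p: "p \<in> L" "\<And>\<alpha>. \<alpha> \<in> BoxX \<Longrightarrow> Phi \<alpha> p \<in> box_ideal \<alpha>"
  shows "p \<in> UV"
proof -
  have "1 \<in> {u \<in> L. u * p \<in> UV}"
  proof (rule nullstellensatz)
    show "rel_ideal L {u \<in> L. u * p \<in> UV}" using p(1) by (rule UV.colon_ideal)
    show sub: "UV \<subseteq> {u \<in> L. u * p \<in> UV}" using UV.ideal_sub p(1) by (auto intro: UV.ideal_mult')
    fix r :: "nat \<Rightarrow> complex" assume nz: "\<And>i. i \<in> V \<Longrightarrow> r i \<noteq> 0"
    show "\<exists>u\<in>{u \<in> L. u * p \<in> UV}. eval r u \<noteq> 0"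
    proof (cases "\<forall>u\<in>UV. eval r u = 0")
      case False
      then show ?thesis using sub by blast
    next
      case True
      then obtain \<alpha> where \<alpha>: "\<alpha> \<in> BoxX" "\<forall>i\<in>V. K_point \<alpha> i = r i" using points_in_Box[of r] nz by blast
      obtain u where u: "u \<in> L" "eval (K_point \<alpha>) u \<noteq> 0" "u * p \<in> UV" using local_injectivity[OF \<alpha>(1) p(1) p(2)[OF \<alpha>(1)]] by blast
      have "eval (K_point \<alpha>) u = eval r u" unfolding laurent_eval_def using \<alpha>(2) by simp
      then show ?thesis using u by auto
    qed
  qed
  then show ?thesis by simp
qed

text \<open>
  Two distinct points differ in some coordinate, and a power of \<open>R\<^sub>i - r\<^sub>i\<close>, with \<open>r\<^sub>i\<close> the coordinate of the
  one point, is killed there but a unit at the other.  Products of such powers separate the points.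
\<close>

lemma chinese_remainder: "\<exists>p\<in>L. \<forall>\<alpha>\<in>BoxX. Phi \<alpha> p - t \<alpha> \<in> box_ideal \<alpha>"
proof -
  have sep: "\<exists>w\<in>L. eval (K_point \<alpha>) w \<noteq> 0 \<and> Phi \<gamma> w \<in> box_ideal \<gamma>" if ag: "\<alpha> \<in> BoxX" "\<gamma> \<in> BoxX" "\<gamma> \<noteq> \<alpha>" for \<alpha> \<gamma>
  proof -
    obtain i where i: "i \<in> V" "K_point \<alpha> i \<noteq> K_point \<gamma> i" using K_point_inj[OF ag(1,2)] ag(3) by blast
    let ?w = "laurent_var i - scalar (K_point \<gamma> i)"
    have wL: "?w \<in> L" using laurent_power_in[OF i(1)] by (intro L.diff_in L_scalar)
    have ev: "eval r ?w = r i - K_point \<gamma> i" for r by (simp add: eval_diff eval_laurent_power[OF i(1)])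
    have "T.nilp \<gamma> (Phi \<gamma> ?w)" using Phi_nilp[of \<gamma> ?w] by (simp add: ev)
    then obtain n where n: "Phi \<gamma> ?w ^ n \<in> box_ideal \<gamma>" by (auto simp: T.nilp_def)
    have "Phi \<gamma> (?w ^ n) \<in> box_ideal \<gamma>" using T.cong_in_iff[OF Phi_power] n by blast
    moreover have "eval (K_point \<alpha>) (?w ^ n) = (K_point \<alpha> i - K_point \<gamma> i) ^ n"
      by (induction n) (simp_all add: eval_mult_K ev)
    ultimately show ?thesis using wL L.power_in i(2) by (intro bexI[of _ "?w ^ n"]) auto
  qed
  have ind: "\<exists>p\<in>L. Phi \<alpha> p - t \<alpha> \<in> box_ideal \<alpha> \<and> (\<forall>\<gamma>\<in>BoxX - {\<alpha>}. Phi \<gamma> p \<in> box_ideal \<gamma>)" if \<alpha>: "\<alpha> \<in> BoxX" for \<alpha>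
  proof -
    obtain w where w: "\<And>\<gamma>. \<gamma> \<in> BoxX - {\<alpha>} \<Longrightarrow> w \<gamma> \<in> L \<and> eval (K_point \<alpha>) (w \<gamma>) \<noteq> 0 \<and> Phi \<gamma> (w \<gamma>) \<in> box_ideal \<gamma>"
      using sep[OF \<alpha>] by (metis Diff_iff singletonI)
    \<comment> \<open>A unit at \<open>\<alpha>\<close> that is killed at all other points.\<close>
    define W where "W = (\<Prod>\<gamma>\<in>BoxX - {\<alpha>}. w \<gamma>)"
    have fin: "finite (BoxX - {\<alpha>})" using finite_Box by simp
    have WL: "W \<in> L" unfolding W_def using w by (intro L.prod_in) blast
    have eW: "eval (K_point \<alpha>) W \<noteq> 0" unfolding W_def eval_prod[OF K_point_nz] using w fin by simp
    have PW: "Phi \<gamma> W \<in> box_ideal \<gamma>" if "\<gamma> \<in> BoxX - {\<alpha>}" for \<gamma>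
    proof -
      have "(\<Prod>\<delta>\<in>BoxX - {\<alpha>}. Phi \<gamma> (w \<delta>)) \<in> box_ideal \<gamma>" by (rule T.ideal_prod[OF fin that]) (use w[OF that] in simp_all)
      then show ?thesis unfolding W_def using T.cong_in_iff[OF Phi_prod] by blast
    qed
    obtain y where "(scalar (eval (K_point \<alpha>) W) + (Phi \<alpha> W - scalar (eval (K_point \<alpha>) W))) * y - 1 \<in> box_ideal \<alpha>"
      using T.unit_nilp_inverse[OF Phi_nilp eW] by blast
    then have y: "Phi \<alpha> W * y - 1 \<in> box_ideal \<alpha>" by simp
    obtain q where q: "q \<in> L" "Phi \<alpha> q - y * t \<alpha> \<in> box_ideal \<alpha>" using Phi_surj by blast
    have "Phi \<alpha> (W * q) - t \<alpha> = (Phi \<alpha> (W * q) - Phi \<alpha> W * Phi \<alpha> q) + Phi \<alpha> W * (Phi \<alpha> q - y * t \<alpha>) + t \<alpha> * (Phi \<alpha> W * y - 1)"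
      by (simp add: algebra_simps)
    also have "\<dots> \<in> box_ideal \<alpha>" by (intro T.ideal_add T.ideal_mult Phi_mult q(2) y) simp_all
    finally have 1: "Phi \<alpha> (W * q) - t \<alpha> \<in> box_ideal \<alpha>" .
    have "Phi \<gamma> (W * q) \<in> box_ideal \<gamma>" if "\<gamma> \<in> BoxX - {\<alpha>}" for \<gamma>
    proof -
      have "Phi \<gamma> W * Phi \<gamma> q \<in> box_ideal \<gamma>" using PW[OF that] by (rule T.ideal_mult') simp
      then show ?thesis using T.cong_in_iff[OF Phi_mult] by blast
    qed
    then show ?thesis using 1 WL q(1) L_mult by blast
  qed
  then obtain p where p: "\<And>\<alpha>. \<alpha> \<in> BoxX \<Longrightarrow> p \<alpha> \<in> L \<and> Phi \<alpha> (p \<alpha>) - t \<alpha> \<in> box_ideal \<alpha> \<and> (\<forall>\<gamma>\<in>BoxX - {\<alpha>}. Phi \<gamma> (p \<alpha>) \<in> box_ideal \<gamma>)"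
    by metis
  show ?thesis
  proof (intro bexI[of _ "\<Sum>\<alpha>\<in>BoxX. p \<alpha>"] ballI)
    show "(\<Sum>\<alpha>\<in>BoxX. p \<alpha>) \<in> L" using p by (intro L.sum_in) blast
    fix \<gamma> assume \<gamma>: "\<gamma> \<in> BoxX"
    have "Phi \<gamma> (\<Sum>\<alpha>\<in>BoxX. p \<alpha>) - t \<gamma> = (Phi \<gamma> (p \<gamma>) - t \<gamma>) + (\<Sum>\<alpha>\<in>BoxX - {\<gamma>}. Phi \<gamma> (p \<alpha>))"
      unfolding Phi_sum using sum.remove[OF finite_Box \<gamma>, of "\<lambda>\<alpha>. Phi \<gamma> (p \<alpha>)"] by simp
    also have "\<dots> \<in> box_ideal \<gamma>" using p \<gamma> by (intro T.ideal_add T.ideal_sum) auto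
    finally show "Phi \<gamma> (\<Sum>\<alpha>\<in>BoxX. p \<alpha>) - t \<gamma> \<in> box_ideal \<gamma>" .
  qed
qed

end

section \<open>Localization at the complement of a set of denominators\<close>

text \<open>
  A surjection \<open>h\<close> that makes the elements outside \<open>P\<close> invertible, and whose kernel consists of elements
  annihilated by some element outside \<open>P\<close>, identifies \<open>B\<close> with the localization of \<open>A\<close> at \<open>P\<close>.
\<close>

locale localization_hom =
  A: cring A + B: cring B for A :: "('a, 'm) ring_scheme" (structure) and B :: "('b, 'n) ring_scheme" (structure) +
  fixes P :: "'a set" and h :: "'a \<Rightarrow> 'b"
  assumes h: "h \<in> ring_hom A B"
    and one_not: "\<one> \<notin> P"
    and mult_not: "\<And>s t. s \<in> carrier A - P \<Longrightarrow> t \<in> carrier A - P \<Longrightarrow> s \<otimes> t \<notin> P"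
    and unit: "\<And>s. s \<in> carrier A - P \<Longrightarrow> h s \<in> Units B"
    and surj: "h ` carrier A = carrier B"
    and ker: "\<And>a. a \<in> carrier A \<Longrightarrow> h a = \<zero>\<^bsub>B\<^esub> \<Longrightarrow> \<exists>u\<in>carrier A - P. u \<otimes> a = \<zero>"
begin

abbreviation "D \<equiv> carrier A - P"

lemma h_closed: "a \<in> carrier A \<Longrightarrow> h a \<in> carrier B"
  and h_mult: "a \<in> carrier A \<Longrightarrow> b \<in> carrier A \<Longrightarrow> h (a \<otimes> b) = h a \<otimes>\<^bsub>B\<^esub> h b"
  and h_add: "a \<in> carrier A \<Longrightarrow> b \<in> carrier A \<Longrightarrow> h (a \<oplus> b) = h a \<oplus>\<^bsub>B\<^esub> h b"
  and h_one: "h \<one> = \<one>\<^bsub>B\<^esub>"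
  using h by (auto simp: ring_hom_def)

sublocale hom: ring_hom_cring A B h
  by (rule ring_hom_cringI[OF A.is_cring B.is_cring h])

definition val :: "'a \<Rightarrow> 'a \<Rightarrow> 'b" where "val a s = h a \<otimes>\<^bsub>B\<^esub> inv\<^bsub>B\<^esub> (h s)"

lemma val_closed: "a \<in> carrier A \<Longrightarrow> s \<in> D \<Longrightarrow> val a s \<in> carrier B"
  unfolding val_def using h_closed unit by auto

lemma val_prop: "a \<in> carrier A \<Longrightarrow> s \<in> D \<Longrightarrow> h s \<otimes>\<^bsub>B\<^esub> val a s = h a"
proof -
  assume a: "a \<in> carrier A" and s: "s \<in> D"
  have "h s \<otimes>\<^bsub>B\<^esub> (x \<otimes>\<^bsub>B\<^esub> i) = x \<otimes>\<^bsub>B\<^esub> (h s \<otimes>\<^bsub>B\<^esub> i)" if "x \<in> carrier B" "i \<in> carrier B" for x i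
    using that s h_closed by (simp add: B.m_lcomm)
  then show ?thesis unfolding val_def using a unit[OF s] h_closed[OF a]
    by (simp only: B.Units_inv_closed B.Units_r_inv B.r_one)
qed

lemma val_unique: "a \<in> carrier A \<Longrightarrow> s \<in> D \<Longrightarrow> y \<in> carrier B \<Longrightarrow> h s \<otimes>\<^bsub>B\<^esub> y = h a \<Longrightarrow> val a s = y"
  using val_prop[of a s] B.Units_l_cancel[OF unit[of s], of "val a s" y] val_closed[of a s] by simp

lemma val_eq_iff:
  assumes "a \<in> carrier A" "s \<in> D" "b \<in> carrier A" "t \<in> D"
  shows "val a s = val b t \<longleftrightarrow> h (t \<otimes> a) = h (s \<otimes> b)"
proof -
  have c: "h s \<in> Units B" "h t \<in> Units B" "h s \<in> carrier B" "h t \<in> carrier B"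
    "val a s \<in> carrier B" "val b t \<in> carrier B"
    using assms h_closed unit val_closed by auto
  have 1: "h s \<otimes>\<^bsub>B\<^esub> (h t \<otimes>\<^bsub>B\<^esub> val a s) = h (t \<otimes> a)"
    using assms c val_prop[OF assms(1,2)] B.m_lcomm[of "h s" "h t" "val a s"] by (simp add: h_mult)
  have 2: "h s \<otimes>\<^bsub>B\<^esub> (h t \<otimes>\<^bsub>B\<^esub> val b t) = h (s \<otimes> b)"
    using assms val_prop[OF assms(3,4)] by (simp add: h_mult)
  have "val a s = val b t \<longleftrightarrow> h s \<otimes>\<^bsub>B\<^esub> (h t \<otimes>\<^bsub>B\<^esub> val a s) = h s \<otimes>\<^bsub>B\<^esub> (h t \<otimes>\<^bsub>B\<^esub> val b t)"
    using c by (simp add: B.Units_l_cancel)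
  then show ?thesis unfolding 1 2 .
qed

lemma in_fraction_iff:
  assumes "a \<in> carrier A" "s \<in> D"
  shows "(b, t) \<in> fraction A P a s \<longleftrightarrow> b \<in> carrier A \<and> t \<in> D \<and> val b t = val a s"
proof -
  have "(\<exists>u\<in>D. u \<otimes> (t \<otimes> a \<ominus> s \<otimes> b) = \<zero>) \<longleftrightarrow> val b t = val a s"
    if bt: "b \<in> carrier A" "t \<in> D"
  proof -
    have car: "t \<otimes> a \<in> carrier A" "s \<otimes> b \<in> carrier A" using assms bt by auto
    have hd: "h (t \<otimes> a \<ominus> s \<otimes> b) = h (t \<otimes> a) \<ominus>\<^bsub>B\<^esub> h (s \<otimes> b)"
      using car by (simp add: A.minus_eq B.minus_eq)
    have "(\<exists>u\<in>D. u \<otimes> (t \<otimes> a \<ominus> s \<otimes> b) = \<zero>) \<longleftrightarrow> h (t \<otimes> a \<ominus> s \<otimes> b) = \<zero>\<^bsub>B\<^esub>"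
    proof
      assume "\<exists>u\<in>D. u \<otimes> (t \<otimes> a \<ominus> s \<otimes> b) = \<zero>"
      then obtain u where u: "u \<in> D" "u \<otimes> (t \<otimes> a \<ominus> s \<otimes> b) = \<zero>" by blast
      have z: "h u \<otimes>\<^bsub>B\<^esub> h (t \<otimes> a \<ominus> s \<otimes> b) = \<zero>\<^bsub>B\<^esub>"
        using arg_cong[OF u(2), of h] u(1) car h_mult[of u "t \<otimes> a \<ominus> s \<otimes> b"] by simp
      have "h (t \<otimes> a \<ominus> s \<otimes> b) \<in> carrier B" using car by (intro h_closed A.minus_closed)
      then show "h (t \<otimes> a \<ominus> s \<otimes> b) = \<zero>\<^bsub>B\<^esub>"
        using z B.Units_l_cancel[OF unit[OF u(1)], of "h (t \<otimes> a \<ominus> s \<otimes> b)" "\<zero>\<^bsub>B\<^esub>"] u(1) h_closed by simp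
    next
      assume "h (t \<otimes> a \<ominus> s \<otimes> b) = \<zero>\<^bsub>B\<^esub>"
      then show "\<exists>u\<in>D. u \<otimes> (t \<otimes> a \<ominus> s \<otimes> b) = \<zero>"
        using car by (intro ker A.minus_closed)
    qed
    also have "\<dots> \<longleftrightarrow> h (t \<otimes> a) = h (s \<otimes> b)"
      unfolding hd using car h_closed by (intro B.r_right_minus_eq) auto
    also have "\<dots> \<longleftrightarrow> val a s = val b t" using val_eq_iff assms bt by blast
    finally show ?thesis by auto
  qed
  then show ?thesis unfolding fraction_def by auto
qed

lemma fraction_eq_iff:
  assumes "a \<in> carrier A" "s \<in> D" "b \<in> carrier A" "t \<in> D"
  shows "fraction A P a s = fraction A P b t \<longleftrightarrow> val a s = val b t"
proof
  assume "fraction A P a s = fraction A P b t"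
  moreover have "(a, s) \<in> fraction A P a s" using in_fraction_iff assms by blast
  ultimately show "val a s = val b t" using in_fraction_iff[OF assms(3,4)] by blast
next
  assume "val a s = val b t"
  then show "fraction A P a s = fraction A P b t"
    using in_fraction_iff[OF assms(1,2)] in_fraction_iff[OF assms(3,4)] by auto
qed

definition loc_map :: "('a \<times> 'a) set \<Rightarrow> 'b" where
  "loc_map F = (THE x. \<exists>(a, s)\<in>F. x = val a s)"

lemma loc_map_fraction:
  assumes "a \<in> carrier A" "s \<in> D" shows "loc_map (fraction A P a s) = val a s"
  unfolding loc_map_def
proof (rule the_equality)
  have "(a, s) \<in> fraction A P a s" using in_fraction_iff assms by blast
  then show "\<exists>(a', s')\<in>fraction A P a s. val a s = val a' s'" by blast
qed (use in_fraction_iff[OF assms] in auto)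

lemma one_D: "\<one> \<in> D" using one_not by auto

lemma mult_D: "s \<in> D \<Longrightarrow> t \<in> D \<Longrightarrow> s \<otimes> t \<in> D" using mult_not by auto

lemma val_mult:
  assumes "a \<in> carrier A" "s \<in> D" "b \<in> carrier A" "t \<in> D"
  shows "val (a \<otimes> b) (s \<otimes> t) = val a s \<otimes>\<^bsub>B\<^esub> val b t"
proof (rule val_unique[OF _ mult_D])
  have c: "h s \<in> carrier B" "h t \<in> carrier B" "val a s \<in> carrier B" "val b t \<in> carrier B"
    using assms h_closed val_closed by auto
  have "h (s \<otimes> t) \<otimes>\<^bsub>B\<^esub> (val a s \<otimes>\<^bsub>B\<^esub> val b t) = (h s \<otimes>\<^bsub>B\<^esub> val a s) \<otimes>\<^bsub>B\<^esub> (h t \<otimes>\<^bsub>B\<^esub> val b t)"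
    using assms c by (simp add: h_mult B.m_ac)
  then show "h (s \<otimes> t) \<otimes>\<^bsub>B\<^esub> (val a s \<otimes>\<^bsub>B\<^esub> val b t) = h (a \<otimes> b)"
    using assms by (simp only: val_prop h_mult)
qed (use assms val_closed in auto)

lemma val_add:
  assumes "a \<in> carrier A" "s \<in> D" "b \<in> carrier A" "t \<in> D"
  shows "val (t \<otimes> a \<oplus> s \<otimes> b) (s \<otimes> t) = val a s \<oplus>\<^bsub>B\<^esub> val b t"
proof (rule val_unique[OF _ mult_D])
  have c: "h s \<in> carrier B" "h t \<in> carrier B" "val a s \<in> carrier B" "val b t \<in> carrier B"
    using assms h_closed val_closed by auto
  have "h (s \<otimes> t) \<otimes>\<^bsub>B\<^esub> (val a s \<oplus>\<^bsub>B\<^esub> val b t)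
      = h t \<otimes>\<^bsub>B\<^esub> (h s \<otimes>\<^bsub>B\<^esub> val a s) \<oplus>\<^bsub>B\<^esub> h s \<otimes>\<^bsub>B\<^esub> (h t \<otimes>\<^bsub>B\<^esub> val b t)"
    using assms c by (simp add: h_mult B.r_distr B.m_ac)
  also have "\<dots> = h t \<otimes>\<^bsub>B\<^esub> h a \<oplus>\<^bsub>B\<^esub> h s \<otimes>\<^bsub>B\<^esub> h b" using assms by (simp only: val_prop)
  finally show "h (s \<otimes> t) \<otimes>\<^bsub>B\<^esub> (val a s \<oplus>\<^bsub>B\<^esub> val b t) = h (t \<otimes> a \<oplus> s \<otimes> b)"
    using assms by (simp add: h_mult h_add)
qed (use assms val_closed in auto)

text \<open>
  A class of fractions is determined by its value in \<open>B\<close>, so all members of the unions in the ring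
  operations are the same class.
\<close>

lemma localization_op:
  assumes "a \<in> carrier A" "s \<in> D" "b \<in> carrier A" "t \<in> D"
    and f_closed: "\<And>a s b t. a \<in> carrier A \<Longrightarrow> s \<in> D \<Longrightarrow> b \<in> carrier A \<Longrightarrow> t \<in> D \<Longrightarrow> f a s b t \<in> carrier A"
    and val: "\<And>a s b t. a \<in> carrier A \<Longrightarrow> s \<in> D \<Longrightarrow> b \<in> carrier A \<Longrightarrow> t \<in> D \<Longrightarrow>
      val (f a s b t) (s \<otimes> t) = k (val a s) (val b t)"
  shows "(\<Union>(a, s)\<in>fraction A P a s. \<Union>(b, t)\<in>fraction A P b t. fraction A P (f a s b t) (s \<otimes> t))
    = fraction A P (f a s b t) (s \<otimes> t)"
proof -
  have eq: "fraction A P (f a' s' b' t') (s' \<otimes> t') = fraction A P (f a s b t) (s \<otimes> t)"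
    if "(a', s') \<in> fraction A P a s" "(b', t') \<in> fraction A P b t" for a' s' b' t'
  proof -
    have *: "a' \<in> carrier A" "s' \<in> D" "val a' s' = val a s" "b' \<in> carrier A" "t' \<in> D" "val b' t' = val b t"
      using that in_fraction_iff assms(1-4) by auto
    have "val (f a' s' b' t') (s' \<otimes> t') = val (f a s b t) (s \<otimes> t)"
      unfolding val[OF *(1,2,4,5)] val[OF assms(1-4)] *(3,6) ..
    then show ?thesis
      unfolding fraction_eq_iff[OF f_closed[OF *(1,2,4,5)] mult_D[OF *(2,5)] f_closed[OF assms(1-4)] mult_D[OF assms(2,4)]] .
  qed
  have "(a, s) \<in> fraction A P a s" "(b, t) \<in> fraction A P b t" using in_fraction_iff assms(1-4) by blast+
  then show ?thesis using eq by fast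
qed

lemma loc_map_iso: "loc_map \<in> ring_iso (localization A P) B"
proof -
  have car: "carrier (localization A P) = {fraction A P a s | a s. a \<in> carrier A \<and> s \<in> D}"
    by (simp add: localization_def)
  have one: "loc_map (fraction A P a \<one>) = h a" if "a \<in> carrier A" for a
    unfolding loc_map_fraction[OF that one_D] val_def h_one using h_closed[OF that] by simp
  have "loc_map \<in> ring_hom (localization A P) B"
  proof (rule ring_hom_memI)
    fix F assume "F \<in> carrier (localization A P)"
    then show "loc_map F \<in> carrier B" unfolding car using loc_map_fraction val_closed by auto
  next
    fix F G assume "F \<in> carrier (localization A P)" "G \<in> carrier (localization A P)"
    then obtain a s b t where F: "F = fraction A P a s" "a \<in> carrier A" "s \<in> D" and G: "G = fraction A P b t" "b \<in> carrier A" "t \<in> D"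
      unfolding car by blast
    have "F \<otimes>\<^bsub>localization A P\<^esub> G = fraction A P (a \<otimes> b) (s \<otimes> t)"
      unfolding F(1) G(1) localization_def monoid.simps
      by (rule localization_op[where f = "\<lambda>a s b t. a \<otimes> b" and k = "(\<otimes>\<^bsub>B\<^esub>)"]) (use F G val_mult in auto)
    then show "loc_map (F \<otimes>\<^bsub>localization A P\<^esub> G) = loc_map F \<otimes>\<^bsub>B\<^esub> loc_map G"
      using F G mult_D val_mult by (simp add: loc_map_fraction)
    have "F \<oplus>\<^bsub>localization A P\<^esub> G = fraction A P (t \<otimes> a \<oplus> s \<otimes> b) (s \<otimes> t)"
      unfolding F(1) G(1) localization_def ring.simps
      by (rule localization_op[where f = "\<lambda>a s b t. t \<otimes> a \<oplus> s \<otimes> b" and k = "(\<oplus>\<^bsub>B\<^esub>)"]) (use F G val_add in auto)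
    then show "loc_map (F \<oplus>\<^bsub>localization A P\<^esub> G) = loc_map F \<oplus>\<^bsub>B\<^esub> loc_map G"
      using F G mult_D val_add by (simp add: loc_map_fraction)
  next
    show "loc_map \<one>\<^bsub>localization A P\<^esub> = \<one>\<^bsub>B\<^esub>" using one[OF A.one_closed] h_one by (simp add: localization_def)
  qed
  moreover have "bij_betw loc_map (carrier (localization A P)) (carrier B)"
  proof (rule bij_betw_imageI)
    show "inj_on loc_map (carrier (localization A P))"
    proof (rule inj_onI)
      fix F G assume "F \<in> carrier (localization A P)" "G \<in> carrier (localization A P)" and eq: "loc_map F = loc_map G"
      then obtain a s b t where F: "F = fraction A P a s" "a \<in> carrier A" "s \<in> D"
        and G: "G = fraction A P b t" "b \<in> carrier A" "t \<in> D" unfolding car by blast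
      have "val a s = val b t" using eq unfolding F(1) G(1) loc_map_fraction[OF F(2,3)] loc_map_fraction[OF G(2,3)] .
      then show "F = G" unfolding F(1) G(1) fraction_eq_iff[OF F(2,3) G(2,3)] .
    qed
    show "loc_map ` carrier (localization A P) = carrier B"
    proof
      show "loc_map ` carrier (localization A P) \<subseteq> carrier B" unfolding car using loc_map_fraction val_closed by auto
      show "carrier B \<subseteq> loc_map ` carrier (localization A P)"
      proof
        fix b assume "b \<in> carrier B"
        then obtain a where a: "a \<in> carrier A" "b = h a" using surj by blast
        then have "b = loc_map (fraction A P a \<one>)" using one by simp
        then show "b \<in> loc_map ` carrier (localization A P)" unfolding car using a(1) one_D by blast
      qed
    qed
  qed
  ultimately show ?thesis by (simp add: ring_iso_def)
qed

lemma loc_map_one: "a \<in> carrier A \<Longrightarrow> loc_map (fraction A P a \<one>) = h a"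
  unfolding loc_map_fraction[OF _ one_D] val_def h_one using h_closed by simp

end

section \<open>The isomorphisms\<close>

context fan_basis begin

lemma UV_sub: "additive_subset UV"
  by unfold_locales auto

lemma K_class_translate: "Kclass p = (\<lambda>h. h + p) ` UV"
  unfolding K_class_def by (rule coset_translate) simp

lemma K_class_eq_iff: "Kclass p = Kclass q \<longleftrightarrow> p - q \<in> UV"
  unfolding K_class_translate by (rule additive_subset.translate_eq_iff[OF UV_sub])

lemma UV_ideal: "ideal UV Lring"
  unfolding ideal_rel_ideal by (rule UV_props(1))

lemma KC_cring: "cring (Kring)"
  unfolding KC_def by (rule ideal.quotient_is_cring[OF UV_ideal Lring_cring])

lemma KC_sel:
  "carrier (Kring) = Kclass ` L"
  "\<one>\<^bsub>Kring\<^esub> = Kclass 1"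
  "\<zero>\<^bsub>Kring\<^esub> = Kclass 0"
  "p \<in> L \<Longrightarrow> q \<in> L \<Longrightarrow> Kclass p \<oplus>\<^bsub>Kring\<^esub> Kclass q = Kclass (p + q)"
  "p \<in> L \<Longrightarrow> q \<in> L \<Longrightarrow> Kclass p \<otimes>\<^bsub>Kring\<^esub> Kclass q = Kclass (p * q)"
proof -
  have h: "(+>\<^bsub>Lring\<^esub>) UV \<in> ring_hom Lring (Kring)"
    unfolding KC_def by (rule ideal.rcos_ring_hom[OF UV_ideal])
  show "carrier (Kring) = Kclass ` L"
    unfolding KC_def FactRing_def K_class_def A_RCOSETS_def RCOSETS_def a_r_coset_def by auto
  show "\<one>\<^bsub>Kring\<^esub> = Kclass 1" using ring_hom_one[OF h] by (simp add: K_class_def)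
  show "\<zero>\<^bsub>Kring\<^esub> = Kclass 0" by (simp add: KC_def FactRing_def K_class_translate)
  show "Kclass p \<oplus>\<^bsub>Kring\<^esub> Kclass q = Kclass (p + q)" if "p \<in> L" "q \<in> L"
    using ring_hom_add[OF h, of p q] that by (simp add: K_class_def)
  show "Kclass p \<otimes>\<^bsub>Kring\<^esub> Kclass q = Kclass (p * q)" if "p \<in> L" "q \<in> L"
    using ring_hom_mult[OF h, of p q] that by (simp add: K_class_def)
qed

definition K_map :: "(nat \<Rightarrow> complex) \<Rightarrow> laurent set \<Rightarrow> ('v \<Rightarrow>\<^sub>0 complex) set" where
  "K_map \<alpha> x = box_class \<alpha> (Phi \<alpha> (SOME p. p \<in> L \<and> Kclass p = x))"

text \<open>The choice of the representative does not matter because \<open>Phi \<alpha>\<close> kills \<open>U + V\<close>.\<close>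

lemma K_map_class:
  assumes \<alpha>: "\<alpha> \<in> BoxX" and p: "p \<in> L"
  shows "K_map \<alpha> (Kclass p) = box_class \<alpha> (Phi \<alpha> p)"
proof -
  define q where "q = (SOME q. q \<in> L \<and> Kclass q = Kclass p)"
  have "q \<in> L \<and> Kclass q = Kclass p" unfolding q_def by (rule someI[of _ p]) (use p in simp)
  then have "q - p \<in> UV" using K_class_eq_iff by blast
  then have "Phi \<alpha> q - Phi \<alpha> p \<in> box_ideal \<alpha>" using Phi_UV[OF \<alpha>] by (simp flip: Phi_diff)
  then show ?thesis unfolding K_map_def q_def[symmetric] box_class_eq_iff[OF \<alpha>] .
qed

lemma class_in_max_iff:
  assumes \<alpha>: "\<alpha> \<in> BoxX" and p: "p \<in> L"
  shows "Kclass p \<in> Kmax \<alpha> \<longleftrightarrow> eval (K_point \<alpha>) p = 0"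
proof
  assume "Kclass p \<in> Kmax \<alpha>"
  then obtain q where q: "q \<in> L" "eval (K_point \<alpha>) q = 0" "Kclass p = Kclass q"
    unfolding K_max_ideal_def by auto
  then have "eval (K_point \<alpha>) (p - q) = 0" using eval_UV[OF \<alpha>] K_class_eq_iff by blast
  then show "eval (K_point \<alpha>) p = 0" using q by (simp add: eval_diff)
next
  assume "eval (K_point \<alpha>) p = 0"
  then show "Kclass p \<in> Kmax \<alpha>" unfolding K_max_ideal_def using p by simp
qed

lemma outside_max:
  assumes \<alpha>: "\<alpha> \<in> BoxX"
  shows "carrier (Kring) - Kmax \<alpha> = Kclass ` {p \<in> L. eval (K_point \<alpha>) p \<noteq> 0}"
  unfolding KC_sel using class_in_max_iff[OF \<alpha>] by auto

lemma K_map_localization: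
  assumes \<alpha>: "\<alpha> \<in> BoxX"
  shows "localization_hom (Kring) (Qring \<alpha>) (Kmax \<alpha>) (K_map \<alpha>)"
proof -
  interpret A: cring "Kring" by (rule KC_cring)
  interpret B: cring "Qring \<alpha>" by (rule Q_cring[OF \<alpha>])
  show ?thesis
  proof
    show "K_map \<alpha> \<in> ring_hom (Kring) (Qring \<alpha>)"
    proof (rule ring_hom_memI)
      fix x assume "x \<in> carrier (Kring)"
      then show "K_map \<alpha> x \<in> carrier (Qring \<alpha>)" unfolding K_map_def box_class_hom(5)[OF \<alpha>] by blast
    next
      fix x y assume "x \<in> carrier (Kring)" "y \<in> carrier (Kring)"
      then obtain p q where pq: "p \<in> L" "q \<in> L" "x = Kclass p" "y = Kclass q" unfolding KC_sel by blast
      show "K_map \<alpha> (x \<otimes>\<^bsub>Kring\<^esub> y) = K_map \<alpha> x \<otimes>\<^bsub>Qring \<alpha>\<^esub> K_map \<alpha> y"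
        using pq L_mult Phi_mult[of \<alpha> p q]
        by (simp add: KC_sel K_map_class[OF \<alpha>] box_class_hom(2)[OF \<alpha>, symmetric] box_class_eq_iff[OF \<alpha>])
      show "K_map \<alpha> (x \<oplus>\<^bsub>Kring\<^esub> y) = K_map \<alpha> x \<oplus>\<^bsub>Qring \<alpha>\<^esub> K_map \<alpha> y"
        using pq L_add by (simp add: KC_sel K_map_class[OF \<alpha>] box_class_hom(1)[OF \<alpha>, symmetric] Phi_add)
    next
      show "K_map \<alpha> \<one>\<^bsub>Kring\<^esub> = \<one>\<^bsub>Qring \<alpha>\<^esub>"
        by (simp add: KC_sel K_map_class[OF \<alpha>] box_class_hom(3)[OF \<alpha>] box_class_eq_iff[OF \<alpha>] Phi_1)
    qed
    show "\<one>\<^bsub>Kring\<^esub> \<notin> Kmax \<alpha>" unfolding KC_sel class_in_max_iff[OF \<alpha> L.one_in] by simp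
    show "s \<otimes>\<^bsub>Kring\<^esub> t \<notin> Kmax \<alpha>"
      if "s \<in> carrier (Kring) - Kmax \<alpha>" "t \<in> carrier (Kring) - Kmax \<alpha>" for s t
      using that L_mult unfolding outside_max[OF \<alpha>] by (auto simp: KC_sel class_in_max_iff[OF \<alpha>] eval_mult_K)
    show "K_map \<alpha> s \<in> Units (Qring \<alpha>)" if "s \<in> carrier (Kring) - Kmax \<alpha>" for s
    proof -
      obtain p where p: "p \<in> L" "eval (K_point \<alpha>) p \<noteq> 0" "s = Kclass p"
        using \<open>s \<in> carrier (Kring) - Kmax \<alpha>\<close> unfolding outside_max[OF \<alpha>] by blast
      obtain y where "(scalar (eval (K_point \<alpha>) p) + (Phi \<alpha> p - scalar (eval (K_point \<alpha>) p))) * y - 1 \<in> box_ideal \<alpha>"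
        using T.unit_nilp_inverse[OF Phi_nilp p(2)] by blast
      then have "box_class \<alpha> (Phi \<alpha> p * y) = box_class \<alpha> 1" unfolding box_class_eq_iff[OF \<alpha>] by simp
      then have "K_map \<alpha> s \<otimes>\<^bsub>Qring \<alpha>\<^esub> box_class \<alpha> y = \<one>\<^bsub>Qring \<alpha>\<^esub>"
        unfolding p(3) K_map_class[OF \<alpha> p(1)] box_class_hom(2,3)[OF \<alpha>] .
      moreover have "K_map \<alpha> s \<in> carrier (Qring \<alpha>)" "box_class \<alpha> y \<in> carrier (Qring \<alpha>)"
        unfolding K_map_def box_class_hom(5)[OF \<alpha>] by blast+
      moreover from calculation have "box_class \<alpha> y \<otimes>\<^bsub>Qring \<alpha>\<^esub> K_map \<alpha> s = \<one>\<^bsub>Qring \<alpha>\<^esub>"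
        using B.m_comm[of "K_map \<alpha> s" "box_class \<alpha> y"] by simp
      ultimately show ?thesis unfolding Units_def by blast
    qed
    show "K_map \<alpha> ` carrier (Kring) = carrier (Qring \<alpha>)"
    proof
      show "K_map \<alpha> ` carrier (Kring) \<subseteq> carrier (Qring \<alpha>)" unfolding K_map_def box_class_hom(5)[OF \<alpha>] by blast
      show "carrier (Qring \<alpha>) \<subseteq> K_map \<alpha> ` carrier (Kring)"
      proof
        fix y assume "y \<in> carrier (Qring \<alpha>)"
        then obtain t where t: "y = box_class \<alpha> t" unfolding box_class_hom(5)[OF \<alpha>] by blast
        obtain p where p: "p \<in> L" "Phi \<alpha> p - t \<in> box_ideal \<alpha>" using Phi_surj by blast
        then have "y = K_map \<alpha> (Kclass p)" unfolding t K_map_class[OF \<alpha> p(1)] using box_class_eq_iff[OF \<alpha>] by blast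
        then show "y \<in> K_map \<alpha> ` carrier (Kring)" unfolding KC_sel using p(1) by blast
      qed
    qed
    show "\<exists>u\<in>carrier (Kring) - Kmax \<alpha>. u \<otimes>\<^bsub>Kring\<^esub> a = \<zero>\<^bsub>Kring\<^esub>"
      if a: "a \<in> carrier (Kring)" "K_map \<alpha> a = \<zero>\<^bsub>Qring \<alpha>\<^esub>" for a
    proof -
      obtain p where p: "p \<in> L" "a = Kclass p" using a(1) unfolding KC_sel by blast
      have "box_class \<alpha> (Phi \<alpha> p) = box_class \<alpha> 0" using a(2) unfolding p(2) K_map_class[OF \<alpha> p(1)] box_class_hom(4)[OF \<alpha>] .
      then have "Phi \<alpha> p \<in> box_ideal \<alpha>" unfolding box_class_eq_iff[OF \<alpha>] by simp
      then obtain u where u: "u \<in> L" "eval (K_point \<alpha>) u \<noteq> 0" "u * p \<in> UV" using local_injectivity[OF \<alpha> p(1)] by blast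
      have "Kclass u \<otimes>\<^bsub>Kring\<^esub> a = \<zero>\<^bsub>Kring\<^esub>"
        unfolding p(2) KC_sel(5)[OF u(1) p(1)] KC_sel(3) K_class_eq_iff using u(3) by simp
      then show ?thesis unfolding outside_max[OF \<alpha>] using u by blast
    qed
  qed
qed

definition phi_loc where
  "phi_loc \<alpha> = localization_hom.loc_map (Qring \<alpha>) (K_map \<alpha>)"

lemma phi_loc_class:
  assumes "\<alpha> \<in> BoxX" "p \<in> L"
  shows "phi_loc \<alpha> (Klocalize \<alpha> (Kclass p)) = box_class \<alpha> (Phi \<alpha> p)"
  unfolding phi_loc_def K_localize_def
  using localization_hom.loc_map_one[OF K_map_localization[OF assms(1)], of "Kclass p"] assms
  by (simp add: KC_sel K_map_class)

lemma phi_loc_iso: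
  assumes \<alpha>: "\<alpha> \<in> BoxX"
  shows "phi_loc \<alpha> \<in> complex_algebra_iso
         (KC_local X \<beta> \<alpha>) (\<lambda>c. Klocalize \<alpha> (Kclass (scalar c)))
         (Qring \<alpha>) (\<lambda>c. Qclass \<alpha> (scalar c))"
proof -
  have "phi_loc \<alpha> \<in> ring_iso (KC_local X \<beta> \<alpha>) (Qring \<alpha>)"
    unfolding phi_loc_def KC_local_def by (rule localization_hom.loc_map_iso[OF K_map_localization[OF \<alpha>]])
  moreover have "phi_loc \<alpha> (Klocalize \<alpha> (Kclass (scalar c))) = Qclass \<alpha> (scalar c)" for c
  proof -
    have "Qclass \<alpha> (scalar c) = box_class \<alpha> (scalar c)" by (simp add: box_class_def scalar_sr_hom) (simp add: scalar_def)
    then show ?thesis unfolding phi_loc_class[OF \<alpha> L_scalar] using Phi_scalar box_class_eq_iff[OF \<alpha>] by simp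
  qed
  ultimately show ?thesis by (simp add: complex_algebra_iso_def)
qed

lemma phi_loc_var:
  assumes \<alpha>: "\<alpha> \<in> BoxX" and i: "i \<in> V"
  shows "phi_loc \<alpha> (Klocalize \<alpha> (Kclass (laurent_var i))) =
            exp_nilpotent (Qring \<alpha>) (\<lambda>c. Qclass \<alpha> (scalar c))
              (two_pi_i * \<alpha> i) (Qclass \<alpha> (ray_elt X i))"
proof -
  obtain a where a: "T.is_exp \<alpha> (mvar i) a" "Phi \<alpha> (laurent_var i) = scalar (exp (two_pi_i * \<alpha> i)) * a"
    using Phi_var[OF i] by blast
  have "Qclass \<alpha> (ray_elt X i) = box_class \<alpha> (mvar i)" unfolding box_class_def sr_hom_mvar using i by simp
  then show ?thesis unfolding phi_loc_class[OF \<alpha> laurent_power_in[OF i]] a(2) by (simp only: exp_nilpotent_box_class[OF \<alpha> a(1)])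
qed

definition phi_glob where
  "phi_glob x = finsum (Hmod) (\<lambda>\<alpha>. H_summand d X g \<beta> \<alpha> (phi_loc \<alpha> (Klocalize \<alpha> x))) (BoxX)"

lemma phi_glob_class:
  assumes p: "p \<in> L"
  shows "phi_glob (Kclass p) = HC_class (module_sum (\<lambda>\<alpha>. Phi \<alpha> p))"
proof -
  interpret H: abelian_monoid "Hmod" by (rule HC_monoid[OF finite_Box])
  have "HC_class (module_map \<alpha> (Phi \<alpha> p)) \<in> carrier (Hmod)" if "\<alpha> \<in> BoxX" for \<alpha>
    unfolding HC_sel(1)[OF finite_Box] module_sum_single[OF finite_Box that, symmetric] by blast
  then have "phi_glob (Kclass p) = finsum (Hmod) (\<lambda>\<alpha>. HC_class (module_map \<alpha> (Phi \<alpha> p))) (BoxX)"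
    unfolding phi_glob_def
    by (intro H.finsum_cong') (auto simp: phi_loc_class[OF _ p] H_summand_box_class[OF finite_Box])
  also have "\<dots> = HC_class (module_sum (\<lambda>\<alpha>. Phi \<alpha> p))" unfolding module_sum_def by (rule HC_finsum[OF finite_Box]) simp
  finally show ?thesis .
qed

lemma phi_glob_iso:
  "phi_glob \<in> complex_linear_iso
      (Kring) (\<lambda>c x. Kclass (scalar c) \<otimes>\<^bsub>Kring\<^esub> x)
      (Hmod) (\<lambda>c x. scalar c \<odot>\<^bsub>Hmod\<^esub> x)"
  unfolding complex_linear_iso_def
proof (intro CollectI conjI ballI allI)
  show "bij_betw phi_glob (carrier (Kring)) (carrier (Hmod))"
  proof (rule bij_betw_imageI)
    show "inj_on phi_glob (carrier (Kring))"
    proof (rule inj_onI)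
      fix x y assume "x \<in> carrier (Kring)" "y \<in> carrier (Kring)" and eq: "phi_glob x = phi_glob y"
      then obtain p q where pq: "p \<in> L" "q \<in> L" "x = Kclass p" "y = Kclass q" unfolding KC_sel by blast
      have "\<forall>\<alpha>\<in>BoxX. Phi \<alpha> p - Phi \<alpha> q \<in> box_ideal \<alpha>"
        using eq unfolding pq phi_glob_class[OF pq(1)] phi_glob_class[OF pq(2)] HC_class_module_sum_eq_iff[OF finite_Box] .
      then have "p - q \<in> UV" using pq(1,2) by (intro global_injectivity L.diff_in) (simp_all add: Phi_diff)
      then show "x = y" unfolding pq K_class_eq_iff .
    qed
    show "phi_glob ` carrier (Kring) = carrier (Hmod)"
    proof
      show "phi_glob ` carrier (Kring) \<subseteq> carrier (Hmod)"
        unfolding KC_sel HC_sel(1)[OF finite_Box] by (auto simp: phi_glob_class)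
      show "carrier (Hmod) \<subseteq> phi_glob ` carrier (Kring)"
      proof
        fix y assume "y \<in> carrier (Hmod)"
        then obtain t where t: "y = HC_class (module_sum t)" unfolding HC_sel(1)[OF finite_Box] by blast
        obtain p where p: "p \<in> L" "\<forall>\<alpha>\<in>BoxX. Phi \<alpha> p - t \<alpha> \<in> box_ideal \<alpha>" using chinese_remainder by blast
        have "phi_glob (Kclass p) = y"
          unfolding t phi_glob_class[OF p(1)] HC_class_module_sum_eq_iff[OF finite_Box] by (rule p(2))
        then show "y \<in> phi_glob ` carrier (Kring)" unfolding KC_sel using p(1) by blast
      qed
    qed
  qed
  fix x y assume "x \<in> carrier (Kring)" "y \<in> carrier (Kring)"
  then obtain p q where pq: "p \<in> L" "q \<in> L" "x = Kclass p" "y = Kclass q" unfolding KC_sel by blast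
  show "phi_glob (x \<oplus>\<^bsub>Kring\<^esub> y) = phi_glob x \<oplus>\<^bsub>Hmod\<^esub> phi_glob y"
    using pq L_add by (simp add: KC_sel phi_glob_class HC_sel(3)[OF finite_Box] Phi_add module_sum_add)
next
  fix c x assume "x \<in> carrier (Kring)"
  then obtain p where p: "p \<in> L" "x = Kclass p" unfolding KC_sel by blast
  have "Phi \<alpha> (scalar c * p) - scalar c * Phi \<alpha> p \<in> box_ideal \<alpha>" for \<alpha>
  proof -
    have "Phi \<alpha> (scalar c) * Phi \<alpha> p - scalar c * Phi \<alpha> p \<in> box_ideal \<alpha>"
      by (rule T.cong_mult[OF Phi_scalar]) simp_all
    then show ?thesis by (rule T.cong_trans[OF Phi_mult])
  qed
  then have "HC_class (module_sum (\<lambda>\<alpha>. Phi \<alpha> (scalar c * p))) = HC_class (module_sum (\<lambda>\<alpha>. scalar c * Phi \<alpha> p))"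
    unfolding HC_class_module_sum_eq_iff[OF finite_Box] by blast
  also have "\<dots> = scalar c \<odot>\<^bsub>Hmod\<^esub> HC_class (module_sum (\<lambda>\<alpha>. Phi \<alpha> p))"
    using HC_smult[OF finite_Box, of "scalar c"] by (simp add: scalar_def sr_hom_scalar)
  finally show "phi_glob (Kclass (scalar c) \<otimes>\<^bsub>Kring\<^esub> x) = scalar c \<odot>\<^bsub>Hmod\<^esub> phi_glob x"
    unfolding p(2) KC_sel(5)[OF L_scalar p(1)] phi_glob_class[OF p(1)] phi_glob_class[OF L_mult[OF L_scalar p(1)]] .
qed

end

theorem theorem3p3:
  fixes d :: nat
    and X :: "'v::real_vector stacky_fan"
    and g :: "nat \<Rightarrow> 'v \<Rightarrow> real"
    and \<beta> :: "'v \<times> 'v"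
  assumes "simplicial_stacky_fan d X"
    and "is_dual_basis d (lat X) g"
  shows "\<exists>\<phi> \<phi>loc.
    (\<forall>\<alpha>\<in>Box X \<beta>.
       \<phi>loc \<alpha> \<in> complex_algebra_iso
         (KC_local X \<beta> \<alpha>) (\<lambda>c. K_localize X \<beta> \<alpha> (K_class X \<beta> (scalar c)))
         (Q_ring d X g \<beta> \<alpha>) (\<lambda>c. Q_class d X g \<beta> \<alpha> (scalar c)) \<and>
       (\<forall>i\<in>{1..nrays X}.
          \<phi>loc \<alpha> (K_localize X \<beta> \<alpha> (K_class X \<beta> (laurent_var i))) =
            exp_nilpotent (Q_ring d X g \<beta> \<alpha>) (\<lambda>c. Q_class d X g \<beta> \<alpha> (scalar c))
              (2 * of_real pi * \<i> * \<alpha> i) (Q_class d X g \<beta> \<alpha> (ray_elt X i)))) \<and>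
    \<phi> \<in> complex_linear_iso
      (KC X \<beta>) (\<lambda>c x. K_class X \<beta> (scalar c) \<otimes>\<^bsub>KC X \<beta>\<^esub> x)
      (HC d X g \<beta>) (\<lambda>c x. scalar c \<odot>\<^bsub>HC d X g \<beta>\<^esub> x) \<and>
    (\<forall>x\<in>carrier (KC X \<beta>).
       \<phi> x = finsum (HC d X g \<beta>)
               (\<lambda>\<alpha>. H_summand d X g \<beta> \<alpha> (\<phi>loc \<alpha> (K_localize X \<beta> \<alpha> x))) (Box X \<beta>))"
proof -
  interpret fan_basis d X g \<beta>
    by unfold_locales (rule assms)+
  show ?thesis
    by (intro exI[of _ phi_glob] exI[of _ phi_loc] conjI ballI phi_loc_iso phi_loc_var phi_glob_iso)
      (simp_all add: phi_glob_def)
qed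

end
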